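(* The Discrete Curve/Point Set Matching problem under translations in $\mathbb{R}^2$ (points may be visited more than once) can be solved, in both its Subset and its All-Points version, as follows. (1) (Decision version.) There is an algorithm that, given a polygonal curve $P$ in $\mathbb{R}^2$ with $n$ vertices, a set $S\subset\mathbb{R}^2$ of $k$ points, and a real $\varepsilon>0$, decides in $O(n^2k^2\log(nk))$ time whether there exist a translation vector $t\in\mathbb{R}^2$ and an admissible polygonal curve $Q$ such that $\delta_{\mathrm F}(P+t,Q)\le\varepsilon$. (2) (Optimization version.) There is an algorithm that, given $P$ and $S$ as in (1), finds $t\in\mathbb{R}^2$ minimizing the minimum of $\delta_{\mathrm F}(P+t,Q)$ over all admissible polygonal curves $Q$, in $O(n^2k^2\log^2(nk))$ time. Here, in the Subset version, a polygonal curve $Q$ is admissible if all its vertices belong to $S$ (repetitions allowed); in the All-Points version, $Q$ is admissible if all its vertices belong to $S$ (repetitions allowed) and every point of $S$ is a vertex of $Q$.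
   Context: $\|p,q\|$ denotes the Euclidean distance between points $p,q$. A polygonal curve is given by its sequence of vertices; $P+t$ is the curve with every vertex translated by $t$. For polygonal curves $P$ with vertices $P_1,\dots,P_n$ and $Q$ with vertices $Q_1,\dots,Q_m$, a paired walk is a sequence of integer pairs $(a_1,b_1),\dots,(a_l,b_l)$ with $(a_1,b_1)=(1,1)$, $(a_l,b_l)=(n,m)$, and $(a_{i+1},b_{i+1})\in\{(a_i+1,b_i),(a_i,b_i+1),(a_i+1,b_i+1)\}$ for all $i$. With $W$ the set of all paired walks, the discrete Fréchet distance is $$\delta_{\mathrm F}(P,Q)=\min_{(a,b)\in W}\max_i\|P_{a_i},Q_{b_i}\|.$$ Running times are in the real-RAM model in which basic operations on constant-degree algebraic expressions take constant time. *)

theory Defs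
  imports "HOL-Analysis.Analysis" "HOL-Computational_Algebra.Polynomial"
begin

section \<open>Discrete Frechet distance\<close>

text \<open>A polygonal curve is the nonempty list of its vertices. Walks use the 1-based
  indices of the usual definition, whence the shift by one in \<open>discrete_frechet\<close>.\<close>

type_synonym point = "real ^ 2"

definition translate :: "point list \<Rightarrow> point \<Rightarrow> point list" where
  "translate P t = map (\<lambda>p. p + t) P"

definition paired_walk :: "nat \<Rightarrow> nat \<Rightarrow> (nat \<times> nat) list \<Rightarrow> bool" where
  "paired_walk n m w \<longleftrightarrow>
     w \<noteq> [] \<and> hd w = (1, 1) \<and> last w = (n, m) \<and>
     (\<forall>i. Suc i < length w \<longrightarrow>
        (case w ! i of (a, b) \<Rightarrow> w ! Suc i \<in> {(a + 1, b), (a, b + 1), (a + 1, b + 1)}))"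

definition walk_cost :: "point list \<Rightarrow> point list \<Rightarrow> (nat \<times> nat) list \<Rightarrow> real" where
  "walk_cost P Q w = Max ((\<lambda>(a, b). dist (P ! (a - 1)) (Q ! (b - 1))) ` set w)"

definition discrete_frechet :: "point list \<Rightarrow> point list \<Rightarrow> real" where
  "discrete_frechet P Q = Min (walk_cost P Q ` {w. paired_walk (length P) (length Q) w})"


section \<open>Curve/point set matching\<close>

datatype matching_version = Subset_Version | All_Points_Version

fun admissible :: "matching_version \<Rightarrow> point set \<Rightarrow> point list \<Rightarrow> bool" where
  "admissible Subset_Version S Q \<longleftrightarrow> Q \<noteq> [] \<and> set Q \<subseteq> S"
| "admissible All_Points_Version S Q \<longleftrightarrow> Q \<noteq> [] \<and> set Q \<subseteq> S \<and> S \<subseteq> set Q"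

definition matching_distance ::
    "matching_version \<Rightarrow> point list \<Rightarrow> point set \<Rightarrow> point \<Rightarrow> real" where
  "matching_distance v P S t =
     Min ((\<lambda>Q. discrete_frechet (translate P t) Q) ` {Q. admissible v S Q})"


text \<open>Both minima are taken over finite nonempty sets of reals, so that \<^const>\<open>Min\<close> is
  meaningful, although there are infinitely many admissible curves.\<close>

lemma paired_walk_nth_le:
  assumes "paired_walk n m w" and "i \<le> j" and "j < length w"
  shows "fst (w ! i) \<le> fst (w ! j) \<and> snd (w ! i) \<le> snd (w ! j)"
  using assms(2,3)
proof (induction j rule: dec_induct)
  case base
  then show ?case by simp
next
  case (step j)
  obtain a b where ab: "w ! j = (a, b)" by fastforce
  have "w ! Suc j \<in> {(a + 1, b), (a, b + 1), (a + 1, b + 1)}"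
    using assms(1) step.prems ab unfolding paired_walk_def by fastforce
  then show ?case using step ab by auto
qed

lemma paired_walk_subset:
  assumes "paired_walk n m w"
  shows "set w \<subseteq> {1..n} \<times> {1..m}"
proof
  fix x assume "x \<in> set w"
  then obtain i where i: "i < length w" "w ! i = x" by (auto simp: in_set_conv_nth)
  have "w ! 0 = (1, 1)" "w ! (length w - 1) = (n, m)"
    using assms unfolding paired_walk_def by (auto simp: hd_conv_nth last_conv_nth)
  with paired_walk_nth_le[OF assms, of 0 i] paired_walk_nth_le[OF assms, of i "length w - 1"] i
  show "x \<in> {1..n} \<times> {1..m}" by (cases x) auto
qed

lemma paired_walk_snoc:
  assumes "paired_walk n m w" and "x \<in> {(n + 1, m), (n, m + 1), (n + 1, m + 1)}"
  shows "paired_walk (fst x) (snd x) (w @ [x])"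
proof -
  have l: "w ! (length w - 1) = (n, m)" "w \<noteq> []"
    using assms(1) unfolding paired_walk_def by (auto simp: last_conv_nth)
  have "case (w @ [x]) ! i of (a, b) \<Rightarrow>
      (w @ [x]) ! Suc i \<in> {(a + 1, b), (a, b + 1), (a + 1, b + 1)}"
    if "Suc i < length (w @ [x])" for i
  proof (cases "Suc i < length w")
    case True
    then show ?thesis using assms(1) unfolding paired_walk_def by (simp add: nth_append)
  next
    case False
    with that have "i = length w - 1" "Suc i = length w" by auto
    then show ?thesis using l assms(2) by (simp add: nth_append)
  qed
  then show ?thesis using assms(1) unfolding paired_walk_def by auto
qed

lemma paired_walk_exists: "\<exists>w. paired_walk (Suc n) (Suc m) w"
proof (induction n)
  case 0
  show ?case
  proof (induction m)
    case 0
    have "paired_walk (Suc 0) (Suc 0) [(1, 1)]" unfolding paired_walk_def by simp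
    then show ?case by blast
  next
    case (Suc m)
    then obtain w where "paired_walk (Suc 0) (Suc m) w" by blast
    from paired_walk_snoc[OF this, of "(Suc 0, Suc (Suc m))"] show ?case by auto
  qed
next
  case (Suc n)
  then obtain w where "paired_walk (Suc n) (Suc m) w" by blast
  from paired_walk_snoc[OF this, of "(Suc (Suc n), Suc m)"] show ?case by auto
qed

lemma walk_cost_mem:
  assumes "paired_walk (length P) (length Q) w"
  shows "walk_cost P Q w \<in> (\<lambda>(p, q). dist p q) ` (set P \<times> set Q)"
proof -
  have "w \<noteq> []" using assms unfolding paired_walk_def by simp
  then have "walk_cost P Q w \<in> (\<lambda>(a, b). dist (P ! (a - 1)) (Q ! (b - 1))) ` set w"
    unfolding walk_cost_def by (intro Max_in) auto
  then obtain a b where ab: "(a, b) \<in> set w"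
    "walk_cost P Q w = dist (P ! (a - 1)) (Q ! (b - 1))" by auto
  then have "(a, b) \<in> {1..length P} \<times> {1..length Q}"
    using paired_walk_subset[OF assms] by blast
  then have "a - 1 < length P" "b - 1 < length Q" by auto
  then have "(P ! (a - 1), Q ! (b - 1)) \<in> set P \<times> set Q" by simp
  then show ?thesis unfolding ab(2) by (rule rev_image_eqI) simp
qed

lemma discrete_frechet_min_wf:
  assumes "P \<noteq> []" and "Q \<noteq> []"
  shows "finite (walk_cost P Q ` {w. paired_walk (length P) (length Q) w})"
    and "walk_cost P Q ` {w. paired_walk (length P) (length Q) w} \<noteq> {}"
    and "discrete_frechet P Q \<in> (\<lambda>(p, q). dist p q) ` (set P \<times> set Q)"
proof -
  let ?V = "walk_cost P Q ` {w. paired_walk (length P) (length Q) w}"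
  have sub: "?V \<subseteq> (\<lambda>(p, q). dist p q) ` (set P \<times> set Q)"
    using walk_cost_mem by blast
  then show fin: "finite ?V" by (rule finite_subset) simp
  show ne: "?V \<noteq> {}"
    using paired_walk_exists[of "length P - 1" "length Q - 1"] assms by auto
  show "discrete_frechet P Q \<in> (\<lambda>(p, q). dist p q) ` (set P \<times> set Q)"
    unfolding discrete_frechet_def using Min_in[OF fin ne] sub by blast
qed

lemma admissibleD: "admissible v S Q \<Longrightarrow> Q \<noteq> [] \<and> set Q \<subseteq> S"
  by (cases v) auto

lemma matching_distance_min_wf:
  assumes "P \<noteq> []" and "finite S" and "S \<noteq> {}"
  shows "finite ((\<lambda>Q. discrete_frechet (translate P t) Q) ` {Q. admissible v S Q})"
    and "{Q. admissible v S Q} \<noteq> {}"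
proof -
  have P: "translate P t \<noteq> []" using assms(1) by (simp add: translate_def)
  have "discrete_frechet (translate P t) Q
      \<in> (\<lambda>(p, q). dist p q) ` (set (translate P t) \<times> S)" if "admissible v S Q" for Q
    using discrete_frechet_min_wf(3)[OF P, of Q] admissibleD[OF that] by blast
  then have "(\<lambda>Q. discrete_frechet (translate P t) Q) ` {Q. admissible v S Q}
      \<subseteq> (\<lambda>(p, q). dist p q) ` (set (translate P t) \<times> S)" by blast
  then show "finite ((\<lambda>Q. discrete_frechet (translate P t) Q) ` {Q. admissible v S Q})"
    by (rule finite_subset) (simp add: assms(2))
  obtain xs where "set xs = S" using finite_list[OF assms(2)] by blast
  then have "admissible v S xs" using assms(3) by (cases v) auto
  then show "{Q. admissible v S Q} \<noteq> {}" by blast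
qed


section \<open>Real RAM\<close>

text \<open>
  Programs of a real RAM in structured form. The memory consists of finitely many named
  integer arrays and real arrays with indirect addressing (a scalar is cell 0 of an array).
  Every executed elementary command or test costs one unit: its expressions are
  part of the program text, so that each of them stands for a number of
  elementary operations which is bounded independently of the input.

  The model is kept from gaining power beyond the customary one as follows.
  Integers admit no multiplication, division or bit operations;
  there is no rounding and no other conversion from reals to integers; and a program
  contains no real constants other than those denoted by natural numbers.
  The algebraic operations are the field operations and \<open>RRoot j [c0, ..., cd]\<close>, the
  real root number j (in increasing order, starting from 0) of c0 + c1 x + ... + cd x^d.
  Its degree is bounded by the program text.
  Undefined operations (division by zero, a nonexistent root) return 0.
\<close>

type_synonym vname = string

datatype iexp =
    INat nat
  | IGet vname iexp
  | IAdd iexp iexp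
  | ISub iexp iexp

datatype rexp =
    RNat iexp
  | RGet vname iexp
  | RAdd rexp rexp
  | RSub rexp rexp
  | RMul rexp rexp
  | RDiv rexp rexp
  | RRoot nat "rexp list"

datatype bexp =
    ILess iexp iexp
  | RLess rexp rexp
  | BNot bexp
  | BAnd bexp bexp

datatype com =
    Skip
  | IPut vname iexp iexp
  | RPut vname iexp rexp
  | Seq com com
  | Cond bexp com com
  | While bexp com

record store =
  imem :: "vname \<Rightarrow> nat \<Rightarrow> nat"
  rmem :: "vname \<Rightarrow> nat \<Rightarrow> real"

definition nth_real_root :: "nat \<Rightarrow> real poly \<Rightarrow> real" where
  "nth_real_root j p =
     (if p \<noteq> 0 \<and> j < card {x. poly p x = 0} then sorted_list_of_set {x. poly p x = 0} ! j else 0)"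

fun ieval :: "iexp \<Rightarrow> store \<Rightarrow> nat" where
  "ieval (INat m) s = m"
| "ieval (IGet x e) s = imem s x (ieval e s)"
| "ieval (IAdd e f) s = ieval e s + ieval f s"
| "ieval (ISub e f) s = ieval e s - ieval f s"

fun reval :: "rexp \<Rightarrow> store \<Rightarrow> real" where
  "reval (RNat e) s = real (ieval e s)"
| "reval (RGet x e) s = rmem s x (ieval e s)"
| "reval (RAdd e f) s = reval e s + reval f s"
| "reval (RSub e f) s = reval e s - reval f s"
| "reval (RMul e f) s = reval e s * reval f s"
| "reval (RDiv e f) s = reval e s / reval f s"
| "reval (RRoot j es) s = nth_real_root j (Poly (map (\<lambda>e. reval e s) es))"

fun beval :: "bexp \<Rightarrow> store \<Rightarrow> bool" where
  "beval (ILess e f) s \<longleftrightarrow> ieval e s < ieval f s"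
| "beval (RLess e f) s \<longleftrightarrow> reval e s < reval f s"
| "beval (BNot b) s \<longleftrightarrow> \<not> beval b s"
| "beval (BAnd b c) s \<longleftrightarrow> beval b s \<and> beval c s"

text \<open>\<open>exec c s T s'\<close>: started in \<open>s\<close>, program \<open>c\<close> halts in \<open>s'\<close> after exactly
  \<open>T\<close> units of time.\<close>

inductive exec :: "com \<Rightarrow> store \<Rightarrow> nat \<Rightarrow> store \<Rightarrow> bool" where
  exec_Skip: "exec Skip s 1 s"
| exec_IPut: "exec (IPut x e f) s 1
    (s\<lparr>imem := (imem s)(x := (imem s x)(ieval e s := ieval f s))\<rparr>)"
| exec_RPut: "exec (RPut x e r) s 1
    (s\<lparr>rmem := (rmem s)(x := (rmem s x)(ieval e s := reval r s))\<rparr>)"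
| exec_Seq: "exec c s T s' \<Longrightarrow> exec d s' T' s'' \<Longrightarrow> exec (Seq c d) s (T + T') s''"
| exec_CondT: "beval b s \<Longrightarrow> exec c s T s' \<Longrightarrow> exec (Cond b c d) s (T + 1) s'"
| exec_CondF: "\<not> beval b s \<Longrightarrow> exec d s T s' \<Longrightarrow> exec (Cond b c d) s (T + 1) s'"
| exec_WhileF: "\<not> beval b s \<Longrightarrow> exec (While b c) s 1 s"
| exec_WhileT: "beval b s \<Longrightarrow> exec c s T s' \<Longrightarrow> exec (While b c) s' T' s'' \<Longrightarrow>
    exec (While b c) s (T + T' + 1) s''"

inductive_cases exec_SkipE: "exec Skip s T s'"
inductive_cases exec_IPutE: "exec (IPut x e f) s T s'"
inductive_cases exec_RPutE: "exec (RPut x e r) s T s'"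
inductive_cases exec_SeqE: "exec (Seq c d) s T s'"
inductive_cases exec_CondE: "exec (Cond b c d) s T s'"
inductive_cases exec_WhileE: "exec (While b c) s T s'"

lemma exec_deterministic:
  "exec c s T s' \<Longrightarrow> exec c s U u \<Longrightarrow> U = T \<and> u = s'"
proof (induction arbitrary: U u rule: exec.induct)
  case (exec_Skip s)
  then show ?case by (rule exec_SkipE) simp
next
  case (exec_IPut x e f s)
  then show ?case by (rule exec_IPutE) simp
next
  case (exec_RPut x e r s)
  then show ?case by (rule exec_RPutE) simp
next
  case (exec_Seq c s T s' d T' s'')
  from exec_Seq.prems show ?case by (rule exec_SeqE) (use exec_Seq.IH in blast)
next
  case (exec_CondT b s c T s' d)
  from exec_CondT.prems show ?case
    by (rule exec_CondE) (use exec_CondT.IH exec_CondT.hyps in fastforce)+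
next
  case (exec_CondF b s d T s' c)
  from exec_CondF.prems show ?case
    by (rule exec_CondE) (use exec_CondF.IH exec_CondF.hyps in fastforce)+
next
  case (exec_WhileF b s c)
  from exec_WhileF.prems show ?case
    by (rule exec_WhileE) (use exec_WhileF.hyps in simp_all)
next
  case (exec_WhileT b s c T s' T' s'')
  from exec_WhileT.prems show ?case
  proof (rule exec_WhileE)
    fix V r V'
    assume *: "U = Suc (V + V')" "exec c s V r" "exec (While b c) r V' u"
    from exec_WhileT.IH(1)[OF *(2)] have "V = T" "r = s'" by simp_all
    with exec_WhileT.IH(2)[of V' u] * show ?thesis by simp
  qed (use exec_WhileT.hyps in simp)
qed


section \<open>Inputs and outputs\<close>

text \<open>The set of points is presented as an array of its elements, in any order and
  without duplicates. All cells that do not hold input are 0 initially.\<close>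

definition coord_array :: "point list \<Rightarrow> 2 \<Rightarrow> nat \<Rightarrow> real" where
  "coord_array ps c i = (if i < length ps then ps ! i $ c else 0)"

definition matching_input :: "point list \<Rightarrow> point list \<Rightarrow> store" where
  "matching_input P xs =
     \<lparr>imem = (\<lambda>_ _. 0)
        (''n'' := (\<lambda>_. 0)(0 := length P),
         ''k'' := (\<lambda>_. 0)(0 := length xs)),
      rmem = (\<lambda>_ _. 0)
        (''px'' := coord_array P 1, ''py'' := coord_array P 2,
         ''sx'' := coord_array xs 1, ''sy'' := coord_array xs 2)\<rparr>"

definition decision_input :: "point list \<Rightarrow> point list \<Rightarrow> real \<Rightarrow> store" where
  "decision_input P xs \<epsilon> =
     (matching_input P xs)
       \<lparr>rmem := (rmem (matching_input P xs))(''eps'' := (\<lambda>_. 0)(0 := \<epsilon>))\<rparr>"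

definition decision_output :: "store \<Rightarrow> nat" where
  "decision_output s = imem s ''answer'' 0"

definition translation_output :: "store \<Rightarrow> point" where
  "translation_output s = vector [rmem s ''tx'' 0, rmem s ''ty'' 0]"

end

theory Submission imports Defs "HOL-Library.Sublist" begin

text \<open>
  A walk through the points near each vertex in turn shows that a suitable curve within distance \<open>r\<close> of
  \<open>P + t\<close> exists iff every vertex of \<open>P + t\<close> is within \<open>r\<close> of a point of \<open>S\<close> and, in the all-points
  version, vice versa. Thus \<open>t\<close> has to lie within \<open>r\<close> of one of the centres \<open>q - p\<close> of every row (and
  column) of the array of all differences; let \<open>M = O(n k)\<close> be the number of centres.

  Let the pivot \<open>a\<close> be the nearest centre of a group whose nearest centre is farthest. With
  \<open>t = a + l (1, m)\<close>, up to a rotation by a multiple of a right angle, a centre with relative position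
  \<open>(u, v)\<close> is at least as near as the pivot iff \<open>u\<^sup>2 + v\<^sup>2 \<le> 2 l (u + m v)\<close>. Hence the points of the ray
  which are at least as far from the pivot as from every group form an upward closed set of parameters \<open>l\<close>.
  For a fixed radius it suffices to test the point at that distance from the pivot: each centre is within
  reach for an interval of slopes \<open>m\<close>, and sweeping the sorted end points takes \<open>O(M log M)\<close> time per pivot.
  In general the least \<open>1 / l\<close> allowed by the groups is a lower envelope of upper envelopes of the lines
  \<open>2 (u + m v) / (u\<^sup>2 + v\<^sup>2)\<close>. The labels along it contain no alternation a b a b a, so that it has
  \<open>O(M log M)\<close> pieces and is built by merging in \<open>O(M log\<^sup>2 M)\<close> time. On each piece the radius is
  minimal at an end or at one explicit interior point.
\<close>

section \<open>Total correctness with time credits\<close>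

text \<open>Written in \<open>1 / l\<close>, the condition on a centre becomes linear in the slope
  \<open>m\<close> (this is inversion at the pivot), which is why lines and their envelopes appear
  at all. Two degeneracies shape the details. A centre that coincides with the pivot has no line;
  its group is satisfied on every ray, so it is dropped from the envelope, and if no group remains
  the pivot itself is optimal. Touching or coincident lines would make the labels ambiguous; lines
  are therefore compared immediately to the right of \<open>m\<close>, labels deciding last, and
  pieces are half-open. Then the best line is unique at every slope and two lines change their order
  at most once, which is the one geometric fact behind both bounds on the number of pieces. The
  price is a limit argument at the right end of a piece, where its optimum may lie. The bound for
  sequences without a b a b a comes from deleting a symbol of at most average frequency, which
  produces a harmonic sum. Since the machine neither multiplies nor divides integers, merging runs
  on a queue of blocks instead of halving index ranges, and tables replace the decoding of
  labels.\<close>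

definition wp :: "com \<Rightarrow> (store \<Rightarrow> nat \<Rightarrow> bool) \<Rightarrow> store \<Rightarrow> nat \<Rightarrow> bool" where
  "wp c Q s t \<longleftrightarrow> (\<exists>T s'. exec c s T s' \<and> T \<le> t \<and> Q s' (t - T))"

lemma wp_conseq:
  assumes "wp c Q s t" and "\<And>s' t'. Q s' t' \<Longrightarrow> t' \<le> t \<Longrightarrow> Q' s' t'"
  shows "wp c Q' s t"
proof -
  obtain T s' where "exec c s T s'" "T \<le> t" "Q s' (t - T)"
    using assms(1) unfolding wp_def by blast
  with assms(2)[of s' "t - T"] show ?thesis unfolding wp_def by (intro exI[of _ T] exI[of _ s']) simp
qed

lemma wp_Skip: "1 \<le> t \<Longrightarrow> Q s (t - 1) \<Longrightarrow> wp Skip Q s t"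
  unfolding wp_def using exec_Skip by blast

lemma wp_IPut:
  "1 \<le> t \<Longrightarrow> Q (s\<lparr>imem := (imem s)(x := (imem s x)(ieval e s := ieval f s))\<rparr>) (t - 1)
    \<Longrightarrow> wp (IPut x e f) Q s t"
  unfolding wp_def using exec_IPut by blast

lemma wp_RPut:
  "1 \<le> t \<Longrightarrow> Q (s\<lparr>rmem := (rmem s)(x := (rmem s x)(ieval e s := reval r s))\<rparr>) (t - 1)
    \<Longrightarrow> wp (RPut x e r) Q s t"
  unfolding wp_def using exec_RPut by blast

text \<open>The postcondition of \<open>wp\<close> receives the unspent credits, so the second
  program simply starts with what the first one leaves; costs are never added up in a
  specification.\<close>

lemma wp_Seq: "wp c (wp d Q) s t \<Longrightarrow> wp (Seq c d) Q s t"
  unfolding wp_def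
proof (elim exE conjE)
  fix T s' T' s''
  assume "exec c s T s'" "T \<le> t" "exec d s' T' s''" "T' \<le> t - T" "Q s'' (t - T - T')"
  then show "\<exists>T s'. exec (Seq c d) s T s' \<and> T \<le> t \<and> Q s' (t - T)"
    using exec_Seq[of c s T s' d T' s''] by (intro exI[of _ "T + T'"] exI[of _ s'']) simp
qed

lemma wp_Cond:
  assumes "1 \<le> t" and "beval b s \<Longrightarrow> wp c Q s (t - 1)" and "\<not> beval b s \<Longrightarrow> wp d Q s (t - 1)"
  shows "wp (Cond b c d) Q s t"
proof (cases "beval b s")
  case True
  then obtain T s' where "exec c s T s'" "T \<le> t - 1" "Q s' (t - 1 - T)"
    using assms(2) unfolding wp_def by blast
  then have "exec (Cond b c d) s (T + 1) s'" "T + 1 \<le> t" "Q s' (t - (T + 1))"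
    using exec_CondT[OF True] assms(1) by auto
  then show ?thesis unfolding wp_def by blast
next
  case False
  then obtain T s' where "exec d s T s'" "T \<le> t - 1" "Q s' (t - 1 - T)"
    using assms(3) unfolding wp_def by blast
  then have "exec (Cond b c d) s (T + 1) s'" "T + 1 \<le> t" "Q s' (t - (T + 1))"
    using exec_CondF[OF False] assms(1) by auto
  then show ?thesis unfolding wp_def by blast
qed

text \<open>Every iteration costs at least one credit, so no separate variant is needed.\<close>

lemma wp_While:
  assumes "I s t"
    and step: "\<And>s t. I s t \<Longrightarrow> beval b s \<Longrightarrow> 1 \<le> t \<and> wp c I s (t - 1)"
    and fin: "\<And>s t. I s t \<Longrightarrow> \<not> beval b s \<Longrightarrow> 1 \<le> t \<and> Q s (t - 1)"
  shows "wp (While b c) Q s t"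
  using assms(1)
proof (induction t arbitrary: s rule: less_induct)
  case (less t)
  show ?case
  proof (cases "beval b s")
    case True
    then obtain T s' where *: "1 \<le> t" "exec c s T s'" "T \<le> t - 1" "I s' (t - 1 - T)"
      using step[OF less.prems] unfolding wp_def by blast
    then obtain T' s'' where "exec (While b c) s' T' s''" "T' \<le> t - 1 - T" "Q s'' (t - 1 - T - T')"
      using less.IH[of "t - 1 - T" s'] unfolding wp_def by auto
    with * have "exec (While b c) s (T + T' + 1) s''" "T + T' + 1 \<le> t" "Q s'' (t - (T + T' + 1))"
      using exec_WhileT[OF True, of c T s' T' s''] by simp_all
    then show ?thesis unfolding wp_def by (intro exI conjI)
  next
    case False
    with exec_WhileF fin[OF less.prems] show ?thesis unfolding wp_def by blast
  qed
qed

fun imods :: "com \<Rightarrow> vname list" where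
  "imods Skip = []"
| "imods (IPut x e f) = [x]"
| "imods (RPut x e f) = []"
| "imods (Seq c d) = imods c @ imods d"
| "imods (Cond b c d) = imods c @ imods d"
| "imods (While b c) = imods c"

fun rmods :: "com \<Rightarrow> vname list" where
  "rmods Skip = []"
| "rmods (IPut x e f) = []"
| "rmods (RPut x e f) = [x]"
| "rmods (Seq c d) = rmods c @ rmods d"
| "rmods (Cond b c d) = rmods c @ rmods d"
| "rmods (While b c) = rmods c"

lemma exec_frame:
  "exec c s T s' \<Longrightarrow> (x \<notin> set (imods c) \<longrightarrow> imem s' x = imem s x)
    \<and> (x \<notin> set (rmods c) \<longrightarrow> rmem s' x = rmem s x)"
  by (induction rule: exec.induct) simp_all

definition same_except :: "vname list \<Rightarrow> vname list \<Rightarrow> store \<Rightarrow> store \<Rightarrow> bool" where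
  "same_except is rs s s' \<longleftrightarrow> (\<forall>x. x \<notin> set is \<longrightarrow> imem s' x = imem s x)
    \<and> (\<forall>x. x \<notin> set rs \<longrightarrow> rmem s' x = rmem s x)"

lemma same_exceptD:
  assumes "same_except is rs s s'"
  shows "x \<notin> set is \<Longrightarrow> imem s' x = imem s x" "x \<notin> set rs \<Longrightarrow> rmem s' x = rmem s x"
  using assms unfolding same_except_def by auto

text \<open>The rule by which subprograms are used: the callee is verified once, with its own budget
  \<open>B\<close> and a postcondition free of time. The caller pays \<open>B\<close> and recovers
  everything else from the set of array names that occur on the left of an assignment.\<close>

lemma wp_call:
  assumes "wp c (\<lambda>s' _. R s') s B" and "B \<le> t"
    and "\<And>s' t'. R s' \<Longrightarrow> same_except (imods c) (rmods c) s s' \<Longrightarrow> t - B \<le> t' \<Longrightarrow> t' \<le> t \<Longrightarrow> Q s' t'"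
  shows "wp c Q s t"
proof -
  from assms(1) obtain T s' where *: "exec c s T s'" "T \<le> B" "R s'" unfolding wp_def by blast
  then have "same_except (imods c) (rmods c) s s'"
    unfolding same_except_def using exec_frame by blast
  from assms(3)[OF *(3) this, of "t - T"] have "Q s' (t - T)" using * assms(2) by auto
  moreover have "T \<le> t" using * assms(2) by simp
  ultimately show ?thesis unfolding wp_def using * by blast
qed

lemma wp_time_mono:
  assumes "wp c (\<lambda>s' _. R s') s B" and "B \<le> t"
  shows "wp c (\<lambda>s' _. R s') s t"
  by (rule wp_call[OF assms])

abbreviation seq_syntax :: "com \<Rightarrow> com \<Rightarrow> com" (infixr ";;" 60) where
  "c ;; d \<equiv> Seq c d"

abbreviation iv :: "vname \<Rightarrow> iexp" where "iv x \<equiv> IGet x (INat 0)"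
abbreviation rv :: "vname \<Rightarrow> rexp" where "rv x \<equiv> RGet x (INat 0)"
abbreviation iset :: "vname \<Rightarrow> iexp \<Rightarrow> com" where "iset x e \<equiv> IPut x (INat 0) e"
abbreviation rset :: "vname \<Rightarrow> rexp \<Rightarrow> com" where "rset x e \<equiv> RPut x (INat 0) e"
abbreviation iinc :: "vname \<Rightarrow> com" where "iinc x \<equiv> iset x (IAdd (iv x) (INat 1))"
abbreviation bor :: "bexp \<Rightarrow> bexp \<Rightarrow> bexp" where "bor b c \<equiv> BNot (BAnd (BNot b) (BNot c))"

abbreviation ival :: "store \<Rightarrow> vname \<Rightarrow> nat" where "ival s x \<equiv> imem s x 0"
abbreviation rval :: "store \<Rightarrow> vname \<Rightarrow> real" where "rval s x \<equiv> rmem s x 0"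

lemmas wp_straight = wp_Seq wp_IPut wp_RPut wp_Skip

text \<open>These rules name the intermediate stores instead of composing the updates, which keeps the goals
  of long straight-line programs small.\<close>

lemma wp_IPut_step:
  assumes "1 \<le> t" and "\<And>s'. rmem s' = rmem s \<Longrightarrow> imem s' = (imem s)(x := (imem s x)(ieval e s := ieval f s)) \<Longrightarrow> Q s' (t - 1)"
  shows "wp (IPut x e f) Q s t"
  by (rule wp_IPut[OF assms(1)]) (rule assms(2); simp)

lemma wp_RPut_step:
  assumes "1 \<le> t" and "\<And>s'. imem s' = imem s \<Longrightarrow> rmem s' = (rmem s)(x := (rmem s x)(ieval e s := reval r s)) \<Longrightarrow> Q s' (t - 1)"
  shows "wp (RPut x e r) Q s t"
  by (rule wp_RPut[OF assms(1)]) (rule assms(2); simp)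

lemmas wp_steps = wp_Seq wp_IPut_step wp_RPut_step wp_Skip

section \<open>Binary logarithm, rounded up\<close>

text \<open>The recursion is that of pairwise merging: one round turns \<open>n\<close> blocks into
  \<open>Suc n div 2\<close>, so \<open>cl n\<close> counts the rounds.\<close>

fun cl :: "nat \<Rightarrow> nat" where
  "cl n = (if n \<le> 1 then 0 else Suc (cl (Suc n div 2)))"

declare cl.simps [simp del]

lemma cl_le_1: "n \<le> 1 \<Longrightarrow> cl n = 0"
  by (simp add: cl.simps)

lemma cl_rec: "2 \<le> n \<Longrightarrow> cl n = Suc (cl (Suc n div 2))"
  by (subst cl.simps) simp

lemma cl_mono: "m \<le> n \<Longrightarrow> cl m \<le> cl n"
proof (induction n arbitrary: m rule: less_induct)
  case (less n)
  show ?case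
  proof (cases "m \<le> 1")
    case True
    then show ?thesis by (simp add: cl_le_1)
  next
    case False
    then have "Suc m div 2 \<le> Suc n div 2" "Suc n div 2 < n" using less.prems by auto
    then have "cl (Suc m div 2) \<le> cl (Suc n div 2)" by (intro less.IH)
    then show ?thesis using False less.prems cl_rec[of m] cl_rec[of n] by simp
  qed
qed

lemma le_power_cl: "n \<le> 2 ^ cl n"
proof (induction n rule: less_induct)
  case (less n)
  show ?case
  proof (cases "n \<le> 1")
    case True
    then show ?thesis by (simp add: cl_le_1)
  next
    case False
    then have "Suc n div 2 \<le> 2 ^ cl (Suc n div 2)" by (intro less) auto
    then show ?thesis using False cl_rec[of n] by simp
  qed
qed

text \<open>The slack 2 is what lets the induction pass: rounding up in \<open>Suc n div 2\<close>
  loses exactly this much for odd \<open>n\<close>.\<close>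

lemma power_cl_less: "2 \<le> n \<Longrightarrow> 2 ^ cl n + 2 \<le> 2 * n"
proof (induction n rule: less_induct)
  case (less n)
  show ?case
  proof (cases "n = 2")
    case True
    then show ?thesis by (simp add: cl.simps)
  next
    case False
    then have "2 ^ cl (Suc n div 2) + 2 \<le> 2 * (Suc n div 2)" using less.prems by (intro less.IH) auto
    then show ?thesis using less.prems cl_rec[of n] by simp
  qed
qed

lemma cl_le_log:
  assumes "1 \<le> n" shows "real (cl n) \<le> 1 + log 2 (real n)"
proof -
  have "2 ^ cl n \<le> 2 * n" using assms power_cl_less[of n] by (cases "2 \<le> n") (auto simp: cl_le_1)
  then have "(2::real) ^ cl n \<le> 2 * real n" by (metis of_nat_le_iff of_nat_mult of_nat_numeral of_nat_power)
  then have "log 2 ((2::real) ^ cl n) \<le> log 2 (2 * real n)" by (intro log_mono) auto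
  then show ?thesis using assms by (simp add: log_mult)
qed

lemma ln_le_cl:
  assumes "1 \<le> n" shows "ln (real n) \<le> real (cl n)"
proof -
  have "real n \<le> 2 ^ cl n" using le_power_cl[of n] by (metis of_nat_le_iff of_nat_numeral of_nat_power)
  then have "ln (real n) \<le> real (cl n) * ln 2" using assms by (metis ln_mono ln_realpow of_nat_0_less_iff
    less_le_trans zero_less_numeral zero_less_power less_numeral_extra(1))
  also have "\<dots> \<le> real (cl n) * 1" using ln_2_less_1 by (intro mult_left_mono) auto
  finally show ?thesis by simp
qed

section \<open>Sequences without five-fold alternations\<close>

text \<open>Together with \<open>distinct_adj\<close> these are the Davenport-Schinzel sequences of
  order 3. Their true maximal length is only slightly superlinear; the elementary bound n log n is
  enough for the claimed running time.\<close>

definition no_ababa :: "'a list \<Rightarrow> bool" where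
  "no_ababa xs \<longleftrightarrow> (\<forall>a b. subseq [a, b, a, b, a] xs \<longrightarrow> a = b)"

lemma subseq_remdups_adj: "subseq (remdups_adj xs) xs"
  by (induction xs rule: remdups_adj.induct) auto

lemma length_remdups_adj_append:
  "length (remdups_adj as) + length (remdups_adj bs) \<le> Suc (length (remdups_adj (as @ bs)))"
proof (induction as rule: remdups_adj.induct)
  case (2 x)
  then show ?case by (cases bs) auto
qed auto

text \<open>Copies of \<open>x\<close> are never adjacent, so a repetition created by deleting them
  can only stem from a factor \<open>a x a\<close>.\<close>

lemma distinct_adj_filter_neq:
  assumes "distinct_adj vs" and "\<And>a. subseq [a, x, a] vs \<Longrightarrow> a = x"
  shows "distinct_adj (filter (\<lambda>y. y \<noteq> x) vs)"
  using assms
proof (induction vs)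
  case Nil
  then show ?case by simp
next
  case (Cons y vs)
  have IH: "distinct_adj (filter (\<lambda>y. y \<noteq> x) vs)"
    using Cons.prems(1) by (intro Cons.IH) (auto simp: distinct_adj_Cons intro: Cons.prems(2) list_emb_Cons)
  show ?case
  proof (cases "y = x \<or> vs = []")
    case True
    then show ?thesis using IH by auto
  next
    case False
    then obtain z zs where vs: "vs = z # zs" by (cases vs) auto
    show ?thesis
    proof (cases "z = x")
      case False
      then show ?thesis using \<open>\<not> (y = x \<or> vs = [])\<close> IH Cons.prems(1) vs by (simp add: distinct_adj_Cons)
    next
      case True
      show ?thesis
      proof (cases zs)
        case Nil
        then show ?thesis using vs True by simp
      next
        case (Cons w ws)
        then have "w \<noteq> x" using Cons.prems(1) vs True by auto
        moreover have "w \<noteq> y"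
        proof
          assume "w = y"
          then have "subseq [y, x, y] (y # vs)" using vs True Cons by (simp add: subseq_Cons2)
          then show False using Cons.prems(2) \<open>\<not> (y = x \<or> vs = [])\<close> by blast
        qed
        ultimately show ?thesis using IH vs True Cons \<open>\<not> (y = x \<or> vs = [])\<close> by simp
      qed
    qed
  qed
qed

text \<open>Deleting a symbol creates adjacent duplicates only around its first and its last occurrence:
  around an inner occurrence the alternation would be five-fold.\<close>

lemma length_filter_neq_le:
  assumes "distinct_adj xs" and "no_ababa xs"
  shows "length (filter (\<lambda>y. y \<noteq> x) xs) \<le> length (remdups_adj (filter (\<lambda>y. y \<noteq> x) xs)) + 2"
proof (cases "x \<in> set xs")
  case False
  then have "filter (\<lambda>y. y \<noteq> x) xs = xs" by (intro filter_True) auto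
  moreover have "remdups_adj xs = xs" using assms(1) by (simp flip: distinct_adj_altdef)
  ultimately show ?thesis by simp
next
  case True
  let ?f = "filter (\<lambda>y. y \<noteq> x)"
  obtain us ws where us: "xs = us @ x # ws" "x \<notin> set us" using split_list_first[OF True] by blast
  have fus: "?f us = us" using us by (intro filter_True) auto
  have dus: "distinct_adj us" "distinct_adj ws"
    using assms(1) us by (auto simp: distinct_adj_append_iff distinct_adj_Cons)
  show ?thesis
  proof (cases "x \<in> set ws")
    case False
    then have "?f ws = ws" by (intro filter_True) auto
    then have "?f xs = us @ ws" using us fus by simp
    have "length (us @ ws) \<le> length (remdups_adj (us @ ws)) + 2"
      using length_remdups_adj_append[of us ws] dus[unfolded distinct_adj_conv_length_remdups_adj]
      unfolding length_append by linarith
    then show ?thesis unfolding \<open>?f xs = us @ ws\<close> .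
  next
    case True
    then obtain vs zs where vs: "ws = vs @ x # zs" "x \<notin> set zs"
      using split_list_last[OF True] by blast
    have fzs: "?f zs = zs" using vs by (intro filter_True) auto
    have dvs: "distinct_adj vs" "distinct_adj zs"
      using dus(2) vs by (auto simp: distinct_adj_append_iff distinct_adj_Cons)
    have "distinct_adj (?f vs)"
    proof (rule distinct_adj_filter_neq[OF dvs(1)])
      fix a assume a: "subseq [a, x, a] vs"
      have "subseq ([] @ [x] @ [a, x, a] @ [x] @ []) (us @ [x] @ vs @ [x] @ zs)"
        by (intro list_emb_append_mono a) auto
      then show "a = x" using assms(2) us vs unfolding no_ababa_def by auto
    qed
    then have "length (us @ ?f vs @ zs) \<le> length (remdups_adj (us @ ?f vs @ zs)) + 2"
      using length_remdups_adj_append[of us "?f vs @ zs"] length_remdups_adj_append[of "?f vs" zs]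
        dus[unfolded distinct_adj_conv_length_remdups_adj] dvs[unfolded distinct_adj_conv_length_remdups_adj]
      unfolding distinct_adj_conv_length_remdups_adj length_append by linarith
    moreover have "?f xs = us @ ?f vs @ zs" using us vs fus fzs by simp
    ultimately show ?thesis by (rule ssubst[rotated])
  qed
qed

text \<open>Delete a symbol of at most average frequency and collapse the repetitions. Among
  \<open>N + 1\<close> symbols a sequence of length \<open>l\<close> loses at most
  \<open>l / (N + 1) + 2\<close> entries, so that the length per symbol exceeds that for
  \<open>N\<close> symbols by at most \<open>2 / N\<close>. Summation gives the harmonic
  number.\<close>

lemma no_ababa_length_harm:
  assumes "distinct_adj xs" and "no_ababa xs" and "card (set xs) = Suc n"
  shows "real (length xs) \<le> real (Suc n) * (1 + 2 * harm n)"
  using assms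
proof (induction n arbitrary: xs)
  case 0
  then obtain x where x: "set xs = {x}" by (auto simp: card_Suc_eq)
  have "length xs \<le> 1"
  proof (rule ccontr)
    assume "\<not> length xs \<le> 1"
    then have "xs ! 0 \<noteq> xs ! Suc 0" "xs ! 0 \<in> set xs" "xs ! Suc 0 \<in> set xs"
      using 0 by (auto simp: distinct_adj_conv_nth intro: nth_mem)
    then show False using x by simp
  qed
  then show ?case by (simp add: harm_def)
next
  case (Suc n)
  have cnt: "sum (count_list xs) (set xs) = length xs" by (intro sum_count_set) auto
  have "\<exists>x\<in>set xs. Suc (Suc n) * count_list xs x \<le> length xs"
  proof (rule ccontr)
    assume neg: "\<not> ?thesis"
    have "Suc (Suc n) * length xs = (\<Sum>x\<in>set xs. Suc (Suc n) * count_list xs x)"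
      using cnt by (simp add: sum_distrib_left[symmetric] del: mult_Suc)
    also have "\<dots> > (\<Sum>x\<in>set xs. length xs)"
      using neg Suc.prems(3) by (intro sum_strict_mono) (auto simp: not_le simp del: mult_Suc)
    finally show False using Suc.prems(3) by simp
  qed
  then obtain x where x: "x \<in> set xs" "Suc (Suc n) * count_list xs x \<le> length xs" by blast
  define ys where "ys = remdups_adj (filter (\<lambda>y. y \<noteq> x) xs)"
  have "set ys = set xs - {x}" unfolding ys_def by auto
  then have "card (set ys) = Suc n" using x(1) Suc.prems(3) by simp
  moreover have "subseq ys xs" unfolding ys_def
    using subseq_remdups_adj subseq_filter_left subseq_order.order_trans by metis
  then have "no_ababa ys" using Suc.prems(2) subseq_order.order_trans unfolding no_ababa_def by metis
  moreover have "distinct_adj ys" unfolding ys_def by simp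
  ultimately have IH: "real (length ys) \<le> real (Suc n) * (1 + 2 * harm n)" by (intro Suc.IH)
  have "length xs = count_list xs x + length (filter (\<lambda>y. y \<noteq> x) xs)"
    using sum_length_filter_compl[of "(=) x" xs] by (simp add: count_list_eq_length_filter eq_commute[of x])
  then have "length xs \<le> count_list xs x + length ys + 2"
    using length_filter_neq_le[OF Suc.prems(1,2), of x] unfolding ys_def by simp
  then have 1: "real (length xs) \<le> real (count_list xs x) + real (length ys) + 2"
    by linarith
  have 2: "real (Suc (Suc n)) * real (count_list xs x) \<le> real (length xs)"
    using x(2) by (metis of_nat_le_iff of_nat_mult)
  define c l h where "c = real (count_list xs x)" and "l = real (length xs)" and "h = (harm n :: real)"
  define N where "N = real (Suc n)"
  have N: "N > 0" unfolding N_def by simp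
  have a: "l \<le> c + N * (1 + 2 * h) + 2" "(N + 1) * c \<le> l"
    using 1 2 IH unfolding c_def l_def h_def N_def by (auto simp: algebra_simps)
  have "(N + 1) * l \<le> (N + 1) * (c + N * (1 + 2 * h) + 2)" using a N by (intro mult_left_mono) auto
  then have "N * l \<le> (N + 1) * (N * (1 + 2 * h) + 2)" using a(2) by (simp add: algebra_simps)
  then have "l \<le> (N + 1) * (N * (1 + 2 * h) + 2) / N" using N by (simp add: field_simps)
  also have "\<dots> = (N + 1) * (1 + 2 * (h + inverse N))" using N by (simp add: field_simps)
  finally show ?case unfolding l_def h_def N_def by (simp add: harm_Suc add_ac)
qed

text \<open>The logarithm is taken of an upper bound \<open>M\<close> instead of
  \<open>card A\<close>. The bound is thereby proportional to \<open>card A\<close> with a fixed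
  factor, hence additive over all blocks present in one round of merging.\<close>

lemma no_ababa_length:
  assumes "distinct_adj xs" and "no_ababa xs" and "finite A" and "set xs \<subseteq> A" and "card A \<le> M"
  shows "length xs \<le> card A * (3 + 2 * cl M)"
proof (cases "xs = []")
  case False
  then obtain n where n: "card (set xs) = Suc n" by (metis card_0_eq finite_set set_empty not0_implies_Suc)
  have c: "Suc n \<le> card A" using card_mono[OF assms(3,4)] n by simp
  have "harm n \<le> (1 + real (cl M) :: real)"
  proof (cases "n = 0")
    case True
    then show ?thesis by (simp add: harm_def)
  next
    case False
    \<comment> \<open>The difference \<open>harm n - ln n\<close> decreases in \<open>n\<close>, so
      it is at most its value 1 at \<open>n = 1\<close>.\<close>
    have "harm n - ln (real n) \<le> harm 1 - ln (real 1)"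
      using decseq_harm_diff_ln[unfolded decseq_def, rule_format, of 0 "n - 1"] False by simp
    then have "harm n \<le> 1 + ln (real n)" by (simp add: harm_def)
    also have "ln (real n) \<le> real (cl n)" using ln_le_cl False by simp
    also have "cl n \<le> cl M" using c assms(5) by (intro cl_mono) simp
    finally show ?thesis by simp
  qed
  then have "real (length xs) \<le> real (Suc n) * (1 + 2 * (1 + real (cl M)))"
    by (intro order_trans[OF no_ababa_length_harm[OF assms(1,2) n]] mult_left_mono) auto
  also have "\<dots> = real (Suc n * (3 + 2 * cl M))" by (simp add: algebra_simps)
  finally have "length xs \<le> Suc n * (3 + 2 * cl M)" by linarith
  also have "\<dots> \<le> card A * (3 + 2 * cl M)" using c by (intro mult_right_mono) auto
  finally show ?thesis .
qed simp

section \<open>Envelopes of lines\<close>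

text \<open>The order of the lines \<open>\<alpha> p + \<beta> p * x\<close> immediately to the right of \<open>m\<close>; the sign \<open>\<sigma>\<close> selects
  lower or upper envelopes, and coincident lines are ordered by their labels.\<close>

definition lex_less :: "real \<Rightarrow> real \<Rightarrow> nat \<Rightarrow> real \<Rightarrow> real \<Rightarrow> nat \<Rightarrow> bool" where
  "lex_less u b p v c q \<longleftrightarrow> u < v \<or> u = v \<and> (b < c \<or> b = c \<and> p < q)"

definition kless :: "real \<Rightarrow> (nat \<Rightarrow> real) \<Rightarrow> (nat \<Rightarrow> real) \<Rightarrow> real \<Rightarrow> nat \<Rightarrow> nat \<Rightarrow> bool" where
  "kless \<sigma> \<alpha> \<beta> m p q \<longleftrightarrow>
     lex_less (\<sigma> * (\<alpha> p + \<beta> p * m)) (\<sigma> * \<beta> p) p (\<sigma> * (\<alpha> q + \<beta> q * m)) (\<sigma> * \<beta> q) q"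

definition isbest :: "real \<Rightarrow> (nat \<Rightarrow> real) \<Rightarrow> (nat \<Rightarrow> real) \<Rightarrow> real \<Rightarrow> nat set \<Rightarrow> nat \<Rightarrow> bool" where
  "isbest \<sigma> \<alpha> \<beta> m A p \<longleftrightarrow> p \<in> A \<and> (\<forall>q\<in>A. q = p \<or> kless \<sigma> \<alpha> \<beta> m p q)"

lemma lex_less_order:
  "lex_less u b p v c q \<Longrightarrow> \<not> lex_less v c q u b p"
  "lex_less u b p v c q \<Longrightarrow> lex_less v c q w d r \<Longrightarrow> lex_less u b p w d r"
  "p \<noteq> q \<Longrightarrow> lex_less u b p v c q \<or> lex_less v c q u b p"
  unfolding lex_less_def by auto

lemma kless_asym: "kless \<sigma> \<alpha> \<beta> m p q \<Longrightarrow> \<not> kless \<sigma> \<alpha> \<beta> m q p"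
  unfolding kless_def by (rule lex_less_order)

lemma kless_trans: "kless \<sigma> \<alpha> \<beta> m p q \<Longrightarrow> kless \<sigma> \<alpha> \<beta> m q r \<Longrightarrow> kless \<sigma> \<alpha> \<beta> m p r"
  unfolding kless_def by (rule lex_less_order)

lemma kless_total: "p \<noteq> q \<Longrightarrow> kless \<sigma> \<alpha> \<beta> m p q \<or> kless \<sigma> \<alpha> \<beta> m q p"
  unfolding kless_def by (rule lex_less_order)

lemma kless_le: "kless \<sigma> \<alpha> \<beta> m p q \<Longrightarrow> \<sigma> * (\<alpha> p + \<beta> p * m) \<le> \<sigma> * (\<alpha> q + \<beta> q * m)"
  unfolding kless_def lex_less_def by linarith

lemma affine_cases:
  fixes A B x y :: real
  assumes "x < y"
  shows "A + B * x < A + B * y \<and> B > 0 \<or> A + B * x = A + B * y \<and> B = 0 \<or> A + B * x > A + B * y \<and> B < 0"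
  using assms mult_strict_left_mono[of x y B] mult_strict_left_mono_neg[of x y B]
  by (cases B "0 :: real" rule: linorder_cases) auto

lemma line_diff:
  fixes \<sigma> :: real
  shows "\<sigma> * (\<alpha> q + \<beta> q * m) - \<sigma> * (\<alpha> p + \<beta> p * m) = (\<sigma> * \<alpha> q - \<sigma> * \<alpha> p) + (\<sigma> * \<beta> q - \<sigma> * \<beta> p) * m"
  by (simp add: algebra_simps)

text \<open>Only the affine difference of two lines matters: every later claim about two lines
  becomes a claim about the sign of one affine function.\<close>

lemma kless_diff:
  "kless \<sigma> \<alpha> \<beta> m p q \<longleftrightarrow>
    (let A = \<sigma> * \<alpha> q - \<sigma> * \<alpha> p; B = \<sigma> * \<beta> q - \<sigma> * \<beta> p
     in A + B * m > 0 \<or> A + B * m = 0 \<and> (B > 0 \<or> B = 0 \<and> p < q))"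
  unfolding kless_def lex_less_def Let_def line_diff[symmetric] by linarith

text \<open>A non-constant affine function changes sign once, and coincident lines keep the order of
  their labels, so a change of order is final.\<close>

lemma kless_cross:
  assumes "m1 < m2" and "m2 < m3" and "kless \<sigma> \<alpha> \<beta> m1 p q" and "kless \<sigma> \<alpha> \<beta> m2 q p"
  shows "kless \<sigma> \<alpha> \<beta> m3 q p"
proof -
  define A B where "A = \<sigma> * \<alpha> q - \<sigma> * \<alpha> p" and "B = \<sigma> * \<beta> q - \<sigma> * \<beta> p"
  have 1: "A + B * m1 > 0 \<or> A + B * m1 = 0 \<and> (B > 0 \<or> B = 0 \<and> p < q)"
    using assms(3) unfolding kless_diff Let_def A_def B_def .
  have eq: "\<sigma> * \<alpha> p - \<sigma> * \<alpha> q = - A" "\<sigma> * \<beta> p - \<sigma> * \<beta> q = - B" unfolding A_def B_def by simp_all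
  have 2: "- A + - B * m2 > 0 \<or> - A + - B * m2 = 0 \<and> (- B > 0 \<or> - B = 0 \<and> q < p)"
    using assms(4) unfolding kless_diff Let_def eq .
  have "- A + - B * m3 > 0 \<or> - A + - B * m3 = 0 \<and> (- B > 0 \<or> - B = 0 \<and> q < p)"
    using 1 2 affine_cases[OF assms(1), of A B] affine_cases[OF assms(2), of A B] by auto
  then show ?thesis unfolding kless_diff Let_def eq .
qed

lemma isbest_unique: "isbest \<sigma> \<alpha> \<beta> m A p \<Longrightarrow> isbest \<sigma> \<alpha> \<beta> m A q \<Longrightarrow> p = q"
  unfolding isbest_def by (metis kless_asym)

lemma isbest_Un:
  assumes "isbest \<sigma> \<alpha> \<beta> m A p" and "isbest \<sigma> \<alpha> \<beta> m B q"
  shows "q = p \<or> kless \<sigma> \<alpha> \<beta> m p q \<Longrightarrow> isbest \<sigma> \<alpha> \<beta> m (A \<union> B) p"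
    and "q = p \<or> kless \<sigma> \<alpha> \<beta> m q p \<Longrightarrow> isbest \<sigma> \<alpha> \<beta> m (A \<union> B) q"
  using assms unfolding isbest_def by (metis Un_iff kless_trans)+

lemma isbest_exists: "finite A \<Longrightarrow> A \<noteq> {} \<Longrightarrow> \<exists>p. isbest \<sigma> \<alpha> \<beta> m A p"
proof (induction rule: finite_ne_induct)
  case (singleton x)
  then show ?case unfolding isbest_def by auto
next
  case (insert x A)
  then obtain p where p: "isbest \<sigma> \<alpha> \<beta> m A p" by blast
  have x: "isbest \<sigma> \<alpha> \<beta> m {x} x" unfolding isbest_def by simp
  show ?case using isbest_Un[OF x p] kless_total[of x p] by (metis insert_is_Un)
qed

text \<open>Bare values suffice for the test at \<open>y\<close> because the interval is half-open:
  lines that meet only at \<open>y\<close> require no switch before it.\<close>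

lemma kless_same_until:
  assumes w: "\<not> kless \<sigma> \<alpha> \<beta> x u w" and y: "\<not> \<sigma> * (\<alpha> u + \<beta> u * y) < \<sigma> * (\<alpha> w + \<beta> w * y)"
    and m: "x \<le> m" "m < y"
  shows "u = w \<or> kless \<sigma> \<alpha> \<beta> m w u"
proof (cases "u = w")
  case False
  define A B where "A = \<sigma> * \<alpha> u - \<sigma> * \<alpha> w" and "B = \<sigma> * \<beta> u - \<sigma> * \<beta> w"
  have "kless \<sigma> \<alpha> \<beta> x w u" using kless_total[OF False, of \<sigma> \<alpha> \<beta> x] w by blast
  then have 1: "A + B * x > 0 \<or> A + B * x = 0 \<and> (B > 0 \<or> B = 0 \<and> w < u)"
    unfolding kless_diff Let_def A_def B_def .
  have 2: "A + B * y \<ge> 0" using y unfolding A_def B_def line_diff[symmetric] by linarith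
  have "A + B * m > 0 \<or> A + B * m = 0 \<and> (B > 0 \<or> B = 0 \<and> w < u)"
    using affine_cases[OF m(2), of A B] affine_cases[of x m A B] 1 2 m by (cases "x = m") auto
  then show ?thesis unfolding kless_diff Let_def A_def B_def by blast
qed simp

text \<open>Since \<open>w\<close> leads just to the right of \<open>x\<close> and \<open>u\<close>
  is strictly ahead at \<open>y\<close>, the slopes differ and the division is proper. At the
  crossing \<open>z\<close> itself the slopes decide in favour of \<open>u\<close>, so the new piece
  may start there. The sign \<open>\<sigma>\<close> cancels in the formula for
  \<open>z\<close>.\<close>

lemma kless_switch:
  assumes w: "\<not> kless \<sigma> \<alpha> \<beta> x u w" and y: "\<sigma> * (\<alpha> u + \<beta> u * y) < \<sigma> * (\<alpha> w + \<beta> w * y)"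
    and xy: "x < y" and \<sigma>: "\<sigma> \<noteq> 0" and z: "z = (\<alpha> u - \<alpha> w) / (\<beta> w - \<beta> u)"
  shows "x < z" "z < y" "\<And>m. x \<le> m \<Longrightarrow> m < z \<Longrightarrow> kless \<sigma> \<alpha> \<beta> m w u"
    "\<And>m. z \<le> m \<Longrightarrow> kless \<sigma> \<alpha> \<beta> m u w"
proof -
  define A B where "A = \<sigma> * \<alpha> u - \<sigma> * \<alpha> w" and "B = \<sigma> * \<beta> u - \<sigma> * \<beta> w"
  have eq: "\<sigma> * \<alpha> w - \<sigma> * \<alpha> u = - A" "\<sigma> * \<beta> w - \<sigma> * \<beta> u = - B" unfolding A_def B_def by simp_all
  have "u \<noteq> w" using y by auto
  then have "kless \<sigma> \<alpha> \<beta> x w u" using kless_total[of u w \<sigma> \<alpha> \<beta> x] w by blast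
  then have 1: "A + B * x > 0 \<or> A + B * x = 0 \<and> (B > 0 \<or> B = 0 \<and> w < u)"
    unfolding kless_diff Let_def A_def B_def .
  have 2: "A + B * y < 0" using y unfolding A_def B_def line_diff[symmetric] by linarith
  have B: "B < 0" "A + B * x > 0" using affine_cases[OF xy, of A B] 1 2 by auto
  have z': "A + B * z = 0"
  proof -
    have AB: "B = \<sigma> * (\<beta> u - \<beta> w)" "A = \<sigma> * (\<alpha> u - \<alpha> w)"
      unfolding A_def B_def by (simp_all add: right_diff_distrib)
    have "\<beta> w - \<beta> u \<noteq> 0" using B(1) AB by auto
    then have "(\<beta> w - \<beta> u) * z = \<alpha> u - \<alpha> w" unfolding z by simp
    then have "(\<beta> u - \<beta> w) * z = - (\<alpha> u - \<alpha> w)" by (simp add: left_diff_distrib)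
    moreover have "A + B * z = \<sigma> * ((\<alpha> u - \<alpha> w) + (\<beta> u - \<beta> w) * z)"
      unfolding AB by (simp only: distrib_left mult.assoc)
    ultimately show ?thesis by simp
  qed
  show "x < z" using affine_cases[of z x A B] z' B by (cases x z rule: linorder_cases) auto
  show "z < y" using affine_cases[of y z A B] z' B 2 by (cases z y rule: linorder_cases) auto
  show "kless \<sigma> \<alpha> \<beta> m w u" if "x \<le> m" "m < z" for m
    using affine_cases[OF that(2), of A B] z' B unfolding kless_diff Let_def A_def[symmetric] B_def[symmetric] by auto
  show "kless \<sigma> \<alpha> \<beta> m u w" if "z \<le> m" for m
    using affine_cases[of z m A B] z' B that unfolding kless_diff Let_def eq by (cases "z = m") auto
qed

subsection \<open>Piecewise constant labellings of an interval\<close>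

definition nxt :: "(nat \<Rightarrow> real) \<Rightarrow> nat \<Rightarrow> real \<Rightarrow> nat \<Rightarrow> real" where
  "nxt X hi y k = (if Suc k < hi then X (Suc k) else y)"

text \<open>Piece \<open>k\<close> carries the label \<open>L k\<close> on the half-open interval from \<open>X k\<close> to the next breakpoint;
  the pieces \<open>lo, ..., hi - 1\<close> partition the interval from -1 to \<open>y\<close>.\<close>

definition pseg :: "(real \<Rightarrow> nat \<Rightarrow> bool) \<Rightarrow> (nat \<Rightarrow> real) \<Rightarrow> (nat \<Rightarrow> nat) \<Rightarrow> nat \<Rightarrow> nat \<Rightarrow> real \<Rightarrow> bool" where
  "pseg F X L lo hi y \<longleftrightarrow> lo \<le> hi \<and> (lo = hi \<longrightarrow> y = -1) \<and> (lo < hi \<longrightarrow> X lo = -1)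
     \<and> (\<forall>k. lo \<le> k \<and> k < hi \<longrightarrow> X k < nxt X hi y k \<and> (\<forall>m. X k \<le> m \<and> m < nxt X hi y k \<longrightarrow> F m (L k)))
     \<and> (\<forall>k. lo \<le> k \<and> Suc k < hi \<longrightarrow> L k \<noteq> L (Suc k))"

lemma pseg_cong:
  assumes "\<And>k. lo \<le> k \<Longrightarrow> k < hi \<Longrightarrow> X' k = X k \<and> L' k = L k"
  shows "pseg F X' L' lo hi y = pseg F X L lo hi y"
proof -
  have "nxt X' hi y k = nxt X hi y k" if "lo \<le> k" "k < hi" for k
    using that assms unfolding nxt_def by auto
  then show ?thesis using assms unfolding pseg_def by (auto simp: Suc_le_eq)
qed

text \<open>Lengthening the last piece when the label repeats keeps neighbouring labels different;
  the bounds on the number of pieces rest on this.\<close>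

lemma pseg_emit:
  assumes p: "pseg F X L lo hi x" and xy: "x < y" and F: "\<And>m. x \<le> m \<Longrightarrow> m < y \<Longrightarrow> F m w"
  shows "lo < hi \<Longrightarrow> L (hi - 1) = w \<Longrightarrow> pseg F X L lo hi y"
    and "\<not> (lo < hi \<and> L (hi - 1) = w) \<Longrightarrow> pseg F (X(hi := x)) (L(hi := w)) lo (Suc hi) y"
proof -
  assume h: "lo < hi" "L (hi - 1) = w"
  have n: "nxt X hi y k = (if Suc k < hi then nxt X hi x k else y)" for k unfolding nxt_def by simp
  have last: "nxt X hi x (hi - 1) = x" using h unfolding nxt_def by simp
  show "pseg F X L lo hi y" unfolding pseg_def
  proof (intro conjI allI impI)
    fix k assume k: "lo \<le> k \<and> k < hi"
    show "X k < nxt X hi y k"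
    proof (cases "Suc k < hi")
      case False
      then have "k = hi - 1" using k by arith
      then show ?thesis using p k last xy n[of k] False unfolding pseg_def by auto
    qed (use p k n in \<open>auto simp: pseg_def\<close>)
    fix m assume m: "X k \<le> m \<and> m < nxt X hi y k"
    show "F m (L k)"
    proof (cases "Suc k < hi")
      case False
      then have k': "k = hi - 1" using k by arith
      then have "m < y" using m n False by simp
      then show ?thesis using p k last m F[of m] k' h(2) unfolding pseg_def by (cases "m < x") auto
    qed (use p k n m in \<open>auto simp: pseg_def\<close>)
  qed (use p h in \<open>auto simp: pseg_def\<close>)
next
  assume h: "\<not> (lo < hi \<and> L (hi - 1) = w)"
  let ?X = "X(hi := x)" and ?L = "L(hi := w)"
  have n: "nxt ?X (Suc hi) y k = (if k < hi then nxt X hi x k else y)" for k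
    unfolding nxt_def by auto
  show "pseg F ?X ?L lo (Suc hi) y" unfolding pseg_def
  proof (intro conjI allI impI)
    fix k assume k: "lo \<le> k \<and> k < Suc hi"
    show "?X k < nxt ?X (Suc hi) y k"
      using p k xy unfolding n pseg_def by auto
    fix m assume m: "?X k \<le> m \<and> m < nxt ?X (Suc hi) y k"
    show "F m (?L k)"
      using p k m F unfolding n pseg_def by (cases "k < hi") auto
  next
    fix k assume k: "lo \<le> k \<and> Suc k < Suc hi"
    show "?L k \<noteq> ?L (Suc k)"
    proof (cases "Suc k < hi")
      case False
      then have "k = hi - 1" "lo < hi" using k by auto
      then show ?thesis using h by auto
    qed (use p k in \<open>auto simp: pseg_def\<close>)
  qed (use p in \<open>auto simp: pseg_def\<close>)
qed

lemma pseg_mono: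
  assumes "pseg F X L lo hi y" and "lo \<le> k" and "k < k'" and "k' < hi"
  shows "X k < X k'"
proof -
  have "Suc k + d < hi \<longrightarrow> X k < X (Suc k + d)" for d
  proof (induction d)
    case 0
    have "X k < nxt X hi y k" using assms unfolding pseg_def by simp
    then show ?case using assms unfolding nxt_def by simp
  next
    case (Suc d)
    show ?case
    proof
      assume h: "Suc k + Suc d < hi"
      have "X (Suc k + d) < nxt X hi y (Suc k + d)" using assms(1,2) h unfolding pseg_def by simp
      then show "X k < X (Suc k + Suc d)" using Suc h unfolding nxt_def by simp
    qed
  qed
  from this[of "k' - Suc k"] show ?thesis using assms by simp
qed

lemma pseg_label:
  assumes "pseg F X L lo hi y" and "lo \<le> k" and "k < hi"
  shows "F (X k) (L k)"
  using assms unfolding pseg_def by auto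

lemma pseg_covers:
  assumes "pseg F X L lo hi y" and "lo < hi" and "-1 \<le> m" and "m < y"
  shows "\<exists>k. lo \<le> k \<and> k < hi \<and> X k \<le> m \<and> m < nxt X hi y k"
proof -
  define K where "K = {k. lo \<le> k \<and> k < hi \<and> X k \<le> m}"
  have "finite K" unfolding K_def by simp
  moreover have "lo \<in> K" unfolding K_def using assms by (auto simp: pseg_def)
  ultimately have "Max K \<in> K" "\<And>k. k \<in> K \<Longrightarrow> k \<le> Max K" by (auto intro: Max_in)
  moreover have "m < nxt X hi y (Max K)"
  proof (rule ccontr)
    assume "\<not> ?thesis"
    then have "Suc (Max K) < hi" "X (Suc (Max K)) \<le> m"
      using assms(4) unfolding nxt_def by (auto split: if_splits)
    then have "Suc (Max K) \<in> K" using \<open>Max K \<in> K\<close> unfolding K_def by simp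
    then show False using \<open>\<And>k. k \<in> K \<Longrightarrow> k \<le> Max K\<close> by fastforce
  qed
  ultimately show ?thesis unfolding K_def by blast
qed

lemma subseq_map_upt:
  assumes "subseq (a # ys) (map L [lo..<hi])"
  shows "\<exists>k. lo \<le> k \<and> k < hi \<and> L k = a \<and> subseq ys (map L [Suc k..<hi])"
proof -
  obtain us vs where u: "map L [lo..<hi] = us @ a # vs" "subseq ys vs"
    using list_emb_ConsD[OF assms] by auto
  define k where "k = lo + length us"
  have len: "hi - lo = Suc (length us + length vs)" using arg_cong[OF u(1), of length] by simp
  have "L k = (us @ a # vs) ! length us" unfolding u(1)[symmetric] k_def using len by simp
  moreover have "vs = drop (Suc (length us)) (map L [lo..<hi])" unfolding u(1) by simp
  then have "vs = map L [Suc k..<hi]" unfolding k_def by (simp add: drop_map)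
  ultimately show ?thesis using u(2) len unfolding k_def by (intro exI[of _ "lo + length us"]) auto
qed

lemma pseg_distinct_adj:
  assumes "pseg F X L lo hi y" shows "distinct_adj (map L [lo..<hi])"
  using assms unfolding distinct_adj_conv_nth pseg_def by auto

text \<open>\<open>\<tau> g m\<close> is the label that item \<open>g\<close> contributes at slope
  \<open>m\<close>. For the lines of one group it is \<open>g\<close> itself; on the second level
  \<open>g\<close> is a group and \<open>\<tau> g m\<close> the top line of that group. One merging
  program thus serves both levels.\<close>

definition Rep :: "real \<Rightarrow> (nat \<Rightarrow> real) \<Rightarrow> (nat \<Rightarrow> real) \<Rightarrow> (nat \<Rightarrow> real \<Rightarrow> nat)
    \<Rightarrow> nat list \<Rightarrow> (nat \<Rightarrow> real) \<Rightarrow> (nat \<Rightarrow> nat) \<Rightarrow> nat \<Rightarrow> nat \<Rightarrow> bool" where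
  "Rep \<sigma> \<alpha> \<beta> \<tau> A X L lo hi \<longleftrightarrow>
     lo < hi \<and> pseg (\<lambda>m. isbest \<sigma> \<alpha> \<beta> m ((\<lambda>g. \<tau> g m) ` set A)) X L lo hi 1"

lemma Rep_single:
  assumes "X lo = -1" and "\<And>m. -1 \<le> m \<Longrightarrow> m < 1 \<Longrightarrow> \<tau> g m = L lo"
  shows "Rep \<sigma> \<alpha> \<beta> \<tau> [g] X L lo (Suc lo)"
  using assms unfolding Rep_def pseg_def nxt_def isbest_def by (auto simp: le_less_Suc_eq)

text \<open>A label that returned after another one would make two lines change their order twice,
  so every label occurs on a single piece.\<close>

lemma Rep_distinct_labels:
  assumes "Rep \<sigma> \<alpha> \<beta> (\<lambda>b _. b) A X L lo hi"
  shows "hi - lo \<le> length A"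
proof -
  have p: "pseg (\<lambda>m. isbest \<sigma> \<alpha> \<beta> m (set A)) X L lo hi 1" and lt: "lo < hi"
    using assms unfolding Rep_def by auto
  have adj: "L k \<noteq> L (Suc k)" if "lo \<le> k" "Suc k < hi" for k using p that unfolding pseg_def by blast
  have less: "kless \<sigma> \<alpha> \<beta> (X k) (L k) q" if "lo \<le> k" "k < hi" "q \<in> set A" "q \<noteq> L k" for k q
    using pseg_label[OF p that(1,2)] that(3,4) unfolding isbest_def by auto
  have mem: "L k \<in> set A" if "lo \<le> k" "k < hi" for k
    using pseg_label[OF p that] unfolding isbest_def by auto
  have "L k \<noteq> L k'" if kk: "lo \<le> k" "k < k'" "k' < hi" for k k'
  proof
    assume eq: "L k = L k'"
    have ne: "Suc k \<noteq> k'" using adj[of k] kk eq by auto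
    then have s: "Suc k < k'" using kk by simp
    let ?a = "L k" and ?b = "L (Suc k)"
    have "?a \<noteq> ?b" using adj[of k] kk by simp
    then have "kless \<sigma> \<alpha> \<beta> (X k) ?a ?b" "kless \<sigma> \<alpha> \<beta> (X (Suc k)) ?b ?a" "kless \<sigma> \<alpha> \<beta> (X k') ?a ?b"
      using less[of k ?b] less[of "Suc k" ?a] less[of k' ?b] kk s eq mem by auto
    moreover have "X k < X (Suc k)" "X (Suc k) < X k'" using pseg_mono[OF p] kk s by auto
    ultimately show False using kless_cross kless_asym by metis
  qed
  then have "inj_on L {lo..<hi}" by (intro inj_onI) (metis atLeastLessThan_iff nat_neq_iff)
  moreover have "L ` {lo..<hi} \<subseteq> set A" using mem by auto
  ultimately have "card {lo..<hi} \<le> card (set A)" by (metis card_inj_on_le finite_set)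
  also have "\<dots> \<le> length A" by (rule card_length)
  finally show ?thesis by simp
qed

text \<open>In a pattern a b a b a the line \<open>a\<close> is the top of its group at both ends
  and \<open>b\<close> is the top of its group at both of its occurrences. By
  \<open>kless_cross\<close> each stays the top in between, so at the three inner pieces
  \<open>a\<close> and \<open>b\<close> really compete, and b, a, b would be two changes of order.
  The fifth symbol guarantees that \<open>a\<close> still represents its group at the fourth
  piece.\<close>

lemma Rep_envelope_length:
  assumes R: "Rep 1 \<alpha> \<beta> T A X L lo hi"
    and T: "\<And>g m. g \<in> set A \<Longrightarrow> isbest (-1) \<alpha> \<beta> m (grp g) (T g m)"
    and disj: "\<And>g h. g \<in> set A \<Longrightarrow> h \<in> set A \<Longrightarrow> grp g \<inter> grp h \<noteq> {} \<Longrightarrow> g = h"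
    and fin: "\<And>g. finite (grp g)" and M: "sum_list (map (\<lambda>g. card (grp g)) A) \<le> M"
  shows "hi - lo \<le> sum_list (map (\<lambda>g. card (grp g)) A) * (3 + 2 * cl M)"
proof -
  have p: "pseg (\<lambda>m. isbest 1 \<alpha> \<beta> m ((\<lambda>g. T g m) ` set A)) X L lo hi 1"
    using R unfolding Rep_def by auto
  have lab: "isbest 1 \<alpha> \<beta> (X k) ((\<lambda>g. T g (X k)) ` set A) (L k)" if "lo \<le> k" "k < hi" for k
    by (rule pseg_label[OF p that])
  have own: "\<exists>g\<in>set A. L k \<in> grp g \<and> T g (X k) = L k" if k: "lo \<le> k" "k < hi" for k
    using lab[OF k] T unfolding isbest_def by fastforce
  have "no_ababa (map L [lo..<hi])"
    unfolding no_ababa_def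
  proof (intro allI impI, rule ccontr)
    fix a b assume sub: "subseq [a, b, a, b, a] (map L [lo..<hi])" and ab: "a \<noteq> b"
    obtain k1 where k1: "lo \<le> k1" "k1 < hi" "L k1 = a" "subseq [b, a, b, a] (map L [Suc k1..<hi])"
      using subseq_map_upt[OF sub] by blast
    obtain k2 where k2: "Suc k1 \<le> k2" "k2 < hi" "L k2 = b" "subseq [a, b, a] (map L [Suc k2..<hi])"
      using subseq_map_upt[OF k1(4)] by blast
    obtain k3 where k3: "Suc k2 \<le> k3" "k3 < hi" "L k3 = a" "subseq [b, a] (map L [Suc k3..<hi])"
      using subseq_map_upt[OF k2(4)] by blast
    obtain k4 where k4: "Suc k3 \<le> k4" "k4 < hi" "L k4 = b" "subseq [a] (map L [Suc k4..<hi])"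
      using subseq_map_upt[OF k3(4)] by blast
    obtain k5 where k5: "Suc k4 \<le> k5" "k5 < hi" "L k5 = a"
      using subseq_map_upt[OF k4(4)] by blast
    have lt: "X k1 < X k2" "X k2 < X k3" "X k3 < X k4" "X k4 < X k5"
      using pseg_mono[OF p] k1 k2 k3 k4 k5 by auto
    obtain g where g: "g \<in> set A" "a \<in> grp g" "T g (X k1) = a" using own[of k1] k1 by auto
    have ga: "T g (X k3) = a" "T g (X k5) = a"
      using own[of k3] own[of k5] k1 k2 k3 k4 k5 g disj by (fastforce dest: disj)+
    obtain h where h: "h \<in> set A" "b \<in> grp h" "T h (X k2) = b" using own[of k2] k1 k2 by auto
    have hb: "T h (X k4) = b"
      using own[of k4] k1 k2 k3 k4 h disj by (fastforce dest: disj)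
    \<comment> \<open>Within a group the top line is never resumed once it is lost: a rival would
      overtake it and be overtaken again.\<close>
    have stay: "T f m' = c" if f: "f \<in> set A" "T f m = c" "T f m'' = c" "m < m'" "m' < m''" for f m m' m'' c
    proof (rule ccontr)
      assume ne: "T f m' \<noteq> c"
      have mem: "c \<in> grp f" "T f m' \<in> grp f" using T[OF f(1)] f(2) unfolding isbest_def by blast+
      have "kless (-1) \<alpha> \<beta> m c (T f m')" "kless (-1) \<alpha> \<beta> m'' c (T f m')" "kless (-1) \<alpha> \<beta> m' (T f m') c"
        using T[OF f(1)] mem f(2,3) ne unfolding isbest_def by metis+
      then show False using kless_cross[OF f(4,5)] kless_asym by blast
    qed
    have "T g (X k2) = a" "T g (X k4) = a" "T h (X k3) = b"
      using stay[OF g(1,3) ga(1) lt(1,2)] stay[OF g(1) ga(1,2) lt(3,4)] stay[OF h(1,3) hb lt(2,3)] by auto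
    then have "kless 1 \<alpha> \<beta> (X k2) b a" "kless 1 \<alpha> \<beta> (X k3) a b" "kless 1 \<alpha> \<beta> (X k4) b a"
      using lab[of k2] lab[of k3] lab[of k4] k1 k2 k3 k4 g h ab unfolding isbest_def by fastforce+
    then show False using kless_cross[OF lt(2,3)] kless_asym by blast
  qed
  moreover have "set (map L [lo..<hi]) \<subseteq> (\<Union>g\<in>set A. grp g)" using own by fastforce
  moreover have c: "card (\<Union>g\<in>set A. grp g) \<le> sum_list (map (\<lambda>g. card (grp g)) A)"
  proof -
    have "card (\<Union>g\<in>set A. grp g) \<le> (\<Sum>g\<in>set A. card (grp g))" by (intro card_UN_le) auto
    also have "\<dots> \<le> sum_list (map (\<lambda>g. card (grp g)) A)"
      by (induction A) (auto simp: sum.insert_if)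
    finally show ?thesis .
  qed
  ultimately have "length (map L [lo..<hi]) \<le> card (\<Union>g\<in>set A. grp g) * (3 + 2 * cl M)"
    using M fin by (intro no_ababa_length[OF pseg_distinct_adj[OF p]]) auto
  also have "\<dots> \<le> sum_list (map (\<lambda>g. card (grp g)) A) * (3 + 2 * cl M)" using c by (intro mult_right_mono) auto
  finally show ?thesis by simp
qed

section \<open>Merging a queue of blocks\<close>

text \<open>Block \<open>q\<close> occupies the cells \<open>bl q, ..., bh q - 1\<close> of the arrays \<open>X\<close> and \<open>L\<close>. The two blocks at
  the head of the queue are merged into a new block at its tail; new data is always appended at \<open>e\<close>.\<close>

definition QPRE :: com where
  "QPRE = iset ''i'' (IGet ''bl'' (iv ''qh'')) ;; iset ''ie'' (IGet ''bh'' (iv ''qh'')) ;;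
    iset ''j'' (IGet ''bl'' (IAdd (iv ''qh'') (INat 1))) ;;
    iset ''je'' (IGet ''bh'' (IAdd (iv ''qh'') (INat 1))) ;; iset ''o'' (iv ''e'')"

definition QPOST :: com where
  "QPOST = IPut ''bl'' (iv ''qt'') (iv ''o'') ;; IPut ''bh'' (iv ''qt'') (iv ''e'') ;;
    iset ''qh'' (IAdd (iv ''qh'') (INat 2)) ;; iinc ''qt''"

definition QUEUE :: "com \<Rightarrow> com" where
  "QUEUE mc = While (ILess (IAdd (iv ''qh'') (INat 1)) (iv ''qt'')) (QPRE ;; mc ;; QPOST)"

lemma mods_QPRE [simp]: "imods QPRE = [''i'', ''ie'', ''j'', ''je'', ''o'']" "rmods QPRE = []"
  unfolding QPRE_def by simp_all

lemma mods_QPOST [simp]: "imods QPOST = [''bl'', ''bh'', ''qh'', ''qt'']" "rmods QPOST = []"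
  unfolding QPOST_def by simp_all

lemma wp_QPRE:
  "wp QPRE (\<lambda>s' _. ival s' ''i'' = imem s ''bl'' (ival s ''qh'') \<and> ival s' ''ie'' = imem s ''bh'' (ival s ''qh'')
     \<and> ival s' ''j'' = imem s ''bl'' (Suc (ival s ''qh'')) \<and> ival s' ''je'' = imem s ''bh'' (Suc (ival s ''qh''))
     \<and> ival s' ''o'' = ival s ''e'') s 5"
  unfolding QPRE_def by (intro wp_straight; simp)

lemma wp_QPOST:
  "wp QPOST (\<lambda>s' _. imem s' ''bl'' = (imem s ''bl'')(ival s ''qt'' := ival s ''o'')
     \<and> imem s' ''bh'' = (imem s ''bh'')(ival s ''qt'' := ival s ''e'')
     \<and> ival s' ''qh'' = ival s ''qh'' + 2 \<and> ival s' ''qt'' = Suc (ival s ''qt'')) s 4"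
  unfolding QPOST_def by (intro wp_straight; simp)

text \<open>\<open>R A X L lo hi\<close> says that the block stores the structure belonging to the
  items \<open>A\<close>, and \<open>\<Lambda>\<close> bounds its cells per unit of weight. This
  size bound is demanded only for items from \<open>S0\<close> of total weight at most
  \<open>W0\<close>, because the bound for envelopes needs genuine, disjoint groups and a fixed
  logarithm. Always merging the two front blocks requires neither a stack nor the halving of an
  index.\<close>

locale queue_merge =
  fixes mc :: com and R :: "nat list \<Rightarrow> (nat \<Rightarrow> real) \<Rightarrow> (nat \<Rightarrow> nat) \<Rightarrow> nat \<Rightarrow> nat \<Rightarrow> bool"
    and Ctx :: "store \<Rightarrow> bool" and c :: nat and \<Lambda> :: nat and w :: "nat \<Rightarrow> nat" and S0 :: "nat set" and W0 :: nat
  assumes R_cong: "\<And>A X L X' L' lo hi. (\<And>k. lo \<le> k \<Longrightarrow> k < hi \<Longrightarrow> X' k = X k \<and> L' k = L k) \<Longrightarrow>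
      R A X' L' lo hi = R A X L lo hi"
    and R_less: "\<And>A X L lo hi. R A X L lo hi \<Longrightarrow> lo < hi"
    and R_size: "\<And>A X L lo hi. R A X L lo hi \<Longrightarrow> set A \<subseteq> S0 \<Longrightarrow> sum_list (map w A) \<le> W0 \<Longrightarrow>
      hi - lo \<le> \<Lambda> * sum_list (map w A)"
    and Ctx_frame: "\<And>s s'. Ctx s \<Longrightarrow> same_except (imods (QUEUE mc)) (rmods (QUEUE mc)) s s' \<Longrightarrow> Ctx s'"
    and mc_mods: "set (imods mc) \<inter> {''bl'', ''bh'', ''qh'', ''qt'', ''o''} = {}"
    and merge: "\<And>s A B. Ctx s \<Longrightarrow> R A (rmem s ''X'') (imem s ''L'') (ival s ''i'') (ival s ''ie'') \<Longrightarrow>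
      R B (rmem s ''X'') (imem s ''L'') (ival s ''j'') (ival s ''je'') \<Longrightarrow> ival s ''ie'' \<le> ival s ''e'' \<Longrightarrow>
      ival s ''je'' \<le> ival s ''e'' \<Longrightarrow> ival s ''o'' = ival s ''e'' \<Longrightarrow>
      wp mc (\<lambda>s' _. ival s ''e'' \<le> ival s' ''e''
          \<and> (\<forall>k<ival s ''e''. rmem s' ''X'' k = rmem s ''X'' k \<and> imem s' ''L'' k = imem s ''L'' k)
          \<and> R (A @ B) (rmem s' ''X'') (imem s' ''L'') (ival s ''e'') (ival s' ''e'')) s
        (c * ((ival s ''ie'' - ival s ''i'') + (ival s ''je'' - ival s ''j'')))"
begin

definition holds :: "nat list list \<Rightarrow> store \<Rightarrow> bool" where
  "holds qs s \<longleftrightarrow> ival s ''qt'' = ival s ''qh'' + length qs \<and>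
     (\<forall>r<length qs. R (qs ! r) (rmem s ''X'') (imem s ''L'') (imem s ''bl'' (ival s ''qh'' + r))
        (imem s ''bh'' (ival s ''qh'' + r)) \<and> imem s ''bh'' (ival s ''qh'' + r) \<le> ival s ''e'')"

abbreviation wt :: "nat list \<Rightarrow> nat" where "wt A \<equiv> sum_list (map w A)"

definition extends :: "store \<Rightarrow> store \<Rightarrow> bool" where
  "extends s s' \<longleftrightarrow> ival s ''e'' \<le> ival s' ''e''
     \<and> (\<forall>k<ival s ''e''. rmem s' ''X'' k = rmem s ''X'' k \<and> imem s' ''L'' k = imem s ''L'' k)"

lemma extends_trans: "extends s s' \<Longrightarrow> extends s' s'' \<Longrightarrow> extends s s''"
  unfolding extends_def by auto

lemma wp_merge_step:
  assumes h: "holds (A # B # qs) s" and ctx: "Ctx s"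
    and S0: "set A \<subseteq> S0" "set B \<subseteq> S0" and W0: "wt A \<le> W0" "wt B \<le> W0"
  shows "wp (QPRE ;; mc ;; QPOST) (\<lambda>s' _. holds (qs @ [A @ B]) s' \<and> extends s s' \<and> Ctx s') s
    (9 + c * (\<Lambda> * (wt A + wt B)))"
proof -
  let ?h = "ival s ''qh''" and ?bl = "imem s ''bl''" and ?bh = "imem s ''bh''"
  note h' = h[unfolded holds_def]
  have RA: "R A (rmem s ''X'') (imem s ''L'') (?bl ?h) (?bh ?h)" "?bh ?h \<le> ival s ''e''"
    using h' by (auto dest!: spec[of _ 0])
  have RB: "R B (rmem s ''X'') (imem s ''L'') (?bl (Suc ?h)) (?bh (Suc ?h))" "?bh (Suc ?h) \<le> ival s ''e''"
    using h' by (auto dest!: spec[of _ 1])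
  have size: "(?bh ?h - ?bl ?h) + (?bh (Suc ?h) - ?bl (Suc ?h)) \<le> \<Lambda> * (wt A + wt B)"
    using R_size[OF RA(1) S0(1) W0(1)] R_size[OF RB(1) S0(2) W0(2)] by (simp add: distrib_left)
  have mods: "x \<notin> set (imods mc)" if "x \<in> {''bl'', ''bh'', ''qh'', ''qt'', ''o''}" for x
    using mc_mods that by auto
  show ?thesis
  proof (rule wp_Seq, rule wp_call[OF wp_QPRE], simp, elim conjE)
    fix s1 t1
    assume t1: "9 + c * (\<Lambda> * (wt A + wt B)) - 5 \<le> t1" and fr1: "same_except (imods QPRE) (rmods QPRE) s s1"
      and v1: "ival s1 ''i'' = ?bl ?h" "ival s1 ''ie'' = ?bh ?h" "ival s1 ''j'' = ?bl (Suc ?h)"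
        "ival s1 ''je'' = ?bh (Suc ?h)" "ival s1 ''o'' = ival s ''e''"
    have e1: "rmem s1 = rmem s" "imem s1 ''L'' = imem s ''L''" "imem s1 ''e'' = imem s ''e''"
      "imem s1 ''qh'' = imem s ''qh''" "imem s1 ''qt'' = imem s ''qt''" "imem s1 ''bl'' = ?bl" "imem s1 ''bh'' = ?bh"
      using fr1 unfolding same_except_def by (auto intro: ext)
    have ctx1: "Ctx s1"
      by (rule Ctx_frame[OF ctx]) (use fr1 in \<open>auto simp: same_except_def QUEUE_def\<close>)
    have m: "wp mc (\<lambda>s' _. ival s1 ''e'' \<le> ival s' ''e''
          \<and> (\<forall>k<ival s1 ''e''. rmem s' ''X'' k = rmem s1 ''X'' k \<and> imem s' ''L'' k = imem s1 ''L'' k)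
          \<and> R (A @ B) (rmem s' ''X'') (imem s' ''L'') (ival s1 ''e'') (ival s' ''e'')) s1
        (c * ((ival s1 ''ie'' - ival s1 ''i'') + (ival s1 ''je'' - ival s1 ''j'')))"
      by (rule merge[OF ctx1]) (use RA RB v1 e1 in auto)
    have le: "c * ((ival s1 ''ie'' - ival s1 ''i'') + (ival s1 ''je'' - ival s1 ''j'')) \<le> c * (\<Lambda> * (wt A + wt B))"
      using size unfolding v1 by (rule mult_left_mono) simp
    show "wp (mc ;; QPOST) (\<lambda>s' _. holds (qs @ [A @ B]) s' \<and> extends s s' \<and> Ctx s') s1 t1"
    proof (rule wp_Seq, rule wp_call[OF m], goal_cases)
      case 1
      show ?case using le t1 by linarith
    next
      case (2 s2 t2)
      have e2: "imem s2 ''qh'' = imem s ''qh''" "imem s2 ''qt'' = imem s ''qt''" "imem s2 ''bl'' = ?bl"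
        "imem s2 ''bh'' = ?bh" "ival s2 ''o'' = ival s ''e''"
        using same_exceptD(1)[OF 2(2)] mods e1 v1 by simp_all
      have ctx2: "Ctx s2"
        by (rule Ctx_frame[OF ctx1]) (use 2(2) in \<open>auto simp: same_except_def QUEUE_def\<close>)
      have t2: "4 \<le> t2" using 2(3) t1 le by linarith
      show ?case
      proof (rule wp_call[OF wp_QPOST], rule t2, elim conjE, intro conjI)
        fix s3 t3
        assume v3: "imem s3 ''bl'' = (imem s2 ''bl'')(ival s2 ''qt'' := ival s2 ''o'')"
          "imem s3 ''bh'' = (imem s2 ''bh'')(ival s2 ''qt'' := ival s2 ''e'')"
          "ival s3 ''qh'' = ival s2 ''qh'' + 2" "ival s3 ''qt'' = Suc (ival s2 ''qt'')"
          and fr3: "same_except (imods QPOST) (rmods QPOST) s2 s3"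
        have e3: "rmem s3 = rmem s2" "imem s3 ''L'' = imem s2 ''L''" "imem s3 ''e'' = imem s2 ''e''"
          using fr3 unfolding same_except_def by (auto intro: ext)
        show "Ctx s3"
          by (rule Ctx_frame[OF ctx2]) (use fr3 in \<open>auto simp: same_except_def QUEUE_def\<close>)
        show ext: "extends s s3" using 2(1) e1 e3 unfolding extends_def by simp
        have keep: "R D (rmem s3 ''X'') (imem s3 ''L'') lo hi"
          if "R D (rmem s ''X'') (imem s ''L'') lo hi" "hi \<le> ival s ''e''" for D lo hi
          using that(1) by (subst R_cong) (use that(2) ext in \<open>auto simp: extends_def\<close>)
        show "holds (qs @ [A @ B]) s3" unfolding holds_def
        proof (intro conjI allI impI)
          show "ival s3 ''qt'' = ival s3 ''qh'' + length (qs @ [A @ B])" using v3 e2 h' by simp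
          fix r assume r: "r < length (qs @ [A @ B])"
          have "R ((qs @ [A @ B]) ! r) (rmem s3 ''X'') (imem s3 ''L'') (imem s3 ''bl'' (ival s3 ''qh'' + r))
              (imem s3 ''bh'' (ival s3 ''qh'' + r)) \<and> imem s3 ''bh'' (ival s3 ''qh'' + r) \<le> ival s3 ''e''"
          proof (cases "r < length qs")
            case True
            have "R ((A # B # qs) ! Suc (Suc r)) (rmem s ''X'') (imem s ''L'') (?bl (?h + Suc (Suc r))) (?bh (?h + Suc (Suc r)))"
              "?bh (?h + Suc (Suc r)) \<le> ival s ''e''"
              using h'[THEN conjunct2, rule_format, of "Suc (Suc r)"] True by simp_all
            then show ?thesis using keep ext True v3 e2 h' unfolding extends_def by (auto simp: nth_append)
          next
            case False
            then have "r = length qs" using r by simp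
            then show ?thesis using 2(1) v3 e2 e3 e1 h' by (simp add: nth_append)
          qed
          then show "R ((qs @ [A @ B]) ! r) (rmem s3 ''X'') (imem s3 ''L'') (imem s3 ''bl'' (ival s3 ''qh'' + r))
              (imem s3 ''bh'' (ival s3 ''qh'' + r))" "imem s3 ''bh'' (ival s3 ''qh'' + r) \<le> ival s3 ''e''" by auto
        qed
      qed
    qed
  qed
qed

text \<open>The queue consists of the blocks \<open>old\<close> of the current round and the blocks \<open>new\<close> of the next one;
  every round costs at most \<open>K * W\<close>.\<close>

lemma wp_QUEUE:
  assumes h: "holds qs s" and ne: "qs \<noteq> []" and ctx: "Ctx s"
    and S0: "set (concat qs) \<subseteq> S0" and W: "wt (concat qs) \<le> W0"
  shows "wp (QUEUE mc) (\<lambda>s' _. \<exists>A. mset A = mset (concat qs) \<and> holds [A] s' \<and> extends s s') s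
    (2 + (c + 10) * \<Lambda> * wt (concat qs) * Suc (cl (length qs)))"
proof -
  define W where "W = wt (concat qs)"
  \<comment> \<open>The 10 units are 5 for \<open>QPRE\<close>, 4 for \<open>QPOST\<close> and 1 for
    the loop test. They can be charged to the merged cells because blocks are nonempty, which forces
    \<open>\<Lambda> * (wt A + wt B)\<close> to be at least 1.\<close>
  define K where "K = (c + 10) * \<Lambda>"
  \<comment> \<open>\<open>length new + Suc (length old) div 2\<close> is the number of blocks with
    which the next round will start. Merging two old blocks leaves it unchanged and is paid by the
    weight of \<open>old\<close>; all later rounds are prepaid through \<open>cl\<close>. Merging
    reorders the items, hence the multisets.\<close>
  define I where "I s' t' \<longleftrightarrow> (\<exists>old new. old @ new \<noteq> [] \<and> mset (concat (old @ new)) = mset (concat qs) \<and>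
     holds (old @ new) s' \<and> extends s s' \<and> Ctx s' \<and>
     Suc (K * wt (concat old) + K * W * cl (length new + Suc (length old) div 2)) \<le> t')" for s' t'
  have wt_mset: "wt A = W" if "mset A = mset (concat qs)" for A
    unfolding W_def using that by (metis mset_map sum_mset_sum_list)
  show ?thesis unfolding QUEUE_def
  proof (rule wp_While[where I = I])
    have "K * W * cl (Suc (length qs) div 2) \<le> K * W * cl (length qs)"
      using ne by (intro mult_left_mono cl_mono) (cases qs, auto)
    then show "I s (2 + (c + 10) * \<Lambda> * wt (concat qs) * Suc (cl (length qs)))"
      unfolding I_def using h ctx ne
      by (intro exI[of _ qs] exI[of _ "[]"]) (auto simp: extends_def K_def[symmetric] W_def[symmetric])
  next
    fix s1 t1 assume I1: "I s1 t1" and b: "\<not> beval (ILess (IAdd (iv ''qh'') (INat 1)) (iv ''qt'')) s1"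
    then obtain old new where *: "old @ new \<noteq> []" "mset (concat (old @ new)) = mset (concat qs)"
      "holds (old @ new) s1" "extends s s1" "1 \<le> t1" using I1 unfolding I_def by fastforce
    have "length (old @ new) \<le> 1" using *(3) b unfolding holds_def by simp
    with *(1) obtain A where A: "old @ new = [A]" by (cases "old @ new") auto
    then show "1 \<le> t1 \<and> (\<exists>A. mset A = mset (concat qs) \<and> holds [A] s1 \<and> extends s s1)"
      using * unfolding A by auto
  next
    fix s1 t1 assume I1: "I s1 t1" and b: "beval (ILess (IAdd (iv ''qh'') (INat 1)) (iv ''qt'')) s1"
    then obtain old0 new0 where 0: "mset (concat (old0 @ new0)) = mset (concat qs)"
      "holds (old0 @ new0) s1" "extends s s1" "Ctx s1"
      "Suc (K * wt (concat old0) + K * W * cl (length new0 + Suc (length old0) div 2)) \<le> t1"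
      unfolding I_def by blast
    have len: "2 \<le> length old0 + length new0" using 0(2) b unfolding holds_def by simp
    have "\<exists>A B old new. old0 @ new0 = A # B # old @ new \<and>
      Suc (K * wt (concat (A # B # old)) + K * W * cl (length new + Suc (length (A # B # old)) div 2)) \<le> t1"
    proof (cases "2 \<le> length old0")
      case True
      then obtain A B old where "old0 = A # B # old"
        by (metis Suc_le_length_iff numeral_2_eq_2)
      then show ?thesis using 0(5) by (intro exI[of _ A] exI[of _ B] exI[of _ old] exI[of _ new0]) simp
    next
      \<comment> \<open>The round is over, possibly with one old block left, which joins the next
        round. Declaring all blocks old releases one full \<open>K * W\<close>, by the recursion of
        \<open>cl\<close>.\<close>
      case False
      obtain A B old where o: "old0 @ new0 = A # B # old"
        using len by (metis Suc_le_length_iff numeral_2_eq_2 length_append)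
      let ?q = "length old0 + length new0"
      have "length new0 + Suc (length old0) div 2 = ?q" using False by (cases "length old0") auto
      then have "Suc (K * wt (concat old0) + K * W * Suc (cl (Suc ?q div 2))) \<le> t1"
        using 0(5) cl_rec[OF len] by (simp only:)
      then have t: "Suc (K * W * Suc (cl (Suc ?q div 2))) \<le> t1" by linarith
      have "length (A # B # old) = ?q" using o by (metis length_append)
      moreover have "wt (concat (A # B # old)) = W" using wt_mset[OF 0(1)] unfolding o .
      ultimately show ?thesis using o t
        by (intro exI[of _ A] exI[of _ B] exI[of _ old] exI[of _ "[]"]) (simp only: list.size append_Nil2 add_0 mult_Suc_right simp_thms)
    qed
    then obtain A B old new where o: "old0 @ new0 = A # B # old @ new" and
      t: "Suc (K * wt (concat (A # B # old)) + K * W * cl (length new + Suc (length (A # B # old)) div 2)) \<le> t1"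
      by blast
    have set: "set A \<subseteq> S0" "set B \<subseteq> S0"
      using S0 mset_eq_setD[OF 0(1)] unfolding o by (auto simp del: set_concat)
    have wts: "wt A \<le> W0" "wt B \<le> W0"
      using wt_mset[OF 0(1)] W unfolding o W_def by auto
    have "wt A + wt B \<ge> 1"
    proof -
      have "R A (rmem s1 ''X'') (imem s1 ''L'') (imem s1 ''bl'' (ival s1 ''qh'')) (imem s1 ''bh'' (ival s1 ''qh''))"
        using 0(2) unfolding holds_def o by (auto dest!: spec[of _ 0])
      from R_less[OF this] R_size[OF this set(1) wts(1)] show ?thesis by (cases "wt A") auto
    qed
    moreover have "\<Lambda> \<ge> 1"
    proof (rule ccontr)
      assume "\<not> \<Lambda> \<ge> 1"
      have "R A (rmem s1 ''X'') (imem s1 ''L'') (imem s1 ''bl'' (ival s1 ''qh'')) (imem s1 ''bh'' (ival s1 ''qh''))"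
        using 0(2) unfolding holds_def o by (auto dest!: spec[of _ 0])
      moreover have "\<Lambda> = 0" using \<open>\<not> \<Lambda> \<ge> 1\<close> by simp
      ultimately show False using R_less R_size[OF _ set(1) wts(1)] by fastforce
    qed
    ultimately have "1 * 1 \<le> \<Lambda> * (wt A + wt B)" by (intro mult_mono) auto
    then have cost: "10 + c * (\<Lambda> * (wt A + wt B)) \<le> K * (wt A + wt B)"
      unfolding K_def by (simp add: algebra_simps)
    have cnt: "length (new @ [A @ B]) + Suc (length old) div 2 = length new + Suc (length (A # B # old)) div 2" by simp
    have t': "11 + c * (\<Lambda> * (wt A + wt B)) +
        (K * wt (concat old) + K * W * cl (length (new @ [A @ B]) + Suc (length old) div 2)) \<le> t1"
      using t cost unfolding cnt by (simp add: distrib_left)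
    show "1 \<le> t1 \<and> wp (QPRE ;; mc ;; QPOST) I s1 (t1 - 1)"
    proof (intro conjI)
      show "1 \<le> t1" using t' by simp
      show "wp (QPRE ;; mc ;; QPOST) I s1 (t1 - 1)"
      proof (rule wp_call[OF wp_merge_step[OF 0(2)[unfolded o] 0(4) set wts]], goal_cases)
        case 1
        show ?case using t' by linarith
      next
        case (2 s2 t2)
        note * = 2(1) and t2 = 2(3)
        show ?case unfolding I_def
        proof (rule exI[of _ old], rule exI[of _ "new @ [A @ B]"], intro conjI)
          show "mset (concat (old @ new @ [A @ B])) = mset (concat qs)"
            using 0(1) unfolding o by (simp add: ac_simps)
          show "extends s s2" using * 0(3) extends_trans by blast
          show "Suc (K * wt (concat old) + K * W * cl (length (new @ [A @ B]) + Suc (length old) div 2)) \<le> t2"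
            using t' t2 by linarith
        qed (use * in auto)
      qed
    qed
  qed
qed

end

section \<open>Merging two envelopes\<close>

definition LINE :: "iexp \<Rightarrow> rexp \<Rightarrow> rexp" where
  "LINE p m = RMul (rv ''sg'') (RAdd (RGet ''AL'' p) (RMul (RGet ''BE'' p) m))"

definition KLESS :: "iexp \<Rightarrow> iexp \<Rightarrow> rexp \<Rightarrow> bexp" where
  "KLESS p q m = bor (RLess (LINE p m) (LINE q m)) (BAnd (BNot (RLess (LINE q m) (LINE p m)))
     (bor (RLess (RMul (rv ''sg'') (RGet ''BE'' p)) (RMul (rv ''sg'') (RGet ''BE'' q)))
       (BAnd (BNot (RLess (RMul (rv ''sg'') (RGet ''BE'' q)) (RMul (rv ''sg'') (RGet ''BE'' p)))) (ILess p q))))"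

lemma reval_LINE [simp]:
  "reval (LINE p m) s = rval s ''sg'' * (rmem s ''AL'' (ieval p s) + rmem s ''BE'' (ieval p s) * reval m s)"
  unfolding LINE_def by simp

lemma lex_less_iff: "lex_less u b p v c q \<longleftrightarrow> \<not> (\<not> u < v \<and> \<not> (\<not> v < u \<and> \<not> (\<not> b < c \<and> \<not> (\<not> c < b \<and> p < q))))"
  unfolding lex_less_def by auto

lemma beval_KLESS [simp]:
  "beval (KLESS p q m) s = kless (rval s ''sg'') (rmem s ''AL'') (rmem s ''BE'') (reval m s) (ieval p s) (ieval q s)"
  unfolding KLESS_def kless_def lex_less_iff by (simp only: beval.simps reval_LINE reval.simps ieval.simps)

definition EMIT :: "rexp \<Rightarrow> iexp \<Rightarrow> com" where
  "EMIT r w = Cond (BAnd (ILess (iv ''o'') (iv ''e'')) (BNot (bor (ILess (IGet ''L'' (ISub (iv ''e'') (INat 1))) w)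
      (ILess w (IGet ''L'' (ISub (iv ''e'') (INat 1)))))))
    Skip (RPut ''X'' (iv ''e'') r ;; IPut ''L'' (iv ''e'') w ;; iinc ''e'')"

lemma mods_EMIT [simp]: "imods (EMIT r w) = [''L'', ''e'']" "rmods (EMIT r w) = [''X'']"
  unfolding EMIT_def by simp_all

text \<open>The label expression must be insensitive to the real memory because the breakpoint is
  written before the label is read.\<close>

lemma wp_EMIT:
  assumes p: "pseg F (rmem s ''X'') (imem s ''L'') (ival s ''o'') (ival s ''e'') (reval r s)"
    and xy: "reval r s < y" and F: "\<And>m. reval r s \<le> m \<Longrightarrow> m < y \<Longrightarrow> F m u"
    and u: "ieval w s = u" "\<And>X'. ieval w (s\<lparr>rmem := X'\<rparr>) = u"
  shows "wp (EMIT r w) (\<lambda>s'. \<lambda>_. pseg F (rmem s' ''X'') (imem s' ''L'') (ival s ''o'') (ival s' ''e'') y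
      \<and> ival s ''o'' < ival s' ''e'' \<and> ival s ''e'' \<le> ival s' ''e''
      \<and> (\<forall>k<ival s ''e''. rmem s' ''X'' k = rmem s ''X'' k \<and> imem s' ''L'' k = imem s ''L'' k)) s 4"
proof (cases "ival s ''o'' < ival s ''e'' \<and> imem s ''L'' (ival s ''e'' - 1) = u")
  case True
  have "pseg F (rmem s ''X'') (imem s ''L'') (ival s ''o'') (ival s ''e'') y"
    by (rule pseg_emit(1)[OF p xy F]) (use True in auto)
  then show ?thesis unfolding EMIT_def
    by (intro wp_Cond wp_straight) (use True u in auto)
next
  case False
  have q: "pseg F ((rmem s ''X'')(ival s ''e'' := reval r s)) ((imem s ''L'')(ival s ''e'' := u))
      (ival s ''o'') (Suc (ival s ''e'')) y"
    by (rule pseg_emit(2)[OF p xy F False])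
  have "ival s ''o'' \<le> ival s ''e''" using p unfolding pseg_def by simp
  then show ?thesis unfolding EMIT_def
    by (intro wp_Cond wp_straight) (use False u q in \<open>auto simp: fun_upd_def\<close>)
qed

definition EM_Y :: com where
  "EM_Y = Cond (ILess (IAdd (iv ''i'') (INat 1)) (iv ''ie'')) (rset ''y1'' (RGet ''X'' (IAdd (iv ''i'') (INat 1))))
      (rset ''y1'' (RNat (INat 1))) ;;
    Cond (ILess (IAdd (iv ''j'') (INat 1)) (iv ''je'')) (rset ''y2'' (RGet ''X'' (IAdd (iv ''j'') (INat 1))))
      (rset ''y2'' (RNat (INat 1))) ;;
    Cond (RLess (rv ''y2'') (rv ''y1'')) (rset ''y'' (rv ''y2'')) (rset ''y'' (rv ''y1''))"

definition EM_WU :: com where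
  "EM_WU = iset ''w'' (IGet ''L'' (iv ''j'')) ;; iset ''u'' (IGet ''L'' (iv ''i'')) ;;
    Cond (KLESS (iv ''u'') (iv ''w'') (rv ''x''))
      (iset ''tmp'' (iv ''u'') ;; iset ''u'' (iv ''w'') ;; iset ''w'' (iv ''tmp'')) Skip"

definition EM_OUT :: com where
  "EM_OUT = EMIT (rv ''x'') (iv ''w'') ;;
    Cond (RLess (LINE (iv ''u'') (rv ''y'')) (LINE (iv ''w'') (rv ''y'')))
      (rset ''z'' (RDiv (RSub (RGet ''AL'' (iv ''u'')) (RGet ''AL'' (iv ''w'')))
          (RSub (RGet ''BE'' (iv ''w'')) (RGet ''BE'' (iv ''u'')))) ;;
       EMIT (rv ''z'') (iv ''u'')) Skip"

definition EM_ADV :: com where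
  "EM_ADV = Cond (RLess (rv ''y'') (rv ''y1'')) Skip (iinc ''i'') ;;
    Cond (RLess (rv ''y'') (rv ''y2'')) Skip (iinc ''j'') ;; rset ''x'' (rv ''y'')"

text \<open>Both blocks partition the interval from -1 to 1, so they are exhausted simultaneously
  and testing one cursor suffices.\<close>

definition EMERGE :: com where
  "EMERGE = rset ''x'' (RSub (RNat (INat 0)) (RNat (INat 1))) ;;
    While (ILess (iv ''i'') (iv ''ie'')) (EM_Y ;; EM_WU ;; EM_OUT ;; EM_ADV)"

lemma mods_EM [simp]:
  "imods EM_Y = []" "rmods EM_Y = [''y1'', ''y1'', ''y2'', ''y2'', ''y'', ''y'']"
  "imods EM_WU = [''w'', ''u'', ''tmp'', ''u'', ''w'']" "rmods EM_WU = []"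
  "imods EM_OUT = [''L'', ''e'', ''L'', ''e'']" "rmods EM_OUT = [''X'', ''z'', ''X'']"
  "imods EM_ADV = [''i'', ''j'']" "rmods EM_ADV = [''x'']"
  unfolding EM_Y_def EM_WU_def EM_OUT_def EM_ADV_def by simp_all

lemma wp_EM_Y:
  "wp EM_Y (\<lambda>s' _. rval s' ''y1'' = nxt (rmem s ''X'') (ival s ''ie'') 1 (ival s ''i'')
     \<and> rval s' ''y2'' = nxt (rmem s ''X'') (ival s ''je'') 1 (ival s ''j'')
     \<and> rval s' ''y'' = min (rval s' ''y1'') (rval s' ''y2'')) s 6"
  unfolding EM_Y_def nxt_def by (intro wp_straight wp_Cond; simp)

lemma wp_EM_WU:
  "wp EM_WU (\<lambda>s' _. (let l = imem s ''L''; i = ival s ''i''; j = ival s ''j'' in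
       (ival s' ''w'' = l i \<and> ival s' ''u'' = l j \<or> ival s' ''w'' = l j \<and> ival s' ''u'' = l i)
     \<and> \<not> kless (rval s ''sg'') (rmem s ''AL'') (rmem s ''BE'') (rval s ''x'') (ival s' ''u'') (ival s' ''w''))) s 6"
  unfolding EM_WU_def Let_def by (intro wp_straight wp_Cond; simp add: kless_asym)

lemma wp_EM_ADV:
  "wp EM_ADV (\<lambda>s' _. ival s' ''i'' = (if rval s ''y'' < rval s ''y1'' then ival s ''i'' else Suc (ival s ''i''))
     \<and> ival s' ''j'' = (if rval s ''y'' < rval s ''y2'' then ival s ''j'' else Suc (ival s ''j''))
     \<and> rval s' ''x'' = rval s ''y'') s 5"
  unfolding EM_ADV_def by (intro wp_straight wp_Cond; simp)

text \<open>Between two breakpoints only two lines compete and they cross at most once. So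
  \<open>w\<close> leads on the whole interval, or \<open>w\<close> up to the crossing and
  \<open>u\<close> from there on.\<close>

lemma wp_EM_OUT:
  fixes s :: store
  defines "k \<equiv> kless (rval s ''sg'') (rmem s ''AL'') (rmem s ''BE'')"
    and "w \<equiv> ival s ''w''" and "u \<equiv> ival s ''u''" and "x \<equiv> rval s ''x''" and "y \<equiv> rval s ''y''"
  assumes p: "pseg F (rmem s ''X'') (imem s ''L'') (ival s ''o'') (ival s ''e'') x"
    and xy: "x < y" and nk: "\<not> k x u w" and sg: "rval s ''sg'' \<noteq> 0"
    and Fw: "\<And>m. x \<le> m \<Longrightarrow> m < y \<Longrightarrow> u = w \<or> k m w u \<Longrightarrow> F m w"
    and Fu: "\<And>m. x \<le> m \<Longrightarrow> m < y \<Longrightarrow> k m u w \<Longrightarrow> F m u"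
  shows "wp EM_OUT (\<lambda>s' _. pseg F (rmem s' ''X'') (imem s' ''L'') (ival s ''o'') (ival s' ''e'') y
      \<and> ival s ''o'' < ival s' ''e'' \<and> ival s ''e'' \<le> ival s' ''e''
      \<and> (\<forall>k<ival s ''e''. rmem s' ''X'' k = rmem s ''X'' k \<and> imem s' ''L'' k = imem s ''L'' k)) s 10"
proof -
  let ?\<sigma> = "rval s ''sg''" and ?\<alpha> = "rmem s ''AL''" and ?\<beta> = "rmem s ''BE''"
  show ?thesis
  proof (cases "?\<sigma> * (?\<alpha> u + ?\<beta> u * y) < ?\<sigma> * (?\<alpha> w + ?\<beta> w * y)")
    case False
    have E: "wp (EMIT (rv ''x'') (iv ''w'')) (\<lambda>s'. \<lambda>_. pseg F (rmem s' ''X'') (imem s' ''L'') (ival s ''o'') (ival s' ''e'') y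
      \<and> ival s ''o'' < ival s' ''e'' \<and> ival s ''e'' \<le> ival s' ''e''
      \<and> (\<forall>k<ival s ''e''. rmem s' ''X'' k = rmem s ''X'' k \<and> imem s' ''L'' k = imem s ''L'' k)) s 4"
    proof (rule wp_EMIT)
      fix m assume "reval (rv ''x'') s \<le> m" "m < y"
      then show "F m w" using Fw[of m] kless_same_until[OF nk[unfolded k_def] False, of m] unfolding k_def x_def by simp
    qed (use p xy in \<open>simp_all add: x_def w_def\<close>)
    show ?thesis unfolding EM_OUT_def
    proof (rule wp_Seq, rule wp_call[OF E], simp, goal_cases)
      case (1 s1 t1)
      have "\<not> beval (RLess (LINE (iv ''u'') (rv ''y'')) (LINE (iv ''w'') (rv ''y''))) s1"
        using 1(2) False unfolding u_def w_def y_def by (simp add: same_except_def)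
      then show ?case using 1 by (intro wp_Cond wp_Skip) auto
    qed
  next
    case True
    define z where "z = (?\<alpha> u - ?\<alpha> w) / (?\<beta> w - ?\<beta> u)"
    note sw = kless_switch[OF nk[unfolded k_def] True xy sg z_def]
    have E: "wp (EMIT (rv ''x'') (iv ''w'')) (\<lambda>s'. \<lambda>_. pseg F (rmem s' ''X'') (imem s' ''L'') (ival s ''o'') (ival s' ''e'') z
      \<and> ival s ''o'' < ival s' ''e'' \<and> ival s ''e'' \<le> ival s' ''e''
      \<and> (\<forall>k<ival s ''e''. rmem s' ''X'' k = rmem s ''X'' k \<and> imem s' ''L'' k = imem s ''L'' k)) s 4"
    proof (rule wp_EMIT)
      fix m assume "reval (rv ''x'') s \<le> m" "m < z"
      then show "F m w" using Fw[of m] sw unfolding k_def x_def by simp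
    qed (use p sw in \<open>simp_all add: x_def w_def\<close>)
    show ?thesis unfolding EM_OUT_def
    proof (rule wp_Seq, rule wp_call[OF E], simp, goal_cases)
      case (1 s1 t1)
      have same: "rmem s1 ''AL'' = ?\<alpha>" "rmem s1 ''BE'' = ?\<beta>" "rmem s1 ''sg'' = rmem s ''sg''"
        "imem s1 ''u'' = imem s ''u''" "imem s1 ''w'' = imem s ''w''" "imem s1 ''o'' = imem s ''o''"
        "rmem s1 ''y'' = rmem s ''y''"
        using 1(2) by (simp_all add: same_except_def)
      have b: "beval (RLess (LINE (iv ''u'') (rv ''y'')) (LINE (iv ''w'') (rv ''y''))) s1"
        using same True unfolding u_def w_def y_def by simp
      let ?s2 = "s1\<lparr>rmem := (rmem s1)(''z'' := (rmem s1 ''z'')(0 := z))\<rparr>"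
      have E2: "wp (EMIT (rv ''z'') (iv ''u'')) (\<lambda>s'. \<lambda>_. pseg F (rmem s' ''X'') (imem s' ''L'') (ival ?s2 ''o'') (ival s' ''e'') y
        \<and> ival ?s2 ''o'' < ival s' ''e'' \<and> ival ?s2 ''e'' \<le> ival s' ''e''
        \<and> (\<forall>k<ival ?s2 ''e''. rmem s' ''X'' k = rmem ?s2 ''X'' k \<and> imem s' ''L'' k = imem ?s2 ''L'' k)) ?s2 4"
      proof (rule wp_EMIT)
        fix m assume "reval (rv ''z'') ?s2 \<le> m" "m < y"
        then show "F m u" using Fu[of m] sw unfolding k_def x_def by simp
      qed (use 1(1) sw same in \<open>simp_all add: u_def\<close>)
      have "wp (rset ''z'' (RDiv (RSub (RGet ''AL'' (iv ''u'')) (RGet ''AL'' (iv ''w'')))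
          (RSub (RGet ''BE'' (iv ''w'')) (RGet ''BE'' (iv ''u'')))) ;; EMIT (rv ''z'') (iv ''u''))
          (\<lambda>s' _. pseg F (rmem s' ''X'') (imem s' ''L'') (ival s ''o'') (ival s' ''e'') y
      \<and> ival s ''o'' < ival s' ''e'' \<and> ival s ''e'' \<le> ival s' ''e''
      \<and> (\<forall>k<ival s ''e''. rmem s' ''X'' k = rmem s ''X'' k \<and> imem s' ''L'' k = imem s ''L'' k)) s1 (t1 - 1)"
      proof (rule wp_Seq, rule wp_RPut)
        show "1 \<le> t1 - 1" using 1 by simp
        have s2: "s1\<lparr>rmem := (rmem s1)(''z'' := (rmem s1 ''z'')(ieval (INat 0) s1 :=
            reval (RDiv (RSub (RGet ''AL'' (iv ''u'')) (RGet ''AL'' (iv ''w''))) (RSub (RGet ''BE'' (iv ''w'')) (RGet ''BE'' (iv ''u'')))) s1))\<rparr> = ?s2"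
          using same unfolding z_def u_def w_def by simp
        show "wp (EMIT (rv ''z'') (iv ''u'')) (\<lambda>s' _. pseg F (rmem s' ''X'') (imem s' ''L'') (ival s ''o'') (ival s' ''e'') y
      \<and> ival s ''o'' < ival s' ''e'' \<and> ival s ''e'' \<le> ival s' ''e''
      \<and> (\<forall>k<ival s ''e''. rmem s' ''X'' k = rmem s ''X'' k \<and> imem s' ''L'' k = imem s ''L'' k)) (s1\<lparr>rmem := (rmem s1)(''z'' := (rmem s1 ''z'')(ieval (INat 0) s1 :=
            reval (RDiv (RSub (RGet ''AL'' (iv ''u'')) (RGet ''AL'' (iv ''w''))) (RSub (RGet ''BE'' (iv ''w'')) (RGet ''BE'' (iv ''u'')))) s1))\<rparr>) (t1 - 1 - 1)"
          unfolding s2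
        proof (rule wp_call[OF E2], goal_cases)
          case 1
          show ?case using \<open>10 - 4 \<le> t1\<close> by simp
        next
          case (2 s3 t3)
          then show ?case using 1(1) same by auto
        qed
      qed
      then show ?case using b 1 by (intro wp_Cond) auto
    qed
  qed
qed

lemma pseg_less:
  assumes "pseg F X L lo hi y" and "lo \<le> k" and "k < hi"
  shows "X k < y" "nxt X hi y k \<le> y"
proof -
  have "X (hi - 1) < nxt X hi y (hi - 1)" using assms unfolding pseg_def by simp
  then have last: "X (hi - 1) < y" using assms(2,3) unfolding nxt_def by simp
  have less: "X k' < y" if "lo \<le> k'" "k' < hi" for k'
  proof (cases "k' = hi - 1")
    case False
    then have "k' < hi - 1" "hi - 1 < hi" using that by auto
    then show ?thesis using pseg_mono[OF assms(1) that(1)] last by force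
  qed (use last in simp)
  show "X k < y" using less assms by simp
  show "nxt X hi y k \<le> y" using less[of "Suc k"] assms unfolding nxt_def by (auto intro: less_imp_le)
qed

lemma pseg_next:
  assumes "pseg F X L lo hi y" and "lo \<le> k" and "Suc k < hi"
  shows "nxt X hi y k = X (Suc k)" "X (Suc k) < nxt X hi y (Suc k)"
  using assms unfolding pseg_def by (auto simp: nxt_def)

text \<open>\<open>y\<close> never exceeds the end of the current piece, so the cursor moves by at
  most one. The equivalence of \<open>k' < hi\<close> and \<open>y < 1\<close> is what keeps the two
  cursors of a merge synchronous.\<close>

lemma pseg_advance:
  assumes p: "pseg F X L lo hi 1" and k: "lo \<le> k" "k < hi" and x: "X k \<le> x" "x < y" "y \<le> nxt X hi 1 k"
    and k': "k' = (if y < nxt X hi 1 k then k else Suc k)"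
  shows "lo \<le> k' \<and> k' \<le> hi \<and> (k' < hi \<longleftrightarrow> y < 1) \<and> (k' < hi \<longrightarrow> X k' \<le> y \<and> y < nxt X hi 1 k')"
proof (cases "y < nxt X hi 1 k")
  case True
  then show ?thesis using k' k x pseg_less[OF p k] by auto
next
  case False
  then have y: "y = nxt X hi 1 k" "k' = Suc k" using x k' by auto
  show ?thesis
  proof (cases "Suc k < hi")
    case True
    then show ?thesis using y k pseg_next[OF p k(1) True] pseg_less[OF p _ True] by auto
  next
    case False
    then have "Suc k = hi" "y = 1" using k y unfolding nxt_def by auto
    then show ?thesis using y k by auto
  qed
qed

lemma cost_start: "2 \<le> (n::nat) \<Longrightarrow> Suc (28 * n) \<le> 32 * n - 1" by simp
lemma cost_sort: "1 \<le> (n::nat) \<Longrightarrow> Suc (6 * n) \<le> 7 * n" by simp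
lemma cost_copy: "(n::nat) + 1 \<le> m \<Longrightarrow> t - 1 - 1 - 4 \<le> t' \<Longrightarrow> Suc (6 * m) \<le> t \<Longrightarrow> Suc (6 * n) \<le> t'" by linarith
lemma cost_left: "Suc (6 * (n::nat)) \<le> t \<Longrightarrow> 1 \<le> n \<Longrightarrow> 1 \<le> t - 1 \<and> 1 \<le> t" by linarith
lemma cost_step: "(n::nat) \<le> m \<Longrightarrow> 1 + c * m \<le> t \<Longrightarrow> Suc (c * n) \<le> t"
  using mult_le_mono2[of n m c] by linarith

lemma wp_EMERGE:
  fixes s :: store
  defines "\<sigma> \<equiv> rval s ''sg''" and "\<alpha> \<equiv> rmem s ''AL''" and "\<beta> \<equiv> rmem s ''BE''"
    and "X \<equiv> rmem s ''X''" and "L \<equiv> imem s ''L''" and "e \<equiv> ival s ''e''"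
    and "ie \<equiv> ival s ''ie''" and "je \<equiv> ival s ''je''"
  assumes \<sigma>: "\<sigma> \<noteq> 0" and A: "Rep \<sigma> \<alpha> \<beta> \<tau> A X L (ival s ''i'') ie" and B: "Rep \<sigma> \<alpha> \<beta> \<tau> B X L (ival s ''j'') je"
    and ie: "ie \<le> e" and je: "je \<le> e" and o: "ival s ''o'' = e"
  shows "wp EMERGE (\<lambda>s' _. e \<le> ival s' ''e'' \<and> (\<forall>k<e. rmem s' ''X'' k = X k \<and> imem s' ''L'' k = L k)
      \<and> Rep \<sigma> \<alpha> \<beta> \<tau> (A @ B) (rmem s' ''X'') (imem s' ''L'') e (ival s' ''e'')) s
    (32 * ((ie - ival s ''i'') + (je - ival s ''j'')))"
proof -
  define F where "F m = isbest \<sigma> \<alpha> \<beta> m ((\<lambda>g. \<tau> g m) ` set (A @ B))" for m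
  have i0: "ival s ''i'' < ie" "ival s ''j'' < je" using A B unfolding Rep_def by auto
  have pA: "pseg (\<lambda>m. isbest \<sigma> \<alpha> \<beta> m ((\<lambda>g. \<tau> g m) ` set A)) X L (ival s ''i'') ie 1"
    and pB: "pseg (\<lambda>m. isbest \<sigma> \<alpha> \<beta> m ((\<lambda>g. \<tau> g m) ` set B)) X L (ival s ''j'') je 1"
    using A B unfolding Rep_def by auto
  define inpos where "inpos lo hi i x \<longleftrightarrow> lo \<le> i \<and> i \<le> hi \<and> (i < hi \<longleftrightarrow> x < 1) \<and> (i < hi \<longrightarrow> X i \<le> x \<and> x < nxt X hi 1 i)"
    for lo hi i :: nat and x :: real
  define static where "static s' \<longleftrightarrow> ival s' ''ie'' = ie \<and> ival s' ''je'' = je \<and> ival s' ''o'' = e \<and>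
    rval s' ''sg'' = \<sigma> \<and> rmem s' ''AL'' = \<alpha> \<and> rmem s' ''BE'' = \<beta>" for s'
  define keep where "keep s' \<longleftrightarrow> e \<le> ival s' ''e'' \<and> (\<forall>k<e. rmem s' ''X'' k = X k \<and> imem s' ''L'' k = L k)" for s'
  \<comment> \<open>28 is 6 + 6 + 10 + 5 for the four parts of the body and 1 for the test; each
    iteration advances at least one cursor.\<close>
  define I where "I s' t' \<longleftrightarrow> static s' \<and> keep s' \<and> inpos (ival s ''i'') ie (ival s' ''i'') (rval s' ''x'') \<and>
     inpos (ival s ''j'') je (ival s' ''j'') (rval s' ''x'') \<and> rval s' ''x'' \<le> 1 \<and>
     pseg F (rmem s' ''X'') (imem s' ''L'') e (ival s' ''e'') (rval s' ''x'') \<and>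
     Suc (28 * ((ie - ival s' ''i'') + (je - ival s' ''j''))) \<le> t'" for s' t'
  have start: "X (ival s ''i'') = -1" "X (ival s ''j'') = -1" using pA pB i0 unfolding pseg_def by auto
  have at0: "inpos (ival s ''i'') ie (ival s ''i'') (-1)" "inpos (ival s ''j'') je (ival s ''j'') (-1)"
    using pA pB i0 start unfolding inpos_def pseg_def by auto
  have out: "e \<le> ival s' ''e'' \<and> (\<forall>k<e. rmem s' ''X'' k = X k \<and> imem s' ''L'' k = L k)
      \<and> Rep \<sigma> \<alpha> \<beta> \<tau> (A @ B) (rmem s' ''X'') (imem s' ''L'') e (ival s' ''e'')"
    if "I s' t'" "\<not> ival s' ''i'' < ival s' ''ie''" for s' t'
  proof -
    have "rval s' ''x'' = 1" using that unfolding I_def inpos_def static_def by auto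
    then have "pseg F (rmem s' ''X'') (imem s' ''L'') e (ival s' ''e'') 1" using that(1) unfolding I_def by auto
    moreover have "e < ival s' ''e''" using \<open>pseg F _ _ e _ 1\<close> unfolding pseg_def by (cases "e = ival s' ''e''") auto
    ultimately show ?thesis using that(1) unfolding I_def keep_def Rep_def F_def by simp
  qed
  have step: "wp (EM_Y ;; EM_WU ;; EM_OUT ;; EM_ADV) I s0 (t0 - 1)"
    if I0: "I s0 t0" and b: "ival s0 ''i'' < ie" for s0 t0
  proof -
    let ?i = "ival s0 ''i''" and ?j = "ival s0 ''j''" and ?x = "rval s0 ''x''"
    have s0: "static s0" "keep s0" "inpos (ival s ''i'') ie ?i ?x" "inpos (ival s ''j'') je ?j ?x"
      "pseg F (rmem s0 ''X'') (imem s0 ''L'') e (ival s0 ''e'') ?x"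
      "Suc (28 * ((ie - ?i) + (je - ?j))) \<le> t0" using I0 unfolding I_def by auto
    have lt: "?x < 1" "?j < je" using s0(3,4) b unfolding inpos_def by auto
    have pos: "ival s ''i'' \<le> ?i" "X ?i \<le> ?x" "?x < nxt X ie 1 ?i" "ival s ''j'' \<le> ?j" "X ?j \<le> ?x" "?x < nxt X je 1 ?j"
      using s0(3,4) b lt unfolding inpos_def by auto
    have nx: "nxt (rmem s0 ''X'') ie 1 ?i = nxt X ie 1 ?i" "nxt (rmem s0 ''X'') je 1 ?j = nxt X je 1 ?j"
      using s0(2) ie je unfolding keep_def nxt_def by auto
    have lab: "imem s0 ''L'' ?i = L ?i" "imem s0 ''L'' ?j = L ?j" using s0(2) ie je b lt unfolding keep_def by auto
    \<comment> \<open>Up to the nearer of the two next breakpoints both blocks have constant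
      labels.\<close>
    define y where "y = min (nxt X ie 1 ?i) (nxt X je 1 ?j)"
    have y: "?x < y" "y \<le> nxt X ie 1 ?i" "y \<le> nxt X je 1 ?j" "y \<le> 1"
      using pos pseg_less(2)[OF pA pos(1) b] unfolding y_def by auto
    have bi: "isbest \<sigma> \<alpha> \<beta> m ((\<lambda>g. \<tau> g m) ` set A) (L ?i)" and bj: "isbest \<sigma> \<alpha> \<beta> m ((\<lambda>g. \<tau> g m) ` set B) (L ?j)"
      if "?x \<le> m" "m < y" for m
      using pA pB pos b lt y that unfolding pseg_def by auto
    have t: "28 + 28 * ((ie - ?i) + (je - ?j) - 1) \<le> t0 - 1" using s0(6) b by simp
    show ?thesis
    proof (rule wp_Seq, rule wp_call[OF wp_EM_Y], goal_cases)
      case 1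
      show ?case using t by linarith
    next
      case (2 s1 t1)
      have e1: "imem s1 = imem s0" "rmem s1 ''X'' = rmem s0 ''X''" "rval s1 ''x'' = ?x" "rval s1 ''sg'' = rval s0 ''sg''"
        "rmem s1 ''AL'' = rmem s0 ''AL''" "rmem s1 ''BE'' = rmem s0 ''BE''"
        using 2(2) unfolding same_except_def by (auto intro: ext)
      have y1: "rval s1 ''y1'' = nxt X ie 1 ?i" "rval s1 ''y2'' = nxt X je 1 ?j" "rval s1 ''y'' = y"
        using 2(1) s0(1) nx unfolding static_def y_def by auto
      show ?case
      proof (rule wp_Seq, rule wp_call[OF wp_EM_WU], goal_cases)
        case 1
        show ?case using t 2(3) by linarith
      next
        case (2 s2 t2)
        note t1 = \<open>t0 - 1 - 6 \<le> t1\<close>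
        have e2: "rmem s2 = rmem s1" "imem s2 ''L'' = imem s0 ''L''" "ival s2 ''i'' = ?i" "ival s2 ''j'' = ?j"
          "ival s2 ''o'' = ival s0 ''o''" "ival s2 ''e'' = ival s0 ''e''" "ival s2 ''ie'' = ival s0 ''ie''"
          "ival s2 ''je'' = ival s0 ''je''"
          using 2(2) e1 unfolding same_except_def by (auto intro: ext)
        have st2: "rval s2 ''sg'' = \<sigma>" "rmem s2 ''AL'' = \<alpha>" "rmem s2 ''BE'' = \<beta>" "rval s2 ''x'' = ?x"
          using e1 e2 s0(1) unfolding static_def by auto
        have wu: "ival s2 ''w'' = L ?i \<and> ival s2 ''u'' = L ?j \<or> ival s2 ''w'' = L ?j \<and> ival s2 ''u'' = L ?i"
          "\<not> kless \<sigma> \<alpha> \<beta> ?x (ival s2 ''u'') (ival s2 ''w'')"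
          using 2(1) e1 lab s0(1) unfolding Let_def static_def by auto
        have un: "(\<lambda>g. \<tau> g m) ` set (A @ B) = (\<lambda>g. \<tau> g m) ` set A \<union> (\<lambda>g. \<tau> g m) ` set B" for m by auto
        have Fw: "F m (ival s2 ''w'')" if "?x \<le> m" "m < y"
            "ival s2 ''u'' = ival s2 ''w'' \<or> kless \<sigma> \<alpha> \<beta> m (ival s2 ''w'') (ival s2 ''u'')" for m
          using isbest_Un[OF bi[OF that(1,2)] bj[OF that(1,2)]] wu(1) that(3) unfolding F_def un by auto
        have Fu: "F m (ival s2 ''u'')" if "?x \<le> m" "m < y" "kless \<sigma> \<alpha> \<beta> m (ival s2 ''u'') (ival s2 ''w'')" for m
          using isbest_Un[OF bi[OF that(1,2)] bj[OF that(1,2)]] wu(1) that(3) unfolding F_def un by auto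
        have OUT: "wp EM_OUT (\<lambda>s' _. pseg F (rmem s' ''X'') (imem s' ''L'') (ival s2 ''o'') (ival s' ''e'') (rval s2 ''y'')
            \<and> ival s2 ''o'' < ival s' ''e'' \<and> ival s2 ''e'' \<le> ival s' ''e''
            \<and> (\<forall>k<ival s2 ''e''. rmem s' ''X'' k = rmem s2 ''X'' k \<and> imem s' ''L'' k = imem s2 ''L'' k)) s2 10"
          by (rule wp_EM_OUT) (use s0(1,5) st2 e2 e1 y1 y wu(2) \<sigma> Fw Fu in \<open>simp_all add: static_def\<close>)
        show ?case
        proof (rule wp_Seq, rule wp_call[OF OUT], goal_cases)
          case 1
          show ?case using t t1 2(3) by linarith
        next
          case (2 s3 t3)
          note t2 = \<open>t1 - 6 \<le> t2\<close>
          have e3: "imem s3 ''i'' = imem s2 ''i''" "imem s3 ''j'' = imem s2 ''j''" "imem s3 ''o'' = imem s2 ''o''"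
            "imem s3 ''ie'' = imem s2 ''ie''" "imem s3 ''je'' = imem s2 ''je''" "rmem s3 ''sg'' = rmem s2 ''sg''"
            "rmem s3 ''AL'' = rmem s2 ''AL''" "rmem s3 ''BE'' = rmem s2 ''BE''" "rmem s3 ''y'' = rmem s2 ''y''"
            "rmem s3 ''y1'' = rmem s2 ''y1''" "rmem s3 ''y2'' = rmem s2 ''y2''"
            using 2(2) by (simp_all add: same_except_def)
          show ?case
          proof (rule wp_call[OF wp_EM_ADV], goal_cases)
            case 1
            show ?case using t t1 t2 2(3) by linarith
          next
            case (2 s4 t4)
            note t3 = \<open>t2 - 10 \<le> t3\<close> and P3 = \<open>pseg F (rmem s3 ''X'') _ _ _ _ \<and> _\<close>
            have e4: "imem s4 ''o'' = imem s3 ''o''" "imem s4 ''ie'' = imem s3 ''ie''" "imem s4 ''je'' = imem s3 ''je''"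
              "rmem s4 ''sg'' = rmem s3 ''sg''" "rmem s4 ''AL'' = rmem s3 ''AL''" "rmem s4 ''BE'' = rmem s3 ''BE''"
              "rmem s4 ''X'' = rmem s3 ''X''" "imem s4 ''L'' = imem s3 ''L''" "imem s4 ''e'' = imem s3 ''e''"
              using 2(2) by (simp_all add: same_except_def)
            have v: "ival s4 ''i'' = (if y < nxt X ie 1 ?i then ?i else Suc ?i)"
              "ival s4 ''j'' = (if y < nxt X je 1 ?j then ?j else Suc ?j)" "rval s4 ''x'' = y"
              using 2(1) e3 e2 y1 by auto
            have "inpos (ival s ''i'') ie (ival s4 ''i'') y"
              unfolding inpos_def by (rule pseg_advance[OF pA pos(1) b pos(2) y(1,2) v(1)])
            moreover have "inpos (ival s ''j'') je (ival s4 ''j'') y"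
              unfolding inpos_def by (rule pseg_advance[OF pB pos(4) lt(2) pos(5) y(1,3) v(2)])
            moreover have "static s4" using s0(1) st2 e2 e3 e4 unfolding static_def by simp
            moreover have "keep s4" using s0(2) P3 e1 e2 e4 unfolding keep_def by auto
            moreover have "pseg F (rmem s4 ''X'') (imem s4 ''L'') e (ival s4 ''e'') y"
              using P3 s0(1) e1 e2 e4 y1 unfolding static_def by simp
            moreover have "Suc (28 * ((ie - ival s4 ''i'') + (je - ival s4 ''j''))) \<le> t4"
            proof -
              have "y = nxt X ie 1 ?i \<or> y = nxt X je 1 ?j" unfolding y_def by linarith
              then have "(ie - ival s4 ''i'') + (je - ival s4 ''j'') \<le> (ie - ?i) + (je - ?j) - 1"
                using v b lt by auto
              moreover have "1 + 28 * ((ie - ?i) + (je - ?j) - 1) \<le> t4" using t t1 t2 t3 2(3) by linarith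
              ultimately show ?thesis by (rule cost_step)
            qed
            ultimately show "I s4 t4" using y(4) v(3) unfolding I_def by simp
          qed
        qed
      qed
    qed
  qed
  show ?thesis unfolding EMERGE_def
  proof (intro wp_Seq wp_RPut)
    have "(ie - ival s ''i'') + (je - ival s ''j'') \<ge> 2" using i0 by simp
    then show "1 \<le> 32 * ((ie - ival s ''i'') + (je - ival s ''j''))" by simp
    show "wp (While (ILess (iv ''i'') (iv ''ie'')) (EM_Y ;; EM_WU ;; EM_OUT ;; EM_ADV))
      (\<lambda>s' _. e \<le> ival s' ''e'' \<and> (\<forall>k<e. rmem s' ''X'' k = X k \<and> imem s' ''L'' k = L k)
        \<and> Rep \<sigma> \<alpha> \<beta> \<tau> (A @ B) (rmem s' ''X'') (imem s' ''L'') e (ival s' ''e''))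
      (s\<lparr>rmem := (rmem s)(''x'' := (rmem s ''x'')(ieval (INat 0) s := reval (RSub (RNat (INat 0)) (RNat (INat 1))) s))\<rparr>)
      (32 * (ie - ival s ''i'' + (je - ival s ''j'')) - 1)"
    proof (rule wp_While[where I = I], goal_cases)
      case 1
      have "pseg F (rmem s ''X'') (imem s ''L'') e e (-1)" unfolding pseg_def by auto
      moreover have "Suc (28 * ((ie - ival s ''i'') + (je - ival s ''j''))) \<le> 32 * (ie - ival s ''i'' + (je - ival s ''j'')) - 1"
        using i0 by (intro cost_start) simp
      ultimately show ?case unfolding I_def using at0 o
        by (simp add: static_def keep_def \<sigma>_def \<alpha>_def \<beta>_def X_def L_def e_def ie_def je_def)
    next
      case (2 s0 t0)
      have "static s0" "1 \<le> t0" using 2(1) unfolding I_def by auto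
      then show ?case using step[OF 2(1)] 2(2) unfolding static_def by simp
    next
      case (3 s0 t0)
      have "1 \<le> t0" using 3(1) unfolding I_def by auto
      then show ?case using out[OF 3(1)] 3(2) by simp
    qed
  qed
qed

lemma Rep_cong:
  assumes "\<And>k. lo \<le> k \<Longrightarrow> k < hi \<Longrightarrow> X' k = X k \<and> L' k = L k"
  shows "Rep \<sigma> \<alpha> \<beta> \<tau> A X' L' lo hi = Rep \<sigma> \<alpha> \<beta> \<tau> A X L lo hi"
  unfolding Rep_def using pseg_cong[of lo hi X' X L' L] assms by blast

lemma EMERGE_queue_merge:
  assumes "\<sigma> \<noteq> 0"
    and "\<And>A X L lo hi. Rep \<sigma> \<alpha> \<beta> \<tau> A X L lo hi \<Longrightarrow> set A \<subseteq> S0 \<Longrightarrow> sum_list (map w A) \<le> W0 \<Longrightarrow>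
      hi - lo \<le> \<Lambda> * sum_list (map w A)"
  shows "queue_merge EMERGE (Rep \<sigma> \<alpha> \<beta> \<tau>) (\<lambda>s. rval s ''sg'' = \<sigma> \<and> rmem s ''AL'' = \<alpha> \<and> rmem s ''BE'' = \<beta>) 32 \<Lambda> w S0 W0"
proof
  fix s A B
  assume "rval s ''sg'' = \<sigma> \<and> rmem s ''AL'' = \<alpha> \<and> rmem s ''BE'' = \<beta>"
    and "Rep \<sigma> \<alpha> \<beta> \<tau> A (rmem s ''X'') (imem s ''L'') (ival s ''i'') (ival s ''ie'')"
    and "Rep \<sigma> \<alpha> \<beta> \<tau> B (rmem s ''X'') (imem s ''L'') (ival s ''j'') (ival s ''je'')"
    and "ival s ''ie'' \<le> ival s ''e''" "ival s ''je'' \<le> ival s ''e''" "ival s ''o'' = ival s ''e''"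
  then show "wp EMERGE (\<lambda>s' _. ival s ''e'' \<le> ival s' ''e''
          \<and> (\<forall>k<ival s ''e''. rmem s' ''X'' k = rmem s ''X'' k \<and> imem s' ''L'' k = imem s ''L'' k)
          \<and> Rep \<sigma> \<alpha> \<beta> \<tau> (A @ B) (rmem s' ''X'') (imem s' ''L'') (ival s ''e'') (ival s' ''e'')) s
        (32 * ((ival s ''ie'' - ival s ''i'') + (ival s ''je'' - ival s ''j'')))"
    using wp_EMERGE[of s \<tau> A B] assms(1) by simp
next
  fix A and L L' :: "nat \<Rightarrow> nat" and X X' :: "nat \<Rightarrow> real" and lo hi :: nat
  assume "\<And>k. lo \<le> k \<Longrightarrow> k < hi \<Longrightarrow> X' k = X k \<and> L' k = L k"
  then show "Rep \<sigma> \<alpha> \<beta> \<tau> A X' L' lo hi = Rep \<sigma> \<alpha> \<beta> \<tau> A X L lo hi" by (rule Rep_cong)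
qed (use assms(2) in \<open>auto simp: same_except_def QUEUE_def EMERGE_def Rep_def\<close>)

section \<open>Merging two sorted sequences of events\<close>

text \<open>Kinds break ties so that at equal positions opening events (kind 0) precede closing ones
  (kind 1): closed intervals that share only an end point have to be counted as overlapping.\<close>

definition ele :: "(nat \<Rightarrow> real) \<Rightarrow> (nat \<Rightarrow> nat) \<Rightarrow> nat \<Rightarrow> nat \<Rightarrow> bool" where
  "ele pos kd a b \<longleftrightarrow> pos a < pos b \<or> pos a = pos b \<and> kd a \<le> kd b"

definition SRep :: "(nat \<Rightarrow> real) \<Rightarrow> (nat \<Rightarrow> nat) \<Rightarrow> nat list \<Rightarrow> (nat \<Rightarrow> real) \<Rightarrow> (nat \<Rightarrow> nat) \<Rightarrow> nat \<Rightarrow> nat \<Rightarrow> bool" where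
  "SRep pos kd A X L lo hi \<longleftrightarrow> lo < hi \<and> mset (map L [lo..<hi]) = mset A \<and> (\<forall>k. lo \<le> k \<and> k < hi \<longrightarrow> X k = pos (L k))
     \<and> sorted_wrt (ele pos kd) (map L [lo..<hi])"

definition SLESS :: "iexp \<Rightarrow> iexp \<Rightarrow> bexp" where
  "SLESS p q = bor (RLess (RGet ''X'' p) (RGet ''X'' q)) (BAnd (BNot (RLess (RGet ''X'' q) (RGet ''X'' p)))
     (ILess (IGet ''kd'' (IGet ''L'' p)) (IGet ''kd'' (IGet ''L'' q))))"

definition SCOPY :: "vname \<Rightarrow> com" where
  "SCOPY x = RPut ''X'' (iv ''e'') (RGet ''X'' (iv x)) ;; IPut ''L'' (iv ''e'') (IGet ''L'' (iv x)) ;; iinc x ;; iinc ''e''"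

definition SMERGE :: com where
  "SMERGE = While (bor (ILess (iv ''i'') (iv ''ie'')) (ILess (iv ''j'') (iv ''je'')))
    (Cond (BAnd (ILess (iv ''j'') (iv ''je'')) (bor (BNot (ILess (iv ''i'') (iv ''ie''))) (SLESS (iv ''j'') (iv ''i''))))
      (SCOPY ''j'') (SCOPY ''i''))"

lemma wp_SCOPY:
  assumes "x = ''i'' \<or> x = ''j''"
  shows "wp (SCOPY x) (\<lambda>s' _. rmem s' ''X'' = (rmem s ''X'')(ival s ''e'' := rmem s ''X'' (ival s x))
     \<and> imem s' ''L'' = (imem s ''L'')(ival s ''e'' := imem s ''L'' (ival s x))
     \<and> ival s' x = Suc (ival s x) \<and> ival s' ''e'' = Suc (ival s ''e'')) s 4"
  using assms unfolding SCOPY_def by (intro wp_straight; auto)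

lemma ele_total: "\<not> ele pos kd a b \<Longrightarrow> ele pos kd b a"
  unfolding ele_def by auto

lemma ele_trans: "ele pos kd a b \<Longrightarrow> ele pos kd b c \<Longrightarrow> ele pos kd a c"
  unfolding ele_def by auto

lemma cost_left6: "Suc (6 * (n::nat)) \<le> t \<Longrightarrow> 1 \<le> n \<Longrightarrow> 4 \<le> t - 1 - 1" by linarith

lemma wp_SMERGE:
  fixes s :: store
  defines "X \<equiv> rmem s ''X''" and "L \<equiv> imem s ''L''" and "e \<equiv> ival s ''e''"
    and "ie \<equiv> ival s ''ie''" and "je \<equiv> ival s ''je''"
  assumes kd: "imem s ''kd'' = kd" and A: "SRep pos kd A X L (ival s ''i'') ie" and B: "SRep pos kd B X L (ival s ''j'') je"
    and ie: "ie \<le> e" and je: "je \<le> e"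
  shows "wp SMERGE (\<lambda>s' _. e \<le> ival s' ''e'' \<and> (\<forall>k<e. rmem s' ''X'' k = X k \<and> imem s' ''L'' k = L k)
      \<and> SRep pos kd (A @ B) (rmem s' ''X'') (imem s' ''L'') e (ival s' ''e'')) s
    (7 * ((ie - ival s ''i'') + (je - ival s ''j'')))"
proof -
  let ?le = "ele pos kd"
  have i0: "ival s ''i'' < ie" "ival s ''j'' < je" using A B unfolding SRep_def by auto
  define static where "static s' \<longleftrightarrow> imem s' ''kd'' = kd \<and> ival s' ''ie'' = ie \<and> ival s' ''je'' = je" for s'
  define keep where "keep s' \<longleftrightarrow> e \<le> ival s' ''e'' \<and> (\<forall>k<e. rmem s' ''X'' k = X k \<and> imem s' ''L'' k = L k)" for s'
  define inrange where "inrange s' \<longleftrightarrow> ival s ''i'' \<le> ival s' ''i'' \<and> ival s' ''i'' \<le> ie \<and>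
     ival s ''j'' \<le> ival s' ''j'' \<and> ival s' ''j'' \<le> je" for s'
  \<comment> \<open>Only the heads of the two remainders are compared; sortedness and transitivity
    carry the comparison to all remaining events, so the output can be extended.\<close>
  define ordered where "ordered out r1 r2 \<longleftrightarrow> mset out + mset r1 + mset r2 = mset (A @ B) \<and> sorted_wrt ?le out \<and>
     sorted_wrt ?le r1 \<and> sorted_wrt ?le r2 \<and> (\<forall>a\<in>set out. \<forall>b\<in>set r1 \<union> set r2. ?le a b)" for out r1 r2
  define out where "out s' = map (imem s' ''L'') [e..<ival s' ''e'']" for s'
  define r1 where "r1 s' = map L [ival s' ''i''..<ie]" for s'
  define r2 where "r2 s' = map L [ival s' ''j''..<je]" for s'
  define tagged where "tagged s' \<longleftrightarrow> (\<forall>k. e \<le> k \<and> k < ival s' ''e'' \<longrightarrow> rmem s' ''X'' k = pos (imem s' ''L'' k))" for s'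
  define I where "I s' t' \<longleftrightarrow> static s' \<and> keep s' \<and> inrange s' \<and> ordered (out s') (r1 s') (r2 s') \<and> tagged s' \<and>
     Suc (6 * ((ie - ival s' ''i'') + (je - ival s' ''j''))) \<le> t'" for s' t'
  have pos: "X k = pos (L k)" if "ival s ''i'' \<le> k \<and> k < ie \<or> ival s ''j'' \<le> k \<and> k < je" for k
    using A B that unfolding SRep_def by auto
  have copy: "wp (SCOPY x) I s1 (t1 - 1 - 1)"
    if I1: "I s1 t1" and x: "x = ''i'' \<and> ival s1 ''i'' < ie \<and> (ival s1 ''j'' < je \<longrightarrow> ?le (L (ival s1 ''i'')) (L (ival s1 ''j'')))
      \<or> x = ''j'' \<and> ival s1 ''j'' < je \<and> (ival s1 ''i'' < ie \<longrightarrow> ?le (L (ival s1 ''j'')) (L (ival s1 ''i'')))" for s1 t1 x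
  proof (rule wp_call[OF wp_SCOPY], goal_cases)
    case 1
    show ?case using x by blast
  next
    case 2
    have "Suc (6 * ((ie - ival s1 ''i'') + (je - ival s1 ''j''))) \<le> t1" using I1 unfolding I_def by simp
    moreover have "1 \<le> (ie - ival s1 ''i'') + (je - ival s1 ''j'')" using x by force
    ultimately show ?case by (rule cost_left6)
  next
    case (3 s2 t2)
    let ?p = "ival s1 x" and ?e = "ival s1 ''e''"
    have I1': "static s1" "keep s1" "inrange s1" "ordered (out s1) (r1 s1) (r2 s1)" "tagged s1"
      "Suc (6 * ((ie - ival s1 ''i'') + (je - ival s1 ''j''))) \<le> t1"
      using I1 unfolding I_def by blast+
    have xij: "x = ''i'' \<or> x = ''j''" using x by blast
    have "''kd'' \<notin> set (imods (SCOPY x))" "''ie'' \<notin> set (imods (SCOPY x))" "''je'' \<notin> set (imods (SCOPY x))"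
      using xij unfolding SCOPY_def by auto
    then have "imem s2 ''kd'' = imem s1 ''kd''" "imem s2 ''ie'' = imem s1 ''ie''" "imem s2 ''je'' = imem s1 ''je''"
      using same_exceptD(1)[OF 3(2)] by blast+
    then have static: "static s2" using I1'(1) unfolding static_def by simp
    have ij: "x = ''i'' \<Longrightarrow> ival s2 ''j'' = ival s1 ''j''" "x = ''j'' \<Longrightarrow> ival s2 ''i'' = ival s1 ''i''"
      using same_exceptD(1)[OF 3(2), of "''j''"] same_exceptD(1)[OF 3(2), of "''i''"] unfolding SCOPY_def by simp_all
    have pr: "ival s ''i'' \<le> ?p \<and> ?p < ie \<or> ival s ''j'' \<le> ?p \<and> ?p < je"
      using x I1'(3) unfolding inrange_def by blast
    have p: "?p < e" "X ?p = pos (L ?p)" using pr ie je pos[OF pr] by linarith+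
    have e2: "ival s2 ''e'' = Suc ?e" using 3(1) by simp
    have L2: "imem s2 ''L'' = (imem s1 ''L'')(?e := L ?p)" "rmem s2 ''X'' = (rmem s1 ''X'')(?e := X ?p)"
      using 3(1) I1'(2) p(1) unfolding keep_def by simp_all
    have keep: "keep s2" using I1'(2) e2 unfolding keep_def L2 by simp
    have out2: "out s2 = out s1 @ [L ?p]" using I1'(2) unfolding out_def e2 L2 keep_def by simp
    have tagged: "tagged s2" unfolding tagged_def
    proof (intro allI impI)
      fix k assume k: "e \<le> k \<and> k < ival s2 ''e''"
      show "rmem s2 ''X'' k = pos (imem s2 ''L'' k)"
      proof (cases "k = ?e")
        case False
        then have "e \<le> k \<and> k < ?e" using k e2 by simp
        then have "rmem s1 ''X'' k = pos (imem s1 ''L'' k)" using I1'(5) unfolding tagged_def by blast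
        then show ?thesis unfolding L2 using False by simp
      qed (use p(2) L2 in simp)
    qed
    note J = I1'(4)[unfolded ordered_def]
    have "ordered (out s2) (r1 s2) (r2 s2)" using x
    proof
      assume x: "x = ''i'' \<and> ival s1 ''i'' < ie \<and> (ival s1 ''j'' < je \<longrightarrow> ?le (L (ival s1 ''i'')) (L (ival s1 ''j'')))"
      have r1: "r1 s1 = L ?p # r1 s2" using x 3(1) unfolding r1_def by (simp add: upt_conv_Cons)
      have r2: "r2 s2 = r2 s1" using x ij unfolding r2_def by simp
      have le: "?le (L ?p) b" if "b \<in> set (r2 s1)" for b
      proof -
        have j: "ival s1 ''j'' < je" using that unfolding r2_def by auto
        then have "r2 s1 = L (ival s1 ''j'') # map L [Suc (ival s1 ''j'')..<je]" unfolding r2_def by (simp add: upt_conv_Cons)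
        then have "b = L (ival s1 ''j'') \<or> ?le (L (ival s1 ''j'')) b" using that J by auto
        then show ?thesis using x j ele_trans[of pos kd "L ?p" "L (ival s1 ''j'')" b] by auto
      qed
      show ?thesis unfolding ordered_def out2 r2 using J le unfolding r1 by (auto simp: sorted_wrt_append)
    next
      assume x: "x = ''j'' \<and> ival s1 ''j'' < je \<and> (ival s1 ''i'' < ie \<longrightarrow> ?le (L (ival s1 ''j'')) (L (ival s1 ''i'')))"
      have r2: "r2 s1 = L ?p # r2 s2" using x 3(1) unfolding r2_def by (simp add: upt_conv_Cons)
      have r1: "r1 s2 = r1 s1" using x ij unfolding r1_def by simp
      have le: "?le (L ?p) b" if "b \<in> set (r1 s1)" for b
      proof -
        have j: "ival s1 ''i'' < ie" using that unfolding r1_def by auto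
        then have "r1 s1 = L (ival s1 ''i'') # map L [Suc (ival s1 ''i'')..<ie]" unfolding r1_def by (simp add: upt_conv_Cons)
        then have "b = L (ival s1 ''i'') \<or> ?le (L (ival s1 ''i'')) b" using that J by auto
        then show ?thesis using x j ele_trans[of pos kd "L ?p" "L (ival s1 ''i'')" b] by auto
      qed
      show ?thesis unfolding ordered_def out2 r1 using J le unfolding r2 by (auto simp: sorted_wrt_append)
    qed
    moreover have "(ie - ival s2 ''i'') + (je - ival s2 ''j'') + 1 \<le> (ie - ival s1 ''i'') + (je - ival s1 ''j'')"
      using x
    proof
      assume "x = ''i'' \<and> ival s1 ''i'' < ie \<and> (ival s1 ''j'' < je \<longrightarrow> ?le (L (ival s1 ''i'')) (L (ival s1 ''j'')))"
      then have "ival s2 ''j'' = ival s1 ''j''" "ival s2 ''i'' = Suc (ival s1 ''i'')" "ival s1 ''i'' < ie"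
        using 3(1) ij(1) by simp_all
      then show ?thesis by arith
    next
      assume "x = ''j'' \<and> ival s1 ''j'' < je \<and> (ival s1 ''i'' < ie \<longrightarrow> ?le (L (ival s1 ''j'')) (L (ival s1 ''i'')))"
      then have "ival s2 ''i'' = ival s1 ''i''" "ival s2 ''j'' = Suc (ival s1 ''j'')" "ival s1 ''j'' < je"
        using 3(1) ij(2) by simp_all
      then show ?thesis by arith
    qed
    then have "Suc (6 * ((ie - ival s2 ''i'') + (je - ival s2 ''j''))) \<le> t2"
      using 3(3) I1'(6) by (rule cost_copy)
    moreover have "inrange s2"
      using x
    proof
      assume "x = ''i'' \<and> ival s1 ''i'' < ie \<and> (ival s1 ''j'' < je \<longrightarrow> ?le (L (ival s1 ''i'')) (L (ival s1 ''j'')))"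
      then show ?thesis using 3(1) ij(1) I1'(3) unfolding inrange_def by simp
    next
      assume "x = ''j'' \<and> ival s1 ''j'' < je \<and> (ival s1 ''i'' < ie \<longrightarrow> ?le (L (ival s1 ''j'')) (L (ival s1 ''i'')))"
      then show ?thesis using 3(1) ij(2) I1'(3) unfolding inrange_def by simp
    qed
    ultimately show ?case using static keep tagged unfolding I_def by simp
  qed
  show ?thesis unfolding SMERGE_def
  proof (rule wp_While[where I = I], goal_cases)
    case 1
    have "mset (map L [ival s ''i''..<ie]) = mset A" "mset (map L [ival s ''j''..<je]) = mset B"
      using A B unfolding SRep_def by auto
    moreover have "Suc (6 * ((ie - ival s ''i'') + (je - ival s ''j''))) \<le> 7 * ((ie - ival s ''i'') + (je - ival s ''j''))"
      using i0 by (intro cost_sort) simp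
    moreover have "ordered (out s) (r1 s) (r2 s)"
      using A B unfolding ordered_def out_def r1_def r2_def SRep_def by (simp add: e_def del: mset_map)
    ultimately show ?case unfolding I_def using kd i0
      by (simp add: static_def keep_def inrange_def tagged_def X_def L_def e_def ie_def je_def)
  next
    case (2 s1 t1)
    have range: "ival s ''i'' \<le> ival s1 ''i''" "ival s1 ''i'' \<le> ie" "ival s ''j'' \<le> ival s1 ''j''" "ival s1 ''j'' \<le> je"
      "ival s1 ''ie'' = ie" "ival s1 ''je'' = je" "imem s1 ''kd'' = kd"
      using 2(1) unfolding I_def static_def inrange_def by simp_all
    have "Suc (6 * ((ie - ival s1 ''i'') + (je - ival s1 ''j''))) \<le> t1" using 2(1) unfolding I_def by simp
    moreover have "1 \<le> (ie - ival s1 ''i'') + (je - ival s1 ''j'')" using 2(2) range by auto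
    ultimately have t1: "1 \<le> t1 - 1" "1 \<le> t1" using cost_left by blast+
    have eq: "rmem s1 ''X'' k = pos (L k)" "imem s1 ''L'' k = L k"
      if "ival s ''i'' \<le> k \<and> k < ie \<or> ival s ''j'' \<le> k \<and> k < je" for k
    proof -
      have "keep s1" "k < e" using 2(1) that ie je unfolding I_def by auto
      then show "rmem s1 ''X'' k = pos (L k)" "imem s1 ''L'' k = L k" using pos[OF that] unfolding keep_def by auto
    qed
    have less: "beval (SLESS (iv ''j'') (iv ''i'')) s1 \<longleftrightarrow> \<not> ?le (L (ival s1 ''i'')) (L (ival s1 ''j''))"
      if "ival s1 ''i'' < ie" "ival s1 ''j'' < je"
      using that range eq[of "ival s1 ''i''"] eq[of "ival s1 ''j''"] unfolding SLESS_def ele_def by auto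
    show ?case
    proof (intro conjI wp_Cond t1)
      assume "beval (BAnd (ILess (iv ''j'') (iv ''je'')) (bor (BNot (ILess (iv ''i'') (iv ''ie''))) (SLESS (iv ''j'') (iv ''i'')))) s1"
      then have "ival s1 ''j'' < je" "ival s1 ''i'' < ie \<longrightarrow> ?le (L (ival s1 ''j'')) (L (ival s1 ''i''))"
        using less range ele_total by auto
      then show "wp (SCOPY ''j'') I s1 (t1 - 1 - 1)" by (intro copy[OF 2(1)]) auto
    next
      assume "\<not> beval (BAnd (ILess (iv ''j'') (iv ''je'')) (bor (BNot (ILess (iv ''i'') (iv ''ie''))) (SLESS (iv ''j'') (iv ''i'')))) s1"
      then have "ival s1 ''i'' < ie" "ival s1 ''j'' < je \<longrightarrow> ?le (L (ival s1 ''i'')) (L (ival s1 ''j''))"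
        using less range 2(2) by auto
      then show "wp (SCOPY ''i'') I s1 (t1 - 1 - 1)" by (intro copy[OF 2(1)]) auto
    qed
  next
    case (3 s1 t1)
    have I1: "static s1" "keep s1" "inrange s1" "ordered (out s1) (r1 s1) (r2 s1)" "tagged s1" "1 \<le> t1"
      using 3(1) unfolding I_def by simp_all
    have "ival s1 ''i'' = ie" "ival s1 ''j'' = je" using 3(2) I1(1,3) unfolding static_def inrange_def by auto
    then have "r1 s1 = []" "r2 s1 = []" unfolding r1_def r2_def by simp_all
    then have m: "mset (map (imem s1 ''L'') [e..<ival s1 ''e'']) = mset (A @ B)"
      "sorted_wrt ?le (map (imem s1 ''L'') [e..<ival s1 ''e''])"
      using I1(4) unfolding ordered_def out_def by simp_all
    have "length (map L [ival s ''i''..<ie]) = length A" using A unfolding SRep_def by (metis size_mset)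
    moreover have "length (map (imem s1 ''L'') [e..<ival s1 ''e'']) = length (A @ B)" using m(1) by (metis size_mset)
    ultimately have "e < ival s1 ''e''" using i0 by simp
    then show ?case using I1(2,5,6) m unfolding keep_def tagged_def SRep_def by simp
  qed
qed

lemma SMERGE_queue_merge:
  "queue_merge SMERGE (SRep pos kd) (\<lambda>s. imem s ''kd'' = kd) 7 1 (\<lambda>_. 1) UNIV W0"
proof
  fix A and L L' :: "nat \<Rightarrow> nat" and X X' :: "nat \<Rightarrow> real" and lo hi :: nat
  assume c: "\<And>k. lo \<le> k \<Longrightarrow> k < hi \<Longrightarrow> X' k = X k \<and> L' k = L k"
  then have m: "map L' [lo..<hi] = map L [lo..<hi]" by auto
  have X: "(\<forall>k. lo \<le> k \<and> k < hi \<longrightarrow> X' k = pos (L' k)) \<longleftrightarrow> (\<forall>k. lo \<le> k \<and> k < hi \<longrightarrow> X k = pos (L k))"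
    using c by metis
  show "SRep pos kd A X' L' lo hi = SRep pos kd A X L lo hi" unfolding SRep_def m X ..
next
  fix A X L lo hi assume "SRep pos kd A X L lo hi"
  then have "size (mset (map L [lo..<hi])) = size (mset A)" unfolding SRep_def by simp
  then show "hi - lo \<le> 1 * sum_list (map (\<lambda>_. 1) A)" by (simp add: sum_list_triv)
next
  fix s A B
  assume "imem s ''kd'' = kd"
    and "SRep pos kd A (rmem s ''X'') (imem s ''L'') (ival s ''i'') (ival s ''ie'')"
    and "SRep pos kd B (rmem s ''X'') (imem s ''L'') (ival s ''j'') (ival s ''je'')"
    and "ival s ''ie'' \<le> ival s ''e''" "ival s ''je'' \<le> ival s ''e''"
  then show "wp SMERGE (\<lambda>s' _. ival s ''e'' \<le> ival s' ''e''
          \<and> (\<forall>k<ival s ''e''. rmem s' ''X'' k = rmem s ''X'' k \<and> imem s' ''L'' k = imem s ''L'' k)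
          \<and> SRep pos kd (A @ B) (rmem s' ''X'') (imem s' ''L'') (ival s ''e'') (ival s' ''e'')) s
        (7 * ((ival s ''ie'' - ival s ''i'') + (ival s ''je'' - ival s ''j'')))"
    by (rule wp_SMERGE)
qed (auto simp: same_except_def QUEUE_def SMERGE_def SCOPY_def SRep_def)

section \<open>Covering by groups of discs\<close>

text \<open>The group \<open>g\<close> consists of the centres with labels \<open>gst g, ..., gst (Suc g) - 1\<close>. A translation is
  feasible for the radius whose square is \<open>q\<close> iff it is within that distance of a centre of every group.\<close>

abbreviation grp :: "(nat \<Rightarrow> nat) \<Rightarrow> nat \<Rightarrow> nat set" where
  "grp gst g \<equiv> {gst g..<gst (Suc g)}"

definition sqd :: "(nat \<Rightarrow> real) \<Rightarrow> (nat \<Rightarrow> real) \<Rightarrow> real \<Rightarrow> real \<Rightarrow> nat \<Rightarrow> real" where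
  "sqd cx cy x y b = (x - cx b)\<^sup>2 + (y - cy b)\<^sup>2"

definition covered :: "(nat \<Rightarrow> real) \<Rightarrow> (nat \<Rightarrow> real) \<Rightarrow> (nat \<Rightarrow> nat) \<Rightarrow> nat \<Rightarrow> real \<Rightarrow> real \<Rightarrow> real \<Rightarrow> bool" where
  "covered cx cy gst G x y q \<longleftrightarrow> (\<forall>g<G. \<exists>b\<in>grp gst g. sqd cx cy x y b \<le> q)"

definition groups :: "(nat \<Rightarrow> nat) \<Rightarrow> nat \<Rightarrow> bool" where
  "groups gst G \<longleftrightarrow> 0 < G \<and> gst 0 = 0 \<and> (\<forall>g<G. gst g < gst (Suc g))"

lemma groups_mono:
  assumes "groups gst G" and "g \<le> h" and "h \<le> G" shows "gst g \<le> gst h"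
  using assms(2,3)
proof (induction h rule: dec_induct)
  case (step h)
  then show ?case using assms(1) unfolding groups_def by (meson Suc_leD Suc_le_eq le_trans less_imp_le)
qed simp

lemma grp_label_less:
  assumes "groups gst G" and "g < G" and "b \<in> grp gst g" shows "b < gst G"
  using groups_mono[OF assms(1), of "Suc g" G] assms(2,3) by auto

lemma grp_unique:
  assumes "groups gst G" and "g < G" and "h < G" and "b \<in> grp gst g" and "b \<in> grp gst h" shows "g = h"
proof (rule ccontr)
  assume "g \<noteq> h"
  then consider "Suc g \<le> h" | "Suc h \<le> g" by linarith
  then show False
    using groups_mono[OF assms(1), of "Suc g" h] groups_mono[OF assms(1), of "Suc h" g] assms by cases auto
qed

lemma grp_exists:
  assumes "groups gst G" and "b < gst G"
  shows "\<exists>g<G. b \<in> grp gst g"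
proof -
  define K where "K = {g. g < G \<and> gst g \<le> b}"
  have K: "finite K" "0 \<in> K" using assms unfolding K_def groups_def by auto
  then have m: "Max K \<in> K" "\<And>g. g \<in> K \<Longrightarrow> g \<le> Max K" by (auto intro: Max_in)
  have "b < gst (Suc (Max K))"
  proof (rule ccontr)
    assume *: "\<not> b < gst (Suc (Max K))"
    have "Suc (Max K) \<noteq> G" using * assms(2) by auto
    then have "Suc (Max K) \<in> K" using * m(1) unfolding K_def by auto
    then show False using m(2) by fastforce
  qed
  then show ?thesis using m(1) unfolding K_def by auto
qed

subsection \<open>Directions\<close>

text \<open>The four charts cover the directions of the plane by \<open>(1, m)\<close> with \<open>-1 \<le> m < 1\<close>, rotated by
  multiples of a right angle.\<close>

definition charts :: "(real \<times> real) set" where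
  "charts = {(1, 0), (0, 1), (-1, 0), (0, -1)}"

lemma chart_unit: "(rc, rs) \<in> charts \<Longrightarrow> rc\<^sup>2 + rs\<^sup>2 = 1"
  unfolding charts_def by auto

lemma chart_witness:
  assumes "(rc, rs) \<in> charts" and "l > 0" and "-1 \<le> m" and "m < 1"
    and "vx = l * (rc - m * rs)" and "vy = l * (rs + m * rc)"
  shows "\<exists>(rc, rs)\<in>charts. \<exists>l>0. \<exists>m\<ge>-1. m < 1 \<and> vx = l * (rc - m * rs) \<and> vy = l * (rs + m * rc)"
  using assms by blast

lemma chart_covers:
  assumes "(vx, vy) \<noteq> (0::real, 0::real)"
  shows "\<exists>(rc, rs)\<in>charts. \<exists>l>0. \<exists>m\<ge>-1. m < 1 \<and> vx = l * (rc - m * rs) \<and> vy = l * (rs + m * rc)"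
proof -
  \<comment> \<open>The diagonals cut the punctured plane into four sectors. Each owns exactly one
    of its bounding rays, in accordance with the half-open range of slopes.\<close>
  consider "vx > 0" "- vx \<le> vy" "vy < vx" | "vy > 0" "- vy < vx" "vx \<le> vy"
    | "vx < 0" "vx < vy" "vy \<le> - vx" | "vy < 0" "vy \<le> vx" "vx < - vy"
    using assms by (cases "vx" "0::real" rule: linorder_cases; cases "vy" "0::real" rule: linorder_cases) force+
  then show ?thesis
  proof cases
    case 1
    then show ?thesis by (intro chart_witness[of 1 0 vx "vy / vx"]) (auto simp: charts_def field_simps)
  next
    case 2
    then show ?thesis by (intro chart_witness[of 0 1 vy "- vx / vy"]) (auto simp: charts_def field_simps)
  next
    case 3
    then show ?thesis by (intro chart_witness[of "-1" 0 "- vx" "vy / vx"]) (auto simp: charts_def field_simps)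
  next
    case 4
    then show ?thesis by (intro chart_witness[of 0 "-1" "- vy" "- vx / vy"]) (auto simp: charts_def field_simps)
  qed
qed

text \<open>\<open>ecx\<close> and \<open>ecy\<close> are the coordinates of the vector from centre \<open>a\<close> to centre \<open>b\<close> in a chart, and \<open>DD\<close>
  is its squared length.\<close>

definition ecx :: "(nat \<Rightarrow> real) \<Rightarrow> (nat \<Rightarrow> real) \<Rightarrow> real \<Rightarrow> real \<Rightarrow> nat \<Rightarrow> nat \<Rightarrow> real" where
  "ecx cx cy rc rs a b = rc * (cx b - cx a) + rs * (cy b - cy a)"

definition ecy :: "(nat \<Rightarrow> real) \<Rightarrow> (nat \<Rightarrow> real) \<Rightarrow> real \<Rightarrow> real \<Rightarrow> nat \<Rightarrow> nat \<Rightarrow> real" where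
  "ecy cx cy rc rs a b = rc * (cy b - cy a) - rs * (cx b - cx a)"

definition DD :: "(nat \<Rightarrow> real) \<Rightarrow> (nat \<Rightarrow> real) \<Rightarrow> nat \<Rightarrow> nat \<Rightarrow> real" where
  "DD cx cy a b = (cx b - cx a) * (cx b - cx a) + (cy b - cy a) * (cy b - cy a)"

lemma DD_nonneg: "DD cx cy a b \<ge> 0"
  unfolding DD_def by simp

lemma DD_chart:
  assumes "(rc, rs) \<in> charts"
  shows "(ecx cx cy rc rs a b)\<^sup>2 + (ecy cx cy rc rs a b)\<^sup>2 = DD cx cy a b"
proof -
  have "(ecx cx cy rc rs a b)\<^sup>2 + (ecy cx cy rc rs a b)\<^sup>2 = (rc\<^sup>2 + rs\<^sup>2) * DD cx cy a b"
    unfolding ecx_def ecy_def DD_def by (simp add: power2_eq_square algebra_simps)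
  then show ?thesis using chart_unit[OF assms] by simp
qed

lemma sqd_ray:
  assumes "(rc, rs) \<in> charts"
  shows "sqd cx cy (cx a + l * (rc - m * rs)) (cy a + l * (rs + m * rc)) b
    = l\<^sup>2 * (1 + m\<^sup>2) - 2 * l * (ecx cx cy rc rs a b + m * ecy cx cy rc rs a b) + DD cx cy a b"
proof -
  have "sqd cx cy (cx a + l * (rc - m * rs)) (cy a + l * (rs + m * rc)) b
    = l\<^sup>2 * ((rc\<^sup>2 + rs\<^sup>2) * (1 + m\<^sup>2)) - 2 * l * (ecx cx cy rc rs a b + m * ecy cx cy rc rs a b) + DD cx cy a b"
    unfolding sqd_def ecx_def ecy_def DD_def by (simp add: power2_eq_square algebra_simps)
  then show ?thesis using chart_unit[OF assms] by simp
qed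

lemma sqd_self: "sqd cx cy (cx a) (cy a) b = DD cx cy a b"
  unfolding sqd_def DD_def by (simp add: power2_eq_square algebra_simps)

text \<open>The pivot \<open>a\<close> is the nearest centre of a group whose nearest centre is farthest.\<close>

lemma covered_pivot:
  assumes gs: "groups gst G" and cov: "covered cx cy gst G x y q"
  shows "\<exists>a<gst G. sqd cx cy x y a \<le> q \<and> covered cx cy gst G x y (sqd cx cy x y a)"
proof -
  define f where "f = sqd cx cy x y"
  have ne: "grp gst g \<noteq> {}" if "g < G" for g using gs that unfolding groups_def by auto
  have "\<exists>b\<in>grp gst g. \<forall>b'\<in>grp gst g. f b \<le> f b'" if "g < G" for g
    using ne[OF that] arg_min_if_finite[of "grp gst g" f] by (metis finite_atLeastLessThan not_le_imp_less)
  then obtain nb where nb: "\<And>g. g < G \<Longrightarrow> nb g \<in> grp gst g" "\<And>g b. g < G \<Longrightarrow> b \<in> grp gst g \<Longrightarrow> f (nb g) \<le> f b"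
    by metis
  have G: "{..<G} \<noteq> {}" "finite {..<G}" using gs unfolding groups_def by auto
  define v where "v = Max ((\<lambda>g. f (nb g)) ` {..<G})"
  have "v \<in> (\<lambda>g. f (nb g)) ` {..<G}" unfolding v_def using G by (intro Max_in) auto
  then obtain g0 where g0: "g0 < G" "v = f (nb g0)" by auto
  have max: "f (nb g) \<le> v" if "g < G" for g unfolding v_def using G that by (intro Max_ge) auto
  obtain b where "b \<in> grp gst g0" "f b \<le> q" using cov g0(1) unfolding covered_def f_def by blast
  then have "f (nb g0) \<le> q" using nb(2)[OF g0(1)] by fastforce
  moreover have "covered cx cy gst G x y (f (nb g0))"
    unfolding covered_def using nb(1) max g0(2) f_def by metis
  ultimately show ?thesis using grp_label_less[OF gs g0(1) nb(1)[OF g0(1)]] unfolding f_def by blast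
qed

text \<open>Seen from the pivot, a disc through it contains the centre \<open>b\<close> iff \<open>DD \<le> 2 * l * (ecx + m * ecy)\<close>;
  this persists if the point moves away from the pivot.\<close>

lemma covered_ray:
  assumes gs: "groups gst G" and cov: "covered cx cy gst G x y q"
  shows "\<exists>a<gst G. (\<forall>g<G. \<exists>b\<in>grp gst g. DD cx cy a b = 0) \<or>
    (\<exists>(rc, rs)\<in>charts. \<exists>l>0. \<exists>m\<ge>-1. m < 1 \<and> l\<^sup>2 * (1 + m\<^sup>2) \<le> q \<and>
      (\<forall>g<G. \<exists>b\<in>grp gst g. DD cx cy a b \<le> 2 * l * (ecx cx cy rc rs a b + m * ecy cx cy rc rs a b)))"
proof -
  obtain a where a: "a < gst G" "sqd cx cy x y a \<le> q" "covered cx cy gst G x y (sqd cx cy x y a)"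
    using covered_pivot[OF assms] by blast
  show ?thesis
  \<comment> \<open>A point that coincides with its pivot has no direction. Its distance to the
    pivot is 0, so every group must have a centre at the very same place.\<close>
  proof (cases "(x - cx a, y - cy a) = (0, 0)")
    case True
    then have eq: "x = cx a" "y = cy a" by auto
    have "\<exists>b\<in>grp gst g. DD cx cy a b = 0" if "g < G" for g
    proof -
      obtain b where "b \<in> grp gst g" "sqd cx cy x y b \<le> sqd cx cy x y a" using a(3) \<open>g < G\<close> unfolding covered_def by blast
      then have "DD cx cy a b \<le> DD cx cy a a" unfolding eq sqd_self by blast
      moreover have "DD cx cy a a = 0" unfolding DD_def by simp
      ultimately show ?thesis using \<open>b \<in> _\<close> DD_nonneg[of cx cy a b] by (metis order_antisym)
    qed
    then show ?thesis using a(1) by blast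
  next
    case False
    then obtain rc rs l m where r: "(rc, rs) \<in> charts" "l > 0" "-1 \<le> m" "m < 1"
      "x - cx a = l * (rc - m * rs)" "y - cy a = l * (rs + m * rc)"
      using chart_covers[OF False] by auto
    have xy: "x = cx a + l * (rc - m * rs)" "y = cy a + l * (rs + m * rc)" using r(5,6) by auto
    have sa: "sqd cx cy x y a = l\<^sup>2 * (1 + m\<^sup>2)"
      using sqd_ray[OF r(1), of cx cy a l m a] xy by (simp add: ecx_def ecy_def DD_def)
    have "\<exists>b\<in>grp gst g. DD cx cy a b \<le> 2 * l * (ecx cx cy rc rs a b + m * ecy cx cy rc rs a b)" if "g < G" for g
    proof -
      obtain b where "b \<in> grp gst g" "sqd cx cy x y b \<le> sqd cx cy x y a" using a(3) \<open>g < G\<close> unfolding covered_def by blast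
      then show ?thesis using sqd_ray[OF r(1), of cx cy a l m b] unfolding sa xy[symmetric]
        by (intro bexI[of _ b]) auto
    qed
    then show ?thesis using a(1,2) r(1-4) sa by (intro exI[of _ a] conjI disjI2 bexI[of _ "(rc, rs)"]) auto
  qed
qed

subsection \<open>The decision problem\<close>

text \<open>This is \<open>D \<le> 2 l (ex + m ey)\<close> for the point at distance
  \<open>\<epsilon>\<close> from the pivot, that is for
  \<open>l = \<epsilon> / sqrt (1 + m^2)\<close>, squared so that field operations suffice to test
  it.\<close>

definition reach :: "real \<Rightarrow> real \<Rightarrow> real \<Rightarrow> real \<Rightarrow> real \<Rightarrow> bool" where
  "reach \<epsilon> ex ey D m \<longleftrightarrow> 0 \<le> ex + m * ey \<and> D * D * (1 + m * m) \<le> 4 * \<epsilon> * \<epsilon> * ((ex + m * ey) * (ex + m * ey))"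

lemma reach_iff:
  assumes "0 < \<epsilon>" and "0 < D"
  shows "reach \<epsilon> ex ey D m \<longleftrightarrow> D * sqrt (1 + m\<^sup>2) \<le> 2 * \<epsilon> * (ex + m * ey)"
proof -
  have sq: "(D * sqrt (1 + m\<^sup>2))\<^sup>2 = D * D * (1 + m * m)"
    by (simp add: power_mult_distrib power2_eq_square)
  have sq': "(2 * \<epsilon> * (ex + m * ey))\<^sup>2 = 4 * \<epsilon> * \<epsilon> * ((ex + m * ey) * (ex + m * ey))"
    by (simp add: power2_eq_square algebra_simps)
  have pos: "0 < D * sqrt (1 + m\<^sup>2)" using assms(2) by (simp add: add_pos_nonneg)
  show ?thesis
  proof
    assume r: "reach \<epsilon> ex ey D m"
    then have "0 \<le> 2 * \<epsilon> * (ex + m * ey)" using assms(1) unfolding reach_def by simp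
    then show "D * sqrt (1 + m\<^sup>2) \<le> 2 * \<epsilon> * (ex + m * ey)"
      using r sq sq' unfolding reach_def by (metis power2_le_imp_le)
  next
    assume l: "D * sqrt (1 + m\<^sup>2) \<le> 2 * \<epsilon> * (ex + m * ey)"
    then have "0 < 2 * \<epsilon> * (ex + m * ey)" using pos by linarith
    then have "0 \<le> ex + m * ey" using assms(1) by (simp add: zero_less_mult_iff)
    moreover have "(D * sqrt (1 + m\<^sup>2))\<^sup>2 \<le> (2 * \<epsilon> * (ex + m * ey))\<^sup>2" using l pos by (intro power_mono) auto
    ultimately show "reach \<epsilon> ex ey D m" using sq sq' unfolding reach_def by simp
  qed
qed

definition feasible :: "(nat \<Rightarrow> real) \<Rightarrow> (nat \<Rightarrow> real) \<Rightarrow> (nat \<Rightarrow> nat) \<Rightarrow> nat \<Rightarrow> real \<Rightarrow> nat \<Rightarrow> real \<Rightarrow> real \<Rightarrow> bool" where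
  "feasible cx cy gst G \<epsilon> a rc rs \<longleftrightarrow> (\<exists>m. -1 \<le> m \<and> m \<le> 1 \<and> (\<forall>g<G. \<exists>b\<in>grp gst g. DD cx cy a b = 0 \<or>
     reach \<epsilon> (ecx cx cy rc rs a b) (ecy cx cy rc rs a b) (DD cx cy a b) m))"

text \<open>A covered point may be pushed away from its pivot until their distance is
  \<open>\<epsilon>\<close>, since the condition on each centre persists. This leaves the slope as
  the only unknown.\<close>

lemma decision_pivot:
  assumes gs: "groups gst G" and \<epsilon>: "0 < \<epsilon>"
  shows "(\<exists>x y. covered cx cy gst G x y (\<epsilon>\<^sup>2)) \<longleftrightarrow>
    (\<exists>a<gst G. \<exists>(rc, rs)\<in>charts. feasible cx cy gst G \<epsilon> a rc rs)"
proof
  assume "\<exists>x y. covered cx cy gst G x y (\<epsilon>\<^sup>2)"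
  then obtain x y where "covered cx cy gst G x y (\<epsilon>\<^sup>2)" by blast
  from covered_ray[OF gs this] obtain a where a: "a < gst G" and
    "(\<forall>g<G. \<exists>b\<in>grp gst g. DD cx cy a b = 0) \<or>
    (\<exists>(rc, rs)\<in>charts. \<exists>l>0. \<exists>m\<ge>-1. m < 1 \<and> l\<^sup>2 * (1 + m\<^sup>2) \<le> \<epsilon>\<^sup>2 \<and>
      (\<forall>g<G. \<exists>b\<in>grp gst g. DD cx cy a b \<le> 2 * l * (ecx cx cy rc rs a b + m * ecy cx cy rc rs a b)))"
    by blast
  then consider "\<forall>g<G. \<exists>b\<in>grp gst g. DD cx cy a b = 0" |
    rc rs l m where "(rc, rs) \<in> charts" "l > 0" "-1 \<le> m" "m < 1" "l\<^sup>2 * (1 + m\<^sup>2) \<le> \<epsilon>\<^sup>2"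
      "\<forall>g<G. \<exists>b\<in>grp gst g. DD cx cy a b \<le> 2 * l * (ecx cx cy rc rs a b + m * ecy cx cy rc rs a b)"
    by blast
  then show "\<exists>a<gst G. \<exists>(rc, rs)\<in>charts. feasible cx cy gst G \<epsilon> a rc rs"
  proof cases
    case 1
    then have "feasible cx cy gst G \<epsilon> a 1 0" unfolding feasible_def by (intro exI[of _ 0]) auto
    then show ?thesis using a unfolding charts_def by auto
  next
    case 2
    have sq: "l * sqrt (1 + m\<^sup>2) \<le> \<epsilon>"
    proof (rule power2_le_imp_le)
      have "(l * sqrt (1 + m\<^sup>2))\<^sup>2 = l\<^sup>2 * (1 + m\<^sup>2)" by (simp add: power_mult_distrib)
      then show "(l * sqrt (1 + m\<^sup>2))\<^sup>2 \<le> \<epsilon>\<^sup>2" using 2(5) by simp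
    qed (use \<epsilon> in simp)
    have "\<exists>b\<in>grp gst g. DD cx cy a b = 0 \<or>
      reach \<epsilon> (ecx cx cy rc rs a b) (ecy cx cy rc rs a b) (DD cx cy a b) m" if "g < G" for g
    proof -
      obtain b where b: "b \<in> grp gst g" "DD cx cy a b \<le> 2 * l * (ecx cx cy rc rs a b + m * ecy cx cy rc rs a b)"
        using 2(6) \<open>g < G\<close> by blast
      let ?u = "ecx cx cy rc rs a b + m * ecy cx cy rc rs a b"
      have u: "0 \<le> ?u" using b(2) DD_nonneg[of cx cy a b] 2(2) by (smt (verit) mult_pos_neg)
      have "DD cx cy a b * sqrt (1 + m\<^sup>2) \<le> 2 * l * ?u * sqrt (1 + m\<^sup>2)" using b(2) by (intro mult_right_mono) auto
      also have "\<dots> = 2 * ?u * (l * sqrt (1 + m\<^sup>2))" by simp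
      also have "\<dots> \<le> 2 * ?u * \<epsilon>" using sq u by (intro mult_left_mono) auto
      finally have "DD cx cy a b * sqrt (1 + m\<^sup>2) \<le> 2 * \<epsilon> * ?u" by (simp add: mult_ac)
      then have "DD cx cy a b = 0 \<or> reach \<epsilon> (ecx cx cy rc rs a b) (ecy cx cy rc rs a b) (DD cx cy a b) m"
        using reach_iff[OF \<epsilon>, of "DD cx cy a b"] DD_nonneg[of cx cy a b] by (cases "DD cx cy a b = 0") auto
      then show ?thesis using b(1) by blast
    qed
    then have "feasible cx cy gst G \<epsilon> a rc rs"
      unfolding feasible_def using 2(3,4) by (intro exI[of _ m]) simp
    then show ?thesis using a 2(1) by blast
  qed
next
  assume "\<exists>a<gst G. \<exists>(rc, rs)\<in>charts. feasible cx cy gst G \<epsilon> a rc rs"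
  then obtain a rc rs m where a: "(rc, rs) \<in> charts" "\<forall>g<G. \<exists>b\<in>grp gst g. DD cx cy a b = 0 \<or>
     reach \<epsilon> (ecx cx cy rc rs a b) (ecy cx cy rc rs a b) (DD cx cy a b) m"
    unfolding feasible_def by auto
  \<comment> \<open>The point of the ray whose distance from the pivot is exactly
    \<open>\<epsilon>\<close>.\<close>
  define l where "l = \<epsilon> / sqrt (1 + m\<^sup>2)"
  have s: "0 < sqrt (1 + m\<^sup>2)" by (simp add: add_pos_nonneg)
  have l: "l\<^sup>2 * (1 + m\<^sup>2) = \<epsilon>\<^sup>2" "0 < l" unfolding l_def using s \<epsilon> by (auto simp: power_divide)
  let ?x = "cx a + l * (rc - m * rs)" and ?y = "cy a + l * (rs + m * rc)"
  have "\<exists>b\<in>grp gst g. sqd cx cy ?x ?y b \<le> \<epsilon>\<^sup>2" if "g < G" for g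
  proof -
    obtain b where b: "b \<in> grp gst g" "DD cx cy a b = 0 \<or>
      reach \<epsilon> (ecx cx cy rc rs a b) (ecy cx cy rc rs a b) (DD cx cy a b) m" using a(2) \<open>g < G\<close> by blast
    let ?u = "ecx cx cy rc rs a b + m * ecy cx cy rc rs a b"
    have "DD cx cy a b \<le> 2 * l * ?u"
    proof (cases "DD cx cy a b = 0")
      case True
      then have "ecx cx cy rc rs a b = 0" "ecy cx cy rc rs a b = 0"
        using DD_chart[OF a(1), of cx cy a b] by (auto simp: sum_power2_eq_zero_iff)
      then show ?thesis using True by simp
    next
      case False
      then have "DD cx cy a b * sqrt (1 + m\<^sup>2) \<le> 2 * \<epsilon> * ?u"
        using b(2) reach_iff[OF \<epsilon>, of "DD cx cy a b"] DD_nonneg[of cx cy a b] by auto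
      then show ?thesis unfolding l_def using s by (simp add: field_simps)
    qed
    then show ?thesis using b(1) sqd_ray[OF a(1), of cx cy a l m b] l(1) by (intro bexI[of _ b]) auto
  qed
  then show "\<exists>x y. covered cx cy gst G x y (\<epsilon>\<^sup>2)" unfolding covered_def by blast
qed

subsection \<open>The directions in which a disc is reached\<close>

definition reach_set :: "real \<Rightarrow> real \<Rightarrow> real \<Rightarrow> real \<Rightarrow> real set" where
  "reach_set \<epsilon> ex ey D = {m. -1 \<le> m \<and> m \<le> 1 \<and> reach \<epsilon> ex ey D m}"

definition reach_poly :: "real \<Rightarrow> real \<Rightarrow> real \<Rightarrow> real \<Rightarrow> real poly" where
  "reach_poly \<epsilon> ex ey D = Poly [4 * \<epsilon> * \<epsilon> * (ex * ex) - D * D, 8 * \<epsilon> * \<epsilon> * (ex * ey), 4 * \<epsilon> * \<epsilon> * (ey * ey) - D * D]"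

text \<open>A nonexistent root appears as the default value 0. This does no harm because candidates
  are used only after intersection with \<open>reach_set\<close>.\<close>

definition reach_cands :: "real \<Rightarrow> real \<Rightarrow> real \<Rightarrow> real \<Rightarrow> real set" where
  "reach_cands \<epsilon> ex ey D = {-1, 1, nth_real_root 0 (reach_poly \<epsilon> ex ey D), nth_real_root 1 (reach_poly \<epsilon> ex ey D)}"

lemma root_of_quadratic:
  assumes "p \<noteq> 0" and "degree p \<le> 2" and "poly p z = 0"
  shows "z = nth_real_root 0 p \<or> z = nth_real_root 1 p"
proof -
  let ?R = "{x. poly p x = 0}"
  have fin: "finite ?R" using assms(1) by (rule poly_roots_finite)
  have card: "card ?R \<le> 2" using card_poly_roots_bound[OF assms(1)] assms(2) by simp
  have "z \<in> set (sorted_list_of_set ?R)" using fin assms(3) by simp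
  then obtain i where i: "i < length (sorted_list_of_set ?R)" "sorted_list_of_set ?R ! i = z"
    by (auto simp: in_set_conv_nth)
  then have "i < card ?R" by simp
  moreover then have "i = 0 \<or> i = 1" using card by auto
  ultimately show ?thesis using i(2) assms(1) unfolding nth_real_root_def by auto
qed

lemma reach_set_root:
  assumes \<epsilon>: "0 < \<epsilon>" and D: "0 < D" and z: "D * sqrt (1 + z\<^sup>2) = 2 * \<epsilon> * (ex + z * ey)"
  shows "z = nth_real_root 0 (reach_poly \<epsilon> ex ey D) \<or> z = nth_real_root 1 (reach_poly \<epsilon> ex ey D)"
proof (rule root_of_quadratic)
  let ?p = "reach_poly \<epsilon> ex ey D"
  have "(D * sqrt (1 + z\<^sup>2))\<^sup>2 = D * D * (1 + z * z)" by (simp add: power_mult_distrib power2_eq_square)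
  moreover have "(2 * \<epsilon> * (ex + z * ey))\<^sup>2 = 4 * \<epsilon> * \<epsilon> * ((ex + z * ey) * (ex + z * ey))"
    by (simp add: power2_eq_square algebra_simps)
  ultimately have "D * D * (1 + z * z) = 4 * \<epsilon> * \<epsilon> * ((ex + z * ey) * (ex + z * ey))" using z by simp
  then show "poly ?p z = 0" unfolding reach_poly_def by (simp add: algebra_simps)
  show "degree ?p \<le> 2" unfolding reach_poly_def by (rule degree_le) (auto simp: coeff_pCons split: nat.split)
  \<comment> \<open>Vanishing outer coefficients would give \<open>ex\<close> and \<open>ey\<close>
    a common nonzero square, whereas the middle one says that their product is 0.\<close>
  show "?p \<noteq> 0"
  proof
    assume "?p = 0"
    then have c: "coeff ?p 0 = 0" "coeff ?p 1 = 0" "coeff ?p 2 = 0" by simp_all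
    then have "4 * \<epsilon> * \<epsilon> * (ex * ex) = D * D" "8 * \<epsilon> * \<epsilon> * (ex * ey) = 0" "4 * \<epsilon> * \<epsilon> * (ey * ey) = D * D"
      unfolding reach_poly_def by (simp_all add: nth_default_def numeral_2_eq_2)
    then show False using \<epsilon> D by auto
  qed
qed

text \<open>The function is the modulus of the complex number with real part 1 and imaginary part
  \<open>u\<close>, so that its convexity is the triangle inequality.\<close>

lemma sqrt_one_plus_sq_convex:
  assumes "0 \<le> s" and "s \<le> 1"
  shows "sqrt (1 + ((1 - s) * x + s * y)\<^sup>2) \<le> (1 - s) * sqrt (1 + x\<^sup>2) + s * sqrt (1 + y\<^sup>2)"
proof -
  have n: "cmod (Complex 1 u) = sqrt (1 + u\<^sup>2)" for u by (simp add: cmod_def)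
  have "Complex 1 ((1 - s) * x + s * y) = of_real (1 - s) * Complex 1 x + of_real s * Complex 1 y"
    by (simp add: complex_eq_iff)
  then have "cmod (Complex 1 ((1 - s) * x + s * y)) \<le> cmod (of_real (1 - s) * Complex 1 x) + cmod (of_real s * Complex 1 y)"
    using norm_triangle_ineq by metis
  then show ?thesis unfolding norm_mult n norm_of_real using assms by simp
qed

text \<open>By \<open>reach_iff\<close> a convex function of the slope has to stay below an affine
  one.\<close>

lemma reach_set_convex:
  assumes \<epsilon>: "0 < \<epsilon>" and D: "0 < D" and x: "x \<in> reach_set \<epsilon> ex ey D" and y: "y \<in> reach_set \<epsilon> ex ey D"
    and m: "x \<le> m" "m \<le> y"
  shows "m \<in> reach_set \<epsilon> ex ey D"
proof (cases "x = y")
  case False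
  define s where "s = (m - x) / (y - x)"
  have lt: "x < y" using False m by simp
  have s: "0 \<le> s" "s \<le> 1" unfolding s_def using lt m by (auto simp: field_simps)
  have "s * (y - x) = m - x" unfolding s_def using lt by simp
  then have ms: "m = (1 - s) * x + s * y" by (simp add: algebra_simps)
  have "D * sqrt (1 + m\<^sup>2) \<le> D * ((1 - s) * sqrt (1 + x\<^sup>2) + s * sqrt (1 + y\<^sup>2))"
    unfolding ms using sqrt_one_plus_sq_convex[OF s] D by (intro mult_left_mono) auto
  also have "\<dots> = (1 - s) * (D * sqrt (1 + x\<^sup>2)) + s * (D * sqrt (1 + y\<^sup>2))" by (simp add: algebra_simps)
  also have "\<dots> \<le> (1 - s) * (2 * \<epsilon> * (ex + x * ey)) + s * (2 * \<epsilon> * (ex + y * ey))"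
    using x y s unfolding reach_set_def by (intro add_mono mult_left_mono) (auto simp: reach_iff[OF \<epsilon> D])
  also have "\<dots> = 2 * \<epsilon> * (ex + m * ey)" unfolding ms by (simp add: algebra_simps)
  finally show ?thesis using x y m unfolding reach_set_def by (auto simp: reach_iff[OF \<epsilon> D])
qed (use x m in auto)

text \<open>Moving from \<open>m\<close> towards an end of the chart, either the end itself is
  reachable or the slack \<open>h\<close> turns negative. In the latter case it vanishes in between,
  at a root of the quadratic.\<close>

lemma reach_set_cand:
  assumes \<epsilon>: "0 < \<epsilon>" and D: "0 < D" and m: "m \<in> reach_set \<epsilon> ex ey D"
  shows "\<exists>v\<in>reach_cands \<epsilon> ex ey D \<inter> reach_set \<epsilon> ex ey D. v \<le> m"
    and "\<exists>v\<in>reach_cands \<epsilon> ex ey D \<inter> reach_set \<epsilon> ex ey D. m \<le> v"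
proof -
  define h where "h z = 2 * \<epsilon> * (ex + z * ey) - D * sqrt (1 + z\<^sup>2)" for z
  have rs: "z \<in> reach_set \<epsilon> ex ey D \<longleftrightarrow> -1 \<le> z \<and> z \<le> 1 \<and> 0 \<le> h z" for z
    unfolding reach_set_def h_def by (auto simp: reach_iff[OF \<epsilon> D])
  have cont: "isCont h z" for z unfolding h_def by (intro continuous_intros)
  have root: "z \<in> reach_cands \<epsilon> ex ey D" if "h z = 0" for z
    using reach_set_root[OF \<epsilon> D, of z ex ey] that unfolding h_def reach_cands_def by auto
  have m': "-1 \<le> m" "m \<le> 1" "0 \<le> h m" using m rs by auto
  show "\<exists>v\<in>reach_cands \<epsilon> ex ey D \<inter> reach_set \<epsilon> ex ey D. v \<le> m"
  proof (cases "0 \<le> h (-1)")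
    case True
    then show ?thesis using m' rs by (intro bexI[of _ "-1"]) (auto simp: reach_cands_def)
  next
    case False
    then obtain z where "-1 \<le> z" "z \<le> m" "h z = 0" using IVT[of h "-1" 0 m] m' cont by auto
    then show ?thesis using m' rs root by (intro bexI[of _ z]) auto
  qed
  show "\<exists>v\<in>reach_cands \<epsilon> ex ey D \<inter> reach_set \<epsilon> ex ey D. m \<le> v"
  proof (cases "0 \<le> h 1")
    case True
    then show ?thesis using m' rs by (intro bexI[of _ 1]) (auto simp: reach_cands_def)
  next
    case False
    then obtain z where "m \<le> z" "z \<le> 1" "h z = 0" using IVT2[of h 1 0 m] m' cont by auto
    then show ?thesis using m' rs root by (intro bexI[of _ z]) auto
  qed
qed

text \<open>The sentinels 2 and -2 stand for the ends of an empty interval.\<close>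

definition ends :: "real set \<Rightarrow> real \<Rightarrow> real \<Rightarrow> bool" where
  "ends V lo hi \<longleftrightarrow> (\<forall>v\<in>V. lo \<le> v \<and> v \<le> hi) \<and> lo \<in> insert 2 V \<and> hi \<in> insert (-2) V"

text \<open>Every reachable slope lies between two reachable candidates, and convexity fills the
  range between the extreme ones. The sentinels are outside the chart, so they can only produce an
  empty interval.\<close>

lemma reach_set_interval:
  assumes \<epsilon>: "0 < \<epsilon>" and D: "0 < D" and e: "ends (reach_cands \<epsilon> ex ey D \<inter> reach_set \<epsilon> ex ey D) lo hi"
  shows "reach_set \<epsilon> ex ey D = {lo..hi}"
proof
  let ?J = "reach_set \<epsilon> ex ey D" and ?V = "reach_cands \<epsilon> ex ey D \<inter> reach_set \<epsilon> ex ey D"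
  show "?J \<subseteq> {lo..hi}"
  proof
    fix m assume "m \<in> ?J"
    from reach_set_cand[OF \<epsilon> D this] obtain v w where "v \<in> ?V" "v \<le> m" "w \<in> ?V" "m \<le> w" by blast
    moreover have "lo \<le> v" "w \<le> hi" using e \<open>v \<in> ?V\<close> \<open>w \<in> ?V\<close> unfolding ends_def by blast+
    ultimately show "m \<in> {lo..hi}" by simp
  qed
  show "{lo..hi} \<subseteq> ?J"
  proof
    fix m assume m: "m \<in> {lo..hi}"
    have V: "-1 \<le> v \<and> v \<le> 1" if "v \<in> ?V" for v using that unfolding reach_set_def by auto
    have "lo \<noteq> 2"
    proof
      assume "lo = 2"
      then have "hi \<in> ?V" using m e unfolding ends_def by auto
      then show False using V m \<open>lo = 2\<close> by fastforce
    qed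
    then have lo: "lo \<in> ?V" using e unfolding ends_def by blast
    have "hi \<noteq> -2"
    proof
      assume "hi = -2"
      then show False using V[OF lo] m by auto
    qed
    then have "hi \<in> ?V" using e unfolding ends_def by blast
    then show "m \<in> ?J" using reach_set_convex[OF \<epsilon> D _ _, of lo ex ey hi m] lo m by auto
  qed
qed

text \<open>Event \<open>2 * b\<close> opens the interval of centre \<open>b\<close> and event \<open>2 * b + 1\<close> closes it.\<close>

definition opened :: "nat set \<Rightarrow> nat set \<Rightarrow> nat set" where
  "opened V E = {b \<in> V. 2 * b \<in> E \<and> Suc (2 * b) \<notin> E}"

text \<open>Coverage of groups can only improve when an interval opens, so it is enough to check
  before all events and after each opening. Conversely the position of that opening event lies in
  every interval open at this moment. \<open>Z\<close> collects the centres that are always within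
  reach.\<close>

lemma scan_correct:
  fixes es :: "nat list" and pos :: "nat \<Rightarrow> real" and kd gst :: "nat \<Rightarrow> nat" and V Z :: "nat set" and G :: nat
  defines "full q \<equiv> \<forall>g<G. \<exists>b\<in>grp gst g. b \<in> Z \<or> b \<in> opened V (set (take q es))"
  assumes sorted: "sorted_wrt (ele pos kd) es" and set: "set es = (\<Union>b\<in>V. {2 * b, Suc (2 * b)})"
    and kd: "\<And>b. b \<in> V \<Longrightarrow> kd (2 * b) = 0 \<and> kd (Suc (2 * b)) = 1"
    and J: "\<And>b. b \<in> V \<Longrightarrow> J b = {pos (2 * b)..pos (Suc (2 * b))} \<and> -1 \<le> pos (2 * b) \<and> pos (2 * b) \<le> 1"
  shows "(\<exists>m. -1 \<le> m \<and> m \<le> 1 \<and> (\<forall>g<G. \<exists>b\<in>grp gst g. b \<in> Z \<or> b \<in> V \<and> m \<in> J b)) \<longleftrightarrow>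
    full 0 \<or> (\<exists>q<length es. kd (es ! q) = 0 \<and> full (Suc q))"
proof
  assume "\<exists>m. -1 \<le> m \<and> m \<le> 1 \<and> (\<forall>g<G. \<exists>b\<in>grp gst g. b \<in> Z \<or> b \<in> V \<and> m \<in> J b)"
  then obtain m where m: "\<forall>g<G. \<exists>b\<in>grp gst g. b \<in> Z \<or> b \<in> V \<and> m \<in> J b" by blast
  \<comment> \<open>After the last opening at or to the left of \<open>m\<close>, all intervals that
    contain \<open>m\<close> are open.\<close>
  define Q where "Q = {q. q < length es \<and> kd (es ! q) = 0 \<and> pos (es ! q) \<le> m}"
  show "full 0 \<or> (\<exists>q<length es. kd (es ! q) = 0 \<and> full (Suc q))"
  proof (cases "Q = {}")
    case True
    have "b \<notin> V \<or> m \<notin> J b" for b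
    proof (rule ccontr)
      assume "\<not> (b \<notin> V \<or> m \<notin> J b)"
      then have b: "b \<in> V" "pos (2 * b) \<le> m" using J by auto
      then have "2 * b \<in> set es" using set by blast
      then obtain q where "q < length es" "es ! q = 2 * b" by (auto simp: in_set_conv_nth)
      then have "q \<in> Q" unfolding Q_def using b kd by auto
      then show False using True by simp
    qed
    then have "full 0" unfolding full_def using m by blast
    then show ?thesis by blast
  next
    case False
    have finQ: "finite Q" unfolding Q_def by simp
    define q where "q = Max Q"
    have q: "q \<in> Q" and qmax: "\<And>r. r \<in> Q \<Longrightarrow> r \<le> q" unfolding q_def using finQ False by auto
    have q': "q < length es" "kd (es ! q) = 0" "pos (es ! q) \<le> m" using q unfolding Q_def by auto
    have "b \<in> opened V (set (take (Suc q) es))" if b: "b \<in> V" "m \<in> J b" for b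
    proof -
      have bm: "pos (2 * b) \<le> m" "m \<le> pos (Suc (2 * b))" using J[OF b(1)] b(2) by auto
      have "2 * b \<in> set es" using set b by blast
      then obtain r where r: "r < length es" "es ! r = 2 * b" by (auto simp: in_set_conv_nth)
      then have "r \<in> Q" unfolding Q_def using bm kd b by auto
      then have "r \<le> q" by (rule qmax)
      then have "2 * b \<in> set (take (Suc q) es)" using r q'(1) by (auto simp: in_set_conv_nth intro!: exI[of _ r])
      moreover have "Suc (2 * b) \<notin> set (take (Suc q) es)"
      proof
        assume "Suc (2 * b) \<in> set (take (Suc q) es)"
        then obtain p where p: "p \<le> q" "es ! p = Suc (2 * b)"
          using q'(1) by (auto simp: in_set_conv_nth less_Suc_eq_le)
        \<comment> \<open>A closing event listed before an opening one has a strictly smaller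
          position, by the tie-breaking of \<open>ele\<close>; so the interval of \<open>b\<close>
          would end before \<open>m\<close>.\<close>
        have "p \<noteq> q" using p q'(2) kd[OF b(1)] by auto
        then have "ele pos kd (es ! p) (es ! q)" using p(1) q'(1) sorted by (simp add: sorted_wrt_iff_nth_less)
        then show False using p q' bm kd[OF b(1)] unfolding ele_def by auto
      qed
      ultimately show ?thesis using b(1) unfolding opened_def by simp
    qed
    then have "full (Suc q)" unfolding full_def using m by blast
    then show ?thesis using q' by blast
  qed
next
  assume "full 0 \<or> (\<exists>q<length es. kd (es ! q) = 0 \<and> full (Suc q))"
  then show "\<exists>m. -1 \<le> m \<and> m \<le> 1 \<and> (\<forall>g<G. \<exists>b\<in>grp gst g. b \<in> Z \<or> b \<in> V \<and> m \<in> J b)"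
  proof
    assume "full 0"
    then have "\<forall>g<G. \<exists>b\<in>grp gst g. b \<in> Z" unfolding full_def opened_def by simp
    then show ?thesis by (intro exI[of _ 0]) auto
  next
    assume "\<exists>q<length es. kd (es ! q) = 0 \<and> full (Suc q)"
    then obtain q where q: "q < length es" "kd (es ! q) = 0" "full (Suc q)" by blast
    have "es ! q \<in> set es" using q(1) by simp
    then obtain c where c: "c \<in> V" "es ! q = 2 * c" using set kd q(2) by fastforce
    define m where "m = pos (es ! q)"
    have "m \<in> J b" if b: "b \<in> opened V (set (take (Suc q) es))" for b
    proof -
      have bV: "b \<in> V" "2 * b \<in> set (take (Suc q) es)" "Suc (2 * b) \<notin> set (take (Suc q) es)"
        using b unfolding opened_def by auto
      obtain r where r: "r \<le> q" "es ! r = 2 * b" using bV(2) q(1) by (auto simp: in_set_conv_nth less_Suc_eq_le)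
      have "pos (2 * b) \<le> m"
      proof (cases "r = q")
        case False
        then have "ele pos kd (es ! r) (es ! q)" using r(1) q(1) sorted by (simp add: sorted_wrt_iff_nth_less)
        then show ?thesis using r(2) unfolding m_def ele_def by auto
      qed (use r in \<open>simp add: m_def\<close>)
      moreover have "m \<le> pos (Suc (2 * b))"
      proof -
        have "Suc (2 * b) \<in> set es" using set bV(1) by blast
        then obtain p where p: "p < length es" "es ! p = Suc (2 * b)" by (auto simp: in_set_conv_nth)
        have "q < p"
        proof (rule ccontr)
          assume "\<not> q < p"
          then have "Suc (2 * b) \<in> set (take (Suc q) es)" using p by (auto simp: in_set_conv_nth intro!: exI[of _ p])
          then show False using bV(3) by simp
        qed
        then have "ele pos kd (es ! q) (es ! p)" using p(1) sorted by (auto simp: sorted_wrt_iff_nth_less)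
        then show ?thesis using p(2) unfolding m_def ele_def by auto
      qed
      ultimately show ?thesis using J[OF bV(1)] by simp
    qed
    then have "\<forall>g<G. \<exists>b\<in>grp gst g. b \<in> Z \<or> b \<in> V \<and> m \<in> J b"
      using q(3) unfolding full_def opened_def by blast
    moreover have "-1 \<le> m" "m \<le> 1" using J[OF c(1)] unfolding m_def c(2) by auto
    ultimately show ?thesis by blast
  qed
qed

subsection \<open>The optimum on one piece of the envelope\<close>

text \<open>A difference form of the derivative of
  \<open>(1 + m^2) / (\<alpha> + \<beta> m)^2\<close>, with denominators cleared: where the line is
  positive, the signs of \<open>\<beta> - \<alpha> m\<close> and \<open>\<beta> - \<alpha> c\<close>
  decide which slope is better.\<close>

lemma line_ratio_diff:
  fixes \<alpha> \<beta> c m :: real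
  shows "(1 + m * m) * ((\<alpha> + \<beta> * c) * (\<alpha> + \<beta> * c)) - (1 + c * c) * ((\<alpha> + \<beta> * m) * (\<alpha> + \<beta> * m))
    = (c - m) * ((\<beta> - \<alpha> * m) * (\<alpha> + \<beta> * c) + (\<beta> - \<alpha> * c) * (\<alpha> + \<beta> * m))"
  by (simp add: algebra_simps)

text \<open>Going right is downhill as long as \<open>\<beta> - \<alpha> m\<close> is nonnegative;
  this expression is affine, so its two end values suffice. What needs an argument is that the line
  stays positive on the way.\<close>

lemma line_ratio_up:
  fixes \<alpha> \<beta> c m :: real
  assumes "m \<le> c" and "0 \<le> \<beta> - \<alpha> * m" and "0 \<le> \<beta> - \<alpha> * c" and pos: "0 < \<alpha> + \<beta> * m"
  shows "0 < \<alpha> + \<beta> * c"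
    and "(1 + c * c) * ((\<alpha> + \<beta> * m) * (\<alpha> + \<beta> * m)) \<le> (1 + m * m) * ((\<alpha> + \<beta> * c) * (\<alpha> + \<beta> * c))"
proof -
  show p: "0 < \<alpha> + \<beta> * c"
  proof (cases "0 \<le> \<beta>")
    case True
    then have "\<beta> * m \<le> \<beta> * c" using assms(1) by (intro mult_left_mono) auto
    then show ?thesis using pos by linarith
  next
    case False
    have "\<alpha> > 0"
    proof (rule ccontr)
      assume a: "\<not> \<alpha> > 0"
      have "\<alpha> * m < 0" using False assms(2) by linarith
      then have "m > 0" using a by (simp add: mult_less_0_iff)
      then have "\<beta> * m < 0" using False by (simp add: mult_less_0_iff)
      then show False using pos a by linarith
    qed
    have "\<alpha> * c < 0" using False assms(3) by linarith
    then have "c < 0" using \<open>\<alpha> > 0\<close> by (simp add: mult_less_0_iff)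
    then have "0 < \<beta> * c" using False by (simp add: zero_less_mult_iff)
    then show ?thesis using \<open>\<alpha> > 0\<close> by linarith
  qed
  have "0 \<le> (c - m) * ((\<beta> - \<alpha> * m) * (\<alpha> + \<beta> * c) + (\<beta> - \<alpha> * c) * (\<alpha> + \<beta> * m))"
  proof (rule mult_nonneg_nonneg)
    show "0 \<le> (\<beta> - \<alpha> * m) * (\<alpha> + \<beta> * c) + (\<beta> - \<alpha> * c) * (\<alpha> + \<beta> * m)"
      using mult_nonneg_nonneg[OF assms(2) less_imp_le[OF p]] mult_nonneg_nonneg[OF assms(3) less_imp_le[OF pos]]
      by linarith
  qed (use assms(1) in simp)
  then show "(1 + c * c) * ((\<alpha> + \<beta> * m) * (\<alpha> + \<beta> * m)) \<le> (1 + m * m) * ((\<alpha> + \<beta> * c) * (\<alpha> + \<beta> * c))"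
    using line_ratio_diff[of m \<alpha> \<beta> c] by linarith
qed

text \<open>The squared radius is \<open>(1 + m^2) / (\<alpha> + \<beta> m)^2\<close>, and where the
  line is positive its derivative has the sign of \<open>\<alpha> m - \<beta>\<close>. Going
  downhill from \<open>m\<close> therefore ends at \<open>\<beta> / \<alpha>\<close> or, before
  that, at an end of the piece.\<close>

lemma piece_optimum:
  fixes \<alpha> \<beta> l m r :: real
  assumes m: "l \<le> m" "m \<le> r" and pos: "0 < \<alpha> + \<beta> * m"
  shows "\<exists>c. (c = l \<or> c = r \<or> c = \<beta> / \<alpha> \<and> l \<le> c \<and> c \<le> r) \<and> 0 < \<alpha> + \<beta> * c \<and>
    (1 + c * c) * ((\<alpha> + \<beta> * m) * (\<alpha> + \<beta> * m)) \<le> (1 + m * m) * ((\<alpha> + \<beta> * c) * (\<alpha> + \<beta> * c))"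
proof -
  have critical: ?thesis if "\<alpha> > 0" "l \<le> \<beta> / \<alpha>" "\<beta> / \<alpha> \<le> r"
  proof -
    define c where "c = \<beta> / \<alpha>"
    have b: "\<beta> = \<alpha> * c" unfolding c_def using that(1) by simp
    have p: "0 < \<alpha> + \<beta> * c" unfolding b using that(1) by (simp add: add_pos_nonneg mult.assoc)
    have "0 \<le> \<alpha> * ((c - m) * (c - m)) * (\<alpha> + \<beta> * c)" using that(1) p by simp
    also have "\<dots> = (c - m) * ((\<beta> - \<alpha> * m) * (\<alpha> + \<beta> * c) + (\<beta> - \<alpha> * c) * (\<alpha> + \<beta> * m))"
      unfolding b by (simp add: algebra_simps)
    finally have "(1 + c * c) * ((\<alpha> + \<beta> * m) * (\<alpha> + \<beta> * m)) \<le> (1 + m * m) * ((\<alpha> + \<beta> * c) * (\<alpha> + \<beta> * c))"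
      using line_ratio_diff[of m \<alpha> \<beta> c] by linarith
    then show ?thesis using p that unfolding c_def by blast
  qed
  show ?thesis
  proof (cases "0 \<le> \<beta> - \<alpha> * m")
    case True
    show ?thesis
    proof (cases "0 \<le> \<beta> - \<alpha> * r")
      case True
      then show ?thesis using line_ratio_up[OF m(2) \<open>0 \<le> \<beta> - \<alpha> * m\<close> True pos] by blast
    next
      case False
      have "\<alpha> * m < \<alpha> * r" using True False by linarith
      then have a: "\<alpha> > 0" using m(2) by (simp add: mult_less_cancel_left)
      have "m \<le> \<beta> / \<alpha>" "\<beta> / \<alpha> \<le> r" using True False a by (simp_all add: field_simps)
      then show ?thesis using critical[OF a] order_trans[OF m(1)] by blast
    qed
  next
    case False
    show ?thesis
    proof (cases "\<beta> - \<alpha> * l \<le> 0")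
      case True
      \<comment> \<open>Going left is going right after the reflection that negates the slopes and
        \<open>\<beta>\<close>.\<close>
      have "- m \<le> - l" "0 \<le> - \<beta> - \<alpha> * - m" "0 \<le> - \<beta> - \<alpha> * - l" "0 < \<alpha> + - \<beta> * - m"
        using m False True pos by auto
      from line_ratio_up[OF this] show ?thesis by (intro exI[of _ l]) simp
    next
      case False
      have "\<alpha> * l < \<alpha> * m" using False \<open>\<not> 0 \<le> \<beta> - \<alpha> * m\<close> by linarith
      then have a: "\<alpha> > 0" using m(1) by (simp add: mult_less_cancel_left)
      have "l \<le> \<beta> / \<alpha>" "\<beta> / \<alpha> \<le> m" using \<open>\<not> 0 \<le> \<beta> - \<alpha> * m\<close> False a by (simp_all add: field_simps)
      then show ?thesis using critical[OF a] order_trans[OF _ m(2)] by blast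
    qed
  qed
qed

text \<open>Pieces are half-open, yet their right ends are candidates too. If all members of the
  finite family were strictly below at \<open>r\<close>, they would still be so shortly before
  \<open>r\<close>. Finiteness matters because the witness may depend on the slope.\<close>

lemma affine_bound_closed:
  fixes f :: "'a \<Rightarrow> real \<Rightarrow> real"
  assumes fin: "finite B" and f: "\<And>b. isCont (f b) r" and h: "isCont h r" and lr: "l < r"
    and le: "\<And>m. l \<le> m \<Longrightarrow> m < r \<Longrightarrow> \<exists>b\<in>B. h m \<le> f b m"
  shows "\<exists>b\<in>B. h r \<le> f b r"
proof (rule ccontr)
  assume "\<not> ?thesis"
  then have lt: "\<forall>b\<in>B. f b r < h r" by auto
  have "\<forall>b\<in>B. \<forall>\<^sub>F m in at_left r. f b m < h m"
  proof
    fix b assume "b \<in> B"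
    have "((\<lambda>m. h m - f b m) \<longlongrightarrow> h r - f b r) (at r)" using f[of b] h unfolding isCont_def by (intro tendsto_diff)
    then have "\<forall>\<^sub>F m in at r. 0 < h m - f b m" using lt \<open>b \<in> B\<close> by (intro order_tendstoD(1)) auto
    then have "\<forall>\<^sub>F m in at r. f b m < h m" by (rule eventually_mono) simp
    then show "\<forall>\<^sub>F m in at_left r. f b m < h m" by (rule filter_leD[OF at_le, rotated]) simp
  qed
  then have "\<forall>\<^sub>F m in at_left r. \<forall>b\<in>B. f b m < h m" by (intro eventually_ball_finite fin)
  moreover have "\<forall>\<^sub>F m in at_left r. m \<in> {l<..<r}" by (rule eventually_at_left_real[OF lr])
  ultimately have "\<forall>\<^sub>F m in at_left r. (\<forall>b\<in>B. f b m < h m) \<and> m \<in> {l<..<r}" by (rule eventually_conj)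
  then obtain m where "\<forall>b\<in>B. f b m < h m" "m \<in> {l<..<r}"
    using eventually_happens trivial_limit_at_left_real by blast
  then show False using le[of m] by fastforce
qed

section \<open>The decision algorithm\<close>

abbreviation rneg1 :: rexp where "rneg1 \<equiv> RSub (RNat (INat 0)) (RNat (INat 1))"

subsection \<open>The pivots and the charts\<close>

definition ROT :: com where
  "ROT = rset ''rt'' (rv ''rc'') ;; rset ''rc'' (RSub (RNat (INat 0)) (rv ''rs'')) ;; rset ''rs'' (rv ''rt'') ;; iinc ''ch''"

definition CHART :: com where
  "CHART = iset ''ch'' (INat 0) ;; rset ''rc'' (RNat (INat 1)) ;; rset ''rs'' (RNat (INat 0))"

definition OUTER :: "com \<Rightarrow> com" where
  "OUTER body = iset ''a'' (INat 0) ;; While (ILess (iv ''a'') (iv ''M''))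
    (CHART ;; While (ILess (iv ''ch'') (INat 4)) (body ;; ROT) ;; iinc ''a'')"

lemma mods_ROT [simp]: "imods ROT = [''ch'']" "rmods ROT = [''rt'', ''rc'', ''rs'']"
  "imods CHART = [''ch'']" "rmods CHART = [''rc'', ''rs'']"
  unfolding ROT_def CHART_def by simp_all

text \<open>The fifth entry is the chart to which the fourth rotation returns; with it the loop
  invariant is meaningful when the counter is 4.\<close>

definition nth_chart :: "nat \<Rightarrow> real \<times> real" where
  "nth_chart i = [(1, 0), (0, 1), (-1, 0), (0, -1), (1, 0)] ! i"

lemma nth_chart_rot: "i < 4 \<Longrightarrow> nth_chart (Suc i) = (- snd (nth_chart i), fst (nth_chart i))"
  unfolding nth_chart_def by (auto simp: less_Suc_eq numeral_eq_Suc)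

lemma nth_chart_image: "nth_chart ` {..<4} = charts"
  unfolding nth_chart_def charts_def by (auto simp: lessThan_Suc numeral_eq_Suc)

definition VEC :: com where
  "VEC = rset ''dx'' (RSub (RGet ''cx'' (iv ''b'')) (RGet ''cx'' (iv ''a''))) ;;
    rset ''dy'' (RSub (RGet ''cy'' (iv ''b'')) (RGet ''cy'' (iv ''a''))) ;;
    rset ''ex'' (RAdd (RMul (rv ''rc'') (rv ''dx'')) (RMul (rv ''rs'') (rv ''dy''))) ;;
    rset ''ey'' (RSub (RMul (rv ''rc'') (rv ''dy'')) (RMul (rv ''rs'') (rv ''dx''))) ;;
    rset ''D'' (RAdd (RMul (rv ''dx'') (rv ''dx'')) (RMul (rv ''dy'') (rv ''dy'')))"

lemma mods_VEC [simp]: "imods VEC = []" "rmods VEC = [''dx'', ''dy'', ''ex'', ''ey'', ''D'']"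
  unfolding VEC_def by simp_all

lemma wp_VEC:
  "wp VEC (\<lambda>s' _. rval s' ''ex'' = ecx (rmem s ''cx'') (rmem s ''cy'') (rval s ''rc'') (rval s ''rs'') (ival s ''a'') (ival s ''b'')
    \<and> rval s' ''ey'' = ecy (rmem s ''cx'') (rmem s ''cy'') (rval s ''rc'') (rval s ''rs'') (ival s ''a'') (ival s ''b'')
    \<and> rval s' ''D'' = DD (rmem s ''cx'') (rmem s ''cy'') (ival s ''a'') (ival s ''b'')) s 5"
  unfolding VEC_def ecx_def ecy_def DD_def by (intro wp_straight; simp)

locale discs =
  fixes cx cy :: "nat \<Rightarrow> real" and gst gr :: "nat \<Rightarrow> nat" and G :: nat
  assumes gs: "groups gst G" and gr: "\<And>g b. g < G \<Longrightarrow> b \<in> grp gst g \<Longrightarrow> gr b = g"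
begin

definition inst :: "store \<Rightarrow> bool" where
  "inst s \<longleftrightarrow> rmem s ''cx'' = cx \<and> rmem s ''cy'' = cy \<and> imem s ''gst'' = gst \<and> imem s ''gr'' = gr
     \<and> ival s ''G'' = G \<and> ival s ''M'' = gst G"

lemma inst_frame:
  assumes "inst s" and "same_except is rs s s'"
    and "set is \<inter> {''gst'', ''gr'', ''G'', ''M''} = {}" and "set rs \<inter> {''cx'', ''cy''} = {}"
  shows "inst s'"
  using assms unfolding inst_def same_except_def by auto

lemma gr_grp: "b < gst G \<Longrightarrow> gr b < G \<and> b \<in> grp gst (gr b)"
  using grp_exists[OF gs] gr by blast

lemma grp_iff: "b < gst G \<Longrightarrow> g < G \<Longrightarrow> b \<in> grp gst g \<longleftrightarrow> gr b = g"
  using gr_grp gr by blast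

lemma G_pos: "0 < G"
  using gs unfolding groups_def by simp

lemma G_le: "G \<le> gst G"
proof -
  have "g \<le> G \<Longrightarrow> g \<le> gst g" for g
  proof (induction g)
    case (Suc g)
    then have "g \<le> gst g" "gst g < gst (Suc g)" using gs unfolding groups_def by auto
    then show ?case by simp
  qed simp
  then show ?thesis by simp
qed

text \<open>Common to both algorithms: the invariant is indexed by the set of pivots and charts
  treated so far. Each chart adds 5 units to the body (rotation and test), and each pivot adds
  6.\<close>

lemma wp_OUTER:
  fixes Inv :: "(nat \<times> real \<times> real) set \<Rightarrow> store \<Rightarrow> bool"
  assumes frame: "\<And>S s s'. Inv S s \<Longrightarrow> same_except [''a'', ''ch''] [''rt'', ''rc'', ''rs''] s s' \<Longrightarrow> Inv S s'"
    and inst: "\<And>S s. Inv S s \<Longrightarrow> inst s"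
    and body: "\<And>S s. Inv S s \<Longrightarrow> ival s ''a'' < gst G \<Longrightarrow> (rval s ''rc'', rval s ''rs'') \<in> charts \<Longrightarrow>
      wp body (\<lambda>s' _. Inv (insert (ival s ''a'', rval s ''rc'', rval s ''rs'') S) s') s B"
    and mods: "set (imods body) \<inter> {''a'', ''ch''} = {}" "set (rmods body) \<inter> {''rc'', ''rs''} = {}"
    and start: "Inv {} s"
  shows "wp (OUTER body) (\<lambda>s' _. Inv ({..<gst G} \<times> charts) s') s (2 + gst G * (6 + 4 * (B + 5)))"
proof -
  define visited where "visited a i = {..<a} \<times> charts \<union> {a} \<times> nth_chart ` {..<i}" for a i :: nat
  have visited4: "visited a 4 = visited (Suc a) 0" for a
    unfolding visited_def nth_chart_image by (auto simp: less_Suc_eq)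
  have visitedSuc: "visited a (Suc i) = insert (a, nth_chart i) (visited a i)" for a i
    unfolding visited_def by (auto simp: lessThan_Suc)
  define J where "J a r s' t' \<longleftrightarrow> ival s' ''a'' = a \<and> ival s' ''ch'' \<le> 4 \<and> Inv (visited a (ival s' ''ch'')) s' \<and>
    (rval s' ''rc'', rval s' ''rs'') = nth_chart (ival s' ''ch'') \<and> r + 1 + (4 - ival s' ''ch'') * (B + 5) \<le> t'"
    for a r s' and t' :: nat
  define I where "I s' t' \<longleftrightarrow> ival s' ''a'' \<le> gst G \<and> Inv (visited (ival s' ''a'') 0) s' \<and>
    1 + (gst G - ival s' ''a'') * (6 + 4 * (B + 5)) \<le> t'" for s' and t' :: nat
  have inner: "wp (body ;; ROT) (J a r) s1 (t1 - 1)" if J1: "J a r s1 t1" and a: "a < gst G" and ch: "ival s1 ''ch'' < 4" for a r s1 t1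
  proof -
    let ?i = "ival s1 ''ch''"
    have s1: "ival s1 ''a'' = a" "Inv (visited a ?i) s1" "(rval s1 ''rc'', rval s1 ''rs'') = nth_chart ?i"
      "r + 1 + (4 - ?i) * (B + 5) \<le> t1" using J1 unfolding J_def by auto
    have c: "(rval s1 ''rc'', rval s1 ''rs'') \<in> charts"
      unfolding s1(3) nth_chart_image[symmetric] using ch by blast
    have "4 - ?i = Suc (4 - Suc ?i)" using ch by simp
    then have t: "r + 1 + (B + 5) + (4 - Suc ?i) * (B + 5) \<le> t1" using s1(4) by simp
    show ?thesis
    proof (rule wp_Seq, rule wp_call[OF body[OF s1(2) _ c]], goal_cases)
      case 1
      show ?case using s1(1) a by simp
    next
      case 2
      show ?case using t by linarith
    next
      case (3 s2 t2)
      have e2: "imem s2 ''a'' = imem s1 ''a''" "imem s2 ''ch'' = imem s1 ''ch''"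
        "rmem s2 ''rc'' = rmem s1 ''rc''" "rmem s2 ''rs'' = rmem s1 ''rs''"
        using same_exceptD[OF 3(2)] mods by auto
      have R: "wp ROT (\<lambda>s' _. ival s' ''ch'' = Suc (ival s2 ''ch'') \<and> rval s' ''rc'' = - rval s2 ''rs'' \<and>
          rval s' ''rs'' = rval s2 ''rc'') s2 4"
        unfolding ROT_def by (intro wp_straight; simp)
      show ?case
      proof (rule wp_call[OF R], goal_cases)
        case 1
        show ?case using 3(3) t by linarith
      next
        case (2 s3 t3)
        have "Inv (insert (a, rval s1 ''rc'', rval s1 ''rs'') (visited a ?i)) s3"
          using frame[OF 3(1)] 2(2) s1(1) by (auto simp: same_except_def)
        then have "Inv (visited a (Suc ?i)) s3" unfolding visitedSuc s1(3) .
        moreover have "(rval s3 ''rc'', rval s3 ''rs'') = nth_chart (Suc ?i)"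
          using 2(1) e2 nth_chart_rot[OF ch] s1(3)[symmetric] by simp
        moreover have "ival s3 ''a'' = a" using 2(2) e2 s1(1) by (simp add: same_except_def)
        moreover have "r + 1 + (4 - Suc ?i) * (B + 5) \<le> t3" using 2(3) 3(3) t by linarith
        ultimately show ?case using 2(1) e2 ch unfolding J_def by simp
      qed
    qed
  qed
  have outer: "wp (CHART ;; While (ILess (iv ''ch'') (INat 4)) (body ;; ROT) ;; iinc ''a'') I s1 (t1 - 1)"
    if I1: "I s1 t1" and a: "ival s1 ''a'' < gst G" for s1 t1
  proof -
    let ?a = "ival s1 ''a''"
    define r where "r = 2 + (gst G - Suc ?a) * (6 + 4 * (B + 5))"
    have s1: "Inv (visited ?a 0) s1" "1 + (gst G - ?a) * (6 + 4 * (B + 5)) \<le> t1" using I1 unfolding I_def by auto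
    have "gst G - ?a = Suc (gst G - Suc ?a)" using a by simp
    then have t: "r + 5 + 4 * (B + 5) \<le> t1" using s1(2) unfolding r_def by simp
    have C: "wp CHART (\<lambda>s' _. ival s' ''ch'' = 0 \<and> rval s' ''rc'' = 1 \<and> rval s' ''rs'' = 0) s1 3"
      unfolding CHART_def by (intro wp_straight; simp)
    show ?thesis
    proof (rule wp_Seq, rule wp_call[OF C], goal_cases)
      case 1
      show ?case using t by linarith
    next
      case (2 s2 t2)
      have "Inv (visited ?a 0) s2" using frame[OF s1(1)] 2(2) by (auto simp: same_except_def)
      moreover have "ival s2 ''a'' = ?a" using 2(2) by (simp add: same_except_def)
      moreover have "r + 1 + 4 * (B + 5) \<le> t2" using 2(3) t by linarith
      ultimately have J2: "J ?a r s2 t2" using 2(1) unfolding J_def nth_chart_def by simp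
      show ?case
      proof (rule wp_Seq, rule wp_While[where I = "J ?a r"], rule J2, goal_cases)
        case (1 s3 t3)
        then show ?case using inner[OF 1(1) a] unfolding J_def by auto
      next
        case (2 s3 t3)
        then have s3: "ival s3 ''a'' = ?a" "ival s3 ''ch'' = 4" "Inv (visited ?a 4) s3" "r + 1 \<le> t3"
          unfolding J_def by auto
        let ?s4 = "s3\<lparr>imem := (imem s3)(''a'' := (imem s3 ''a'')(ieval (INat 0) s3 := ieval (IAdd (iv ''a'') (INat 1)) s3))\<rparr>"
        have "Inv (visited (Suc ?a) 0) ?s4" using frame[OF s3(3)] unfolding visited4 by (simp add: same_except_def)
        moreover have "ival ?s4 ''a'' = Suc ?a" using s3(1) by simp
        moreover have "1 + (gst G - Suc ?a) * (6 + 4 * (B + 5)) \<le> t3 - 1 - 1" using s3(4) unfolding r_def by linarith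
        ultimately have "I ?s4 (t3 - 1 - 1)" using a unfolding I_def by simp
        then show ?case using s3(4) unfolding r_def by (intro conjI wp_IPut) auto
      qed
    qed
  qed
  show ?thesis unfolding OUTER_def
  proof (rule wp_Seq, rule wp_IPut, simp, rule wp_While[where I = I], goal_cases)
    case 1
    have "Inv {} (s\<lparr>imem := (imem s)(''a'' := (imem s ''a'')(ieval (INat 0) s := ieval (INat 0) s))\<rparr>)"
      using frame[OF start] by (simp add: same_except_def)
    moreover have "visited 0 0 = {}" unfolding visited_def by simp
    ultimately show ?case unfolding I_def by simp
  next
    case (2 s1 t1)
    have "ival s1 ''a'' < gst G" using 2 inst unfolding I_def inst_def by auto
    then show ?case using outer[OF 2(1)] 2(1) unfolding I_def by auto
  next
    case (3 s1 t1)
    then have "ival s1 ''a'' = gst G" using inst unfolding I_def inst_def by force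
    then show ?case using 3(1) unfolding I_def visited_def by auto
  qed
qed

end

abbreviation rone :: rexp where "rone \<equiv> RNat (INat 1)"

subsection \<open>Counters of the groups\<close>

definition CINC :: com where
  "CINC = Cond (ILess (IGet ''cnt'' (iv ''g'')) (INat 1)) (iinc ''sat'') Skip ;;
    IPut ''cnt'' (iv ''g'') (IAdd (IGet ''cnt'' (iv ''g'')) (INat 1))"

definition CDEC :: com where
  "CDEC = IPut ''cnt'' (iv ''g'') (ISub (IGet ''cnt'' (iv ''g'')) (INat 1)) ;;
    Cond (ILess (IGet ''cnt'' (iv ''g'')) (INat 1)) (iset ''sat'' (ISub (iv ''sat'') (INat 1))) Skip"

lemma mods_CINC [simp]: "imods CINC = [''sat'', ''cnt'']" "rmods CINC = []"
  "imods CDEC = [''cnt'', ''sat'']" "rmods CDEC = []"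
  unfolding CINC_def CDEC_def by simp_all

context discs
begin

text \<open>The number of nonempty groups is maintained besides the counters so that coverage of all
  groups can be tested in constant time.\<close>

definition cnts :: "nat set \<Rightarrow> store \<Rightarrow> bool" where
  "cnts S s \<longleftrightarrow> (\<forall>g<G. imem s ''cnt'' g = card (S \<inter> grp gst g))
     \<and> ival s ''sat'' = card {g. g < G \<and> S \<inter> grp gst g \<noteq> {}}"

lemma cnts_full:
  assumes "cnts S s"
  shows "\<not> ival s ''sat'' < G \<longleftrightarrow> (\<forall>g<G. \<exists>b\<in>grp gst g. b \<in> S)"
proof -
  let ?K = "{g. g < G \<and> S \<inter> grp gst g \<noteq> {}}"
  have sub: "?K \<subseteq> {..<G}" by auto
  have "\<not> ival s ''sat'' < G \<longleftrightarrow> ?K = {..<G}"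
  proof
    assume "\<not> ival s ''sat'' < G"
    then have "card {..<G} \<le> card ?K" using assms unfolding cnts_def by simp
    then show "?K = {..<G}" using sub by (intro card_seteq) auto
  next
    assume "?K = {..<G}"
    then show "\<not> ival s ''sat'' < G" using assms unfolding cnts_def by simp
  qed
  then show ?thesis by auto
qed

lemma cnts_frame:
  assumes "cnts S s" and "imem s' ''cnt'' = imem s ''cnt''" and "imem s' ''sat'' = imem s ''sat''"
  shows "cnts S s'"
  using assms unfolding cnts_def by simp

lemma cnts_insert:
  assumes b: "b \<notin> S" "b < gst G" and s: "cnts S s"
    and c: "imem s' ''cnt'' = (imem s ''cnt'')(gr b := Suc (imem s ''cnt'' (gr b)))"
    and sat: "ival s' ''sat'' = (if imem s ''cnt'' (gr b) < 1 then Suc (ival s ''sat'') else ival s ''sat'')"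
  shows "cnts (insert b S) s'"
proof -
  have g: "gr b < G" "b \<in> grp gst (gr b)" using gr_grp[OF b(2)] by auto
  have other: "insert b S \<inter> grp gst h = S \<inter> grp gst h" if "h < G" "h \<noteq> gr b" for h
    using grp_iff[OF b(2) that(1)] that(2) by auto
  have own: "insert b S \<inter> grp gst (gr b) = insert b (S \<inter> grp gst (gr b))" using g by auto
  let ?K = "{g. g < G \<and> S \<inter> grp gst g \<noteq> {}}"
  have K: "{g. g < G \<and> insert b S \<inter> grp gst g \<noteq> {}} = insert (gr b) ?K"
  proof (intro set_eqI)
    fix h
    show "h \<in> {g. g < G \<and> insert b S \<inter> grp gst g \<noteq> {}} \<longleftrightarrow> h \<in> insert (gr b) ?K"
    proof (cases "h < G \<and> h \<noteq> gr b")
      case True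
      then have "insert b S \<inter> grp gst h = S \<inter> grp gst h" using other by blast
      then show ?thesis using True by (simp only: mem_Collect_eq insert_iff) simp
    qed (use g in auto)
  qed
  have zero: "imem s ''cnt'' (gr b) < 1 \<longleftrightarrow> gr b \<notin> ?K"
    using s g unfolding cnts_def by (simp add: card_eq_0_iff)
  have "ival s' ''sat'' = card (insert (gr b) ?K)"
  proof (cases "gr b \<in> ?K")
    case True
    then show ?thesis using s sat zero unfolding cnts_def by (simp add: insert_absorb)
  next
    case False
    then have "card (insert (gr b) ?K) = Suc (card ?K)" by (intro card_insert_disjoint) auto
    then show ?thesis using s sat zero False unfolding cnts_def by simp
  qed
  moreover have "imem s' ''cnt'' h = card (insert b S \<inter> grp gst h)" if "h < G" for h
    using that s c b(1) other own unfolding cnts_def by (cases "h = gr b") auto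
  ultimately show ?thesis unfolding cnts_def K by simp
qed

lemma cnts_remove:
  assumes b: "b \<in> S" "b < gst G" and s: "cnts S s"
    and c: "imem s' ''cnt'' = (imem s ''cnt'')(gr b := imem s ''cnt'' (gr b) - 1)"
    and sat: "ival s' ''sat'' = (if imem s ''cnt'' (gr b) - 1 < 1 then ival s ''sat'' - 1 else ival s ''sat'')"
  shows "cnts (S - {b}) s'"
proof -
  have g: "gr b < G" "b \<in> grp gst (gr b)" using gr_grp[OF b(2)] by auto
  have other: "(S - {b}) \<inter> grp gst h = S \<inter> grp gst h" if "h < G" "h \<noteq> gr b" for h
    using grp_iff[OF b(2) that(1)] that(2) by auto
  have own: "(S - {b}) \<inter> grp gst (gr b) = (S \<inter> grp gst (gr b)) - {b}" by auto
  have crd: "card ((S - {b}) \<inter> grp gst (gr b)) = imem s ''cnt'' (gr b) - 1"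
    unfolding own using s g b(1) unfolding cnts_def by (subst card_Diff_singleton) auto
  let ?K = "{g. g < G \<and> S \<inter> grp gst g \<noteq> {}}" and ?K' = "{g. g < G \<and> (S - {b}) \<inter> grp gst g \<noteq> {}}"
  have zero: "imem s ''cnt'' (gr b) - 1 < 1 \<longleftrightarrow> (S - {b}) \<inter> grp gst (gr b) = {}"
    using crd by (metis card_eq_0_iff finite_Int finite_atLeastLessThan less_one)
  have inK: "gr b \<in> ?K" using g b(1) by auto
  have "ival s' ''sat'' = card ?K'"
  proof (cases "(S - {b}) \<inter> grp gst (gr b) = {}")
    case True
    then have "?K' = ?K - {gr b}" using other by auto
    then have "card ?K' = card ?K - 1" using inK by (simp add: card_Diff_singleton)
    then show ?thesis using s sat zero True unfolding cnts_def by simp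
  next
    case False
    then have "?K' = ?K" using other g inK by auto
    then show ?thesis using s sat zero False unfolding cnts_def by simp
  qed
  moreover have "imem s' ''cnt'' h = card ((S - {b}) \<inter> grp gst h)" if "h < G" for h
    using that s c crd other unfolding cnts_def by (cases "h = gr b") auto
  ultimately show ?thesis unfolding cnts_def by simp
qed

lemma wp_CINC:
  assumes "b \<notin> S" "b < gst G" "cnts S s" "ival s ''g'' = gr b"
  shows "wp CINC (\<lambda>s' _. cnts (insert b S) s') s 3"
  unfolding CINC_def
  by (intro wp_straight wp_Cond; (rule cnts_insert[OF assms(1-3)])?; use assms(4) in simp)

lemma wp_CDEC:
  assumes "b \<in> S" "b < gst G" "cnts S s" "ival s ''g'' = gr b"
  shows "wp CDEC (\<lambda>s' _. cnts (S - {b}) s') s 3"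
  unfolding CDEC_def
  by (intro wp_straight wp_Cond; (rule cnts_remove[OF assms(1-3)])?; use assms(4) in simp)

end

subsection \<open>The events of a pivot in a chart\<close>

definition REACH :: bexp where
  "REACH = BAnd (BNot (RLess (rv ''z'') rneg1)) (BAnd (BNot (RLess rone (rv ''z'')))
    (BAnd (BNot (RLess (RAdd (rv ''ex'') (RMul (rv ''z'') (rv ''ey''))) (RNat (INat 0))))
      (BNot (RLess (RMul (RMul (RMul (RNat (INat 4)) (rv ''eps'')) (rv ''eps''))
          (RMul (RAdd (rv ''ex'') (RMul (rv ''z'') (rv ''ey''))) (RAdd (rv ''ex'') (RMul (rv ''z'') (rv ''ey'')))))
        (RMul (RMul (rv ''D'') (rv ''D'')) (RAdd rone (RMul (rv ''z'') (rv ''z''))))))))"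

definition CAND :: "rexp \<Rightarrow> com" where
  "CAND r = rset ''z'' r ;; Cond REACH (Cond (RLess (rv ''z'') (rv ''lo'')) (rset ''lo'' (rv ''z'')) Skip ;;
    Cond (RLess (rv ''hi'') (rv ''z'')) (rset ''hi'' (rv ''z'')) Skip) Skip"

definition RPOLY :: "rexp list" where
  "RPOLY = [RSub (RMul (RMul (RMul (RNat (INat 4)) (rv ''eps'')) (rv ''eps'')) (RMul (rv ''ex'') (rv ''ex''))) (RMul (rv ''D'') (rv ''D'')),
    RMul (RMul (RMul (RNat (INat 8)) (rv ''eps'')) (rv ''eps'')) (RMul (rv ''ex'') (rv ''ey'')),
    RSub (RMul (RMul (RMul (RNat (INat 4)) (rv ''eps'')) (rv ''eps'')) (RMul (rv ''ey'') (rv ''ey''))) (RMul (rv ''D'') (rv ''D''))]"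

definition INTERVAL :: com where
  "INTERVAL = rset ''lo'' (RNat (INat 2)) ;; rset ''hi'' (RSub (RNat (INat 0)) (RNat (INat 2))) ;;
    CAND rneg1 ;; CAND rone ;; CAND (RRoot 0 RPOLY) ;; CAND (RRoot 1 RPOLY)"

lemma mods_INTERVAL [simp]:
  "imods (CAND r) = []" "rmods (CAND r) = [''z'', ''lo'', ''hi'']"
  "imods INTERVAL = []"
  "rmods INTERVAL = [''lo'', ''hi'', ''z'', ''lo'', ''hi'', ''z'', ''lo'', ''hi'', ''z'', ''lo'', ''hi'', ''z'', ''lo'', ''hi'']"
  unfolding INTERVAL_def CAND_def by simp_all

lemma beval_REACH: "beval REACH s \<longleftrightarrow> rval s ''z'' \<in> reach_set (rval s ''eps'') (rval s ''ex'') (rval s ''ey'') (rval s ''D'')"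
  unfolding REACH_def reach_set_def reach_def by (simp add: not_less)

lemma reval_RPOLY: "reval (RRoot j RPOLY) s = nth_real_root j (reach_poly (rval s ''eps'') (rval s ''ex'') (rval s ''ey'') (rval s ''D''))"
  unfolding RPOLY_def reach_poly_def by (simp del: Poly.simps)

definition ivars :: "real \<Rightarrow> real \<Rightarrow> real \<Rightarrow> real \<Rightarrow> store \<Rightarrow> bool" where
  "ivars \<epsilon> x y D s \<longleftrightarrow> rval s ''eps'' = \<epsilon> \<and> rval s ''ex'' = x \<and> rval s ''ey'' = y \<and> rval s ''D'' = D"

lemma ends_step:
  assumes "ends V lo hi" and "z \<in> J"
  shows "ends (V \<union> ({z} \<inter> J)) (if z < lo then z else lo) (if hi < z then z else hi)"
  using assms unfolding ends_def by auto

lemma wp_CAND: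
  assumes i: "ivars \<epsilon> x y D s" and e: "ends V (rval s ''lo'') (rval s ''hi'')" and z: "reval r s = z"
  shows "wp (CAND r) (\<lambda>s' _. ivars \<epsilon> x y D s' \<and>
    ends (V \<union> ({z} \<inter> reach_set \<epsilon> x y D)) (rval s' ''lo'') (rval s' ''hi'')) s 6"
proof (cases "z \<in> reach_set \<epsilon> x y D")
  case True
  have "ends (V \<union> ({z} \<inter> reach_set \<epsilon> x y D)) (if z < rval s ''lo'' then z else rval s ''lo'')
    (if rval s ''hi'' < z then z else rval s ''hi'')" by (rule ends_step[OF e True])
  then show ?thesis unfolding CAND_def using i z True
    by (intro wp_straight wp_Cond) (auto simp: beval_REACH ivars_def split: if_splits)
next
  case False
  then show ?thesis unfolding CAND_def using i z e
    by (intro wp_straight wp_Cond) (auto simp: beval_REACH ivars_def)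
qed

lemma wp_INTERVAL:
  assumes i: "ivars \<epsilon> x y D s" and \<epsilon>: "0 < \<epsilon>" and D: "0 < D"
  shows "wp INTERVAL (\<lambda>s' _. reach_set \<epsilon> x y D = {rval s' ''lo''..rval s' ''hi''}) s 26"
proof -
  let ?J = "reach_set \<epsilon> x y D"
  let ?P = "\<lambda>V s' (t::nat) t'. ivars \<epsilon> x y D s' \<and> ends V (rval s' ''lo'') (rval s' ''hi'') \<and> t \<le> t'"
  have step: "wp (CAND r) (\<lambda>s' t'. ?P (V \<union> ({z} \<inter> ?J)) s' t t') s1 t1"
    if "?P V s1 (t + 6) t1" "reval r s1 = z" for V s1 t t1 r z
    by (rule wp_call[OF wp_CAND[of \<epsilon> x y D s1 V r z]]) (use that in auto)
  have roots: "reval (RRoot j RPOLY) s' = nth_real_root j (reach_poly \<epsilon> x y D)" if "ivars \<epsilon> x y D s'" for j s'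
    using that unfolding reval_RPOLY ivars_def by simp
  define C0 where "C0 = {} \<union> ({-1} \<inter> ?J)"
  define C1 where "C1 = C0 \<union> ({1} \<inter> ?J)"
  define C2 where "C2 = C1 \<union> ({nth_real_root 0 (reach_poly \<epsilon> x y D)} \<inter> ?J)"
  define C3 where "C3 = C2 \<union> ({nth_real_root 1 (reach_poly \<epsilon> x y D)} \<inter> ?J)"
  have C3: "C3 = reach_cands \<epsilon> x y D \<inter> ?J"
    unfolding C0_def C1_def C2_def C3_def reach_cands_def by blast
  let ?Q = "\<lambda>s' _. ?J = {rval s' ''lo''..rval s' ''hi''}"
  have 4: "wp (CAND (RRoot 1 RPOLY)) ?Q s1 t1" if P: "?P C2 s1 6 t1" for s1 t1
  proof (rule wp_conseq[OF step[where t = 0 and V = C2, OF _ roots]])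
    show "?P C2 s1 (0 + 6) t1" using P by simp
    show "ivars \<epsilon> x y D s1" using P by blast
    fix s' t' assume "?P (C2 \<union> ({nth_real_root 1 (reach_poly \<epsilon> x y D)} \<inter> ?J)) s' 0 t'"
    then show "?J = {rval s' ''lo''..rval s' ''hi''}"
      using reach_set_interval[OF \<epsilon> D] unfolding C3_def[symmetric] C3 by blast
  qed
  have 3: "wp (CAND (RRoot 0 RPOLY) ;; CAND (RRoot 1 RPOLY)) ?Q s1 t1" if P: "?P C1 s1 12 t1" for s1 t1
  proof (rule wp_Seq, rule wp_conseq[OF step[where t = 6 and V = C1, OF _ roots]])
    show "?P C1 s1 (6 + 6) t1" using P by simp
    show "ivars \<epsilon> x y D s1" using P by blast
  qed (rule 4, simp only: C2_def)
  have 2: "wp (CAND rone ;; CAND (RRoot 0 RPOLY) ;; CAND (RRoot 1 RPOLY)) ?Q s1 t1" if P: "?P C0 s1 18 t1" for s1 t1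
  proof (rule wp_Seq, rule wp_conseq[OF step[where t = 12 and V = C0 and z = 1]])
    show "?P C0 s1 (12 + 6) t1" using P by simp
  qed (simp, rule 3, simp only: C1_def)
  have 1: "wp (CAND rneg1 ;; CAND rone ;; CAND (RRoot 0 RPOLY) ;; CAND (RRoot 1 RPOLY)) ?Q s1 t1"
    if P: "?P {} s1 24 t1" for s1 t1
  proof (rule wp_Seq, rule wp_conseq[OF step[where t = 18 and V = "{}" and z = "-1"]])
    show "?P {} s1 (18 + 6) t1" using P by simp
  qed (simp, rule 2, simp only: C0_def)
  show ?thesis unfolding INTERVAL_def
    by (rule wp_Seq, rule wp_RPut, simp, rule wp_Seq, rule wp_RPut, simp, rule 1)
      (use i in \<open>auto simp: ivars_def ends_def\<close>)
qed

definition PUSH :: "vname \<Rightarrow> com" where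
  "PUSH x = RPut ''X'' (iv ''e'') (rv x) ;; IPut ''L'' (iv ''e'') (iv ''lb'') ;; IPut ''bl'' (iv ''qt'') (iv ''e'') ;;
    iinc ''e'' ;; IPut ''bh'' (iv ''qt'') (iv ''e'') ;; iinc ''qt''"

lemma mods_PUSH [simp]: "imods (PUSH x) = [''L'', ''bl'', ''e'', ''bh'', ''qt'']" "rmods (PUSH x) = [''X'']"
  unfolding PUSH_def by simp_all

text \<open>The queue consists of singleton blocks for the labels \<open>E\<close>, stored in the cells from \<open>e0\<close> on.\<close>

definition singles :: "(nat \<Rightarrow> real) \<Rightarrow> nat \<Rightarrow> nat list \<Rightarrow> store \<Rightarrow> bool" where
  "singles pos e0 E s \<longleftrightarrow> ival s ''qh'' = 0 \<and> ival s ''qt'' = length E \<and> ival s ''e'' = e0 + length E \<and>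
     (\<forall>r<length E. rmem s ''X'' (e0 + r) = pos (E ! r) \<and> imem s ''L'' (e0 + r) = E ! r \<and>
        imem s ''bl'' r = e0 + r \<and> imem s ''bh'' r = e0 + Suc r)"

lemma singles_cong:
  assumes "singles pos e0 E s" and "rmem s' ''X'' = rmem s ''X''"
    and "\<And>x. x \<in> {''qh'', ''qt'', ''e'', ''L'', ''bl'', ''bh''} \<Longrightarrow> imem s' x = imem s x"
  shows "singles pos e0 E s'"
  using assms unfolding singles_def by simp

lemma wp_PUSH:
  assumes s: "singles pos e0 E s" and x: "x \<noteq> ''X''" "rval s x = pos (ival s ''lb'')"
  shows "wp (PUSH x) (\<lambda>s' _. singles pos e0 (E @ [ival s ''lb'']) s' \<and>
      (\<forall>k<ival s ''e''. rmem s' ''X'' k = rmem s ''X'' k \<and> imem s' ''L'' k = imem s ''L'' k)) s 6"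
  unfolding PUSH_def
  by (intro wp_straight) (use s x in \<open>auto simp: singles_def nth_append less_Suc_eq\<close>)

lemma singles_frame:
  assumes "singles pos e0 E s" and "same_except is rs s s'"
    and "set is \<inter> {''qh'', ''qt'', ''e'', ''L'', ''bl'', ''bh''} = {}" and "''X'' \<notin> set rs"
  shows "singles pos e0 E s'"
proof (rule singles_cong[OF assms(1)])
  show "rmem s' ''X'' = rmem s ''X''" using assms(2,4) unfolding same_except_def by blast
  show "imem s' x = imem s x" if "x \<in> {''qh'', ''qt'', ''e'', ''L'', ''bl'', ''bh''}" for x
    using assms(2,3) that unfolding same_except_def by blast
qed

lemma (in discs) cnts_same:
  assumes "cnts S s" and "same_except is rs s s'" and "set is \<inter> {''cnt'', ''sat''} = {}"
  shows "cnts S s'"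
  using assms(2,3) unfolding same_except_def by (intro cnts_frame[OF assms(1)]) blast+

text \<open>The label is formed as \<open>b + b\<close> since integers cannot be multiplied. They
  cannot be halved either, so the kind and the group of each event are tabulated under its
  label.\<close>

definition DTAB :: com where
  "DTAB = iset ''lb'' (IAdd (iv ''b'') (iv ''b'')) ;; iset ''g'' (IGet ''gr'' (iv ''b'')) ;;
    IPut ''kd'' (iv ''lb'') (INat 0) ;; IPut ''eg'' (iv ''lb'') (iv ''g'') ;; iinc ''lb'' ;;
    IPut ''kd'' (iv ''lb'') (INat 1) ;; IPut ''eg'' (iv ''lb'') (iv ''g'') ;; iset ''lb'' (IAdd (iv ''b'') (iv ''b''))"

lemma mods_DTAB [simp]: "imods DTAB = [''lb'', ''g'', ''kd'', ''eg'', ''lb'', ''kd'', ''eg'', ''lb'']" "rmods DTAB = []"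
  unfolding DTAB_def by simp_all

lemma wp_DTAB:
  "wp DTAB (\<lambda>s' _. ival s' ''lb'' = 2 * ival s ''b'' \<and> ival s' ''g'' = imem s ''gr'' (ival s ''b'')
    \<and> imem s' ''kd'' = (imem s ''kd'')(2 * ival s ''b'' := 0, Suc (2 * ival s ''b'') := 1)
    \<and> imem s' ''eg'' = (imem s ''eg'')(2 * ival s ''b'' := imem s ''gr'' (ival s ''b''),
        Suc (2 * ival s ''b'') := imem s ''gr'' (ival s ''b''))) s 8"
  unfolding DTAB_def by (intro wp_steps; simp add: mult_2)

definition DPUSH :: com where
  "DPUSH = INTERVAL ;; Cond (RLess (rv ''hi'') (rv ''lo'')) Skip (PUSH ''lo'' ;; iinc ''lb'' ;; PUSH ''hi'')"

lemma mods_DPUSH [simp]: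
  "imods DPUSH = [''L'', ''bl'', ''e'', ''bh'', ''qt'', ''lb'', ''L'', ''bl'', ''e'', ''bh'', ''qt'']"
  "rmods DPUSH = rmods INTERVAL @ [''X'', ''X'']"
  unfolding DPUSH_def by simp_all

definition DITEM :: com where
  "DITEM = VEC ;; DTAB ;; Cond (RLess (RNat (INat 0)) (rv ''D'')) DPUSH CINC ;; iinc ''b''"

definition SSTEP :: com where
  "SSTEP = iset ''lb'' (IGet ''L'' (iv ''p'')) ;; iset ''g'' (IGet ''eg'' (iv ''lb'')) ;;
    Cond (ILess (IGet ''kd'' (iv ''lb'')) (INat 1)) (CINC ;; Cond (ILess (iv ''sat'') (iv ''G'')) Skip (iset ''answer'' (INat 1))) CDEC ;;
    iinc ''p''"

definition SCAN :: com where
  "SCAN = iset ''p'' (IGet ''bl'' (iv ''qh'')) ;; iset ''pe'' (IGet ''bh'' (iv ''qh'')) ;;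
    While (ILess (iv ''p'') (iv ''pe'')) SSTEP"

definition CLEAR :: com where
  "CLEAR = iset ''g'' (INat 0) ;; While (ILess (iv ''g'') (iv ''G'')) (IPut ''cnt'' (iv ''g'') (INat 0) ;; iinc ''g'')"

text \<open>The test before the sort handles the groups that are already satisfied by centres at the
  pivot, as the scan tests only after openings. Sorting and scanning are guarded because they
  presuppose a nonempty queue.\<close>

definition DBODY :: com where
  "DBODY = CLEAR ;; (iset ''sat'' (INat 0) ;; iset ''e'' (INat 0) ;; iset ''qh'' (INat 0) ;; iset ''qt'' (INat 0) ;; iset ''b'' (INat 0)) ;;
    While (ILess (iv ''b'') (iv ''M'')) DITEM ;;
    Cond (ILess (iv ''sat'') (iv ''G'')) Skip (iset ''answer'' (INat 1)) ;;
    Cond (ILess (INat 0) (iv ''qt'')) (QUEUE SMERGE ;; SCAN) Skip"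

locale dec_chart = discs +
  fixes a :: nat and c s :: real and \<epsilon> :: real
  assumes eps: "0 < \<epsilon>"
begin

definition J :: "nat \<Rightarrow> real set" where
  "J b = reach_set \<epsilon> (ecx cx cy c s a b) (ecy cx cy c s a b) (DD cx cy a b)"

definition ev :: "nat \<Rightarrow> nat list" where
  "ev b = (if DD cx cy a b = 0 \<or> J b = {} then [] else [2 * b, Suc (2 * b)])"

definition evs :: "nat \<Rightarrow> nat list" where
  "evs b = concat (map ev [0..<b])"

text \<open>Positions are described through the interval itself and not through the computed values,
  so that they are a function of the label alone, as \<open>SRep\<close> requires.\<close>

definition pos :: "nat \<Rightarrow> real" where
  "pos l = (if even l then Inf (J (l div 2)) else Sup (J (l div 2)))"

definition Z :: "nat \<Rightarrow> nat set" where
  "Z b = {b'. b' < b \<and> DD cx cy a b' = 0}"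

definition V :: "nat set" where
  "V = {b. b < gst G \<and> DD cx cy a b \<noteq> 0 \<and> J b \<noteq> {}}"

definition cst :: "store \<Rightarrow> bool" where
  "cst st \<longleftrightarrow> inst st \<and> rval st ''eps'' = \<epsilon> \<and> rval st ''rc'' = c \<and> rval st ''rs'' = s \<and> ival st ''a'' = a"

lemma cst_frame:
  assumes "cst st" and "same_except is rs st st'"
    and "set is \<inter> {''gst'', ''gr'', ''G'', ''M'', ''a''} = {}" and "set rs \<inter> {''cx'', ''cy'', ''eps'', ''rc'', ''rs''} = {}"
  shows "cst st'"
  using assms unfolding cst_def inst_def same_except_def by auto

definition tabs :: "nat \<Rightarrow> store \<Rightarrow> bool" where
  "tabs b st \<longleftrightarrow> (\<forall>l<2 * b. imem st ''kd'' l = l mod 2 \<and> imem st ''eg'' l = gr (l div 2))"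

lemma tabs_same:
  assumes "tabs b st" and "same_except is rs st st'" and "set is \<inter> {''kd'', ''eg''} = {}"
  shows "tabs b st'"
proof -
  have "imem st' ''kd'' = imem st ''kd''" "imem st' ''eg'' = imem st ''eg''"
    using assms(2,3) unfolding same_except_def by blast+
  then show ?thesis using assms(1) unfolding tabs_def by simp
qed

definition DI :: "nat \<Rightarrow> store \<Rightarrow> bool" where
  "DI b st \<longleftrightarrow> cst st \<and> ival st ''b'' = b \<and> singles pos 0 (evs b) st \<and> cnts (Z b) st \<and> tabs b st"

lemma J_interval: "J b = {x..y} \<Longrightarrow> x \<le> y \<Longrightarrow> pos (2 * b) = x \<and> pos (Suc (2 * b)) = y"
  unfolding pos_def by simp

lemma wp_DPUSH:
  assumes ivars: "ivars \<epsilon> (ecx cx cy c s a b) (ecy cx cy c s a b) (DD cx cy a b) st"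
    and D: "0 < DD cx cy a b" and q: "singles pos 0 (evs b) st" and lb: "ival st ''lb'' = 2 * b"
  shows "wp DPUSH (\<lambda>st' _. singles pos 0 (evs (Suc b)) st') st 40"
  unfolding DPUSH_def
proof (rule wp_Seq, rule wp_call[OF wp_INTERVAL[OF ivars eps D]], simp, goal_cases)
  case (1 s1 t1)
  then have J: "J b = {rval s1 ''lo''..rval s1 ''hi''}" unfolding J_def by simp
  have q1: "singles pos 0 (evs b) s1"
    by (rule singles_frame[OF q 1(2)]) auto
  have lb1: "ival s1 ''lb'' = 2 * b" using 1(2) lb by (simp add: same_except_def)
  have t1: "14 \<le> t1" using 1 by simp
  show ?case
  proof (rule wp_Cond)
    show "1 \<le> t1" using t1 by simp
  next
    assume "beval (RLess (rv ''hi'') (rv ''lo'')) s1"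
    then have "J b = {}" using J by simp
    then have "evs (Suc b) = evs b" unfolding evs_def ev_def by simp
    then show "wp Skip (\<lambda>st' _. singles pos 0 (evs (Suc b)) st') s1 (t1 - 1)"
      using q1 t1 by (intro wp_Skip) auto
  next
    assume "\<not> beval (RLess (rv ''hi'') (rv ''lo'')) s1"
    then have le: "rval s1 ''lo'' \<le> rval s1 ''hi''" by simp
    note p = J_interval[OF J le]
    have evs: "evs (Suc b) = (evs b @ [2 * b]) @ [Suc (2 * b)]"
      using J le D unfolding evs_def ev_def by simp
    have P1: "wp (PUSH ''lo'') (\<lambda>s' _. singles pos 0 (evs b @ [ival s1 ''lb'']) s' \<and>
      (\<forall>k<ival s1 ''e''. rmem s' ''X'' k = rmem s1 ''X'' k \<and> imem s' ''L'' k = imem s1 ''L'' k)) s1 6"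
      by (rule wp_PUSH[OF q1]) (use p lb1 in auto)
    show "wp (PUSH ''lo'' ;; iinc ''lb'' ;; PUSH ''hi'') (\<lambda>st' _. singles pos 0 (evs (Suc b)) st') s1 (t1 - 1)"
    proof (rule wp_Seq, rule wp_call[OF P1], goal_cases)
      case 1
      show ?case using t1 by simp
    next
      case (2 s2 t2)
      let ?s3 = "s2\<lparr>imem := (imem s2)(''lb'' := (imem s2 ''lb'')(ieval (INat 0) s2 := ieval (IAdd (iv ''lb'') (INat 1)) s2))\<rparr>"
      have e2: "ival s2 ''lb'' = 2 * b" "rval s2 ''hi'' = rval s1 ''hi''" using 2(2) lb1 by (simp_all add: same_except_def)
      have q3: "singles pos 0 (evs b @ [2 * b]) ?s3"
        by (rule singles_cong[of _ _ _ s2]) (use 2(1) lb1 in auto)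
      have lb3: "ival ?s3 ''lb'' = Suc (2 * b)" using e2 by simp
      have P3: "wp (PUSH ''hi'') (\<lambda>s' _. singles pos 0 ((evs b @ [2 * b]) @ [ival ?s3 ''lb'']) s' \<and>
        (\<forall>k<ival ?s3 ''e''. rmem s' ''X'' k = rmem ?s3 ''X'' k \<and> imem s' ''L'' k = imem ?s3 ''L'' k)) ?s3 6"
        by (rule wp_PUSH[OF q3]) (use p lb3 e2 in auto)
      show ?case
      proof (rule wp_Seq, rule wp_IPut)
        show "1 \<le> t2" using 2(3) t1 by simp
        show "wp (PUSH ''hi'') (\<lambda>st' _. singles pos 0 (evs (Suc b)) st') ?s3 (t2 - 1)"
        proof (rule wp_call[OF P3], goal_cases)
          case 1
          show ?case using 2(3) t1 by simp
        next
          case (2 s4 t4)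
          then show ?case unfolding evs lb3 by blast
        qed
      qed
    qed
  qed
qed

lemma wp_DITEM:
  assumes I: "DI b st" and b: "b < gst G"
  shows "wp DITEM (\<lambda>st' _. DI (Suc b) st') st 55"
proof -
  have I': "cst st" "ival st ''b'' = b" "singles pos 0 (evs b) st" "cnts (Z b) st" "tabs b st"
    using I unfolding DI_def by auto
  have D0: "0 \<le> DD cx cy a b" by (rule DD_nonneg)
  show ?thesis unfolding DITEM_def
  proof (rule wp_Seq, rule wp_call[OF wp_VEC], simp, goal_cases)
    case (1 s1 t1)
    note fr1 = 1(2)
    have c1: "cst s1" by (rule cst_frame[OF I'(1) 1(2)]) auto
    have e1: "imem s1 = imem st" "rmem s1 ''X'' = rmem st ''X''" using 1(2) by (auto simp: same_except_def)
    have v1: "ivars \<epsilon> (ecx cx cy c s a b) (ecy cx cy c s a b) (DD cx cy a b) s1"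
      using 1(1) c1 I'(1,2) unfolding ivars_def cst_def inst_def by simp
    have t1: "50 \<le> t1" using 1 by simp
    show ?case
    proof (rule wp_Seq, rule wp_call[OF wp_DTAB], goal_cases)
      case 1
      show ?case using t1 by simp
    next
      case (2 s2 t2)
      have c2: "cst s2" by (rule cst_frame[OF c1 2(2)]) auto
      have e2: "rmem s2 = rmem s1" "imem s2 ''b'' = imem st ''b''" "imem s2 ''cnt'' = imem st ''cnt''"
        "imem s2 ''sat'' = imem st ''sat''" using 2(2) e1 by (auto simp: same_except_def)
      have v2: "ivars \<epsilon> (ecx cx cy c s a b) (ecy cx cy c s a b) (DD cx cy a b) s2"
        using v1 e2 unfolding ivars_def by simp
      have q2: "singles pos 0 (evs b) s2"
        by (rule singles_frame[OF singles_frame[OF I'(3) fr1] 2(2)]) auto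
      have cn2: "cnts (Z b) s2" by (rule cnts_same[OF cnts_same[OF I'(4) fr1] 2(2)]) auto
      have lb2: "ival s2 ''lb'' = 2 * b" "ival s2 ''g'' = gr b"
        using 2(1) e1 I'(1,2) unfolding cst_def inst_def by simp_all
      have tabs2: "tabs (Suc b) s2"
      proof -
        have k2: "imem s2 ''kd'' = (imem st ''kd'')(2 * b := 0, Suc (2 * b) := 1)"
          "imem s2 ''eg'' = (imem st ''eg'')(2 * b := gr b, Suc (2 * b) := gr b)"
          using 2(1) e1 I'(1,2) unfolding cst_def inst_def by simp_all
        show ?thesis unfolding tabs_def k2
        proof (intro allI impI)
          fix l assume "l < 2 * Suc b"
          then have "l < 2 * b \<or> l = 2 * b \<or> l = Suc (2 * b)" by arith
          then consider "l < 2 * b" | "l = 2 * b" | "l = Suc (2 * b)" by blast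
          then show "((imem st ''kd'')(2 * b := 0, Suc (2 * b) := 1)) l = l mod 2 \<and>
            ((imem st ''eg'')(2 * b := gr b, Suc (2 * b) := gr b)) l = gr (l div 2)"
            using I'(5) unfolding tabs_def by cases auto
        qed
      qed
      have t2: "42 \<le> t2" using 2(3) t1 by simp
      have fin: "wp (iinc ''b'') (\<lambda>st' _. DI (Suc b) st') s3 t3"
        if "cst s3" "ival s3 ''b'' = b" "singles pos 0 (evs (Suc b)) s3" "cnts (Z (Suc b)) s3" "tabs (Suc b) s3" "1 \<le> t3" for s3 t3
      proof (rule wp_IPut)
        let ?s4 = "s3\<lparr>imem := (imem s3)(''b'' := (imem s3 ''b'')(ieval (INat 0) s3 := ieval (IAdd (iv ''b'') (INat 1)) s3))\<rparr>"
        have "cst ?s4" by (rule cst_frame[OF that(1), of "[''b'']" "[]"]) (auto simp: same_except_def)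
        moreover have "singles pos 0 (evs (Suc b)) ?s4" by (rule singles_cong[OF that(3)]) auto
        moreover have "cnts (Z (Suc b)) ?s4" by (rule cnts_frame[OF that(4)]) auto
        moreover have "tabs (Suc b) ?s4" using that(5) unfolding tabs_def by simp
        ultimately show "DI (Suc b) ?s4" using that(2) unfolding DI_def by simp
      qed (rule that)
      show ?case
      proof (rule wp_Seq, rule wp_Cond)
        show "1 \<le> t2" using t2 by simp
      next
        assume "beval (RLess (RNat (INat 0)) (rv ''D'')) s2"
        then have D: "0 < DD cx cy a b" using v2 unfolding ivars_def by simp
        show "wp DPUSH (wp (iinc ''b'') (\<lambda>st' _. DI (Suc b) st')) s2 (t2 - 1)"
        proof (rule wp_call[OF wp_DPUSH[OF v2 D q2 lb2(1)]], goal_cases)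
          case 1
          show ?case using t2 by simp
        next
          case (2 s3 t3)
          have "Z (Suc b) = Z b" unfolding Z_def using D by (auto simp: less_Suc_eq)
          moreover have "cnts (Z b) s3" by (rule cnts_same[OF cn2 2(2)]) auto
          moreover have "cst s3" by (rule cst_frame[OF c2 2(2)]) auto
          moreover have "tabs (Suc b) s3" by (rule tabs_same[OF tabs2 2(2)]) auto
          moreover have "ival s3 ''b'' = b" using 2(2) e2 I'(2) by (simp add: same_except_def)
          moreover have "1 \<le> t3" using 2(3) t2 by simp
          ultimately show ?case using 2(1) by (intro fin) auto
        qed
      next
        assume "\<not> beval (RLess (RNat (INat 0)) (rv ''D'')) s2"
        then have D: "DD cx cy a b = 0" using v2 D0 unfolding ivars_def by simp
        have nb: "b \<notin> Z b" unfolding Z_def by simp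
        show "wp CINC (wp (iinc ''b'') (\<lambda>st' _. DI (Suc b) st')) s2 (t2 - 1)"
        proof (rule wp_call[OF wp_CINC[OF nb b cn2 lb2(2)]], goal_cases)
          case 1
          show ?case using t2 by simp
        next
          case (2 s3 t3)
          have "Z (Suc b) = insert b (Z b)" unfolding Z_def using D by (auto simp: less_Suc_eq)
          moreover have "evs (Suc b) = evs b" unfolding evs_def ev_def using D by simp
          moreover have "singles pos 0 (evs b) s3" by (rule singles_frame[OF q2 2(2)]) auto
          moreover have "cst s3" by (rule cst_frame[OF c2 2(2)]) auto
          moreover have "tabs (Suc b) s3" by (rule tabs_same[OF tabs2 2(2)]) auto
          moreover have "ival s3 ''b'' = b" using 2(2) e2 I'(2) by (simp add: same_except_def)
          moreover have "1 \<le> t3" using 2(3) t2 by simp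
          ultimately show ?case using 2(1) by (intro fin) auto
        qed
      qed
    qed
  qed
qed

lemma set_evs: "set (evs (gst G)) = (\<Union>b\<in>V. {2 * b, Suc (2 * b)})"
  unfolding evs_def ev_def V_def by auto

lemma distinct_evs: "distinct (evs b)"
proof (induction b)
  case (Suc b)
  have "l < 2 * b" if "l \<in> set (evs b)" for l
    using that unfolding evs_def ev_def by (auto split: if_splits)
  then have "2 * b \<notin> set (evs b)" "Suc (2 * b) \<notin> set (evs b)" by fastforce+
  then show ?case using Suc unfolding evs_def ev_def by auto
qed (simp add: evs_def)

lemma length_evs: "length (evs b) \<le> 2 * b"
  by (induction b) (auto simp: evs_def ev_def)

lemma J_V:
  assumes "b \<in> V"
  shows "J b = {pos (2 * b)..pos (Suc (2 * b))}" "-1 \<le> pos (2 * b)" "pos (2 * b) \<le> 1" "pos (2 * b) \<le> pos (Suc (2 * b))"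
proof -
  have D: "0 < DD cx cy a b" using assms DD_nonneg[of cx cy a b] unfolding V_def by auto
  have "finite (reach_cands \<epsilon> (ecx cx cy c s a b) (ecy cx cy c s a b) (DD cx cy a b))" unfolding reach_cands_def by simp
  then have fin: "finite (reach_cands \<epsilon> (ecx cx cy c s a b) (ecy cx cy c s a b) (DD cx cy a b) \<inter> J b)" (is "finite ?V") by simp
  obtain m where "m \<in> J b" using assms unfolding V_def by blast
  then have "?V \<noteq> {}" using reach_set_cand(1)[OF eps D] unfolding J_def by blast
  then have "ends ?V (Min ?V) (Max ?V)"
    unfolding ends_def by (intro conjI ballI insertI2 Min_in Max_in Min_le Max_ge fin)
  then have "J b = {Min ?V..Max ?V}" using reach_set_interval[OF eps D] unfolding J_def by blast
  then obtain lo hi where J: "J b = {lo..hi}" by blast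
  then have le: "lo \<le> hi" using assms unfolding V_def by auto
  show "J b = {pos (2 * b)..pos (Suc (2 * b))}" "pos (2 * b) \<le> pos (Suc (2 * b))" using J_interval[OF J le] J le by auto
  have "pos (2 * b) \<in> J b" using J_interval[OF J le] J le by auto
  then show "-1 \<le> pos (2 * b)" "pos (2 * b) \<le> 1" unfolding J_def reach_set_def by auto
qed

definition full :: "nat list \<Rightarrow> nat \<Rightarrow> bool" where
  "full es q \<longleftrightarrow> (\<forall>g<G. \<exists>b\<in>grp gst g. b \<in> Z (gst G) \<or> b \<in> opened V (set (take q es)))"

lemma feasible_scan:
  assumes sorted: "sorted_wrt (ele pos kd) es" and set: "set es = set (evs (gst G))"
    and kd: "\<And>b. b < gst G \<Longrightarrow> kd (2 * b) = 0 \<and> kd (Suc (2 * b)) = 1"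
  shows "feasible cx cy gst G \<epsilon> a c s \<longleftrightarrow> full es 0 \<or> (\<exists>q<length es. kd (es ! q) = 0 \<and> full es (Suc q))"
proof -
  have "b \<in> Z (gst G) \<or> b \<in> V \<and> m \<in> J b \<longleftrightarrow>
      DD cx cy a b = 0 \<or> reach \<epsilon> (ecx cx cy c s a b) (ecy cx cy c s a b) (DD cx cy a b) m"
    if "g < G" "b \<in> grp gst g" "-1 \<le> m" "m \<le> 1" for g b m
    using grp_label_less[OF gs that(1,2)] that(3,4) unfolding Z_def V_def J_def reach_set_def by auto
  then have "feasible cx cy gst G \<epsilon> a c s \<longleftrightarrow>
    (\<exists>m. -1 \<le> m \<and> m \<le> 1 \<and> (\<forall>g<G. \<exists>b\<in>grp gst g. b \<in> Z (gst G) \<or> b \<in> V \<and> m \<in> J b))"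
    unfolding feasible_def by (intro iff_exI conj_cong refl iff_allI imp_cong bex_cong) simp_all
  also have "\<dots> \<longleftrightarrow> full es 0 \<or> (\<exists>q<length es. kd (es ! q) = 0 \<and> full es (Suc q))"
    unfolding full_def
  proof (rule scan_correct[OF sorted])
    show "set es = (\<Union>b\<in>V. {2 * b, Suc (2 * b)})" unfolding set set_evs ..
    show "kd (2 * b) = 0 \<and> kd (Suc (2 * b)) = 1" if "b \<in> V" for b
      by (rule kd) (use that in \<open>simp add: V_def\<close>)
    show "J b = {pos (2 * b)..pos (Suc (2 * b))} \<and> - 1 \<le> pos (2 * b) \<and> pos (2 * b) \<le> 1" if "b \<in> V" for b
      by (intro conjI J_V[OF that])
  qed
  finally show ?thesis .
qed

end

definition DINIT :: com where
  "DINIT = iset ''sat'' (INat 0) ;; iset ''e'' (INat 0) ;; iset ''qh'' (INat 0) ;; iset ''qt'' (INat 0) ;; iset ''b'' (INat 0)"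

section \<open>Sweeping the events of one pivot in one chart\<close>

context dec_chart
begin

lemma wp_events:
  assumes "DI 0 st"
  shows "wp (While (ILess (iv ''b'') (iv ''M'')) DITEM) (\<lambda>st' _. DI (gst G) st') st (1 + 56 * gst G)"
proof (rule wp_While[where I = "\<lambda>st' t'. ival st' ''b'' \<le> gst G \<and> DI (ival st' ''b'') st' \<and> 1 + 56 * (gst G - ival st' ''b'') \<le> t'"], goal_cases)
  case 1
  then show ?case using assms unfolding DI_def by simp
next
  case (2 s1 t1)
  then have b: "ival s1 ''b'' < gst G" unfolding DI_def cst_def inst_def by auto
  show ?case
  proof
    show "1 \<le> t1" using 2 by linarith
    show "wp DITEM (\<lambda>st' t'. ival st' ''b'' \<le> gst G \<and> DI (ival st' ''b'') st' \<and> 1 + 56 * (gst G - ival st' ''b'') \<le> t') s1 (t1 - 1)"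
    proof (rule wp_call[OF wp_DITEM[OF _ b]], goal_cases)
      case 1
      show ?case using 2 by blast
    next
      case 2
      show ?case using \<open>_ \<and> _ \<and> 1 + 56 * (gst G - ival s1 ''b'') \<le> t1\<close> b by linarith
    next
      case (3 s2 t2)
      then have "ival s2 ''b'' = Suc (ival s1 ''b'')" unfolding DI_def by blast
      then show ?case using 3 2 b by auto
    qed
  qed
next
  case (3 s1 t1)
  then have "ival s1 ''b'' = gst G" unfolding DI_def cst_def inst_def by auto
  then show ?case using 3 by auto
qed

lemma wp_CLEAR:
  assumes "inst st"
  shows "wp CLEAR (\<lambda>st' _. \<forall>g<G. imem st' ''cnt'' g = 0) st (2 + 3 * G)"
  unfolding CLEAR_def
proof (rule wp_Seq, rule wp_IPut, simp, rule wp_While[where I = "\<lambda>st' t'. ival st' ''G'' = G \<and> ival st' ''g'' \<le> G \<and>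
    (\<forall>g<ival st' ''g''. imem st' ''cnt'' g = 0) \<and> 1 + 3 * (G - ival st' ''g'') \<le> t'"], goal_cases)
  case 1
  then show ?case using assms unfolding inst_def by simp
next
  case (2 s1 t1)
  then have "ival s1 ''g'' < G" "1 + 3 * Suc (G - Suc (ival s1 ''g'')) \<le> t1" by auto
  then show ?case using 2 by (intro conjI wp_straight) (auto simp: less_Suc_eq)
next
  case (3 s1 t1)
  then show ?case by auto
qed

text \<open>Every event changes the set of open centres by exactly one element: an opening adds a
  centre that was not open and a closing removes one that was. This is what makes counters, which
  know no sets, exact.\<close>

lemma opened_take:
  assumes sorted: "sorted_wrt (ele pos kd) es" and mset: "mset es = mset (evs (gst G))"
    and kd: "\<And>b. b < gst G \<Longrightarrow> kd (2 * b) = 0 \<and> kd (Suc (2 * b)) = 1"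
    and q: "q < length es" and l: "l = es ! q"
  shows "l div 2 \<in> V" "kd l = l mod 2"
    "kd l = 0 \<Longrightarrow> l div 2 \<notin> opened V (set (take q es)) \<and> opened V (set (take (Suc q) es)) = insert (l div 2) (opened V (set (take q es)))"
    "kd l \<noteq> 0 \<Longrightarrow> l div 2 \<in> opened V (set (take q es)) \<and> opened V (set (take (Suc q) es)) = opened V (set (take q es)) - {l div 2}"
proof -
  have set: "set es = (\<Union>b\<in>V. {2 * b, Suc (2 * b)})" using mset_eq_setD[OF mset] set_evs by simp
  have dist: "distinct es" using mset distinct_evs mset_eq_imp_distinct_iff by blast
  have "l \<in> set es" using q l by simp
  then obtain b where b: "b \<in> V" "l = 2 * b \<or> l = Suc (2 * b)" using set by blast
  have neq: "Suc (2 * x) \<noteq> 2 * y" "2 * y \<noteq> Suc (2 * x)" for x y :: nat by arith+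
  have bG: "b < gst G" using b(1) unfolding V_def by simp
  have lb: "l div 2 = b" using b(2) by auto
  show "l div 2 \<in> V" using lb b by simp
  show kdl: "kd l = l mod 2" using b(2) kd[OF bG] by auto
  \<comment> \<open>The two events of a centre appear in the right order even for an interval
    reduced to a point, because of the kinds.\<close>
  have idx: "i < j" if ij: "i < length es" "j < length es" "es ! i = 2 * b" "es ! j = Suc (2 * b)" for i j
  proof (rule ccontr)
    assume "\<not> i < j"
    moreover have "i \<noteq> j" using ij by auto
    ultimately have "ele pos kd (es ! j) (es ! i)" using sorted ij(1) by (simp add: sorted_wrt_iff_nth_less)
    then show False using ij J_V(4)[OF b(1)] kd[OF bG] unfolding ele_def by auto
  qed
  have tk: "set (take (Suc q) es) = insert l (set (take q es))" using q l by (simp add: take_Suc_conv_app_nth)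
  have notin: "l \<notin> set (take q es)"
    using dist q l by (auto simp: in_set_conv_nth nth_eq_iff_index_eq)
  show "l div 2 \<notin> opened V (set (take q es)) \<and> opened V (set (take (Suc q) es)) = insert (l div 2) (opened V (set (take q es)))"
    if "kd l = 0"
  proof -
    have l2: "l = 2 * b" using that b(2) kdl by auto
    have "Suc (2 * b) \<notin> set (take q es)"
    proof
      assume "Suc (2 * b) \<in> set (take q es)"
      then obtain j where "j < q" "es ! j = Suc (2 * b)" using q by (auto simp: in_set_conv_nth)
      then show False using idx[of q j] q l l2 by simp
    qed
    then have "opened V (insert l (set (take q es))) = insert b (opened V (set (take q es)))"
      unfolding opened_def using b(1) l2 by (auto simp: neq)
    then show ?thesis using notin l2 unfolding lb tk opened_def by simp
  qed
  show "l div 2 \<in> opened V (set (take q es)) \<and> opened V (set (take (Suc q) es)) = opened V (set (take q es)) - {l div 2}"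
    if "kd l \<noteq> 0"
  proof -
    have l2: "l = Suc (2 * b)" using that b(2) kdl by auto
    have "2 * b \<in> set es" using set b(1) by blast
    then obtain i where i: "i < length es" "es ! i = 2 * b" by (auto simp: in_set_conv_nth)
    have "i < q" using idx[of i q] i q l l2 by simp
    then have "2 * b \<in> set (take q es)" using i by (auto simp: in_set_conv_nth intro!: exI[of _ i])
    moreover have "opened V (insert l (set (take q es))) = opened V (set (take q es)) - {b}"
      unfolding opened_def using l2 by (auto simp: neq)
    ultimately show ?thesis using notin l2 b(1) unfolding lb tk opened_def by simp
  qed
qed

lemma wp_SCAN:
  assumes cst: "cst st" and cn: "cnts (Z (gst G)) st" and tabs: "tabs (gst G) st"
    and A: "mset A = mset (evs (gst G))"
    and R: "SRep pos (imem st ''kd'') A (rmem st ''X'') (imem st ''L'') (imem st ''bl'' (ival st ''qh'')) (imem st ''bh'' (ival st ''qh''))"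
    and full0: "full [] 0 \<Longrightarrow> ival st ''answer'' = 1"
  shows "wp SCAN (\<lambda>st' _. ival st' ''answer'' = (if feasible cx cy gst G \<epsilon> a c s then 1 else ival st ''answer'')) st
    (3 + 12 * (2 * gst G))"
proof -
  let ?lo = "imem st ''bl'' (ival st ''qh'')" and ?hi = "imem st ''bh'' (ival st ''qh'')"
  define kd where "kd = imem st ''kd''"
  define es where "es = map (imem st ''L'') [?lo..<?hi]"
  have es: "sorted_wrt (ele pos kd) es" "mset es = mset (evs (gst G))" "?lo < ?hi"
    using R A unfolding SRep_def es_def kd_def by (auto simp del: mset_map)
  have len: "length es = ?hi - ?lo" unfolding es_def by simp
  have "length es = length (evs (gst G))" using es(2) by (metis size_mset)
  then have len2: "?hi - ?lo \<le> 2 * gst G" using length_evs[of "gst G"] len by simp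
  have kd: "kd (2 * b) = 0 \<and> kd (Suc (2 * b)) = 1" if "b < gst G" for b
    using tabs that unfolding tabs_def kd_def by auto
  note op = opened_take[OF es(1,2) kd]
  \<comment> \<open>The answer after \<open>q\<close> events. A positive answer found for an earlier
    pivot or chart is preserved through the default branch.\<close>
  define Ans where "Ans q = (if full es 0 \<or> (\<exists>r<q. kd (es ! r) = 0 \<and> full es (Suc r)) then 1 else ival st ''answer'')" for q
  have feas: "Ans (length es) = (if feasible cx cy gst G \<epsilon> a c s then 1 else ival st ''answer'')"
    unfolding Ans_def using feasible_scan[OF es(1) mset_eq_setD[OF es(2)] kd] by simp
  define I where "I st' t' \<longleftrightarrow> (\<exists>q\<le>length es. ival st' ''p'' = ?lo + q \<and> ival st' ''pe'' = ?hi \<and> ival st' ''G'' = G \<and>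
     imem st' ''L'' = imem st ''L'' \<and> imem st' ''kd'' = imem st ''kd'' \<and> imem st' ''eg'' = imem st ''eg'' \<and>
     cnts (Z (gst G) \<union> opened V (set (take q es))) st' \<and> ival st' ''answer'' = Ans q \<and>
     1 + 12 * (length es - q) \<le> t')" for st' and t' :: nat
  have ZV: "Z (gst G) \<inter> V = {}" unfolding Z_def V_def by auto
  have step: "1 \<le> t1 \<and> wp SSTEP I s1 (t1 - 1)" if I1: "I s1 t1" and lt: "ival s1 ''p'' < ival s1 ''pe''" for s1 t1
  proof -
    obtain q where q: "q \<le> length es" "ival s1 ''p'' = ?lo + q" "ival s1 ''pe'' = ?hi" "ival s1 ''G'' = G"
     "imem s1 ''L'' = imem st ''L''" "imem s1 ''kd'' = imem st ''kd''" "imem s1 ''eg'' = imem st ''eg''"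
     "cnts (Z (gst G) \<union> opened V (set (take q es))) s1" "ival s1 ''answer'' = Ans q"
     "1 + 12 * (length es - q) \<le> t1" using I1 unfolding I_def by blast
    have ql: "q < length es" using lt q(2,3) len by simp
    have t: "13 + 12 * (length es - Suc q) \<le> t1" using q(10) ql by linarith
    define l where "l = es ! q"
    have Ll: "imem s1 ''L'' (ival s1 ''p'') = l" unfolding l_def es_def q(2,5) using ql len by simp
    note o = op[OF _ ql l_def]
    let ?b = "l div 2"
    have b: "?b < gst G" using o(1) unfolding V_def by simp
    have l2: "l < 2 * gst G" using b by linarith
    have eg: "imem s1 ''eg'' l = gr ?b" using tabs l2 unfolding tabs_def q(7) by simp
    have kdl: "imem s1 ''kd'' l = kd l" unfolding q(6) kd_def ..
    let ?s2 = "s1\<lparr>imem := (imem s1)(''lb'' := (imem s1 ''lb'')(0 := l), ''g'' := (imem s1 ''g'')(0 := gr ?b))\<rparr>"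
    have cn2: "cnts (Z (gst G) \<union> opened V (set (take q es))) ?s2" by (rule cnts_frame[OF q(8)]) auto
    have g2: "ival ?s2 ''g'' = gr ?b" by simp
    have AnsSuc: "Ans (Suc q) = (if kd l = 0 \<and> full es (Suc q) then 1 else Ans q)"
      unfolding Ans_def l_def by (auto simp: less_Suc_eq)
    have fin: "wp (iinc ''p'') I s3 t3"
      if "ival s3 ''p'' = ?lo + q" "ival s3 ''pe'' = ?hi" "ival s3 ''G'' = G"
        "imem s3 ''L'' = imem st ''L''" "imem s3 ''kd'' = imem st ''kd''" "imem s3 ''eg'' = imem st ''eg''"
        "cnts (Z (gst G) \<union> opened V (set (take (Suc q) es))) s3" "ival s3 ''answer'' = Ans (Suc q)"
        "2 + 12 * (length es - Suc q) \<le> t3" for s3 t3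
    proof (rule wp_IPut)
      let ?s4 = "s3\<lparr>imem := (imem s3)(''p'' := (imem s3 ''p'')(ieval (INat 0) s3 := ieval (IAdd (iv ''p'') (INat 1)) s3))\<rparr>"
      have "cnts (Z (gst G) \<union> opened V (set (take (Suc q) es))) ?s4" by (rule cnts_frame[OF that(7)]) auto
      then show "I ?s4 (t3 - 1)" using that ql unfolding I_def by (intro exI[of _ "Suc q"]) auto
      show "1 \<le> t3" using that(9) by simp
    qed
    have branch: "wp (Cond (ILess (IGet ''kd'' (iv ''lb'')) (INat 1))
        (CINC ;; Cond (ILess (iv ''sat'') (iv ''G'')) Skip (iset ''answer'' (INat 1))) CDEC) (wp (iinc ''p'') I) ?s2 (t1 - 1 - 1 - 1)"
    proof (rule wp_Cond)
      show "1 \<le> t1 - 1 - 1 - 1" using t by simp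
    next
      assume "beval (ILess (IGet ''kd'' (iv ''lb'')) (INat 1)) ?s2"
      then have k0: "kd l = 0" using kdl by simp
      have nin: "?b \<notin> Z (gst G) \<union> opened V (set (take q es))" using o(3)[OF _ k0] o(1) ZV by blast
      have ins: "insert ?b (Z (gst G) \<union> opened V (set (take q es))) = Z (gst G) \<union> opened V (set (take (Suc q) es))"
        using o(3)[OF _ k0] by blast
      show "wp (CINC ;; Cond (ILess (iv ''sat'') (iv ''G'')) Skip (iset ''answer'' (INat 1))) (wp (iinc ''p'') I) ?s2 (t1 - 1 - 1 - 1 - 1)"
      proof (rule wp_Seq, rule wp_call[OF wp_CINC[OF nin b cn2 g2]], goal_cases)
        case 1
        show ?case using t by simp
      next
        case (2 s3 t3)
        have f3: "ival s3 ''p'' = ?lo + q" "ival s3 ''pe'' = ?hi" "ival s3 ''G'' = G"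
          "imem s3 ''L'' = imem st ''L''" "imem s3 ''kd'' = imem st ''kd''" "imem s3 ''eg'' = imem st ''eg''"
          "ival s3 ''answer'' = Ans q"
          using 2(2) q by (simp_all add: same_except_def)
        have cn3: "cnts (Z (gst G) \<union> opened V (set (take (Suc q) es))) s3" using 2(1) unfolding ins .
        have fl: "\<not> ival s3 ''sat'' < G \<longleftrightarrow> full es (Suc q)" unfolding cnts_full[OF cn3] full_def by auto
        have t3: "5 + 12 * (length es - Suc q) \<le> t3" using 2(3) t by linarith
        show ?case
        proof (rule wp_Cond)
          show "1 \<le> t3" using t3 by simp
        next
          assume "beval (ILess (iv ''sat'') (iv ''G'')) s3"
          then have "Ans (Suc q) = Ans q" using fl f3(3) AnsSuc by simp
          then show "wp Skip (wp (iinc ''p'') I) s3 (t3 - 1)"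
            using f3 cn3 t3 by (intro wp_Skip fin) auto
        next
          assume "\<not> beval (ILess (iv ''sat'') (iv ''G'')) s3"
          then have "Ans (Suc q) = 1" using fl f3(3) AnsSuc k0 by simp
          moreover have "cnts (Z (gst G) \<union> opened V (set (take (Suc q) es)))
            (s3\<lparr>imem := (imem s3)(''answer'' := (imem s3 ''answer'')(ieval (INat 0) s3 := ieval (INat 1) s3))\<rparr>)"
            by (rule cnts_frame[OF cn3]) auto
          ultimately show "wp (iset ''answer'' (INat 1)) (wp (iinc ''p'') I) s3 (t3 - 1)"
            using f3 t3 by (intro wp_IPut fin) auto
        qed
      qed
    next
      assume "\<not> beval (ILess (IGet ''kd'' (iv ''lb'')) (INat 1)) ?s2"
      then have k1: "kd l \<noteq> 0" using kdl by simp
      have isin: "?b \<in> Z (gst G) \<union> opened V (set (take q es))" using o(4)[OF _ k1] by blast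
      have rem: "(Z (gst G) \<union> opened V (set (take q es))) - {?b} = Z (gst G) \<union> opened V (set (take (Suc q) es))"
        using o(4)[OF _ k1] o(1) ZV by blast
      show "wp CDEC (wp (iinc ''p'') I) ?s2 (t1 - 1 - 1 - 1 - 1)"
      proof (rule wp_call[OF wp_CDEC[OF isin b cn2 g2]], goal_cases)
        case 1
        show ?case using t by simp
      next
        case (2 s3 t3)
        have "cnts (Z (gst G) \<union> opened V (set (take (Suc q) es))) s3" using 2(1) unfolding rem .
        moreover have "Ans (Suc q) = Ans q" using AnsSuc k1 by simp
        moreover have "2 + 12 * (length es - Suc q) \<le> t3" using 2(3) t by linarith
        ultimately show ?case using 2(2) q by (intro fin) (auto simp: same_except_def)
      qed
    qed
    show ?thesis
    proof
      show "1 \<le> t1" using t by simp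
      show "wp SSTEP I s1 (t1 - 1)" unfolding SSTEP_def
      proof (rule wp_Seq, rule wp_IPut, goal_cases)
        case 1
        show ?case using t by simp
      next
        case 2
        show ?case
        proof (rule wp_Seq, rule wp_IPut, goal_cases)
          case 1
          show ?case using t by simp
        next
          case 2
          show ?case using branch Ll eg by (intro wp_Seq) simp
        qed
      qed
    qed
  qed
  have start: "cnts (Z (gst G) \<union> opened V (set (take 0 es))) st" using cn unfolding opened_def by simp
  have Ans0: "Ans 0 = ival st ''answer''"
    using full0 unfolding Ans_def full_def by auto
  show ?thesis unfolding SCAN_def
  proof (rule wp_Seq, rule wp_IPut, simp, rule wp_Seq, rule wp_IPut, simp, rule wp_While[where I = I], goal_cases)
    case 1
    show ?case unfolding I_def
    proof (rule exI[of _ 0], intro conjI, goal_cases)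
      case 8
      show ?case by (rule cnts_frame[OF start]) auto
    qed (use cst Ans0 len len2 in \<open>auto simp: cst_def inst_def\<close>)
  next
    case (2 s1 t1)
    then show ?case using step by auto
  next
    case (3 s1 t1)
    then obtain q where "q \<le> length es" "ival s1 ''p'' = ?lo + q" "ival s1 ''pe'' = ?hi" "ival s1 ''answer'' = Ans q" "1 \<le> t1"
      unfolding I_def by auto
    moreover then have "q = length es" using 3(2) len by simp
    ultimately show ?case using feas by simp
  qed
qed

end

lemma mods_SMERGE [simp]: "set (imods (QUEUE SMERGE)) = {''i'', ''ie'', ''j'', ''je'', ''o'', ''L'', ''e'', ''bl'', ''bh'', ''qh'', ''qt''}"
  "set (rmods (QUEUE SMERGE)) = {''X''}"
  unfolding QUEUE_def SMERGE_def SCOPY_def by auto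

lemma mods_SSTEP [simp]: "set (imods SCAN) = {''lb'', ''g'', ''sat'', ''cnt'', ''answer'', ''p'', ''pe''}" "rmods SCAN = []"
  "set (imods DITEM) = {''lb'', ''g'', ''kd'', ''eg'', ''L'', ''bl'', ''e'', ''bh'', ''qt'', ''sat'', ''cnt'', ''b''}"
  "set (rmods DITEM) = {''dx'', ''dy'', ''ex'', ''ey'', ''D'', ''lo'', ''hi'', ''z'', ''X''}"
  "set (imods CLEAR) = {''g'', ''cnt''}" "rmods CLEAR = []"
  unfolding SCAN_def SSTEP_def DITEM_def CLEAR_def by auto

context dec_chart
begin

lemma wp_DSORT:
  assumes cst: "cst st" and q: "singles pos 0 (evs (gst G)) st" and cn: "cnts (Z (gst G)) st" and tabs: "tabs (gst G) st"
    and full0: "full [] 0 \<Longrightarrow> ival st ''answer'' = 1" and ne: "evs (gst G) \<noteq> []"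
  shows "wp (QUEUE SMERGE ;; SCAN) (\<lambda>st' _. ival st' ''answer'' = (if feasible cx cy gst G \<epsilon> a c s then 1 else ival st ''answer'')) st
    (5 + 24 * gst G + 34 * gst G * Suc (cl (2 * gst G)))"
proof -
  let ?M = "gst G"
  define kd where "kd = imem st ''kd''"
  interpret queue_merge SMERGE "SRep pos kd" "\<lambda>s. imem s ''kd'' = kd" 7 1 "\<lambda>_. 1" UNIV "2 * ?M"
    by (rule SMERGE_queue_merge)
  let ?qs = "map (\<lambda>l. [l]) (evs ?M)"
  have conc: "concat (map (\<lambda>l. [l]) xs) = xs" for xs :: "nat list" by (induction xs) auto
  have holds: "holds ?qs st"
    using q unfolding holds_def singles_def SRep_def by (auto simp: less_Suc_eq)
  have w: "sum_list (map (\<lambda>_. 1) (concat ?qs)) = length (evs ?M)" unfolding conc by (simp add: sum_list_triv)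
  have le: "length (evs ?M) \<le> 2 * ?M" by (rule length_evs)
  have Q: "wp (QUEUE SMERGE) (\<lambda>s' _. \<exists>A. mset A = mset (concat ?qs) \<and> holds [A] s' \<and> extends st s') st
    (2 + (7 + 10) * 1 * sum_list (map (\<lambda>_. 1) (concat ?qs)) * Suc (cl (length ?qs)))"
    by (rule wp_QUEUE[OF holds]) (use ne le in \<open>simp_all add: kd_def conc sum_list_triv\<close>)
  have time: "2 + (7 + 10) * 1 * sum_list (map (\<lambda>_. 1) (concat ?qs)) * Suc (cl (length ?qs)) \<le> 2 + 34 * ?M * Suc (cl (2 * ?M))"
  proof -
    have "length (evs ?M) * Suc (cl (length (evs ?M))) \<le> (2 * ?M) * Suc (cl (2 * ?M))"
      using le cl_mono[OF le] by (intro mult_le_mono) auto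
    then show ?thesis unfolding w by simp
  qed
  show ?thesis
  proof (rule wp_Seq, rule wp_call[OF Q], goal_cases)
    case 1
    show ?case using time by linarith
  next
    case (2 s1 t1)
    then obtain A where A: "mset A = mset (evs ?M)" "holds [A] s1" unfolding conc by blast
    have cst1: "cst s1" by (rule cst_frame[OF cst 2(2)]) auto
    have cn1: "cnts (Z ?M) s1" by (rule cnts_same[OF cn 2(2)]) auto
    have tabs1: "tabs ?M s1" by (rule tabs_same[OF tabs 2(2)]) auto
    have k1: "imem s1 ''kd'' = kd" "imem s1 ''answer'' = imem st ''answer''"
      using same_exceptD(1)[OF 2(2)] unfolding kd_def by simp_all
    have R1: "SRep pos (imem s1 ''kd'') A (rmem s1 ''X'') (imem s1 ''L'') (imem s1 ''bl'' (ival s1 ''qh'')) (imem s1 ''bh'' (ival s1 ''qh''))"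
      using A(2) unfolding k1 holds_def by simp
    show ?case
    proof (rule wp_call[OF wp_SCAN[OF cst1 cn1 tabs1 A(1) R1]], goal_cases)
      case 1
      then show ?case using full0 k1 by simp
    next
      case 2
      show ?case using \<open>_ \<le> t1\<close> time by linarith
    next
      case (3 s2 t2)
      then show ?case using k1 by simp
    qed
  qed
qed

lemma wp_DBODY:
  assumes cst: "cst st"
  shows "wp DBODY (\<lambda>st' _. ival st' ''answer'' = (if feasible cx cy gst G \<epsilon> a c s then 1 else ival st ''answer'')) st
    (140 * gst G * Suc (cl (2 * gst G)))"
proof -
  let ?M = "gst G" and ?T = "5 + 24 * gst G + 34 * gst G * Suc (cl (2 * gst G))"
  have M: "1 \<le> ?M" "G \<le> ?M" using G_pos G_le by auto
  have "?M * 1 \<le> ?M * Suc (cl (2 * ?M))" by (intro mult_le_mono) auto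
  then have T: "?T + (2 + 3 * G) + 5 + (1 + 56 * ?M) + 10 \<le> 140 * ?M * Suc (cl (2 * ?M))" using M by (simp add: mult.assoc)
  have inst: "inst st" using cst unfolding cst_def by simp
  \<comment> \<open>The answer set before the sort is justified too: with a centre of every group at
    the pivot, any slope works.\<close>
  have feas0: "feasible cx cy gst G \<epsilon> a c s" if f0: "full [] 0"
    unfolding feasible_def
  proof (intro exI[of _ 0] conjI allI impI)
    fix g assume "g < G"
    then obtain b where "b \<in> grp gst g" "b \<in> Z ?M" using f0 unfolding full_def opened_def by auto
    then show "\<exists>b\<in>grp gst g. DD cx cy a b = 0 \<or> reach \<epsilon> (ecx cx cy c s a b) (ecy cx cy c s a b) (DD cx cy a b) 0"
      unfolding Z_def by blast
  qed auto
  show ?thesis unfolding DBODY_def DINIT_def[symmetric]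
  proof (rule wp_Seq, rule wp_call[OF wp_CLEAR[OF inst]], goal_cases)
    case 1
    show ?case using T by linarith
  next
    case (2 s1 t1)
    have cst1: "cst s1" by (rule cst_frame[OF cst 2(2)]) auto
    have t1: "?T + 5 + (1 + 56 * ?M) + 10 \<le> t1" using 2(3) T by linarith
    have a1: "ival s1 ''answer'' = ival st ''answer''" using same_exceptD(1)[OF 2(2)] by simp
    have cnt1: "\<forall>g<G. imem s1 ''cnt'' g = 0" using 2(1) .
    have init: "wp DINIT (\<lambda>s' _. ival s' ''sat'' = 0 \<and> ival s' ''e'' = 0 \<and> ival s' ''qh'' = 0 \<and> ival s' ''qt'' = 0 \<and> ival s' ''b'' = 0) s1 5"
      unfolding DINIT_def by (intro wp_straight; simp)
    show ?case
    proof (rule wp_Seq, rule wp_call[OF init], goal_cases)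
      case 1
      show ?case using t1 by linarith
    next
      case (2 s2 t2)
      have fr2: "same_except [''sat'', ''e'', ''qh'', ''qt'', ''b''] [] s1 s2" using 2(2) unfolding DINIT_def by simp
      have cst2: "cst s2" by (rule cst_frame[OF cst1 fr2]) auto
      have Z0: "Z 0 = {}" "evs 0 = []" unfolding Z_def evs_def by auto
      have "imem s2 ''cnt'' = imem s1 ''cnt''" using same_exceptD(1)[OF fr2] by simp
      then have "DI 0 s2"
        using cst2 2(1) cnt1 unfolding DI_def Z0 singles_def cnts_def tabs_def by simp
      note E = wp_events[OF this]
      have a2: "ival s2 ''answer'' = ival st ''answer''" using same_exceptD(1)[OF fr2] a1 by simp
      have t2: "?T + (1 + 56 * ?M) + 10 \<le> t2" using 2(3) t1 by linarith
      show ?case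
      proof (rule wp_Seq, rule wp_call[OF E], goal_cases)
        case 1
        show ?case using t2 by linarith
      next
        case (2 s3 t3)
        have s3: "cst s3" "singles pos 0 (evs ?M) s3" "cnts (Z ?M) s3" "tabs ?M s3" using 2(1) unfolding DI_def by auto
        have a3: "ival s3 ''answer'' = ival st ''answer''" using same_exceptD(1)[OF 2(2)] a2 by simp
        have t3: "?T + 10 \<le> t3" using 2(3) t2 by linarith
        have G3: "ival s3 ''G'' = G" using s3(1) unfolding cst_def inst_def by simp
        have fl: "\<not> ival s3 ''sat'' < G \<longleftrightarrow> full [] 0" unfolding cnts_full[OF s3(3)] full_def opened_def by simp
        have fin: "wp (Cond (ILess (INat 0) (iv ''qt'')) (QUEUE SMERGE ;; SCAN) Skip)
            (\<lambda>st' _. ival st' ''answer'' = (if feasible cx cy gst G \<epsilon> a c s then 1 else ival st ''answer'')) s4 t4"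
          if fr: "same_except [''answer''] [] s3 s4" and a4: "ival s4 ''answer'' = (if full [] 0 then 1 else ival st ''answer'')"
            and t4: "?T + 5 \<le> t4" for s4 t4
        proof -
          have s4: "cst s4" "singles pos 0 (evs ?M) s4" "cnts (Z ?M) s4" "tabs ?M s4"
            by (rule cst_frame[OF s3(1) fr]; simp) (rule singles_frame[OF s3(2) fr] cnts_same[OF s3(3) fr] tabs_same[OF s3(4) fr]; simp)+
          show ?thesis
          proof (rule wp_Cond)
            show "1 \<le> t4" using t4 by linarith
          next
            assume "beval (ILess (INat 0) (iv ''qt'')) s4"
            then have ne: "evs ?M \<noteq> []" using s4(2) unfolding singles_def by auto
            show "wp (QUEUE SMERGE ;; SCAN)
              (\<lambda>st' _. ival st' ''answer'' = (if feasible cx cy gst G \<epsilon> a c s then 1 else ival st ''answer'')) s4 (t4 - 1)"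
            proof (rule wp_call[OF wp_DSORT[OF s4 _ ne]], goal_cases)
              case 1
              then show ?case using a4 by simp
            next
              case 2
              show ?case using t4 by linarith
            next
              case (3 s5 t5)
              then show ?case using a4 feas0 by auto
            qed
          next
            assume "\<not> beval (ILess (INat 0) (iv ''qt'')) s4"
            then have e: "evs ?M = []" using s4(2) unfolding singles_def by auto
            have "feasible cx cy gst G \<epsilon> a c s \<longleftrightarrow> full [] 0"
              using feasible_scan[of "\<lambda>l. l mod 2" "[]"] e by simp
            then show "wp Skip (\<lambda>st' _. ival st' ''answer'' = (if feasible cx cy gst G \<epsilon> a c s then 1 else ival st ''answer'')) s4 (t4 - 1)"
              using a4 t4 by (intro wp_Skip) auto
          qed
        qed
        show ?case
        proof (rule wp_Seq, rule wp_Cond)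
          show "1 \<le> t3" using t3 by linarith
        next
          assume "beval (ILess (iv ''sat'') (iv ''G'')) s3"
          then have "\<not> full [] 0" using fl G3 by simp
          then show "wp Skip (wp (Cond (ILess (INat 0) (iv ''qt'')) (QUEUE SMERGE ;; SCAN) Skip)
              (\<lambda>st' _. ival st' ''answer'' = (if feasible cx cy gst G \<epsilon> a c s then 1 else ival st ''answer''))) s3 (t3 - 1)"
            using a3 t3 by (intro wp_Skip fin) (auto simp: same_except_def)
        next
          assume "\<not> beval (ILess (iv ''sat'') (iv ''G'')) s3"
          then have "full [] 0" using fl G3 by simp
          then show "wp (iset ''answer'' (INat 1)) (wp (Cond (ILess (INat 0) (iv ''qt'')) (QUEUE SMERGE ;; SCAN) Skip)
              (\<lambda>st' _. ival st' ''answer'' = (if feasible cx cy gst G \<epsilon> a c s then 1 else ival st ''answer''))) s3 (t3 - 1)"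
            using t3 by (intro wp_IPut fin) (auto simp: same_except_def)
        qed
      qed
    qed
  qed
qed

end

section \<open>The optimization algorithm\<close>

text \<open>\<open>V\<close> records a squared radius. The point lies at \<open>(1, m) / F\<close>
  from the pivot in the current chart, since \<open>F\<close> stands for
  \<open>1 / l\<close>.\<close>

definition UPDATE :: com where
  "UPDATE = rset ''V'' (rv ''v'') ;; iset ''have'' (INat 1) ;;
    rset ''bx'' (RAdd (RGet ''cx'' (iv ''a'')) (RDiv (RSub (rv ''rc'') (RMul (rv ''m'') (rv ''rs''))) (rv ''F''))) ;;
    rset ''by'' (RAdd (RGet ''cy'' (iv ''a'')) (RDiv (RAdd (rv ''rs'') (RMul (rv ''m'') (rv ''rc''))) (rv ''F'')))"

text \<open>A nonpositive \<open>F\<close> gives no point of the ray; the test also discards the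
  meaningless \<open>v\<close> obtained from a division by zero. The flag \<open>have\<close>
  replaces an infinite initial value.\<close>

definition TRY :: com where
  "TRY = rset ''F'' (RAdd (RGet ''AL'' (iv ''w'')) (RMul (RGet ''BE'' (iv ''w'')) (rv ''m''))) ;;
    rset ''v'' (RDiv (RAdd rone (RMul (rv ''m'') (rv ''m''))) (RMul (rv ''F'') (rv ''F''))) ;;
    Cond (BAnd (RLess (RNat (INat 0)) (rv ''F'')) (bor (ILess (iv ''have'') (INat 1)) (RLess (rv ''v'') (rv ''V'')))) UPDATE Skip"

text \<open>The three candidates of \<open>piece_optimum\<close>. For a line with intercept 0 the
  quotient is 0 by convention; this is harmless, as every slope of the closed piece yields a
  covering translation where the line is positive. The same holds for the right end 1 of the last
  piece, which is outside the half-open chart.\<close>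

definition OSTEP :: com where
  "OSTEP = (iset ''w'' (IGet ''L'' (iv ''p'')) ;; rset ''x'' (RGet ''X'' (iv ''p'')) ;;
      Cond (ILess (IAdd (iv ''p'') (INat 1)) (iv ''pe'')) (rset ''y'' (RGet ''X'' (IAdd (iv ''p'') (INat 1)))) (rset ''y'' rone) ;;
      rset ''m'' (rv ''x'')) ;;
    TRY ;; rset ''m'' (rv ''y'') ;; TRY ;; rset ''m'' (RDiv (RGet ''BE'' (iv ''w'')) (RGet ''AL'' (iv ''w''))) ;;
    Cond (BAnd (BNot (RLess (rv ''m'') (rv ''x''))) (BNot (RLess (rv ''y'') (rv ''m'')))) TRY Skip ;; iinc ''p''"

definition OSCAN :: com where
  "OSCAN = iset ''p'' (IGet ''bl'' (iv ''qh'')) ;; iset ''pe'' (IGet ''bh'' (iv ''qh'')) ;;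
    While (ILess (iv ''p'') (iv ''pe'')) OSTEP"

lemma mods_TRY [simp]: "imods TRY = [''have'']" "rmods TRY = [''F'', ''v'', ''V'', ''bx'', ''by'']"
  unfolding TRY_def UPDATE_def by simp_all

context discs
begin

definition sound :: "store \<Rightarrow> bool" where
  "sound st \<longleftrightarrow> (ival st ''have'' = 1 \<longrightarrow> covered cx cy gst G (rval st ''bx'') (rval st ''by'') (rval st ''V''))
     \<and> ival st ''have'' \<le> 1"

definition good :: "real \<Rightarrow> store \<Rightarrow> bool" where
  "good q st \<longleftrightarrow> ival st ''have'' = 1 \<and> rval st ''V'' \<le> q"

text \<open>Each update preserves all bounds already achieved, so \<open>explored\<close> survives
  the treatment of later pivots and charts.\<close>

definition better :: "store \<Rightarrow> store \<Rightarrow> bool" where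
  "better st st' \<longleftrightarrow> (\<forall>q. good q st \<longrightarrow> good q st')"

lemma better_trans: "better st st' \<Longrightarrow> better st' st'' \<Longrightarrow> better st st''"
  unfolding better_def by blast

lemma good_better: "good q st \<Longrightarrow> better st st' \<Longrightarrow> good q st'"
  unfolding better_def by blast

lemma best_frame:
  assumes "same_except is rs st st'" and "''have'' \<notin> set is" and "set rs \<inter> {''V'', ''bx'', ''by''} = {}"
  shows "sound st \<Longrightarrow> sound st'" "better st st'"
proof -
  have e: "imem st' ''have'' = imem st ''have''" "rmem st' ''V'' = rmem st ''V''" "rmem st' ''bx'' = rmem st ''bx''" "rmem st' ''by'' = rmem st ''by''"
    using assms unfolding same_except_def by blast+
  show "sound st \<Longrightarrow> sound st'" "better st st'" using e unfolding sound_def better_def good_def by simp_all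
qed

text \<open>All translations with pivot \<open>a\<close> in the chart \<open>(c, s)\<close> have been taken into account.\<close>

definition explored :: "nat \<Rightarrow> real \<Rightarrow> real \<Rightarrow> store \<Rightarrow> bool" where
  "explored a c s st \<longleftrightarrow>
     ((\<forall>g<G. \<exists>b\<in>grp gst g. DD cx cy a b = 0) \<longrightarrow> good 0 st) \<and>
     (\<forall>l m. 0 < l \<longrightarrow> -1 \<le> m \<longrightarrow> m < 1 \<longrightarrow>
       (\<forall>g<G. \<exists>b\<in>grp gst g. DD cx cy a b \<le> 2 * l * (ecx cx cy c s a b + m * ecy cx cy c s a b)) \<longrightarrow>
       good (l\<^sup>2 * (1 + m\<^sup>2)) st)"

lemma explored_better: "explored a c s st \<Longrightarrow> better st st' \<Longrightarrow> explored a c s st'"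
  unfolding explored_def using good_better by blast

text \<open>By \<open>covered_ray\<close> any covering translation has a pivot and, unless it
  coincides with it, a chart and a slope for which an at least equally good translation was
  considered.\<close>

lemma explored_optimal:
  assumes ex: "\<And>a c s. a < gst G \<Longrightarrow> (c, s) \<in> charts \<Longrightarrow> explored a c s st" and cov: "covered cx cy gst G x y q"
  shows "good q st"
proof -
  have "0 < G" by (rule G_pos)
  then obtain b where "sqd cx cy x y b \<le> q" using cov unfolding covered_def by blast
  moreover have "0 \<le> sqd cx cy x y b" unfolding sqd_def by simp
  ultimately have q: "0 \<le> q" by linarith
  from covered_ray[OF gs cov] obtain a where a: "a < gst G" and
    "(\<forall>g<G. \<exists>b\<in>grp gst g. DD cx cy a b = 0) \<or>
    (\<exists>(rc, rs)\<in>charts. \<exists>l>0. \<exists>m\<ge>-1. m < 1 \<and> l\<^sup>2 * (1 + m\<^sup>2) \<le> q \<and>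
      (\<forall>g<G. \<exists>b\<in>grp gst g. DD cx cy a b \<le> 2 * l * (ecx cx cy rc rs a b + m * ecy cx cy rc rs a b)))" by blast
  then show ?thesis
  proof (elim disjE)
    assume z: "\<forall>g<G. \<exists>b\<in>grp gst g. DD cx cy a b = 0"
    have "(1, 0) \<in> charts" unfolding charts_def by simp
    from ex[OF a this] z have "good 0 st" unfolding explored_def by blast
    then show ?thesis using q unfolding good_def by linarith
  next
    assume "\<exists>(rc, rs)\<in>charts. \<exists>l>0. \<exists>m\<ge>-1. m < 1 \<and> l\<^sup>2 * (1 + m\<^sup>2) \<le> q \<and>
      (\<forall>g<G. \<exists>b\<in>grp gst g. DD cx cy a b \<le> 2 * l * (ecx cx cy rc rs a b + m * ecy cx cy rc rs a b))"
    then obtain rc rs l m where r: "(rc, rs) \<in> charts" "0 < l" "-1 \<le> m" "m < 1" "l\<^sup>2 * (1 + m\<^sup>2) \<le> q"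
      "\<forall>g<G. \<exists>b\<in>grp gst g. DD cx cy a b \<le> 2 * l * (ecx cx cy rc rs a b + m * ecy cx cy rc rs a b)" by blast
    have "good (l\<^sup>2 * (1 + m\<^sup>2)) st" using ex[OF a r(1)] r(2-4,6) unfolding explored_def by blast
    then show ?thesis using r(5) unfolding good_def by linarith
  qed
qed

end

text \<open>Dividing \<open>DD \<le> 2 l (ecx + m ecy)\<close> by \<open>l * DD\<close> turns it
  into \<open>1 / l \<le> \<alpha> + \<beta> m\<close>, a line over the slopes.\<close>

locale opt_chart = discs +
  fixes a :: nat and c s :: real and \<alpha> \<beta> :: "nat \<Rightarrow> real"
  assumes chart: "(c, s) \<in> charts"
    and lines: "\<And>b. b < gst G \<Longrightarrow> \<alpha> b = 2 * ecx cx cy c s a b / DD cx cy a b \<and> \<beta> b = 2 * ecy cx cy c s a b / DD cx cy a b"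
begin

text \<open>A group with a centre at the pivot imposes no bound on \<open>1 / l\<close>, and the
  line of that centre would come from a division by zero. Such groups stay outside the
  envelope.\<close>

definition okg :: "nat \<Rightarrow> bool" where
  "okg g \<longleftrightarrow> (\<forall>b\<in>grp gst g. DD cx cy a b \<noteq> 0)"

definition gl :: "nat \<Rightarrow> nat list" where
  "gl k = filter okg [0..<k]"

definition T :: "nat \<Rightarrow> real \<Rightarrow> nat" where
  "T g m = (SOME p. isbest (-1) \<alpha> \<beta> m (grp gst g) p)"

lemma T_best: "g < G \<Longrightarrow> isbest (-1) \<alpha> \<beta> m (grp gst g) (T g m)"
  unfolding T_def using isbest_exists[of "grp gst g" "-1" \<alpha> \<beta> m] gs unfolding groups_def
  by (metis someI_ex atLeastLessThan_empty_iff finite_atLeastLessThan)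

abbreviation line :: "nat \<Rightarrow> real \<Rightarrow> real" where
  "line b m \<equiv> \<alpha> b + \<beta> b * m"

lemma line_eq:
  assumes "b < gst G"
  shows "line b m = 2 * (ecx cx cy c s a b + m * ecy cx cy c s a b) / DD cx cy a b"
  using lines[OF assms] by (simp add: add_divide_distrib distrib_left mult_ac)

text \<open>Just what makes the translation with \<open>1 / l\<close> equal to the value of line
  \<open>w\<close> a covering one. Unlike being the best label at \<open>m\<close>, this property
  passes to the limit and so extends to the right end of a piece.\<close>

definition wit :: "nat \<Rightarrow> real \<Rightarrow> bool" where
  "wit w m \<longleftrightarrow> (\<forall>g<G. \<exists>b\<in>grp gst g. DD cx cy a b = 0 \<or> line w m \<le> line b m)"

lemma wit_covered:
  assumes "wit w m" and F: "0 < line w m"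
  shows "covered cx cy gst G (cx a + (c - m * s) / line w m) (cy a + (s + m * c) / line w m)
    ((1 + m * m) / (line w m * line w m))"
proof -
  let ?l = "1 / line w m"
  have "\<exists>b\<in>grp gst g. sqd cx cy (cx a + ?l * (c - m * s)) (cy a + ?l * (s + m * c)) b \<le> ?l\<^sup>2 * (1 + m\<^sup>2)" if g: "g < G" for g
  proof -
    obtain b where b: "b \<in> grp gst g" "DD cx cy a b = 0 \<or> line w m \<le> line b m"
      using assms(1) g unfolding wit_def by blast
    let ?u = "ecx cx cy c s a b + m * ecy cx cy c s a b"
    have "DD cx cy a b \<le> 2 * ?l * ?u"
    proof (cases "DD cx cy a b = 0")
      case True
      then have "ecx cx cy c s a b = 0" "ecy cx cy c s a b = 0"
        using DD_chart[OF chart, of cx cy a b] by (auto simp: sum_power2_eq_zero_iff)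
      then show ?thesis using True by simp
    next
      case False
      then have D: "0 < DD cx cy a b" using DD_nonneg[of cx cy a b] by simp
      have "line w m \<le> 2 * ?u / DD cx cy a b" using b False line_eq[OF grp_label_less[OF gs g b(1)]] by auto
      then have "line w m * DD cx cy a b \<le> 2 * ?u" using D by (simp add: field_simps)
      then have "DD cx cy a b \<le> 2 * ?u / line w m" using F by (simp add: field_simps)
      then show ?thesis by simp
    qed
    then show ?thesis using b(1) sqd_ray[OF chart, of cx cy a ?l m b] by (intro bexI[of _ b]) auto
  qed
  moreover have "?l\<^sup>2 * (1 + m\<^sup>2) = (1 + m * m) / (line w m * line w m)"
    by (simp add: power2_eq_square)
  ultimately show ?thesis unfolding covered_def by simp
qed

text \<open>In the interior of the piece the top line of each group witnesses the bound;
  \<open>affine_bound_closed\<close> adds the right end.\<close>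

lemma envelope_wit:
  assumes R: "Rep 1 \<alpha> \<beta> T A X L lo hi" and A: "set A = set (gl G)" and k: "lo \<le> k" "k < hi"
    and m: "X k \<le> m" "m \<le> nxt X hi 1 k"
  shows "wit (L k) m"
proof -
  have p: "pseg (\<lambda>m. isbest 1 \<alpha> \<beta> m ((\<lambda>g. T g m) ` set A)) X L lo hi 1" using R unfolding Rep_def by simp
  have inner: "\<exists>b\<in>grp gst g. line (L k) m' \<le> line b m'" if g: "g < G" "okg g" and m': "X k \<le> m'" "m' < nxt X hi 1 k" for g m'
  proof -
    have best: "isbest 1 \<alpha> \<beta> m' ((\<lambda>g. T g m') ` set A) (L k)" using p k m' unfolding pseg_def by auto
    have "T g m' \<in> (\<lambda>g. T g m') ` set A" using g A unfolding gl_def by auto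
    then have "T g m' = L k \<or> kless 1 \<alpha> \<beta> m' (L k) (T g m')" using best unfolding isbest_def by blast
    then have "line (L k) m' \<le> line (T g m') m'" using kless_le[of 1 \<alpha> \<beta> m' "L k" "T g m'"] by auto
    moreover have "T g m' \<in> grp gst g" using T_best[OF g(1), of m'] unfolding isbest_def by blast
    ultimately show ?thesis by blast
  qed
  have lt: "X k < nxt X hi 1 k" using p k unfolding pseg_def by auto
  show ?thesis unfolding wit_def
  proof (intro allI impI)
    fix g assume g: "g < G"
    show "\<exists>b\<in>grp gst g. DD cx cy a b = 0 \<or> line (L k) m \<le> line b m"
    proof (cases "okg g")
      case False
      then show ?thesis unfolding okg_def by blast
    next
      case True
      have "\<exists>b\<in>grp gst g. line (L k) m \<le> line b m"
      proof (cases "m < nxt X hi 1 k")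
        case True
        then show ?thesis using inner[OF g \<open>okg g\<close> m(1)] by blast
      next
        case False
        then have mr: "m = nxt X hi 1 k" using m by simp
        show ?thesis unfolding mr
        proof (rule affine_bound_closed[OF _ _ _ lt])
          show "isCont (\<lambda>m. line b m) (nxt X hi 1 k)" for b by (intro continuous_intros)
          show "isCont (\<lambda>m. line (L k) m) (nxt X hi 1 k)" by (intro continuous_intros)
          show "\<exists>b\<in>grp gst g. line (L k) m' \<le> line b m'" if "X k \<le> m'" "m' < nxt X hi 1 k" for m'
            by (rule inner[OF g True that])
        qed simp
      qed
      then show ?thesis by blast
    qed
  qed
qed

definition cands :: "(nat \<Rightarrow> real) \<Rightarrow> (nat \<Rightarrow> nat) \<Rightarrow> nat \<Rightarrow> nat \<Rightarrow> real set" where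
  "cands X L hi k = {z. z = X k \<or> z = nxt X hi 1 k \<or> z = \<beta> (L k) / \<alpha> (L k) \<and> X k \<le> z \<and> z \<le> nxt X hi 1 k}"

text \<open>The constraints of the groups kept in the envelope give \<open>1 / l\<close> at most the
  value of the envelope at \<open>m\<close>, so the point on the envelope above \<open>m\<close> is
  no worse; from there \<open>piece_optimum\<close> descends to a candidate of the same
  piece.\<close>

lemma envelope_cands:
  assumes R: "Rep 1 \<alpha> \<beta> T A X L lo hi" and A: "set A = set (gl G)" and l: "0 < l" and m: "-1 \<le> m" "m < 1"
    and cov: "\<forall>g<G. \<exists>b\<in>grp gst g. DD cx cy a b \<le> 2 * l * (ecx cx cy c s a b + m * ecy cx cy c s a b)"
  shows "\<exists>k z. lo \<le> k \<and> k < hi \<and> z \<in> cands X L hi k \<and> 0 < line (L k) z \<and>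
    (1 + z * z) / (line (L k) z * line (L k) z) \<le> l\<^sup>2 * (1 + m\<^sup>2)"
proof -
  have p: "pseg (\<lambda>m. isbest 1 \<alpha> \<beta> m ((\<lambda>g. T g m) ` set A)) X L lo hi 1" and lo: "lo < hi" using R unfolding Rep_def by auto
  obtain k where k: "lo \<le> k" "k < hi" "X k \<le> m" "m < nxt X hi 1 k" using pseg_covers[OF p lo m] by blast
  have "isbest 1 \<alpha> \<beta> m ((\<lambda>g. T g m) ` set A) (L k)" using p k unfolding pseg_def by auto
  then obtain g where g: "g \<in> set A" "L k = T g m" unfolding isbest_def by blast
  then have gG: "g < G" "okg g" using A unfolding gl_def by auto
  obtain b where b: "b \<in> grp gst g" "DD cx cy a b \<le> 2 * l * (ecx cx cy c s a b + m * ecy cx cy c s a b)"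
    using cov gG by blast
  have D: "0 < DD cx cy a b" using gG(2) b(1) DD_nonneg[of cx cy a b] unfolding okg_def by (metis order_le_less)
  have "1 / l \<le> line b m"
    unfolding line_eq[OF grp_label_less[OF gs gG(1) b(1)]] using b(2) D l by (simp add: field_simps)
  moreover have "line b m \<le> line (L k) m"
  proof -
    have "b = L k \<or> kless (-1) \<alpha> \<beta> m (L k) b" using T_best[OF gG(1), of m] b(1) g(2) unfolding isbest_def by auto
    then show ?thesis using kless_le[of "-1" \<alpha> \<beta> m "L k" b] by auto
  qed
  ultimately have F: "1 / l \<le> line (L k) m" by linarith
  have Fp: "0 < line (L k) m" using F l by (smt (verit) divide_pos_pos)
  obtain z where z: "z = X k \<or> z = nxt X hi 1 k \<or> z = \<beta> (L k) / \<alpha> (L k) \<and> X k \<le> z \<and> z \<le> nxt X hi 1 k"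
    "0 < line (L k) z" "(1 + z * z) * (line (L k) m * line (L k) m) \<le> (1 + m * m) * (line (L k) z * line (L k) z)"
    using piece_optimum[OF k(3) less_imp_le[OF k(4)] Fp] by blast
  have "(1 + z * z) / (line (L k) z * line (L k) z) \<le> (1 + m * m) / (line (L k) m * line (L k) m)"
    using z(2,3) Fp by (simp add: divide_simps mult_ac)
  also have "\<dots> \<le> l\<^sup>2 * (1 + m\<^sup>2)"
  proof -
    have "1 \<le> l * line (L k) m" using F l by (simp add: field_simps)
    then have "1 * 1 \<le> (l * line (L k) m) * (l * line (L k) m)" by (intro mult_mono) auto
    then have "(1 + m * m) * 1 \<le> (1 + m * m) * ((l * line (L k) m) * (l * line (L k) m))"
      by (intro mult_left_mono) (auto simp: add_nonneg_nonneg)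
    also have "\<dots> = (l\<^sup>2 * (1 + m\<^sup>2)) * (line (L k) m * line (L k) m)" by (simp add: power2_eq_square mult_ac)
    finally show ?thesis using Fp by (simp add: pos_divide_le_eq)
  qed
  finally show ?thesis using k z(1,2) unfolding cands_def by blast
qed

definition est :: "store \<Rightarrow> bool" where
  "est st \<longleftrightarrow> inst st \<and> rval st ''rc'' = c \<and> rval st ''rs'' = s \<and> ival st ''a'' = a \<and>
     rmem st ''AL'' = \<alpha> \<and> rmem st ''BE'' = \<beta> \<and> (\<forall>b<gst G. rmem st ''DS'' b = DD cx cy a b)"

lemma est_frame:
  assumes "est st" and "same_except is rs st st'"
    and "set is \<inter> {''gst'', ''gr'', ''G'', ''M'', ''a''} = {}"
    and "set rs \<inter> {''cx'', ''cy'', ''rc'', ''rs'', ''AL'', ''BE'', ''DS''} = {}"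
  shows "est st'"
proof -
  have "rmem st' x = rmem st x" if "x \<in> {''cx'', ''cy'', ''rc'', ''rs'', ''AL'', ''BE'', ''DS''}" for x
    using assms(2,4) that unfolding same_except_def by blast
  moreover have "imem st' x = imem st x" if "x \<in> {''gst'', ''gr'', ''G'', ''M'', ''a''}" for x
    using assms(2,3) that unfolding same_except_def by blast
  ultimately show ?thesis using assms(1) unfolding est_def inst_def by simp
qed

lemma wp_TRY:
  fixes st :: store
  defines "z \<equiv> rval st ''m''" and "w \<equiv> ival st ''w''"
  assumes est: "est st" and sound: "sound st" and wit: "wit w z"
  shows "wp TRY (\<lambda>st' _. sound st' \<and> better st st' \<and>
    (0 < line w z \<longrightarrow> good ((1 + z * z) / (line w z * line w z)) st')) st 8"
proof -
  let ?F = "line w z" and ?v = "(1 + z * z) / (line w z * line w z)"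
  have e: "rmem st ''AL'' = \<alpha>" "rmem st ''BE'' = \<beta>" "rval st ''rc'' = c" "rval st ''rs'' = s" "ival st ''a'' = a"
    "rmem st ''cx'' = cx" "rmem st ''cy'' = cy" using est unfolding est_def inst_def by auto
  define s2 where "s2 = st\<lparr>rmem := (rmem st)(''F'' := (rmem st ''F'')(0 := ?F), ''v'' := (rmem st ''v'')(0 := ?v))\<rparr>"
  have s2: "sound s2" "better st s2" using sound unfolding s2_def sound_def better_def good_def by simp_all
  have U: "wp (Cond (BAnd (RLess (RNat (INat 0)) (rv ''F'')) (bor (ILess (iv ''have'') (INat 1)) (RLess (rv ''v'') (rv ''V'')))) UPDATE Skip)
    (\<lambda>st' _. sound st' \<and> better st st' \<and> (0 < ?F \<longrightarrow> good ?v st')) s2 6"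
  proof (rule wp_Cond)
    assume b: "beval (BAnd (RLess (RNat (INat 0)) (rv ''F'')) (bor (ILess (iv ''have'') (INat 1)) (RLess (rv ''v'') (rv ''V'')))) s2"
    then have F: "0 < ?F" and imp: "ival st ''have'' < 1 \<or> ?v < rval st ''V''" unfolding s2_def by auto
    have cov: "covered cx cy gst G (cx a + (c - z * s) / ?F) (cy a + (s + z * c) / ?F) ?v"
      by (rule wit_covered[OF wit F])
    have U: "wp UPDATE (\<lambda>st' _. rval st' ''V'' = ?v \<and> ival st' ''have'' = 1 \<and>
        rval st' ''bx'' = cx a + (c - z * s) / ?F \<and> rval st' ''by'' = cy a + (s + z * c) / ?F) s2 4"
      unfolding UPDATE_def by (intro wp_steps; simp add: s2_def e z_def w_def)
    show "wp UPDATE (\<lambda>st' _. sound st' \<and> better st st' \<and> (0 < ?F \<longrightarrow> good ?v st')) s2 (6 - 1)"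
    proof (rule wp_call[OF U], simp, elim conjE, goal_cases)
      case (1 s3 t3)
      have "sound s3" using 1 cov unfolding sound_def by simp
      moreover have "better st s3" using 1 imp unfolding better_def good_def by force
      moreover have "good ?v s3" using 1 unfolding good_def by simp
      ultimately show ?case by blast
    qed
  next
    assume b: "\<not> beval (BAnd (RLess (RNat (INat 0)) (rv ''F'')) (bor (ILess (iv ''have'') (INat 1)) (RLess (rv ''v'') (rv ''V'')))) s2"
    then have "0 < ?F \<longrightarrow> \<not> ival st ''have'' < 1 \<and> \<not> ?v < rval st ''V''" unfolding s2_def by auto
    moreover have "ival st ''have'' \<le> 1" using sound unfolding sound_def by simp
    ultimately have "0 < ?F \<longrightarrow> good ?v s2" unfolding good_def s2_def by auto
    then show "wp Skip (\<lambda>st' _. sound st' \<and> better st st' \<and> (0 < ?F \<longrightarrow> good ?v st')) s2 (6 - 1)"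
      using s2 by (intro wp_Skip) auto
  qed simp
  have "st\<lparr>rmem := (rmem st)(''F'' := (rmem st ''F'')(0 := reval (RAdd (RGet ''AL'' (iv ''w'')) (RMul (RGet ''BE'' (iv ''w'')) (rv ''m''))) st))\<rparr>
    = st\<lparr>rmem := (rmem st)(''F'' := (rmem st ''F'')(0 := ?F))\<rparr>" using e unfolding z_def w_def by simp
  then show ?thesis unfolding TRY_def
    by (intro wp_Seq wp_RPut) (use U in \<open>simp_all add: s2_def z_def w_def e\<close>)
qed

lemma wp_OSTEP:
  assumes est: "est st" and sound: "sound st" and R: "Rep 1 \<alpha> \<beta> T A (rmem st ''X'') (imem st ''L'') lo hi"
    and A: "set A = set (gl G)" and k: "lo \<le> ival st ''p''" "ival st ''p'' < hi" and hi: "ival st ''pe'' = hi"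
  shows "wp OSTEP (\<lambda>st' _. sound st' \<and> better st st' \<and> ival st' ''p'' = Suc (ival st ''p'') \<and>
    (\<forall>z\<in>cands (rmem st ''X'') (imem st ''L'') hi (ival st ''p''). 0 < line (imem st ''L'' (ival st ''p'')) z \<longrightarrow>
       good ((1 + z * z) / (line (imem st ''L'' (ival st ''p'')) z * line (imem st ''L'' (ival st ''p'')) z)) st')) st 36"
proof -
  let ?k = "ival st ''p''"
  define X L where "X = rmem st ''X''" and "L = imem st ''L''"
  define w where "w = L ?k"
  define y where "y = nxt X hi 1 ?k"
  note wt = envelope_wit[OF R A k, folded X_def L_def]
  have p: "X ?k < y" using R k unfolding Rep_def pseg_def y_def X_def L_def by auto
  define q where "q z st' \<longleftrightarrow> (0 < line w z \<longrightarrow> good ((1 + z * z) / (line w z * line w z)) st')" for z st'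
  have q_better: "q z st' \<Longrightarrow> better st' st'' \<Longrightarrow> q z st''" for z st' st'' unfolding q_def using good_better by blast
  define ok where "ok s' \<longleftrightarrow> est s' \<and> sound s' \<and> better st s' \<and> ival s' ''w'' = w \<and> rval s' ''x'' = X ?k \<and> rval s' ''y'' = y \<and>
    ival s' ''p'' = ?k" for s'
  have ok_m: "ok (s'\<lparr>rmem := (rmem s')(''m'' := f)\<rparr>)" if "ok s'" for s' f
  proof -
    have fr: "same_except [] [''m''] s' (s'\<lparr>rmem := (rmem s')(''m'' := f)\<rparr>)" unfolding same_except_def by simp
    show ?thesis using that best_frame[OF fr] est_frame[OF _ fr] better_trans unfolding ok_def by auto
  qed
  have q_m: "q z (s'\<lparr>rmem := (rmem s')(''m'' := f)\<rparr>) = q z s'" for z s' f unfolding q_def good_def by simp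
  have tri: "wp TRY Q s' t'" if o: "ok s'" and m: "X ?k \<le> rval s' ''m''" "rval s' ''m'' \<le> y" and t: "8 \<le> t'"
    and Q: "\<And>s'' t''. ok s'' \<Longrightarrow> q (rval s' ''m'') s'' \<Longrightarrow> better s' s'' \<Longrightarrow> t' - 8 \<le> t'' \<Longrightarrow> Q s'' t''" for s' t' Q
  proof -
    have "wit (ival s' ''w'') (rval s' ''m'')" using o wt[OF m(1)] m(2) unfolding ok_def w_def y_def by simp
    note W = wp_TRY[OF _ _ this]
    have o': "est s'" "sound s'" using o unfolding ok_def by auto
    show ?thesis
    proof (rule wp_call[OF W[OF o'] t], goal_cases)
      case (1 s2 t2)
      have "est s2" by (rule est_frame[OF o'(1) 1(2)]) auto
      moreover have "imem s2 ''w'' = imem s' ''w''" "rmem s2 ''x'' = rmem s' ''x''" "rmem s2 ''y'' = rmem s' ''y''" "imem s2 ''p'' = imem s' ''p''"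
        using same_exceptD[OF 1(2)] by simp_all
      ultimately have "ok s2" using 1(1) o better_trans unfolding ok_def by auto
      moreover have "q (rval s' ''m'') s2" using 1(1) o unfolding q_def ok_def by simp
      ultimately show ?case using Q 1 by blast
    qed
  qed
  have pre: "wp (iset ''w'' (IGet ''L'' (iv ''p'')) ;; rset ''x'' (RGet ''X'' (iv ''p'')) ;;
      Cond (ILess (IAdd (iv ''p'') (INat 1)) (iv ''pe'')) (rset ''y'' (RGet ''X'' (IAdd (iv ''p'') (INat 1)))) (rset ''y'' rone) ;;
      rset ''m'' (rv ''x'')) (\<lambda>s' _. ival s' ''w'' = w \<and> rval s' ''x'' = X ?k \<and> rval s' ''y'' = y \<and> rval s' ''m'' = X ?k) st 5"
    by (intro wp_steps wp_Cond; simp add: w_def y_def X_def L_def nxt_def hi)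
  have last: "wp (iinc ''p'') (\<lambda>st' _. sound st' \<and> better st st' \<and> ival st' ''p'' = Suc ?k \<and> (\<forall>z\<in>cands X L hi ?k. q z st')) s' t'"
    if "ok s'" "q (X ?k) s'" "q y s'" "X ?k \<le> \<beta> w / \<alpha> w \<and> \<beta> w / \<alpha> w \<le> y \<longrightarrow> q (\<beta> w / \<alpha> w) s'" "1 \<le> t'" for s' t'
  proof (rule wp_IPut[OF that(5)])
    let ?s = "s'\<lparr>imem := (imem s')(''p'' := (imem s' ''p'')(ieval (INat 0) s' := ieval (IAdd (iv ''p'') (INat 1)) s'))\<rparr>"
    have fr: "same_except [''p''] [] s' ?s" unfolding same_except_def by simp
    have b: "sound ?s" "better s' ?s" using best_frame[OF fr] that(1) unfolding ok_def by auto
    have "q z ?s" if "z \<in> cands X L hi ?k" for z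
    proof -
      have "q z s'" using that \<open>q (X ?k) s'\<close> \<open>q y s'\<close> \<open>_ \<longrightarrow> q (\<beta> w / \<alpha> w) s'\<close> unfolding cands_def w_def[symmetric] y_def[symmetric] by auto
      then show ?thesis by (rule q_better[OF _ b(2)])
    qed
    moreover have "better st ?s" using that(1) b(2) better_trans unfolding ok_def by blast
    moreover have "ival ?s ''p'' = Suc ?k" using that(1) unfolding ok_def by simp
    ultimately show "sound ?s \<and> better st ?s \<and> ival ?s ''p'' = Suc ?k \<and> (\<forall>z\<in>cands X L hi ?k. q z ?s)" using b(1) by blast
  qed
  have "wp OSTEP (\<lambda>st' _. sound st' \<and> better st st' \<and> ival st' ''p'' = Suc ?k \<and> (\<forall>z\<in>cands X L hi ?k. q z st')) st 36"
    unfolding OSTEP_def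
  proof (rule wp_Seq, rule wp_call[OF pre], simp, goal_cases)
    case (1 s1 t1)
    have fr: "same_except [''w''] [''x'', ''y'', ''y'', ''m''] st s1" using 1(2) by simp
    have ok1: "ok s1"
      using 1(1) est_frame[OF est fr] best_frame[OF fr] sound same_exceptD(1)[OF fr, of "''p''"] unfolding ok_def by simp
    show ?case
    proof (rule wp_Seq, rule tri[OF ok1], goal_cases)
      case 1
      show ?case using \<open>_ \<and> _ \<and> _ \<and> rval s1 ''m'' = X ?k\<close> by simp
    next
      case 2
      show ?case using \<open>_ \<and> _ \<and> _ \<and> rval s1 ''m'' = X ?k\<close> p by simp
    next
      case 3
      show ?case using 1(3) by simp
    next
      case (4 s2 t2)
      have q2: "q (X ?k) s2" using 4(2) 1(1) by simp
      let ?s3 = "s2\<lparr>rmem := (rmem s2)(''m'' := (rmem s2 ''m'')(ieval (INat 0) s2 := reval (rv ''y'') s2))\<rparr>"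
      have ok3: "ok ?s3" by (rule ok_m[OF 4(1)])
      have m3: "rval ?s3 ''m'' = y" using 4(1) unfolding ok_def by simp
      have t2: "23 \<le> t2" using 4(4) 1(3) by simp
      show ?case
      proof (rule wp_Seq, rule wp_RPut, goal_cases)
        case 1
        show ?case using t2 by simp
      next
        case 2
        show ?case
        proof (rule wp_Seq, rule tri[OF ok3], goal_cases)
          case 1
          show ?case unfolding m3 using p by simp
        next
          case 2
          show ?case unfolding m3 by simp
        next
          case 3
          show ?case using t2 by simp
        next
          case (4 s4 t4)
          have q4: "q (X ?k) s4" "q y s4" using 4(2,3) q2 q_better q_m unfolding m3 by blast+
          have e4: "rmem s4 ''AL'' = \<alpha>" "rmem s4 ''BE'' = \<beta>" "ival s4 ''w'' = w" "rval s4 ''x'' = X ?k" "rval s4 ''y'' = y"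
            using 4(1) unfolding ok_def est_def by auto
          let ?s5 = "s4\<lparr>rmem := (rmem s4)(''m'' := (rmem s4 ''m'')(ieval (INat 0) s4 :=
              reval (RDiv (RGet ''BE'' (iv ''w'')) (RGet ''AL'' (iv ''w''))) s4))\<rparr>"
          have ok5: "ok ?s5" by (rule ok_m[OF 4(1)])
          have m5: "rval ?s5 ''m'' = \<beta> w / \<alpha> w" using e4 by simp
          have q5: "q (X ?k) ?s5" "q y ?s5" using q4 q_m by blast+
          have b5: "beval (BAnd (BNot (RLess (rv ''m'') (rv ''x''))) (BNot (RLess (rv ''y'') (rv ''m'')))) ?s5
            \<longleftrightarrow> X ?k \<le> \<beta> w / \<alpha> w \<and> \<beta> w / \<alpha> w \<le> y" using e4 by (simp add: not_less)
          have t4: "14 \<le> t4" using 4(4) t2 by simp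
          show ?case
          proof (rule wp_Seq, rule wp_RPut, goal_cases)
            case 1
            show ?case using t4 by simp
          next
            case 2
            show ?case
            proof (rule wp_Seq, rule wp_Cond, goal_cases)
              case 1
              show ?case using t4 by simp
            next
              case 2
              show ?case
              proof (rule tri[OF ok5], goal_cases)
                case 1
                show ?case using 2 b5 unfolding m5 by blast
              next
                case 2
                show ?case using \<open>beval _ _\<close> b5 unfolding m5 by blast
              next
                case 3
                show ?case using t4 by simp
              next
                case (4 s6 t6)
                have "q (X ?k) s6" "q y s6" using q5 q_better 4(3) by blast+
                then show ?case using 4 t4 unfolding m5 by (intro last) auto
              qed
            next
              case 3
              then show ?case using ok5 q5 b5 t4 by (intro wp_Skip last) auto
            qed
          qed
        qed
      qed
    qed
  qed
  then show ?thesis unfolding q_def X_def L_def w_def by simp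
qed

end

definition GITEM :: com where
  "GITEM = Cond (RLess (RNat (INat 0)) (RGet ''DS'' (iv ''b''))) Skip (iset ''ok'' (INat 0)) ;; rset ''xm'' rneg1 ;;
    iset ''lb'' (iv ''b'') ;; PUSH ''xm'' ;; iinc ''b''"

definition GINIT :: com where
  "GINIT = iset ''ok'' (INat 1) ;; iset ''qh'' (INat 0) ;; iset ''qt'' (INat 0) ;; iset ''b'' (IGet ''gst'' (iv ''g''))"

text \<open>The queue restarts for every group while \<open>e\<close> keeps growing, so finished
  envelopes remain intact in the lower cells. Saving their bounds is all that is needed to queue
  them again on the second level.\<close>

definition GSAVE :: com where
  "GSAVE = IPut ''glo'' (iv ''ng'') (IGet ''bl'' (iv ''qh'')) ;; IPut ''ghi'' (iv ''ng'') (IGet ''bh'' (iv ''qh'')) ;; iinc ''ng''"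

definition OGRP :: com where
  "OGRP = GINIT ;; While (ILess (iv ''b'') (IGet ''gst'' (IAdd (iv ''g'') (INat 1)))) GITEM ;;
    Cond (ILess (INat 0) (iv ''ok'')) (QUEUE EMERGE ;; GSAVE) Skip ;; iinc ''g''"

definition LOADSTEP :: com where
  "LOADSTEP = IPut ''bl'' (iv ''qt'') (IGet ''glo'' (iv ''qt'')) ;; IPut ''bh'' (iv ''qt'') (IGet ''ghi'' (iv ''qt'')) ;; iinc ''qt''"

definition LINIT :: com where
  "LINIT = iset ''qh'' (INat 0) ;; iset ''qt'' (INat 0) ;; rset ''sg'' rone"

definition OPHASE2 :: com where
  "OPHASE2 = LINIT ;; While (ILess (iv ''qt'') (iv ''ng'')) LOADSTEP ;; QUEUE EMERGE ;; OSCAN"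

text \<open>Without a group in the envelope, every group has a centre at the pivot, and radius 0 is
  attained there.\<close>

definition ONEW :: com where
  "ONEW = rset ''V'' (RNat (INat 0)) ;; iset ''have'' (INat 1) ;; rset ''bx'' (RGet ''cx'' (iv ''a'')) ;;
    rset ''by'' (RGet ''cy'' (iv ''a''))"

definition OITEM :: com where
  "OITEM = VEC ;; RPut ''AL'' (iv ''b'') (RDiv (RMul (RNat (INat 2)) (rv ''ex'')) (rv ''D'')) ;;
    RPut ''BE'' (iv ''b'') (RDiv (RMul (RNat (INat 2)) (rv ''ey'')) (rv ''D'')) ;; RPut ''DS'' (iv ''b'') (rv ''D'') ;; iinc ''b''"

definition OINIT :: com where
  "OINIT = rset ''sg'' rneg1 ;; iset ''g'' (INat 0) ;; iset ''e'' (INat 0) ;; iset ''ng'' (INat 0)"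

definition OBODY :: com where
  "OBODY = iset ''b'' (INat 0) ;; While (ILess (iv ''b'') (iv ''M'')) OITEM ;; OINIT ;;
    While (ILess (iv ''g'') (iv ''G'')) OGRP ;; Cond (ILess (INat 0) (iv ''ng'')) OPHASE2 ONEW"

lemma mods_EMERGE [simp]:
  "set (imods (QUEUE EMERGE)) = {''i'', ''ie'', ''j'', ''je'', ''o'', ''L'', ''e'', ''bl'', ''bh'', ''qh'', ''qt'', ''w'', ''u'', ''tmp''}"
  "set (rmods (QUEUE EMERGE)) = {''x'', ''y1'', ''y2'', ''y'', ''X'', ''z''}"
  unfolding QUEUE_def EMERGE_def by auto

lemma mods_GROUP [simp]:
  "set (imods GITEM) = {''ok'', ''lb'', ''L'', ''bl'', ''e'', ''bh'', ''qt'', ''b''}" "set (rmods GITEM) = {''xm'', ''X''}"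
  "imods GINIT = [''ok'', ''qh'', ''qt'', ''b'']" "rmods GINIT = []"
  "imods GSAVE = [''glo'', ''ghi'', ''ng'']" "rmods GSAVE = []"
  unfolding GITEM_def GINIT_def GSAVE_def by auto

lemma mods_OGRP [simp]:
  "set (imods OGRP) = {''ok'', ''lb'', ''L'', ''bl'', ''e'', ''bh'', ''qt'', ''b'', ''qh'', ''glo'', ''ghi'', ''ng'', ''g'',
     ''i'', ''ie'', ''j'', ''je'', ''o'', ''w'', ''u'', ''tmp''}"
  "set (rmods OGRP) = {''xm'', ''X'', ''x'', ''y1'', ''y2'', ''y'', ''z''}"
  "set (imods OSCAN) = {''p'', ''pe'', ''w'', ''have''}"
  "set (rmods OSCAN) = {''x'', ''y'', ''m'', ''F'', ''v'', ''V'', ''bx'', ''by''}"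
  "imods LOADSTEP = [''bl'', ''bh'', ''qt'']" "rmods LOADSTEP = []"
  "imods LINIT = [''qh'', ''qt'']" "rmods LINIT = [''sg'']"
  "imods OINIT = [''g'', ''e'', ''ng'']" "rmods OINIT = [''sg'']"
  "imods OITEM = [''b'']" "rmods OITEM = [''dx'', ''dy'', ''ex'', ''ey'', ''D'', ''AL'', ''BE'', ''DS'']"
  unfolding OGRP_def OSCAN_def OSTEP_def LOADSTEP_def LINIT_def OINIT_def OITEM_def by auto

section \<open>Envelopes of the groups and their lower envelope\<close>

lemma pseg_imp:
  assumes "pseg F X L lo hi y" and "\<And>m w. F m w \<Longrightarrow> F' m w"
  shows "pseg F' X L lo hi y"
  using assms unfolding pseg_def by blast

lemma concat_singletons: "concat (map (\<lambda>l. [l]) xs) = xs"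
  by (induction xs) auto

context opt_chart
begin

lemma wp_OSCAN:
  assumes est: "est st" and sound: "sound st" and A: "set A = set (gl G)" and ne: "gl G \<noteq> []"
    and R: "Rep 1 \<alpha> \<beta> T A (rmem st ''X'') (imem st ''L'') (imem st ''bl'' (ival st ''qh'')) (imem st ''bh'' (ival st ''qh''))"
    and len: "imem st ''bh'' (ival st ''qh'') - imem st ''bl'' (ival st ''qh'') \<le> n"
  shows "wp OSCAN (\<lambda>st' _. sound st' \<and> better st st' \<and> explored a c s st') st (3 + 37 * n)"
proof -
  let ?lo = "imem st ''bl'' (ival st ''qh'')" and ?hi = "imem st ''bh'' (ival st ''qh'')"
  define X L where "X = rmem st ''X''" and "L = imem st ''L''"
  have R': "Rep 1 \<alpha> \<beta> T A X L ?lo ?hi" using R unfolding X_def L_def .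
  define I where "I st' t' \<longleftrightarrow> (?lo \<le> ival st' ''p'' \<and> ival st' ''p'' \<le> ?hi \<and> ival st' ''pe'' = ?hi \<and> est st' \<and> sound st' \<and> better st st' \<and>
      rmem st' ''X'' = X \<and> imem st' ''L'' = L \<and>
      (\<forall>k z. ?lo \<le> k \<longrightarrow> k < ival st' ''p'' \<longrightarrow> z \<in> cands X L ?hi k \<longrightarrow> 0 < line (L k) z \<longrightarrow>
        good ((1 + z * z) / (line (L k) z * line (L k) z)) st') \<and>
      1 + 37 * (?hi - ival st' ''p'') \<le> t')" for st' and t' :: nat
  have lt: "?lo < ?hi" using R unfolding Rep_def by simp
  have step: "1 \<le> t1 \<and> wp OSTEP I s1 (t1 - 1)" if I1: "I s1 t1" and p: "ival s1 ''p'' < ?hi" for s1 t1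
  proof -
    have s1: "?lo \<le> ival s1 ''p''" "ival s1 ''pe'' = ?hi" "est s1" "sound s1" "better st s1" "rmem s1 ''X'' = X" "imem s1 ''L'' = L"
      "1 + 37 * (?hi - ival s1 ''p'') \<le> t1"
      "\<And>k z. ?lo \<le> k \<Longrightarrow> k < ival s1 ''p'' \<Longrightarrow> z \<in> cands X L ?hi k \<Longrightarrow> 0 < line (L k) z \<Longrightarrow>
        good ((1 + z * z) / (line (L k) z * line (L k) z)) s1"
      using I1 unfolding I_def by blast+
    have R1: "Rep 1 \<alpha> \<beta> T A (rmem s1 ''X'') (imem s1 ''L'') ?lo ?hi" unfolding s1(6,7) by (rule R')
    have t: "38 + 37 * (?hi - Suc (ival s1 ''p'')) \<le> t1" using s1(8) p by linarith
    show ?thesis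
    proof
      show "1 \<le> t1" using t by simp
      show "wp OSTEP I s1 (t1 - 1)"
      proof (rule wp_call[OF wp_OSTEP[OF s1(3,4) R1 A s1(1) p s1(2)]], goal_cases)
        case 1
        show ?case using t by simp
      next
        case (2 s2 t2)
        have e2: "rmem s2 ''X'' = X" "imem s2 ''L'' = L" "ival s2 ''pe'' = ?hi"
          using same_exceptD[OF 2(2)] s1 unfolding OSTEP_def by simp_all
        have est2: "est s2" by (rule est_frame[OF s1(3) 2(2)]) (auto simp: OSTEP_def)
        have p2: "ival s2 ''p'' = Suc (ival s1 ''p'')" using 2(1) by blast
        have g2: "good ((1 + z * z) / (line (L k) z * line (L k) z)) s2"
          if "?lo \<le> k" "k < ival s2 ''p''" "z \<in> cands X L ?hi k" "0 < line (L k) z" for k z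
        proof (cases "k = ival s1 ''p''")
          case True
          then show ?thesis using 2(1) that unfolding s1(6,7) by blast
        next
          case False
          then have "k < ival s1 ''p''" using that(2) p2 by simp
          then show ?thesis using s1(9) that good_better 2(1) by blast
        qed
        have b2: "better st s2" using 2(1) s1(5) better_trans by blast
        have "1 + 37 * (?hi - ival s2 ''p'') \<le> t2" using 2(3) t p2 by linarith
        then show ?case using e2 est2 p2 g2 b2 2(1) s1(1) p unfolding I_def by auto
      qed
    qed
  qed
  have fin: "explored a c s st'" if I1: "I st' t'" and p: "\<not> ival st' ''p'' < ?hi" for st' t'
    unfolding explored_def
  proof (intro conjI impI allI)
    obtain g where "g \<in> set (gl G)" using ne by (cases "gl G") auto
    then have g: "g < G" "okg g" unfolding gl_def by auto
    assume "\<forall>g<G. \<exists>b\<in>grp gst g. DD cx cy a b = 0"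
    then show "good 0 st'" using g unfolding okg_def by blast
  next
    fix l m assume lm: "0 < l" "-1 \<le> m" "m < 1"
      and cov: "\<forall>g<G. \<exists>b\<in>grp gst g. DD cx cy a b \<le> 2 * l * (ecx cx cy c s a b + m * ecy cx cy c s a b)"
    obtain k z where kz: "?lo \<le> k" "k < ?hi" "z \<in> cands X L ?hi k" "0 < line (L k) z"
      "(1 + z * z) / (line (L k) z * line (L k) z) \<le> l\<^sup>2 * (1 + m\<^sup>2)"
      using envelope_cands[OF R' A lm cov] by blast
    have "good ((1 + z * z) / (line (L k) z * line (L k) z)) st'" using I1 p kz unfolding I_def by auto
    then show "good (l\<^sup>2 * (1 + m\<^sup>2)) st'" using kz(5) unfolding good_def by linarith
  qed
  show ?thesis unfolding OSCAN_def
  proof (rule wp_Seq, rule wp_IPut, simp, rule wp_Seq, rule wp_IPut, simp, rule wp_While[where I = I], goal_cases)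
    case 1
    let ?s = "st\<lparr>imem := (imem st)(''p'' := (imem st ''p'')(0 := ?lo), ''pe'' := (imem st ''pe'')(0 := ?hi))\<rparr>"
    have fr: "same_except [''p'', ''pe''] [] st ?s" unfolding same_except_def by simp
    have "est ?s" by (rule est_frame[OF est fr]) auto
    moreover have "sound ?s" "better st ?s" using best_frame[OF fr] sound by auto
    moreover have "37 * (?hi - ?lo) \<le> 37 * n" using len by simp
    ultimately have "I ?s (3 + 37 * n - 1 - 1)" using lt unfolding I_def X_def L_def by auto
    then show ?case by simp
  next
    case (2 s1 t1)
    then have "ival s1 ''p'' < ?hi" unfolding I_def by auto
    then show ?case using step[OF 2(1)] by blast
  next
    case (3 s1 t1)
    then have "\<not> ival s1 ''p'' < ?hi" "sound s1" "better st s1" "1 \<le> t1" unfolding I_def by auto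
    then show ?case using fin[OF 3(1)] by blast
  qed
qed

text \<open>For a single group, the lower envelope over groups is the upper envelope of its lines.
  The same cells can therefore be read with the other sign and serve as input of the second
  level.\<close>

lemma group_envelope:
  assumes R: "Rep (-1) \<alpha> \<beta> (\<lambda>b _. b) A X L lo hi" and A: "mset A = mset [gst g..<gst (Suc g)]" and g: "g < G"
  shows "Rep 1 \<alpha> \<beta> T [g] X L lo hi"
proof -
  have set: "set A = grp gst g" using mset_eq_setD[OF A] by simp
  have p: "pseg (\<lambda>m. isbest (-1) \<alpha> \<beta> m (grp gst g)) X L lo hi 1" "lo < hi" using R set unfolding Rep_def by simp_all
  have "pseg (\<lambda>m. isbest 1 \<alpha> \<beta> m ((\<lambda>g. T g m) ` set [g])) X L lo hi 1"
  proof (rule pseg_imp[OF p(1)])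
    fix m w assume "isbest (-1) \<alpha> \<beta> m (grp gst g) w"
    then have "w = T g m" using T_best[OF g] isbest_unique by blast
    then show "isbest 1 \<alpha> \<beta> m ((\<lambda>g. T g m) ` set [g]) w" unfolding isbest_def by simp
  qed
  then show ?thesis using p(2) unfolding Rep_def by simp
qed

definition PS :: "nat \<Rightarrow> store \<Rightarrow> bool" where
  "PS k st \<longleftrightarrow> est st \<and> rval st ''sg'' = -1 \<and> ival st ''g'' = k \<and> ival st ''ng'' = length (gl k) \<and>
     (\<forall>r<length (gl k). Rep 1 \<alpha> \<beta> T [gl k ! r] (rmem st ''X'') (imem st ''L'') (imem st ''glo'' r) (imem st ''ghi'' r) \<and>
        imem st ''ghi'' r \<le> ival st ''e'')"

text \<open>\<open>st0\<close> is the store before the group is treated: its \<open>e\<close> is the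
  first new cell, and everything below must survive. The flag \<open>ok\<close> stays positive until
  a centre at the pivot is met.\<close>

definition GJ :: "store \<Rightarrow> nat \<Rightarrow> store \<Rightarrow> bool" where
  "GJ st0 g st \<longleftrightarrow> est st \<and> ival st ''g'' = g \<and> singles (\<lambda>_. -1) (ival st0 ''e'') [gst g..<ival st ''b''] st \<and>
     gst g \<le> ival st ''b'' \<and> ival st ''b'' \<le> gst (Suc g) \<and>
     (0 < ival st ''ok'' \<longleftrightarrow> (\<forall>b\<in>{gst g..<ival st ''b''}. DD cx cy a b \<noteq> 0)) \<and>
     (\<forall>k<ival st0 ''e''. rmem st ''X'' k = rmem st0 ''X'' k \<and> imem st ''L'' k = imem st0 ''L'' k)"

lemma wp_GITEM:
  assumes J: "GJ st0 g st" and b: "ival st ''b'' < gst (Suc g)" and g: "g < G"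
  shows "wp GITEM (\<lambda>st' _. GJ st0 g st' \<and> ival st' ''b'' = Suc (ival st ''b'')) st 11"
proof -
  let ?b = "ival st ''b''"
  have J': "est st" "ival st ''g'' = g" "singles (\<lambda>_. -1) (ival st0 ''e'') [gst g..<?b] st" "gst g \<le> ?b"
    "0 < ival st ''ok'' \<longleftrightarrow> (\<forall>b\<in>{gst g..<?b}. DD cx cy a b \<noteq> 0)"
    "\<forall>k<ival st0 ''e''. rmem st ''X'' k = rmem st0 ''X'' k \<and> imem st ''L'' k = imem st0 ''L'' k"
    using J unfolding GJ_def by auto
  have bM: "?b < gst G" using grp_label_less[OF gs g, of ?b] J'(4) b by simp
  have DS: "rmem st ''DS'' ?b = DD cx cy a ?b" using J'(1) bM unfolding est_def by simp
  have nz: "0 < DD cx cy a ?b \<longleftrightarrow> DD cx cy a ?b \<noteq> 0" using DD_nonneg[of cx cy a ?b] by linarith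
  have "wp (Cond (RLess (RNat (INat 0)) (RGet ''DS'' (iv ''b''))) Skip (iset ''ok'' (INat 0)))
    (\<lambda>s' _. 0 < ival s' ''ok'' \<longleftrightarrow> 0 < ival st ''ok'' \<and> DD cx cy a ?b \<noteq> 0) st 2"
    by (intro wp_Cond wp_straight) (use DS nz in auto)
  note C = this
  show ?thesis unfolding GITEM_def
  proof (rule wp_Seq, rule wp_call[OF C], simp, goal_cases)
    case (1 s1 t1)
    have fr1: "same_except [''ok''] [] st s1" using 1(2) by simp
    let ?s2 = "s1\<lparr>rmem := (rmem s1)(''xm'' := (rmem s1 ''xm'')(0 := -1)), imem := (imem s1)(''lb'' := (imem s1 ''lb'')(0 := ?b))\<rparr>"
    have b1: "ival s1 ''b'' = ?b" using same_exceptD(1)[OF fr1] by simp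
    have fr2: "same_except [''ok'', ''lb''] [''xm''] st ?s2" using fr1 unfolding same_except_def by simp
    have q2: "singles (\<lambda>_. -1) (ival st0 ''e'') [gst g..<?b] ?s2" by (rule singles_frame[OF J'(3) fr2]) auto
    have P: "wp (PUSH ''xm'') (\<lambda>s' _. singles (\<lambda>_. -1) (ival st0 ''e'') ([gst g..<?b] @ [ival ?s2 ''lb'']) s' \<and>
      (\<forall>k<ival ?s2 ''e''. rmem s' ''X'' k = rmem ?s2 ''X'' k \<and> imem s' ''L'' k = imem ?s2 ''L'' k)) ?s2 6"
      by (rule wp_PUSH[OF q2]) auto
    have P2: "wp (PUSH ''xm'' ;; iinc ''b'') (\<lambda>st' _. GJ st0 g st' \<and> ival st' ''b'' = Suc ?b) ?s2 (t1 - 1 - 1)"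
    proof (rule wp_Seq, rule wp_call[OF P], goal_cases)
      case 1
      show ?case using \<open>11 - 2 \<le> t1\<close> by simp
    next
      case (2 s3 t3)
      let ?s4 = "s3\<lparr>imem := (imem s3)(''b'' := (imem s3 ''b'')(ieval (INat 0) s3 := ieval (IAdd (iv ''b'') (INat 1)) s3))\<rparr>"
      have fr3: "same_except (imods (PUSH ''xm'')) (rmods (PUSH ''xm'')) ?s2 s3" by (rule 2(2))
      have fr4: "same_except [''b''] [] s3 ?s4" unfolding same_except_def by simp
      have est4: "est ?s4"
        by (rule est_frame[OF est_frame[OF est_frame[OF J'(1) fr2] fr3] fr4]) auto
      have b3: "ival s3 ''b'' = ?b" "ival s3 ''ok'' = ival s1 ''ok''" "ival s3 ''g'' = g"
        using same_exceptD(1)[OF fr3] same_exceptD(1)[OF fr1] b1 J'(2) by simp_all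
      have "[gst g..<?b] @ [?b] = [gst g..<Suc ?b]" using J'(4) by simp
      then have "singles (\<lambda>_. -1) (ival st0 ''e'') [gst g..<Suc ?b] s3" using 2(1) by simp
      then have q4: "singles (\<lambda>_. -1) (ival st0 ''e'') [gst g..<Suc ?b] ?s4" by (rule singles_frame[OF _ fr4]) auto
      have e2: "ival st0 ''e'' \<le> ival ?s2 ''e''" using q2 unfolding singles_def by simp
      have keep: "\<forall>k<ival st0 ''e''. rmem s3 ''X'' k = rmem st0 ''X'' k \<and> imem s3 ''L'' k = imem st0 ''L'' k"
      proof (intro allI impI)
        fix k assume k: "k < ival st0 ''e''"
        have "rmem s3 ''X'' k = rmem ?s2 ''X'' k \<and> imem s3 ''L'' k = imem ?s2 ''L'' k" using 2(1) k e2 by auto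
        moreover have "rmem ?s2 ''X'' = rmem st ''X''" "imem ?s2 ''L'' = imem st ''L''" using same_exceptD[OF fr2] by simp_all
        ultimately show "rmem s3 ''X'' k = rmem st0 ''X'' k \<and> imem s3 ''L'' k = imem st0 ''L'' k" using J'(6) k by simp
      qed
      have ok: "0 < ival s3 ''ok'' \<longleftrightarrow> (\<forall>b\<in>{gst g..<Suc ?b}. DD cx cy a b \<noteq> 0)"
        using b3(2) 1(1) J'(4,5) by (auto simp: less_Suc_eq)
      have "GJ st0 g ?s4" unfolding GJ_def using est4 b3 q4 keep ok J'(4) b by simp
      then show ?case using 2(3) \<open>11 - 2 \<le> t1\<close> b3 by (intro wp_IPut) auto
    qed
    show ?case
      by (rule wp_Seq, rule wp_RPut, use 1 in simp, rule wp_Seq, rule wp_IPut, use 1 in simp) (use P2 b1 in simp)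
  qed
qed

lemma wp_GLOOP:
  assumes J: "GJ st0 g st" and b: "ival st ''b'' = gst g" and g: "g < G"
  shows "wp (While (ILess (iv ''b'') (IGet ''gst'' (IAdd (iv ''g'') (INat 1)))) GITEM)
    (\<lambda>st' _. GJ st0 g st' \<and> ival st' ''b'' = gst (Suc g)) st (1 + 12 * card (grp gst g))"
proof (rule wp_While[where I = "\<lambda>st' t'. GJ st0 g st' \<and> 1 + 12 * (gst (Suc g) - ival st' ''b'') \<le> t'"], goal_cases)
  case 1
  show ?case using J b by simp
next
  case (2 s1 t1)
  have "imem s1 ''gst'' = gst" "ival s1 ''g'' = g" using 2(1) unfolding GJ_def est_def inst_def by auto
  then have lt: "ival s1 ''b'' < gst (Suc g)" using 2(2) by simp
  have t: "13 + 12 * (gst (Suc g) - Suc (ival s1 ''b'')) \<le> t1" using 2(1) lt by linarith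
  show ?case
  proof
    show "1 \<le> t1" using t by simp
    show "wp GITEM (\<lambda>st' t'. GJ st0 g st' \<and> 1 + 12 * (gst (Suc g) - ival st' ''b'') \<le> t') s1 (t1 - 1)"
      by (rule wp_call[OF wp_GITEM[OF conjunct1[OF 2(1)] lt g]]) (use t in auto)
  qed
next
  case (3 s1 t1)
  have "imem s1 ''gst'' = gst" "ival s1 ''g'' = g" "ival s1 ''b'' \<le> gst (Suc g)"
    using 3(1) unfolding GJ_def est_def inst_def by auto
  then show ?case using 3 by auto
qed

lemma wp_GMERGE:
  assumes J: "GJ st0 g st" and b: "ival st ''b'' = gst (Suc g)" and g: "g < G" and sg: "rval st ''sg'' = -1"
  shows "wp (QUEUE EMERGE) (\<lambda>st' _. Rep 1 \<alpha> \<beta> T [g] (rmem st' ''X'') (imem st' ''L'') (imem st' ''bl'' (ival st' ''qh'')) (imem st' ''bh'' (ival st' ''qh'')) \<and>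
      imem st' ''bh'' (ival st' ''qh'') \<le> ival st' ''e'' \<and> ival st0 ''e'' \<le> ival st' ''e'' \<and>
      (\<forall>k<ival st0 ''e''. rmem st' ''X'' k = rmem st0 ''X'' k \<and> imem st' ''L'' k = imem st0 ''L'' k)) st
    (2 + 42 * card (grp gst g) * Suc (cl (card (grp gst g))))"
proof -
  let ?bs = "[gst g..<gst (Suc g)]"
  interpret queue_merge EMERGE "Rep (-1) \<alpha> \<beta> (\<lambda>b _. b)" "\<lambda>s. rval s ''sg'' = -1 \<and> rmem s ''AL'' = \<alpha> \<and> rmem s ''BE'' = \<beta>"
    32 1 "\<lambda>_. 1" UNIV "length ?bs"
    by (rule EMERGE_queue_merge) (use Rep_distinct_labels in \<open>auto simp: sum_list_triv\<close>)
  have q: "singles (\<lambda>_. -1) (ival st0 ''e'') ?bs st" using J b unfolding GJ_def by simp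
  have keep: "\<forall>k<ival st0 ''e''. rmem st ''X'' k = rmem st0 ''X'' k \<and> imem st ''L'' k = imem st0 ''L'' k"
    using J unfolding GJ_def by simp
  have e: "ival st0 ''e'' \<le> ival st ''e''" using q unfolding singles_def by simp
  have "gst g < gst (Suc g)" using gs g unfolding groups_def by blast
  then have ne: "?bs \<noteq> []" by simp
  have holds: "holds (map (\<lambda>l. [l]) ?bs) st"
    using q unfolding holds_def singles_def by (auto intro!: Rep_single)
  have ctx: "rval st ''sg'' = -1 \<and> rmem st ''AL'' = \<alpha> \<and> rmem st ''BE'' = \<beta>" using J sg unfolding GJ_def est_def by simp
  have Q: "wp (QUEUE EMERGE) (\<lambda>s' _. \<exists>A. mset A = mset (concat (map (\<lambda>l. [l]) ?bs)) \<and> holds [A] s' \<and> extends st s') st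
    (2 + (32 + 10) * 1 * sum_list (map (\<lambda>_. 1) (concat (map (\<lambda>l. [l]) ?bs))) * Suc (cl (length (map (\<lambda>l. [l]) ?bs))))"
    by (rule wp_QUEUE[OF holds _ ctx]) (use ne in \<open>simp_all add: concat_singletons sum_list_triv\<close>)
  show ?thesis
  proof (rule wp_call[OF Q], goal_cases)
    case 1
    show ?case by (simp add: concat_singletons sum_list_triv)
  next
    case (2 s1 t1)
    then obtain A where A: "mset A = mset ?bs" "holds [A] s1" "extends st s1" unfolding concat_singletons by blast
    have R: "Rep (-1) \<alpha> \<beta> (\<lambda>b _. b) A (rmem s1 ''X'') (imem s1 ''L'') (imem s1 ''bl'' (ival s1 ''qh'')) (imem s1 ''bh'' (ival s1 ''qh''))"
      "imem s1 ''bh'' (ival s1 ''qh'') \<le> ival s1 ''e''" using A(2) unfolding holds_def by auto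
    show ?case using group_envelope[OF R(1) A(1) g] R(2) A(3) keep e unfolding extends_def by auto
  qed
qed

lemma gl_Suc: "gl (Suc k) = gl k @ (if okg k then [k] else [])"
  unfolding gl_def by simp

lemma wp_OGRP:
  assumes P: "PS k st" and k: "k < G"
  shows "wp OGRP (\<lambda>st' _. PS (Suc k) st') st (70 * card (grp gst k) * Suc (cl (card (grp gst k))))"
proof -
  let ?w = "card (grp gst k)"
  let ?T = "2 + 42 * ?w * Suc (cl ?w)"
  have w: "1 \<le> ?w" using gs k unfolding groups_def by (simp add: Suc_leI)
  have "?w * 1 \<le> ?w * Suc (cl ?w)" by (intro mult_le_mono) auto
  then have T: "4 + (1 + 12 * ?w) + 1 + ?T + 3 + 1 \<le> 70 * ?w * Suc (cl ?w)" using w by (simp add: mult.assoc)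
  have P': "est st" "rval st ''sg'' = -1" "ival st ''g'' = k" "ival st ''ng'' = length (gl k)"
    "\<And>r. r < length (gl k) \<Longrightarrow> Rep 1 \<alpha> \<beta> T [gl k ! r] (rmem st ''X'') (imem st ''L'') (imem st ''glo'' r) (imem st ''ghi'' r)"
    "\<And>r. r < length (gl k) \<Longrightarrow> imem st ''ghi'' r \<le> ival st ''e''"
    using P unfolding PS_def by auto
  have gst: "imem st ''gst'' = gst" using P'(1) unfolding est_def inst_def by simp
  have init: "wp GINIT (\<lambda>s' _. ival s' ''ok'' = 1 \<and> ival s' ''qh'' = 0 \<and> ival s' ''qt'' = 0 \<and> ival s' ''b'' = gst k) st 4"
    unfolding GINIT_def by (intro wp_steps; simp add: gst P'(3))
  have keepR: "\<forall>r<length (gl k). Rep 1 \<alpha> \<beta> T [gl k ! r] (rmem s' ''X'') (imem s' ''L'') (imem st ''glo'' r) (imem st ''ghi'' r) \<and>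
      imem st ''ghi'' r \<le> ival s' ''e''"
    if e: "ival st ''e'' \<le> ival s' ''e''"
      and same: "\<forall>k<ival st ''e''. rmem s' ''X'' k = rmem st ''X'' k \<and> imem s' ''L'' k = imem st ''L'' k" for s'
  proof (intro allI impI)
    fix r assume r: "r < length (gl k)"
    have "Rep 1 \<alpha> \<beta> T [gl k ! r] (rmem s' ''X'') (imem s' ''L'') (imem st ''glo'' r) (imem st ''ghi'' r)
      = Rep 1 \<alpha> \<beta> T [gl k ! r] (rmem st ''X'') (imem st ''L'') (imem st ''glo'' r) (imem st ''ghi'' r)"
      by (rule Rep_cong) (use same P'(6)[OF r] in auto)
    then show "Rep 1 \<alpha> \<beta> T [gl k ! r] (rmem s' ''X'') (imem s' ''L'') (imem st ''glo'' r) (imem st ''ghi'' r) \<and>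
      imem st ''ghi'' r \<le> ival s' ''e''" using P'(5,6)[OF r] e by simp
  qed
  show ?thesis unfolding OGRP_def
  proof (rule wp_Seq, rule wp_call[OF init], goal_cases)
    case 1
    show ?case using T by linarith
  next
    case (2 s1 t1)
    note fr1 = 2(2)
    have e1: "imem s1 ''g'' = imem st ''g''" "imem s1 ''e'' = imem st ''e''" "imem s1 ''L'' = imem st ''L''"
      "rmem s1 ''X'' = rmem st ''X''" "rmem s1 ''sg'' = rmem st ''sg''"
      "imem s1 ''ng'' = imem st ''ng''" "imem s1 ''glo'' = imem st ''glo''" "imem s1 ''ghi'' = imem st ''ghi''"
      using same_exceptD[OF fr1] by simp_all
    have est1: "est s1" by (rule est_frame[OF P'(1) fr1]) auto
    have le: "gst k \<le> gst (Suc k)" using gs k unfolding groups_def by (simp add: less_imp_le)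
    have J1: "GJ st k s1" unfolding GJ_def singles_def using est1 2(1) e1 P'(3) le by simp
    have t1: "(1 + 12 * ?w) + 1 + ?T + 3 + 1 \<le> t1" using 2(3) T by linarith
    have b1: "ival s1 ''b'' = gst k" using 2(1) by simp
    show ?case
    proof (rule wp_Seq, rule wp_call[OF wp_GLOOP[OF J1 b1 k]], goal_cases)
      case 1
      show ?case using t1 by linarith
    next
      case (2 s2 t2)
      have fr2: "same_except (imods GITEM) (rmods GITEM) s1 s2" using 2(2) by simp
      have J2: "GJ st k s2" and b2: "ival s2 ''b'' = gst (Suc k)" using 2(1) by auto
      have e2: "rmem s2 ''sg'' = rmem st ''sg''" "imem s2 ''g'' = imem st ''g''"
        "imem s2 ''ng'' = imem st ''ng''" "imem s2 ''glo'' = imem st ''glo''" "imem s2 ''ghi'' = imem st ''ghi''"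
        using same_exceptD[OF fr2] e1 by simp_all
      have sg2: "rval s2 ''sg'' = -1" using e2 P'(2) by simp
      have ok: "0 < ival s2 ''ok'' \<longleftrightarrow> okg k" using J2 b2 unfolding GJ_def okg_def by auto
      have t2: "1 + ?T + 3 + 1 \<le> t2" using 2(3) t1 by linarith
      have est2: "est s2" using J2 unfolding GJ_def by simp
      have last: "wp (iinc ''g'') (\<lambda>st' _. PS (Suc k) st') s' t'"
        if "est s'" "rval s' ''sg'' = -1" "ival s' ''g'' = k" "ival s' ''ng'' = length (gl (Suc k))"
         "\<forall>r<length (gl (Suc k)). Rep 1 \<alpha> \<beta> T [gl (Suc k) ! r] (rmem s' ''X'') (imem s' ''L'') (imem s' ''glo'' r) (imem s' ''ghi'' r) \<and>
            imem s' ''ghi'' r \<le> ival s' ''e''" "1 \<le> t'" for s' t'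
      proof (rule wp_IPut[OF that(6)])
        let ?s = "s'\<lparr>imem := (imem s')(''g'' := (imem s' ''g'')(ieval (INat 0) s' := ieval (IAdd (iv ''g'') (INat 1)) s'))\<rparr>"
        have "same_except [''g''] [] s' ?s" unfolding same_except_def by simp
        then have "est ?s" by (rule est_frame[OF that(1)]) auto
        then show "PS (Suc k) ?s" using that unfolding PS_def by simp
      qed
      show ?case
      proof (rule wp_Seq, rule wp_Cond, goal_cases)
        case 1
        show ?case using t2 by linarith
      next
        case 2
        then have okk: "okg k" using ok by simp
        show ?case
        proof (rule wp_Seq, rule wp_call[OF wp_GMERGE[OF J2 b2 k sg2]], goal_cases)
          case 1
          show ?case using t2 by linarith
        next
          case (2 s3 t3)
          have est3: "est s3" by (rule est_frame[OF est2 2(2)]) auto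
          have e3: "rmem s3 ''sg'' = rmem st ''sg''" "imem s3 ''g'' = imem st ''g''"
            "imem s3 ''ng'' = imem st ''ng''" "imem s3 ''glo'' = imem st ''glo''" "imem s3 ''ghi'' = imem st ''ghi''"
            using same_exceptD[OF 2(2)] e2 by simp_all
          have t3: "4 \<le> t3" using 2(3) t2 by linarith
          have S: "wp GSAVE (\<lambda>s' _. imem s' ''glo'' = (imem s3 ''glo'')(ival s3 ''ng'' := imem s3 ''bl'' (ival s3 ''qh'')) \<and>
              imem s' ''ghi'' = (imem s3 ''ghi'')(ival s3 ''ng'' := imem s3 ''bh'' (ival s3 ''qh'')) \<and> ival s' ''ng'' = Suc (ival s3 ''ng'')) s3 3"
            unfolding GSAVE_def by (intro wp_steps; simp)
          show ?case
          proof (rule wp_call[OF S], goal_cases)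
            case 1
            show ?case using t3 by simp
          next
            case (2 s4 t4)
            note R3 = \<open>Rep 1 \<alpha> \<beta> T [k] _ _ _ _ \<and> _\<close>
            have est4: "est s4" by (rule est_frame[OF est3 2(2)]) auto
            have e4: "rmem s4 ''sg'' = rmem st ''sg''" "imem s4 ''g'' = imem st ''g''" "rmem s4 ''X'' = rmem s3 ''X''"
              "imem s4 ''L'' = imem s3 ''L''" "imem s4 ''e'' = imem s3 ''e''"
              using same_exceptD[OF 2(2)] e3 by simp_all
            have old: "\<forall>r<length (gl k). Rep 1 \<alpha> \<beta> T [gl k ! r] (rmem s4 ''X'') (imem s4 ''L'') (imem st ''glo'' r) (imem st ''ghi'' r) \<and>
              imem st ''ghi'' r \<le> ival s4 ''e''" by (rule keepR) (use R3 e4 in auto)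
            have "\<forall>r<length (gl (Suc k)). Rep 1 \<alpha> \<beta> T [gl (Suc k) ! r] (rmem s4 ''X'') (imem s4 ''L'') (imem s4 ''glo'' r) (imem s4 ''ghi'' r) \<and>
              imem s4 ''ghi'' r \<le> ival s4 ''e''"
            proof (intro allI impI)
              fix r assume "r < length (gl (Suc k))"
              then have "r < length (gl k) \<or> r = length (gl k)" using okk unfolding gl_Suc by auto
              then show "Rep 1 \<alpha> \<beta> T [gl (Suc k) ! r] (rmem s4 ''X'') (imem s4 ''L'') (imem s4 ''glo'' r) (imem s4 ''ghi'' r) \<and>
                imem s4 ''ghi'' r \<le> ival s4 ''e''"
                using old 2(1) R3 okk e3 e4 P'(4) unfolding gl_Suc by (auto simp: nth_append)
            qed
            then show ?case using est4 e4 e3 P'(2-4) 2(1) 2(3) t3 okk unfolding gl_Suc by (intro last[unfolded gl_Suc]) auto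
          qed
        qed
      next
        case 3
        then have nok: "\<not> okg k" using ok by simp
        have gl: "gl (Suc k) = gl k" using nok unfolding gl_Suc by simp
        have old: "\<forall>r<length (gl k). Rep 1 \<alpha> \<beta> T [gl k ! r] (rmem s2 ''X'') (imem s2 ''L'') (imem st ''glo'' r) (imem st ''ghi'' r) \<and>
              imem st ''ghi'' r \<le> ival s2 ''e''" by (rule keepR) (use J2 in \<open>auto simp: GJ_def singles_def\<close>)
        show ?case using t2 est2 sg2 e2 P'(3,4) old by (intro wp_Skip last) (auto simp: gl)
      qed
    qed
  qed
qed

end

context opt_chart
begin

definition wgt :: "nat \<Rightarrow> nat" where "wgt g = card (grp gst g)"

lemma sum_wgt: "k \<le> G \<Longrightarrow> (\<Sum>g<k. wgt g) = gst k"
proof (induction k)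
  case 0
  then show ?case using gs unfolding groups_def by simp
next
  case (Suc k)
  then have "gst k \<le> gst (Suc k)" using gs unfolding groups_def by (simp add: less_imp_le)
  then show ?case using Suc unfolding wgt_def by simp
qed

lemma sum_list_gl: "sum_list (map wgt (gl G)) \<le> gst G"
proof -
  have le: "sum_list (map wgt (filter okg xs)) \<le> sum_list (map wgt xs)" for xs by (induction xs) auto
  have "sum_list (map wgt [0..<G]) = (\<Sum>g<G. wgt g)" by (simp add: sum_list_distinct_conv_sum_set lessThan_atLeast0)
  then show ?thesis using sum_wgt[of G] le[of "[0..<G]"] unfolding gl_def by simp
qed

text \<open>Group sizes add up to \<open>gst G\<close> and each of their logarithms is at most
  \<open>cl (gst G)\<close>; all upper envelopes together cost no more than one sort.\<close>

lemma wp_GROUPS: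
  assumes P: "PS 0 st"
  shows "wp (While (ILess (iv ''g'') (iv ''G'')) OGRP) (\<lambda>st' _. PS G st') st (1 + 71 * gst G * Suc (cl (gst G)))"
proof -
  let ?S = "Suc (cl (gst G))"
  have wle: "k \<le> G \<Longrightarrow> gst k \<le> gst G" for k using groups_mono[OF gs] by simp
  define I where "I st' t' \<longleftrightarrow> ival st' ''g'' \<le> G \<and> PS (ival st' ''g'') st' \<and>
    1 + 71 * ((gst G - gst (ival st' ''g'')) * ?S) \<le> t'" for st' and t' :: nat
  show ?thesis
  proof (rule wp_While[where I = I], goal_cases)
    case 1
    have "ival st ''g'' = 0" using P unfolding PS_def by simp
    moreover have "gst 0 = 0" using gs unfolding groups_def by simp
    ultimately show ?case using P unfolding I_def by (simp add: mult.assoc)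
  next
    case (2 s1 t1)
    let ?k = "ival s1 ''g''"
    have s1: "PS ?k s1" "1 + 71 * ((gst G - gst ?k) * ?S) \<le> t1" using 2(1) unfolding I_def by auto
    have k: "?k < G" using 2(2) s1(1) unfolding PS_def est_def inst_def by simp
    have lt: "gst ?k < gst (Suc ?k)" using gs k unfolding groups_def by simp
    have le: "gst (Suc ?k) \<le> gst G" using wle k by simp
    have w: "card (grp gst ?k) = gst (Suc ?k) - gst ?k" "1 \<le> card (grp gst ?k)" using lt by auto
    have eq: "gst G - gst ?k = card (grp gst ?k) + (gst G - gst (Suc ?k))" using w lt le by simp
    have "cl (card (grp gst ?k)) \<le> cl (gst G)" using w le by (intro cl_mono) simp
    then have c: "card (grp gst ?k) * Suc (cl (card (grp gst ?k))) \<le> card (grp gst ?k) * ?S" by (intro mult_left_mono) auto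
    have c1: "1 * 1 \<le> card (grp gst ?k) * ?S" using w by (intro mult_le_mono) auto
    have t: "71 * (card (grp gst ?k) * ?S) + (1 + 71 * ((gst G - gst (Suc ?k)) * ?S)) \<le> t1"
      using s1(2) unfolding eq by (simp add: distrib_right distrib_left)
    have B: "70 * card (grp gst ?k) * Suc (cl (card (grp gst ?k))) \<le> 70 * (card (grp gst ?k) * ?S)"
      using mult_left_mono[OF c, of 70] by (simp only: mult.assoc)
    show ?case
    proof
      show "1 \<le> t1" using t by simp
      show "wp OGRP I s1 (t1 - 1)"
      proof (rule wp_call[OF wp_OGRP[OF s1(1) k]], goal_cases)
        case 1
        show ?case using t B c1 by linarith
      next
        case (2 s2 t2)
        have "ival s2 ''g'' = Suc ?k" using 2(1) unfolding PS_def by simp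
        moreover have "1 + 71 * ((gst G - gst (Suc ?k)) * ?S) \<le> t2" using 2(3) t B c1 by linarith
        ultimately show ?case using 2(1) k unfolding I_def by simp
      qed
    qed
  next
    case (3 s1 t1)
    then have "ival s1 ''g'' = G" unfolding I_def PS_def est_def inst_def by auto
    then show ?case using 3(1) unfolding I_def by auto
  qed
qed

lemma wp_LOAD:
  assumes ng: "ival st ''ng'' = length (gl G)" and z: "ival st ''qt'' = 0"
  shows "wp (While (ILess (iv ''qt'') (iv ''ng'')) LOADSTEP)
    (\<lambda>st' _. ival st' ''qt'' = length (gl G) \<and> (\<forall>r<length (gl G). imem st' ''bl'' r = imem st ''glo'' r \<and> imem st' ''bh'' r = imem st ''ghi'' r))
    st (1 + 4 * length (gl G))"
proof (rule wp_While[where I = "\<lambda>st' t'. ival st' ''qt'' \<le> length (gl G) \<and> ival st' ''ng'' = length (gl G) \<and>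
    imem st' ''glo'' = imem st ''glo'' \<and> imem st' ''ghi'' = imem st ''ghi'' \<and>
    (\<forall>r<ival st' ''qt''. imem st' ''bl'' r = imem st ''glo'' r \<and> imem st' ''bh'' r = imem st ''ghi'' r) \<and>
    1 + 4 * (length (gl G) - ival st' ''qt'') \<le> t'"], goal_cases)
  case 1
  show ?case using ng z by simp
next
  case (2 s1 t1)
  then have lt: "ival s1 ''qt'' < length (gl G)" by simp
  then have t: "5 + 4 * (length (gl G) - Suc (ival s1 ''qt'')) \<le> t1" using 2 by linarith
  have W: "wp LOADSTEP (\<lambda>s' _. imem s' ''bl'' = (imem s1 ''bl'')(ival s1 ''qt'' := imem s1 ''glo'' (ival s1 ''qt'')) \<and>
      imem s' ''bh'' = (imem s1 ''bh'')(ival s1 ''qt'' := imem s1 ''ghi'' (ival s1 ''qt'')) \<and> ival s' ''qt'' = Suc (ival s1 ''qt'')) s1 3"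
    unfolding LOADSTEP_def by (intro wp_steps; simp)
  show ?case
  proof
    show "1 \<le> t1" using t by simp
    show "wp LOADSTEP (\<lambda>st' t'. ival st' ''qt'' \<le> length (gl G) \<and> ival st' ''ng'' = length (gl G) \<and>
      imem st' ''glo'' = imem st ''glo'' \<and> imem st' ''ghi'' = imem st ''ghi'' \<and>
      (\<forall>r<ival st' ''qt''. imem st' ''bl'' r = imem st ''glo'' r \<and> imem st' ''bh'' r = imem st ''ghi'' r) \<and>
      1 + 4 * (length (gl G) - ival st' ''qt'') \<le> t') s1 (t1 - 1)"
    proof (rule wp_call[OF W], goal_cases)
      case 1
      show ?case using t by simp
    next
      case (2 s2 t2)
      have e: "imem s2 ''ng'' = imem s1 ''ng''" "imem s2 ''glo'' = imem s1 ''glo''" "imem s2 ''ghi'' = imem s1 ''ghi''"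
        using same_exceptD(1)[OF 2(2)] by simp_all
      have "1 + 4 * (length (gl G) - Suc (ival s1 ''qt'')) \<le> t2" using 2(3) t by linarith
      then show ?case using 2(1) e lt \<open>_ \<and> _ \<and> _ \<and> _ \<and> _ \<and> 1 + 4 * (length (gl G) - ival s1 ''qt'') \<le> t1\<close> by (auto simp: less_Suc_eq)
    qed
  qed
next
  case (3 s1 t1)
  then show ?case by auto
qed

text \<open>The dominant cost: one logarithm bounds the pieces per centre in a lower envelope of
  groups, the other counts the rounds of merging.\<close>

lemma wp_OPHASE2:
  assumes P: "PS G st" and sound: "sound st" and ne: "gl G \<noteq> []"
  shows "wp OPHASE2 (\<lambda>st' _. sound st' \<and> better st st' \<and> explored a c s st') st
    (100 * (gst G * (3 + 2 * cl (gst G)) * Suc (cl (gst G))))"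
proof -
  let ?M = "gst G" and ?\<Lambda> = "3 + 2 * cl (gst G)"
  define W where "W = sum_list (map wgt (gl G))"
  have WM: "W \<le> ?M" unfolding W_def by (rule sum_list_gl)
  have len: "length (gl G) \<le> ?M"
  proof -
    have "length (gl G) \<le> G" unfolding gl_def by (metis length_filter_le length_upt diff_zero)
    then show ?thesis using G_le by simp
  qed
  have M: "1 \<le> ?M" using len ne by (cases "gl G") auto
  \<comment> \<open>Restricting to groups from \<open>gl G\<close> makes their label sets disjoint,
    and the bound \<open>W\<close> on the weight allows one logarithm, that of \<open>gst G\<close>,
    for all intermediate envelopes.\<close>
  interpret queue_merge EMERGE "Rep 1 \<alpha> \<beta> T" "\<lambda>s. rval s ''sg'' = 1 \<and> rmem s ''AL'' = \<alpha> \<and> rmem s ''BE'' = \<beta>"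
    32 "?\<Lambda>" wgt "set (gl G)" W
  proof (rule EMERGE_queue_merge)
    fix A X L lo hi
    assume R: "Rep 1 \<alpha> \<beta> T A X L lo hi" and A: "set A \<subseteq> set (gl G)" and w: "sum_list (map wgt A) \<le> W"
    have AG: "g < G" if "g \<in> set A" for g using A that unfolding gl_def by auto
    have "hi - lo \<le> sum_list (map (\<lambda>g. card (grp gst g)) A) * (3 + 2 * cl ?M)"
    proof (rule Rep_envelope_length[OF R])
      show "isbest (-1) \<alpha> \<beta> m (grp gst g) (T g m)" if "g \<in> set A" for g m using T_best AG that by blast
      show "g = h" if "g \<in> set A" "h \<in> set A" "grp gst g \<inter> grp gst h \<noteq> {}" for g h
        using grp_unique[OF gs AG[OF that(1)] AG[OF that(2)]] that(3) by blast
      show "sum_list (map (\<lambda>g. card (grp gst g)) A) \<le> ?M" using w WM unfolding wgt_def by linarith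
    qed simp
    then show "hi - lo \<le> (3 + 2 * cl ?M) * sum_list (map wgt A)" unfolding wgt_def by (simp only: mult.commute)
  qed simp
  let ?qs = "map (\<lambda>l. [l]) (gl G)"
  define B where "B = ?M * ?\<Lambda> * Suc (cl ?M)"
  have bound: "?\<Lambda> * W * Suc (cl (length (gl G))) \<le> B"
  proof -
    have "?\<Lambda> * W \<le> ?M * ?\<Lambda>" using WM by (subst mult.commute) (intro mult_right_mono, auto)
    moreover have "Suc (cl (length (gl G))) \<le> Suc (cl ?M)" using cl_mono[OF len] by simp
    ultimately show ?thesis unfolding B_def by (rule mult_le_mono)
  qed
  have "?M * 1 * 1 \<le> B" unfolding B_def by (intro mult_le_mono) auto
  then have MB: "?M \<le> B" by simp
  have "?\<Lambda> * W * 1 \<le> ?\<Lambda> * W * Suc (cl (length (gl G)))" by (intro mult_le_mono) auto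
  then have LW: "?\<Lambda> * W \<le> B" using bound by linarith
  have T: "3 + (1 + 4 * length (gl G)) + (2 + 42 * (?\<Lambda> * W * Suc (cl (length (gl G))))) + (3 + 37 * (?\<Lambda> * W)) \<le> 100 * B"
    using bound MB LW len M by linarith
  have init: "wp LINIT (\<lambda>s' _. ival s' ''qh'' = 0 \<and> ival s' ''qt'' = 0 \<and> rval s' ''sg'' = 1) st 3"
    unfolding LINIT_def by (intro wp_steps; simp)
  have est: "est st" using P unfolding PS_def by simp
  show ?thesis unfolding OPHASE2_def B_def[symmetric]
  proof (rule wp_Seq, rule wp_call[OF init], goal_cases)
    case 1
    show ?case using T by linarith
  next
    case (2 s1 t1)
    have fr1: "same_except [''qh'', ''qt''] [''sg''] st s1" using 2(2) by simp
    have est1: "est s1" by (rule est_frame[OF est fr1]) auto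
    have b1: "sound s1" "better st s1" using best_frame[OF fr1] sound by auto
    have e1: "imem s1 ''g'' = imem st ''g''" "imem s1 ''ng'' = imem st ''ng''" "imem s1 ''glo'' = imem st ''glo''"
      "imem s1 ''ghi'' = imem st ''ghi''" "rmem s1 ''X'' = rmem st ''X''" "imem s1 ''L'' = imem st ''L''" "imem s1 ''e'' = imem st ''e''"
      using same_exceptD[OF fr1] by simp_all
    have t1: "(1 + 4 * length (gl G)) + (2 + 42 * (?\<Lambda> * W * Suc (cl (length (gl G))))) + (3 + 37 * (?\<Lambda> * W)) \<le> t1"
      using 2(3) T by linarith
    have ng1: "ival s1 ''ng'' = length (gl G)" using P e1 unfolding PS_def by simp
    have qt1: "ival s1 ''qt'' = 0" using 2(1) by simp
    note LD = wp_LOAD[OF ng1 qt1, unfolded e1]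
    show ?case
    proof (rule wp_Seq, rule wp_call[OF LD], goal_cases)
      case 1
      show ?case using t1 by linarith
    next
      case (2 s2 t2)
      have fr2: "same_except [''bl'', ''bh'', ''qt''] [] s1 s2" using 2(2) by simp
      have est2: "est s2" by (rule est_frame[OF est1 fr2]) auto
      have b2: "sound s2" "better st s2" using best_frame[OF fr2] b1 better_trans by auto
      have e2: "rmem s2 ''X'' = rmem st ''X''" "imem s2 ''L'' = imem st ''L''" "imem s2 ''e'' = imem st ''e''" "ival s2 ''qh'' = 0" "rval s2 ''sg'' = 1"
        using same_exceptD[OF fr2] e1 \<open>ival s1 ''qh'' = 0 \<and> _\<close> by simp_all
      have holds: "holds ?qs s2"
        using P 2(1) e2 unfolding holds_def PS_def by auto
      have ctx: "rval s2 ''sg'' = 1 \<and> rmem s2 ''AL'' = \<alpha> \<and> rmem s2 ''BE'' = \<beta>" using est2 e2 unfolding est_def by simp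
      have Q: "wp (QUEUE EMERGE) (\<lambda>s' _. \<exists>A. mset A = mset (concat ?qs) \<and> holds [A] s' \<and> extends s2 s') s2
        (2 + (32 + 10) * ?\<Lambda> * sum_list (map wgt (concat ?qs)) * Suc (cl (length ?qs)))"
        by (rule wp_QUEUE[OF holds _ ctx]) (use ne in \<open>simp_all add: concat_singletons W_def\<close>)
      have Qt: "2 + (32 + 10) * ?\<Lambda> * sum_list (map wgt (concat ?qs)) * Suc (cl (length ?qs)) = 2 + 42 * (?\<Lambda> * W * Suc (cl (length (gl G))))"
        unfolding concat_singletons W_def by (simp only: mult.assoc length_map) simp
      have t2: "(2 + 42 * (?\<Lambda> * W * Suc (cl (length (gl G))))) + (3 + 37 * (?\<Lambda> * W)) \<le> t2" using 2(3) t1 by linarith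
      show ?case
      proof (rule wp_Seq, rule wp_call[OF Q[unfolded Qt]], goal_cases)
        case 1
        show ?case using t2 by linarith
      next
        case (2 s3 t3)
        then obtain A where A: "mset A = mset (gl G)" "holds [A] s3" unfolding concat_singletons by blast
        have setA: "set A = set (gl G)" using mset_eq_setD[OF A(1)] .
        have est3: "est s3" by (rule est_frame[OF est2 2(2)]) auto
        have b3: "sound s3" "better st s3" using best_frame[OF 2(2)] b2 better_trans by auto
        have R: "Rep 1 \<alpha> \<beta> T A (rmem s3 ''X'') (imem s3 ''L'') (imem s3 ''bl'' (ival s3 ''qh'')) (imem s3 ''bh'' (ival s3 ''qh''))"
          using A(2) unfolding holds_def by auto
        have wA: "sum_list (map wgt A) = W" unfolding W_def using A(1) by (metis mset_map sum_mset_sum_list)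
        have size: "imem s3 ''bh'' (ival s3 ''qh'') - imem s3 ''bl'' (ival s3 ''qh'') \<le> ?\<Lambda> * W"
          using R_size[OF R] setA wA by simp
        show ?case
        proof (rule wp_call[OF wp_OSCAN[OF est3 b3(1) setA ne R size]], goal_cases)
          case 1
          show ?case using 2(3) t2 by linarith
        next
          case (2 s4 t4)
          then show ?case using b3(2) better_trans by blast
        qed
      qed
    qed
  qed
qed

lemma wp_ONEW:
  assumes est: "est st" and sound: "sound st" and e: "gl G = []"
  shows "wp ONEW (\<lambda>st' _. sound st' \<and> better st st' \<and> explored a c s st') st 4"
proof -
  have v: "wp ONEW (\<lambda>s' _. rval s' ''V'' = 0 \<and> ival s' ''have'' = 1 \<and> rval s' ''bx'' = cx a \<and> rval s' ''by'' = cy a) st 4"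
    using est unfolding ONEW_def est_def inst_def by (intro wp_steps; simp)
  have zero: "\<exists>b\<in>grp gst g. DD cx cy a b = 0" if "g < G" for g
  proof -
    have "\<not> okg g"
    proof
      assume "okg g"
      then have "g \<in> set (gl G)" using that unfolding gl_def by simp
      then show False using e by simp
    qed
    then show ?thesis unfolding okg_def by blast
  qed
  have cov: "covered cx cy gst G (cx a) (cy a) 0"
    unfolding covered_def sqd_self
  proof (intro allI impI)
    fix g assume "g < G"
    then obtain b where "b \<in> grp gst g" "DD cx cy a b = 0" using zero by blast
    then show "\<exists>b\<in>grp gst g. DD cx cy a b \<le> 0" by (intro bexI[of _ b]) simp_all
  qed
  \<comment> \<open>Overwriting an earlier record by 0 is an improvement: by \<open>sound\<close>
    the recorded value bounds a squared distance from above and cannot be negative.\<close>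
  have nonneg: "0 \<le> q" if "good q st" for q
  proof -
    have h: "ival st ''have'' = 1" "rval st ''V'' \<le> q" using that unfolding good_def by auto
    then have "covered cx cy gst G (rval st ''bx'') (rval st ''by'') (rval st ''V'')" using sound unfolding sound_def by simp
    then obtain b where "sqd cx cy (rval st ''bx'') (rval st ''by'') b \<le> rval st ''V''" using G_pos unfolding covered_def by blast
    moreover have "0 \<le> sqd cx cy (rval st ''bx'') (rval st ''by'') b" unfolding sqd_def by simp
    ultimately show ?thesis using h by linarith
  qed
  show ?thesis
  proof (rule wp_call[OF v], simp, goal_cases)
    case (1 s1 t1)
    have g: "good q s1" if "0 \<le> q" for q using 1 that unfolding good_def by simp
    have "sound s1" using 1 cov unfolding sound_def by simp
    moreover have "better st s1" unfolding better_def using nonneg g by blast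
    moreover have "explored a c s s1" unfolding explored_def using g by (auto simp: add_nonneg_nonneg)
    ultimately show ?case by blast
  qed
qed

end

section \<open>The complete search for one pivot in one chart\<close>

context discs
begin

lemma wp_LINES:
  fixes st :: store
  defines "a \<equiv> ival st ''a''" and "c \<equiv> rval st ''rc''" and "s \<equiv> rval st ''rs''"
  assumes inst: "inst st" and b0: "ival st ''b'' = 0"
  shows "wp (While (ILess (iv ''b'') (iv ''M'')) OITEM) (\<lambda>st' _. \<forall>b<gst G.
      rmem st' ''AL'' b = 2 * ecx cx cy c s a b / DD cx cy a b \<and> rmem st' ''BE'' b = 2 * ecy cx cy c s a b / DD cx cy a b \<and>
      rmem st' ''DS'' b = DD cx cy a b) st (1 + 10 * gst G)"
proof -
  define I where "I st' t' \<longleftrightarrow> inst st' \<and> ival st' ''a'' = a \<and> rval st' ''rc'' = c \<and> rval st' ''rs'' = s \<and> ival st' ''b'' \<le> gst G \<and>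
    (\<forall>b<ival st' ''b''. rmem st' ''AL'' b = 2 * ecx cx cy c s a b / DD cx cy a b \<and>
      rmem st' ''BE'' b = 2 * ecy cx cy c s a b / DD cx cy a b \<and> rmem st' ''DS'' b = DD cx cy a b) \<and>
    1 + 10 * (gst G - ival st' ''b'') \<le> t'" for st' and t' :: nat
  show ?thesis
  proof (rule wp_While[where I = I], goal_cases)
    case 1
    show ?case using inst b0 unfolding I_def a_def c_def s_def by simp
  next
    case (2 s1 t1)
    have s1: "inst s1" "ival s1 ''a'' = a" "rval s1 ''rc'' = c" "rval s1 ''rs'' = s"
      "\<forall>b<ival s1 ''b''. rmem s1 ''AL'' b = 2 * ecx cx cy c s a b / DD cx cy a b \<and>
        rmem s1 ''BE'' b = 2 * ecy cx cy c s a b / DD cx cy a b \<and> rmem s1 ''DS'' b = DD cx cy a b"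
      "1 + 10 * (gst G - ival s1 ''b'') \<le> t1" using 2(1) unfolding I_def by auto
    have lt: "ival s1 ''b'' < gst G" using 2(2) s1(1) unfolding inst_def by simp
    have t: "11 + 10 * (gst G - Suc (ival s1 ''b'')) \<le> t1" using s1(6) lt by linarith
    have "wp OITEM I s1 (t1 - 1)" unfolding OITEM_def
    proof (rule wp_Seq, rule wp_call[OF wp_VEC], goal_cases)
      case 1
      show ?case using t by simp
    next
      case (2 s2 t2)
      have e2: "rmem s2 ''AL'' = rmem s1 ''AL''" "rmem s2 ''BE'' = rmem s1 ''BE''" "rmem s2 ''DS'' = rmem s1 ''DS''"
        "rmem s2 ''rc'' = rmem s1 ''rc''" "rmem s2 ''rs'' = rmem s1 ''rs''" "imem s2 = imem s1"
        using same_exceptD[OF 2(2)] by (auto intro: ext)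
      have i2: "inst s2" by (rule inst_frame[OF s1(1) 2(2)]) auto
      have v2: "rval s2 ''ex'' = ecx cx cy c s a (ival s1 ''b'')" "rval s2 ''ey'' = ecy cx cy c s a (ival s1 ''b'')"
        "rval s2 ''D'' = DD cx cy a (ival s1 ''b'')" using 2(1) s1 unfolding inst_def by simp_all
      have U: "wp (RPut ''AL'' (iv ''b'') (RDiv (RMul (RNat (INat 2)) (rv ''ex'')) (rv ''D'')) ;;
        RPut ''BE'' (iv ''b'') (RDiv (RMul (RNat (INat 2)) (rv ''ey'')) (rv ''D'')) ;; RPut ''DS'' (iv ''b'') (rv ''D'') ;; iinc ''b'')
        (\<lambda>s' _. rmem s' ''AL'' = (rmem s1 ''AL'')(ival s1 ''b'' := 2 * ecx cx cy c s a (ival s1 ''b'') / DD cx cy a (ival s1 ''b'')) \<and>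
          rmem s' ''BE'' = (rmem s1 ''BE'')(ival s1 ''b'' := 2 * ecy cx cy c s a (ival s1 ''b'') / DD cx cy a (ival s1 ''b'')) \<and>
          rmem s' ''DS'' = (rmem s1 ''DS'')(ival s1 ''b'' := DD cx cy a (ival s1 ''b'')) \<and> ival s' ''b'' = Suc (ival s1 ''b'')) s2 4"
        by (intro wp_steps; simp add: v2 e2)
      show ?case
      proof (rule wp_call[OF U], goal_cases)
        case 1
        show ?case using t 2(3) by simp
      next
        case (2 s3 t3)
        have i3: "inst s3" by (rule inst_frame[OF i2 2(2)]) auto
        have e3: "imem s3 ''a'' = imem s1 ''a''" "rmem s3 ''rc'' = rmem s1 ''rc''" "rmem s3 ''rs'' = rmem s1 ''rs''"
          using same_exceptD[OF 2(2)] e2 by simp_all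
        have "1 + 10 * (gst G - Suc (ival s1 ''b'')) \<le> t3" using 2(3) \<open>t1 - 1 - 5 \<le> t2\<close> t by linarith
        then show ?case using i3 e3 s1(2-5) 2(1) lt unfolding I_def by (auto simp: less_Suc_eq)
      qed
    qed
    then show ?case using t by simp
  next
    case (3 s1 t1)
    then have "ival s1 ''b'' = gst G" unfolding I_def inst_def by auto
    then show ?case using 3(1) unfolding I_def by auto
  qed
qed

lemma wp_OBODY:
  fixes st :: store
  defines "a \<equiv> ival st ''a''" and "c \<equiv> rval st ''rc''" and "s \<equiv> rval st ''rs''"
  assumes inst: "inst st" and chart: "(c, s) \<in> charts" and a: "a < gst G" and sound: "sound st"
  shows "wp OBODY (\<lambda>st' _. sound st' \<and> better st st' \<and> explored a c s st') st
    (200 * (gst G * (3 + 2 * cl (gst G)) * Suc (cl (gst G))))"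
proof -
  let ?M = "gst G"
  define B where "B = ?M * (3 + 2 * cl ?M) * Suc (cl ?M)"
  have M: "1 \<le> ?M" using a by simp
  have "?M * 1 * 1 \<le> B" unfolding B_def by (intro mult_le_mono) auto
  moreover have "?M * 1 * Suc (cl ?M) \<le> B" unfolding B_def by (intro mult_le_mono) auto
  ultimately have MB: "?M \<le> B" "?M * Suc (cl ?M) \<le> B" by simp_all
  have T: "1 + (1 + 10 * ?M) + 4 + (1 + 71 * (?M * Suc (cl ?M))) + (1 + 100 * B) \<le> 200 * B" using MB M by linarith
  let ?s0 = "st\<lparr>imem := (imem st)(''b'' := (imem st ''b'')(ieval (INat 0) st := ieval (INat 0) st))\<rparr>"
  have fr0: "same_except [''b''] [] st ?s0" unfolding same_except_def by simp
  have i0: "inst ?s0" by (rule inst_frame[OF inst fr0]) auto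
  have b0: "sound ?s0" "better st ?s0" using best_frame[OF fr0] sound by auto
  have LN: "wp (While (ILess (iv ''b'') (iv ''M'')) OITEM) (\<lambda>st' _. \<forall>b<gst G.
      rmem st' ''AL'' b = 2 * ecx cx cy c s a b / DD cx cy a b \<and> rmem st' ''BE'' b = 2 * ecy cx cy c s a b / DD cx cy a b \<and>
      rmem st' ''DS'' b = DD cx cy a b) ?s0 (1 + 10 * ?M)"
    using wp_LINES[OF i0] by (simp add: a_def c_def s_def)
  show ?thesis unfolding OBODY_def B_def[symmetric]
  proof (rule wp_Seq, rule wp_IPut, goal_cases)
    case 1
    show ?case using T by linarith
  next
    case 2
    show ?case
    proof (rule wp_Seq, rule wp_call[OF LN], goal_cases)
      case 1
      show ?case using T by linarith
    next
      case (2 s1 t1)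
      have fr1: "same_except (imods OITEM) (rmods OITEM) ?s0 s1" using 2(2) by simp
      have i1: "inst s1" by (rule inst_frame[OF i0 fr1]) auto
      have b1: "sound s1" "better st s1" using best_frame[OF fr1] b0 better_trans by auto
      have e1: "rval s1 ''rc'' = c" "rval s1 ''rs'' = s" "ival s1 ''a'' = a"
        using same_exceptD[OF fr1] unfolding a_def c_def s_def by simp_all
      \<comment> \<open>The arrays themselves, as total functions of the label, are taken for
        \<open>\<alpha>\<close> and \<open>\<beta>\<close>; the formulas are required only below
        \<open>gst G\<close>. The context of the merges can then be stated by equality of
        arrays.\<close>
      interpret oc: opt_chart cx cy gst gr G a c s "rmem s1 ''AL''" "rmem s1 ''BE''"
        by unfold_locales (use chart 2(1) in auto)
      have est1: "oc.est s1" using i1 e1 2(1) unfolding oc.est_def by simp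
      have t1: "4 + (1 + 71 * (?M * Suc (cl ?M))) + (1 + 100 * B) \<le> t1" using 2(3) T by linarith
      have init: "wp OINIT (\<lambda>s' _. rval s' ''sg'' = -1 \<and> ival s' ''g'' = 0 \<and> ival s' ''e'' = 0 \<and> ival s' ''ng'' = 0) s1 4"
        unfolding OINIT_def by (intro wp_steps; simp)
      show ?case
      proof (rule wp_Seq, rule wp_call[OF init], goal_cases)
        case 1
        show ?case using t1 by linarith
      next
        case (2 s2 t2)
        have est2: "oc.est s2" by (rule oc.est_frame[OF est1 2(2)]) auto
        have b2: "sound s2" "better st s2" using best_frame[OF 2(2)] b1 better_trans by auto
        have "oc.PS 0 s2" using est2 2(1) unfolding oc.PS_def oc.gl_def by simp
        note GR = oc.wp_GROUPS[OF this]
        have t2: "(1 + 71 * (?M * Suc (cl ?M))) + (1 + 100 * B) \<le> t2" using 2(3) t1 by linarith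
        show ?case
        proof (rule wp_Seq, rule wp_call[OF GR], goal_cases)
          case 1
          show ?case using t2 by (simp add: mult.assoc)
        next
          case (2 s3 t3)
          have fr3: "same_except (imods OGRP) (rmods OGRP) s2 s3" using 2(2) by simp
          have b3: "sound s3" "better st s3" using best_frame[OF fr3] b2 better_trans by auto
          have est3: "oc.est s3" and ng: "ival s3 ''ng'' = length (oc.gl G)" using 2(1) unfolding oc.PS_def by auto
          have t3: "1 + 100 * B \<le> t3" using 2(3) t2 by (simp add: mult.assoc)
          have fin: "sound s' \<and> better st s' \<and> explored a c s s'" if "sound s' \<and> better s3 s' \<and> explored a c s s'" for s'
            using that b3 better_trans by blast
          show ?case
          proof (rule wp_Cond)
            show "1 \<le> t3" using t3 by simp
          next
            assume "beval (ILess (INat 0) (iv ''ng'')) s3"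
            then have ne: "oc.gl G \<noteq> []" using ng by auto
            show "wp OPHASE2 (\<lambda>st' _. sound st' \<and> better st st' \<and> explored a c s st') s3 (t3 - 1)"
              by (rule wp_call[OF oc.wp_OPHASE2[OF 2(1) b3(1) ne]]) (use t3 fin in \<open>auto simp: B_def\<close>)
          next
            assume "\<not> beval (ILess (INat 0) (iv ''ng'')) s3"
            then have e: "oc.gl G = []" using ng by auto
            show "wp ONEW (\<lambda>st' _. sound st' \<and> better st st' \<and> explored a c s st') s3 (t3 - 1)"
              by (rule wp_call[OF oc.wp_ONEW[OF est3 b3(1) e]]) (use t3 fin MB M in auto)
          qed
        qed
      qed
    qed
  qed
qed

end

section \<open>Matching as covering\<close>

definition close_walk :: "real \<Rightarrow> point list \<Rightarrow> point list \<Rightarrow> bool" where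
  "close_walk r P Q \<longleftrightarrow> (\<exists>w. paired_walk (length P) (length Q) w
     \<and> (\<forall>(a, b) \<in> set w. dist (P ! (a - 1)) (Q ! (b - 1)) \<le> r))"

lemma discrete_frechet_le_iff:
  assumes "P \<noteq> []" and "Q \<noteq> []"
  shows "discrete_frechet P Q \<le> r \<longleftrightarrow> close_walk r P Q"
proof -
  have cost: "walk_cost P Q w \<le> r \<longleftrightarrow> (\<forall>(a, b) \<in> set w. dist (P ! (a - 1)) (Q ! (b - 1)) \<le> r)"
    if "paired_walk (length P) (length Q) w" for w
  proof -
    have "w \<noteq> []" using that unfolding paired_walk_def by simp
    then show ?thesis unfolding walk_cost_def by (subst Max_le_iff) (auto split: prod.splits)
  qed
  have "discrete_frechet P Q \<le> r \<longleftrightarrow> (\<exists>w. paired_walk (length P) (length Q) w \<and> walk_cost P Q w \<le> r)"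
    unfolding discrete_frechet_def by (subst Min_le_iff[OF discrete_frechet_min_wf(1,2)[OF assms]]) auto
  then show ?thesis unfolding close_walk_def using cost by auto
qed

text \<open>The first index starts at 1 and grows by at most 1 per step, so it skips nothing before
  \<open>n\<close>.\<close>

lemma paired_walk_fst_onto:
  assumes "paired_walk n m w"
  shows "{1..n} \<subseteq> fst ` set w"
proof -
  have "i < length w \<Longrightarrow> {1..fst (w ! i)} \<subseteq> fst ` set w" for i
  proof (induction i)
    case 0
    then have "fst (w ! 0) = 1" using assms unfolding paired_walk_def by (auto simp: hd_conv_nth)
    then show ?case using imageI[OF nth_mem[OF 0], of fst] by simp
  next
    case (Suc i)
    then have "fst (w ! Suc i) \<le> Suc (fst (w ! i))"
      using assms unfolding paired_walk_def by (fastforce split: prod.splits)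
    then have "{1..fst (w ! Suc i)} \<subseteq> insert (fst (w ! Suc i)) {1..fst (w ! i)}" by auto
    then show ?case using Suc by auto
  qed
  from this[of "length w - 1"] show ?thesis
    using assms unfolding paired_walk_def by (auto simp: last_conv_nth)
qed

lemma paired_walk_swap: "paired_walk n m w \<Longrightarrow> paired_walk m n (map prod.swap w)"
proof -
  assume w: "paired_walk n m w"
  have "case map prod.swap w ! i of (a, b) \<Rightarrow>
      map prod.swap w ! Suc i \<in> {(a + 1, b), (a, b + 1), (a + 1, b + 1)}"
    if i: "Suc i < length (map prod.swap w)" for i
  proof (cases "w ! i" "w ! Suc i" rule: prod.exhaust[case_product prod.exhaust])
    case (Pair_Pair a b c d)
    then show ?thesis using w i unfolding paired_walk_def by fastforce
  qed
  then show ?thesis using w unfolding paired_walk_def by (simp add: hd_map last_map)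
qed

lemma close_walk_swap:
  assumes "close_walk r P Q"
  shows "close_walk r Q P"
proof -
  obtain w where w: "paired_walk (length P) (length Q) w"
      "\<forall>(a, b) \<in> set w. dist (P ! (a - 1)) (Q ! (b - 1)) \<le> r"
    using assms unfolding close_walk_def by blast
  then show ?thesis unfolding close_walk_def
    by (intro exI[of _ "map prod.swap w"] conjI paired_walk_swap) (auto simp: dist_commute)
qed

lemma close_walk_near:
  assumes "close_walk r P Q" and "p \<in> set P"
  obtains q where "q \<in> set Q" "dist p q \<le> r"
proof -
  obtain w where w: "paired_walk (length P) (length Q) w"
      "\<forall>(a, b) \<in> set w. dist (P ! (a - 1)) (Q ! (b - 1)) \<le> r"
    using assms(1) unfolding close_walk_def by blast
  obtain i where i: "i < length P" "p = P ! i" using assms(2) by (auto simp: in_set_conv_nth)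
  then obtain b where b: "(Suc i, b) \<in> set w" using paired_walk_fst_onto[OF w(1)] by force
  then have "b - 1 < length Q" using paired_walk_subset[OF w(1)] by fastforce
  then show ?thesis using that[of "Q ! (b - 1)"] w(2) b i by auto
qed

text \<open>\<open>x\<close> selects the step: both curves gain a vertex, or only \<open>Q\<close>
  does while \<open>P\<close> waits at its last vertex. These are the steps from which
  \<open>close_walk_concat\<close> is built.\<close>

lemma close_walk_snoc:
  assumes "close_walk r P Q" and "x \<in> {(P @ [p], Q @ [q]), (P, Q @ [q])}" and "dist (last (fst x)) q \<le> r"
    and "P \<noteq> []"
  shows "close_walk r (fst x) (snd x)"
proof -
  obtain w where w: "paired_walk (length P) (length Q) w"
      "\<forall>(a, b) \<in> set w. dist (P ! (a - 1)) (Q ! (b - 1)) \<le> r"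
    using assms(1) unfolding close_walk_def by blast
  have "dist (fst x ! (a - 1)) (snd x ! (b - 1)) \<le> r" if "(a, b) \<in> set w" for a b
  proof -
    have "a - 1 < length P" "b - 1 < length Q" using that paired_walk_subset[OF w(1)] by fastforce+
    then show ?thesis using w(2) that assms(2) by (auto simp: nth_append)
  qed
  moreover have "dist (fst x ! (length (fst x) - 1)) (snd x ! (length (snd x) - 1)) \<le> r"
    using assms(2-4) by (auto simp: last_conv_nth)
  ultimately show ?thesis
    using paired_walk_snoc[OF w(1), of "(length (fst x), length (snd x))"] assms(2) unfolding close_walk_def
    by (intro exI[of _ "w @ [(length (fst x), length (snd x))]"]) auto
qed

lemma close_walk_singleton: "dist p q \<le> r \<Longrightarrow> close_walk r [p] [q]"
  unfolding close_walk_def paired_walk_def by (intro exI[of _ "[(1, 1)]"]) simp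

lemma close_walk_append:
  assumes "close_walk r P Q" and "P \<noteq> []" and "\<forall>q \<in> set L. dist (last P) q \<le> r"
  shows "close_walk r P (Q @ L)"
  using assms(3)
proof (induction L rule: rev_induct)
  case Nil
  show ?case using assms(1) by simp
next
  case (snoc q L)
  then show ?case using close_walk_snoc[of r P "Q @ L" "(P, (Q @ L) @ [q])" undefined q] assms(2) by simp
qed

text \<open>\<open>P\<close> waits at each of its vertices while \<open>Q\<close> runs through the
  points listed for that vertex; nonempty lists let both curves step on together.\<close>

lemma close_walk_concat:
  assumes "P \<noteq> []" and "\<And>p. p \<in> set P \<Longrightarrow> N p \<noteq> [] \<and> (\<forall>q \<in> set (N p). dist p q \<le> r)"
  shows "close_walk r P (concat (map N P))"
  using assms
proof (induction P rule: rev_nonempty_induct)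
  case (single p)
  then obtain q L where L: "N p = q # L" by (cases "N p") auto
  then have "close_walk r [p] ([q] @ L)" using single by (intro close_walk_append close_walk_singleton) auto
  then show ?case using L by simp
next
  case (snoc p P)
  then obtain q L where L: "N p = q # L" by (cases "N p") auto
  have IH: "close_walk r P (concat (map N P))" using snoc by simp
  have d: "\<forall>q' \<in> set (q # L). dist p q' \<le> r" using snoc.prems[of p] L by simp
  have "close_walk r (P @ [p]) (concat (map N P) @ [q])"
    using close_walk_snoc[OF IH, of "(P @ [p], concat (map N P) @ [q])" p q] d snoc.hyps by simp
  then have "close_walk r (P @ [p]) ((concat (map N P) @ [q]) @ L)"
    by (rule close_walk_append) (use d in auto)
  then show ?case using L by simp
qed

text \<open>The directed Hausdorff distance from the translated vertices to \<open>S\<close> is at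
  most \<open>r\<close>; in the all-points version it is the symmetric Hausdorff distance. The order
  of the vertices has disappeared.\<close>

definition hcov :: "matching_version \<Rightarrow> point list \<Rightarrow> point set \<Rightarrow> point \<Rightarrow> real \<Rightarrow> bool" where
  "hcov v P S t r \<longleftrightarrow> (\<forall>p \<in> set P. \<exists>q \<in> S. dist (p + t) q \<le> r)
     \<and> (v = All_Points_Version \<longrightarrow> (\<forall>q \<in> S. \<exists>p \<in> set P. dist (p + t) q \<le> r))"

lemma admissible_iff:
  "admissible v S Q \<longleftrightarrow> Q \<noteq> [] \<and> set Q \<subseteq> S \<and> (v = All_Points_Version \<longrightarrow> S \<subseteq> set Q)"
  by (cases v) auto

lemma hcov_iff:
  assumes "P \<noteq> []" and "finite S"
  shows "(\<exists>Q. admissible v S Q \<and> discrete_frechet (translate P t) Q \<le> r) \<longleftrightarrow> hcov v P S t r"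
proof
  have ne: "translate P t \<noteq> []" and set: "set (translate P t) = (\<lambda>p. p + t) ` set P"
    using assms(1) unfolding translate_def by auto
  {
    assume "\<exists>Q. admissible v S Q \<and> discrete_frechet (translate P t) Q \<le> r"
    then obtain Q where Q: "admissible v S Q" "discrete_frechet (translate P t) Q \<le> r" by blast
    then have c: "close_walk r (translate P t) Q"
      using discrete_frechet_le_iff[OF ne] admissibleD by blast
    have "\<exists>q \<in> S. dist (p + t) q \<le> r" if "p \<in> set P" for p
      using close_walk_near[OF c, of "p + t"] that set admissibleD[OF Q(1)] by blast
    moreover have "\<exists>p \<in> set P. dist (p + t) q \<le> r" if q: "q \<in> S" and v: "v = All_Points_Version" for q
    proof -
      have "q \<in> set Q" using Q(1) q v by auto
      from close_walk_near[OF close_walk_swap[OF c] this] obtain p' where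
        "p' \<in> set (translate P t)" "dist q p' \<le> r" .
      then show ?thesis unfolding set by (auto simp: dist_commute)
    qed
    ultimately show "hcov v P S t r" unfolding hcov_def by blast
  }
  assume h: "hcov v P S t r"
  obtain xs where xs: "set xs = S" using finite_list[OF assms(2)] by blast
  \<comment> \<open>All near points are listed, not just one, so that in the all-points version
    every point of \<open>S\<close> is visited next to some vertex.\<close>
  define N where "N p = filter (\<lambda>q. dist p q \<le> r) xs" for p
  define Q where "Q = concat (map N (translate P t))"
  have N: "N p \<noteq> [] \<and> (\<forall>q \<in> set (N p). dist p q \<le> r)" if "p \<in> set (translate P t)" for p
    using h that xs unfolding N_def set hcov_def by (auto simp: filter_empty_conv)
  have "close_walk r (translate P t) Q" unfolding Q_def by (rule close_walk_concat[OF ne N])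
  moreover have "Q \<noteq> []" unfolding Q_def using N[of "hd (translate P t)"] ne by auto
  moreover have "set Q \<subseteq> S" unfolding Q_def N_def using xs by auto
  moreover have "S \<subseteq> set Q" if v: "v = All_Points_Version"
  proof
    fix q assume q: "q \<in> S"
    then obtain p where "p \<in> set P" "dist (p + t) q \<le> r" using h v unfolding hcov_def by blast
    then show "q \<in> set Q" unfolding Q_def N_def using q xs set by auto
  qed
  ultimately show "\<exists>Q. admissible v S Q \<and> discrete_frechet (translate P t) Q \<le> r"
    using discrete_frechet_le_iff[OF ne] unfolding admissible_iff by blast
qed

lemma matching_distance_le_iff:
  assumes "P \<noteq> []" and "finite S" and "S \<noteq> {}"
  shows "matching_distance v P S t \<le> r \<longleftrightarrow> hcov v P S t r"
  unfolding matching_distance_def hcov_iff[OF assms(1,2), symmetric]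
  by (subst Min_le_iff) (use matching_distance_min_wf[OF assms] in auto)

lemma hcov_nonneg: "P \<noteq> [] \<Longrightarrow> hcov v P S t r \<Longrightarrow> 0 \<le> r"
  unfolding hcov_def by (metis dist_not_less_zero le_less_linear list.set_sel(1) order_less_le_trans order_trans)

section \<open>Building the instance\<close>

definition BCELL :: com where
  "BCELL = RPut ''cx'' (iv ''M'') (RSub (RGet ''sx'' (iv ''j'')) (RGet ''px'' (iv ''i''))) ;;
    RPut ''cy'' (iv ''M'') (RSub (RGet ''sy'' (iv ''j'')) (RGet ''py'' (iv ''i''))) ;;
    IPut ''gr'' (iv ''M'') (iv ''G'') ;; iinc ''M''"

definition BROW :: "vname \<Rightarrow> vname \<Rightarrow> com" where
  "BROW y hi = (IPut ''gst'' (iv ''G'') (iv ''M'') ;; iset y (INat 0)) ;;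
    While (ILess (iv y) (iv hi)) (BCELL ;; iinc y) ;; iinc ''G''"

definition BROWS :: "vname \<Rightarrow> vname \<Rightarrow> vname \<Rightarrow> vname \<Rightarrow> com" where
  "BROWS x bx y hi = iset x (INat 0) ;; While (ILess (iv x) (iv bx)) (BROW y hi ;; iinc x)"

text \<open>In the all-points version each difference is stored twice, once in its row and once in
  its column, because groups must be disjoint intervals of labels. This is where the factor 2 in the
  number of centres comes from. The last assignment closes the final group.\<close>

definition BUILD :: "matching_version \<Rightarrow> com" where
  "BUILD v = (iset ''M'' (INat 0) ;; iset ''G'' (INat 0)) ;; BROWS ''i'' ''n'' ''j'' ''k'' ;;
    (if v = All_Points_Version then BROWS ''j'' ''k'' ''i'' ''n'' else Skip) ;;
    IPut ''gst'' (iv ''G'') (iv ''M'')"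

lemma mods_BUILD [simp]:
  "imods BCELL = [''gr'', ''M'']" "rmods BCELL = [''cx'', ''cy'']"
  "imods (BROW y hi) = [''gst'', y, ''gr'', ''M'', y, ''G'']" "rmods (BROW y hi) = [''cx'', ''cy'']"
  "imods (BROWS x bx y hi) = [x, ''gst'', y, ''gr'', ''M'', y, ''G'', x]" "rmods (BROWS x bx y hi) = [''cx'', ''cy'']"
  "rmods (BUILD v) = [''cx'', ''cy''] @ (if v = All_Points_Version then [''cx'', ''cy''] else [])"
  unfolding BCELL_def BROW_def BROWS_def BUILD_def by simp_all

section \<open>Rows and columns of the array of differences\<close>

locale build =
  fixes P xs :: "point list"
  assumes P_ne: "P \<noteq> []" and xs_ne: "xs \<noteq> []"
begin

abbreviation "n \<equiv> length P"
abbreviation "k \<equiv> length xs"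

definition width :: "nat \<Rightarrow> nat" where "width g = (if g < n then k else n)"
text \<open>The pair always consists of the index of a vertex and the index of a point; rows
  numbered from \<open>n\<close> on are the columns of the array.\<close>

definition cell :: "nat \<Rightarrow> nat \<Rightarrow> nat \<times> nat" where "cell g y = (if g < n then (g, y) else (y, g - n))"
definition off :: "nat \<Rightarrow> nat" where "off g = sum width {..<g}"

lemma off_Suc [simp]: "off (Suc g) = off g + width g"
  unfolding off_def by simp

lemma off_0 [simp]: "off 0 = 0"
  unfolding off_def by simp

lemma off_mono: "g \<le> h \<Longrightarrow> off g \<le> off h"
  unfolding off_def by (intro sum_mono2) auto

lemma off_lt: "h < g \<Longrightarrow> y < width h \<Longrightarrow> off h + y < off g"
  using off_mono[of "Suc h" g] by simp

lemma width_pos: "0 < width g"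
  unfolding width_def using P_ne xs_ne by simp

definition inputs :: "store \<Rightarrow> bool" where
  "inputs s \<longleftrightarrow> rmem s ''px'' = coord_array P 1 \<and> rmem s ''py'' = coord_array P 2 \<and>
     rmem s ''sx'' = coord_array xs 1 \<and> rmem s ''sy'' = coord_array xs 2 \<and> ival s ''n'' = n \<and> ival s ''k'' = k"

lemma inputs_frame:
  assumes "inputs s" and "same_except is rs s s'"
    and "set is \<inter> {''n'', ''k''} = {}" and "set rs \<inter> {''px'', ''py'', ''sx'', ''sy''} = {}"
  shows "inputs s'"
  using assms unfolding inputs_def same_except_def by auto

definition filled :: "nat \<Rightarrow> nat \<Rightarrow> store \<Rightarrow> bool" where
  "filled h y s \<longleftrightarrow> (case cell h y of (i, j) \<Rightarrow>
     rmem s ''cx'' (off h + y) = coord_array xs 1 j - coord_array P 1 i \<and>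
     rmem s ''cy'' (off h + y) = coord_array xs 2 j - coord_array P 2 i \<and> imem s ''gr'' (off h + y) = h)"

definition built :: "nat \<Rightarrow> nat \<Rightarrow> store \<Rightarrow> bool" where
  "built g y s \<longleftrightarrow> ival s ''M'' = off g + y \<and> ival s ''G'' = g \<and> (\<forall>h<g. imem s ''gst'' h = off h)
     \<and> (\<forall>h<g. \<forall>y'<width h. filled h y' s) \<and> (\<forall>y'<y. filled g y' s)"

lemma built_frame:
  assumes "built g y s" and "same_except is rs s s'"
    and "set is \<inter> {''M'', ''G'', ''gst'', ''gr''} = {}" and "set rs \<inter> {''cx'', ''cy''} = {}"
  shows "built g y s'"
proof -
  have "imem s' ''M'' = imem s ''M''" "imem s' ''G'' = imem s ''G''" "imem s' ''gst'' = imem s ''gst''"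
    "imem s' ''gr'' = imem s ''gr''" "rmem s' ''cx'' = rmem s ''cx''" "rmem s' ''cy'' = rmem s ''cy''"
    using assms(2-4) unfolding same_except_def by auto
  then show ?thesis using assms(1) unfolding built_def filled_def by simp
qed

lemma wp_BCELL:
  assumes "built g y s" and "inputs s" and "cell g y = (ival s ''i'', ival s ''j'')"
  shows "wp BCELL (\<lambda>s' _. built g (Suc y) s' \<and> imem s' ''gst'' = imem s ''gst'') s 4"
proof -
  have M: "ival s ''M'' = off g + y" and G: "ival s ''G'' = g" using assms(1) unfolding built_def by auto
  have "wp BCELL (\<lambda>s' _. imem s' ''gst'' = imem s ''gst'' \<and> ival s' ''M'' = Suc (off g + y) \<and> ival s' ''G'' = g \<and>
      rmem s' ''cx'' = (rmem s ''cx'')(off g + y := rmem s ''sx'' (ival s ''j'') - rmem s ''px'' (ival s ''i'')) \<and>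
      rmem s' ''cy'' = (rmem s ''cy'')(off g + y := rmem s ''sy'' (ival s ''j'') - rmem s ''py'' (ival s ''i'')) \<and>
      imem s' ''gr'' = (imem s ''gr'')(off g + y := g)) s 4"
    unfolding BCELL_def by (intro wp_steps; simp add: M G)
  then show ?thesis
  proof (rule wp_conseq, goal_cases)
    case (1 s' t')
    have keep: "filled h y' s'" if "filled h y' s" "off h + y' \<noteq> off g + y" for h y'
      using that 1 unfolding filled_def by (auto split: prod.splits)
    have "filled h y' s'" if "h < g" "y' < width h" for h y'
      using keep[of h y'] that off_lt[OF that] assms(1) unfolding built_def by auto
    moreover have "filled g y' s'" if "y' < Suc y" for y'
    proof (cases "y' = y")
      case True
      then show ?thesis using 1 assms(2,3) unfolding filled_def inputs_def by simp
    next
      case False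
      then show ?thesis using keep[of g y'] that assms(1) unfolding built_def by auto
    qed
    ultimately show ?case using 1 assms(1) unfolding built_def by auto
  qed
qed

lemma wp_BROW:
  assumes "built g 0 s" and "inputs s" and "y = ''j'' \<and> hi = ''k'' \<and> g < n \<and> ival s ''i'' = g
    \<or> y = ''i'' \<and> hi = ''n'' \<and> n \<le> g \<and> ival s ''j'' = g - n"
  shows "wp (BROW y hi) (\<lambda>s' _. built (Suc g) 0 s') s (6 * width g + 4)"
proof -
  have M: "ival s ''M'' = off g" "ival s ''G'' = g" using assms(1) unfolding built_def by auto
  \<comment> \<open>\<open>z\<close> names the counter of the enclosing loop, which is fixed during
    the row; with it one invariant serves rows and columns.\<close>
  define z r where "z = (if g < n then ''i'' else ''j'')" and "r = (if g < n then g else g - n)"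
  have z: "z \<notin> {y, ''n'', ''k'', ''gst'', ''G'', ''M'', ''gr''}" "ival s z = r"
    using assms(3) unfolding z_def r_def by auto
  define I where "I s' t' \<longleftrightarrow> built g (ival s' y) s' \<and> inputs s' \<and> imem s' ''gst'' g = off g \<and> ival s' y \<le> width g \<and>
    ival s' z = r \<and> 2 + 6 * (width g - ival s' y) \<le> t'" for s' and t' :: nat
  have yhi: "y \<notin> {''n'', ''k'', ''gst'', ''G'', ''M'', ''gr''}" "''gst'' \<noteq> y" using assms(3) by auto
  have hi: "ival s' hi = width g" if "inputs s'" for s'
    using that assms(3) unfolding inputs_def width_def by auto
  have "wp (IPut ''gst'' (iv ''G'') (iv ''M'') ;; iset y (INat 0))
      (\<lambda>s' _. ival s' y = 0 \<and> imem s' ''gst'' = (imem s ''gst'')(g := off g)) s 2"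
    using yhi by (intro wp_steps; simp add: M)
  then have init: "wp (IPut ''gst'' (iv ''G'') (iv ''M'') ;; iset y (INat 0)) I s (6 * width g + 4)"
  proof (rule wp_call, goal_cases)
    case (2 s' t')
    have e: "imem s' ''M'' = imem s ''M''" "imem s' ''G'' = imem s ''G''" "imem s' ''gr'' = imem s ''gr''"
      "rmem s' ''cx'' = rmem s ''cx''" "rmem s' ''cy'' = rmem s ''cy''"
      using same_exceptD[OF 2(2)] yhi by auto
    have "built g 0 s'" using assms(1) e 2(1) unfolding built_def filled_def by simp
    moreover have "inputs s'" using yhi by (intro inputs_frame[OF assms(2) 2(2)]) auto
    moreover have "ival s' z = r" using z same_exceptD(1)[OF 2(2)] by simp
    ultimately show ?case using 2(1,3) unfolding I_def by auto
  qed simp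
  have body: "1 \<le> t1 \<and> wp (BCELL ;; iinc y) I s1 (t1 - 1)" if I1: "I s1 t1" and lt: "ival s1 y < width g" for s1 t1
  proof -
    have s1: "built g (ival s1 y) s1" "inputs s1" "imem s1 ''gst'' g = off g"
      "ival s1 z = r" "2 + 6 * (width g - ival s1 y) \<le> t1" using I1 unfolding I_def by auto
    have c: "cell g (ival s1 y) = (ival s1 ''i'', ival s1 ''j'')"
      using s1(4) assms(3) unfolding cell_def z_def r_def by (cases "g < n") auto
    have "wp (BCELL ;; iinc y) I s1 (t1 - 1)"
    proof (rule wp_Seq, rule wp_call[OF wp_BCELL[OF s1(1,2) c]], goal_cases)
      case 1
      show ?case using s1(5) lt by linarith
    next
      case (2 s2 t2)
      have y2: "ival s2 y = ival s1 y" using same_exceptD(1)[OF 2(2)] yhi by simp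
      have z2: "ival s2 z = r" using same_exceptD(1)[OF 2(2)] z(1) s1(4) by simp
      have b2: "built g (Suc (ival s1 y)) s2" "imem s2 ''gst'' = imem s1 ''gst''" using 2(1) by simp_all
      have inp: "inputs s2" by (rule inputs_frame[OF s1(2) 2(2)]) auto
      have "wp (iinc y) (\<lambda>s' _. ival s' y = Suc (ival s2 y)) s2 1"
        by (intro wp_steps; simp)
      then show ?case
      proof (rule wp_call, goal_cases)
        case 1
        show ?case using 2(3) s1(5) lt by linarith
      next
        case (2 s3 t3)
        note fr = 2(2)
        have "built g (Suc (ival s1 y)) s3" using yhi b2(1)
          by (intro built_frame[OF _ fr]) auto
        moreover have "inputs s3" using yhi by (intro inputs_frame[OF inp fr]) auto
        moreover have "imem s3 ''gst'' = imem s1 ''gst''"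
          using same_exceptD(1)[OF fr] yhi b2(2) by simp
        moreover have "ival s3 z = r" using z(1) same_exceptD(1)[OF fr] z2 by simp
        moreover have "ival s3 y = Suc (ival s1 y)" using 2(1) y2 by simp
        moreover have "2 + 6 * (width g - Suc (ival s1 y)) \<le> t3"
          using 2(3) \<open>t1 - 1 - 4 \<le> t2\<close> s1(5) lt by linarith
        ultimately show ?case using s1(3) lt unfolding I_def by simp
      qed
    qed
    then show ?thesis using s1(5) by simp
  qed
  have loop: "wp (While (ILess (iv y) (iv hi)) (BCELL ;; iinc y) ;; iinc ''G'') (\<lambda>s' _. built (Suc g) 0 s') s1 t1"
    if "I s1 t1" for s1 t1
  proof (rule wp_Seq, rule wp_While[where I = I, OF that], goal_cases)
    case (1 s2 t2)
    then have "inputs s2" unfolding I_def by simp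
    with 1 body hi[of s2] show ?case by simp
  next
    case (2 s2 t2)
    then have s2: "built g (ival s2 y) s2" "inputs s2" "imem s2 ''gst'' g = off g" "ival s2 y \<le> width g"
      "2 + 6 * (width g - ival s2 y) \<le> t2" unfolding I_def by auto
    then have y2: "ival s2 y = width g" using 2(2) hi[of s2] by simp
    have "wp (iinc ''G'') (\<lambda>s' _. built (Suc g) 0 s') s2 (t2 - 1)"
    proof (rule wp_IPut)
      show "1 \<le> t2 - 1" using s2(5) by simp
      show "built (Suc g) 0 (s2\<lparr>imem := (imem s2)(''G'' := (imem s2 ''G'')(ieval (INat 0) s2 := ieval (IAdd (iv ''G'') (INat 1)) s2))\<rparr>)"
        using s2(1,3) y2 unfolding built_def filled_def by (auto simp: less_Suc_eq)
    qed
    then show ?case using s2(5) by simp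
  qed
  show ?thesis unfolding BROW_def by (rule wp_Seq, rule wp_conseq[OF init]) (rule loop)
qed

end

context build begin

lemma wp_BROWS:
  assumes "built d 0 s" and "inputs s" and "(x, bx, y, hi, d, N, K) \<in>
    {(''i'', ''n'', ''j'', ''k'', 0, n, k), (''j'', ''k'', ''i'', ''n'', n, k, n)}"
  shows "wp (BROWS x bx y hi) (\<lambda>s' _. built (d + N) 0 s') s (2 + N * (6 * K + 6))"
proof -
  have w: "width (d + h) = K" if "h < N" for h using that assms(3) unfolding width_def by auto
  have names: "x \<notin> {''n'', ''k'', ''M'', ''G'', ''gst'', ''gr'', y}" "y \<notin> {''n'', ''k''}" using assms(3) by auto
  have bx: "ival s' bx = N" if "inputs s'" for s' using that assms(3) unfolding inputs_def by auto
  define I where "I s' t' \<longleftrightarrow> built (d + ival s' x) 0 s' \<and> inputs s' \<and> ival s' x \<le> N \<and>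
    1 + (N - ival s' x) * (6 * K + 6) \<le> t'" for s' and t' :: nat
  have "wp (iset x (INat 0)) (\<lambda>s' _. ival s' x = 0) s 1" by (intro wp_steps; simp)
  then have init: "wp (iset x (INat 0)) I s (2 + N * (6 * K + 6))"
  proof (rule wp_call, goal_cases)
    case (2 s' t')
    have "built d 0 s'" "inputs s'"
      by (rule built_frame[OF assms(1) 2(2)] inputs_frame[OF assms(2) 2(2)]; use names in simp)+
    then show ?case using 2(1,3) unfolding I_def by simp
  qed simp
  have body: "1 \<le> t1 \<and> wp (BROW y hi ;; iinc x) I s1 (t1 - 1)" if I1: "I s1 t1" and lt: "ival s1 x < N" for s1 t1
  proof -
    have s1: "built (d + ival s1 x) 0 s1" "inputs s1" "1 + (N - ival s1 x) * (6 * K + 6) \<le> t1"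
      using I1 unfolding I_def by auto
    have row: "y = ''j'' \<and> hi = ''k'' \<and> d + ival s1 x < n \<and> ival s1 ''i'' = d + ival s1 x
        \<or> y = ''i'' \<and> hi = ''n'' \<and> n \<le> d + ival s1 x \<and> ival s1 ''j'' = d + ival s1 x - n"
      using assms(3) lt by auto
    have "N - ival s1 x = Suc (N - Suc (ival s1 x))" using lt by simp
    then have t: "1 + (6 * K + 6) + (N - Suc (ival s1 x)) * (6 * K + 6) \<le> t1" using s1(3) by simp
    have "wp (BROW y hi ;; iinc x) I s1 (t1 - 1)"
    proof (rule wp_Seq, rule wp_call[OF wp_BROW[OF s1(1,2) row]], goal_cases)
      case 1
      show ?case using t w[OF lt] by linarith
    next
      case (2 s2 t2)
      note b2 = 2(1) and t2 = 2(3)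
      have x2: "ival s2 x = ival s1 x" using same_exceptD(1)[OF 2(2)] names by simp
      have inp: "inputs s2" by (rule inputs_frame[OF s1(2) 2(2)]) (use names in auto)
      have "wp (iinc x) (\<lambda>s' _. ival s' x = Suc (ival s2 x)) s2 1" by (intro wp_steps; simp)
      then show ?case
      proof (rule wp_call, goal_cases)
        case 1
        show ?case using t2 t w[OF lt] by linarith
      next
        case (2 s3 t3)
        have "built (Suc (d + ival s1 x)) 0 s3" "inputs s3"
          by (rule built_frame[OF b2 2(2)] inputs_frame[OF inp 2(2)]; use names in simp)+
        moreover have "1 + (N - Suc (ival s1 x)) * (6 * K + 6) \<le> t3" using 2(3) t2 t w[OF lt] by linarith
        ultimately show ?case using 2(1) x2 lt unfolding I_def by simp
      qed
    qed
    then show ?thesis using t by simp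
  qed
  show ?thesis unfolding BROWS_def
  proof (rule wp_Seq, rule wp_conseq[OF init], rule wp_While[where I = I], assumption, goal_cases)
    case (1 s' t' s1 t1)
    then have "inputs s1" unfolding I_def by simp
    with 1 body bx[of s1] show ?case by simp
  next
    case (2 s' t' s1 t1)
    then have "inputs s1" "ival s1 x \<le> N" "built (d + ival s1 x) 0 s1" "1 \<le> t1" unfolding I_def by auto
    with 2 bx[of s1] show ?case by simp
  qed
qed

definition rows :: "matching_version \<Rightarrow> nat" where
  "rows v = (if v = All_Points_Version then n + k else n)"

lemma wp_BUILD:
  assumes "inputs s"
  shows "wp (BUILD v) (\<lambda>s' _. built (rows v) 0 s' \<and> imem s' ''gst'' (rows v) = off (rows v)) s (40 * (n * k))"
proof -
  have nk: "1 \<le> n" "1 \<le> k" "n \<le> n * k" "k \<le> n * k" "1 \<le> n * k" using P_ne xs_ne by (auto simp: Suc_le_eq)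
  have t: "40 * (n * k) \<ge> 2 + (2 + n * (6 * k + 6)) + (2 + k * (6 * n + 6)) + 2"
  proof -
    have "n * (6 * k + 6) = 6 * (n * k) + 6 * n" "k * (6 * n + 6) = 6 * (n * k) + 6 * k"
      by (simp_all add: algebra_simps)
    then show ?thesis using nk by linarith
  qed
  have fin: "wp (IPut ''gst'' (iv ''G'') (iv ''M'')) (\<lambda>s' _. built (rows v) 0 s' \<and> imem s' ''gst'' (rows v) = off (rows v)) s1 t1"
    if "built (rows v) 0 s1" "1 \<le> t1" for s1 t1
  proof (rule wp_IPut)
    show "1 \<le> t1" by fact
  qed (use that in \<open>auto simp: built_def filled_def\<close>)
  have "wp (iset ''M'' (INat 0) ;; iset ''G'' (INat 0)) (\<lambda>s' _. ival s' ''M'' = 0 \<and> ival s' ''G'' = 0) s 2"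
    by (intro wp_steps; simp)
  then have init: "wp (iset ''M'' (INat 0) ;; iset ''G'' (INat 0)) (\<lambda>s' t'. built 0 0 s' \<and> inputs s' \<and> 40 * (n * k) - 2 \<le> t') s (40 * (n * k))"
  proof (rule wp_call, goal_cases)
    case (2 s' t')
    have "inputs s'" by (rule inputs_frame[OF assms 2(2)]) auto
    then show ?case using 2 unfolding built_def by simp
  qed (use nk in linarith)
  show ?thesis unfolding BUILD_def
  proof (rule wp_Seq, rule wp_conseq[OF init], elim conjE, rule wp_Seq,
      rule wp_call[OF wp_BROWS[where d = 0 and N = n and K = k]], assumption, assumption, goal_cases)
    case (3 s1 t1 s2 t2)
    have inp: "inputs s2" by (rule inputs_frame[OF 3(3) 3(6)]) auto
    have b2: "built n 0 s2" using 3(5) by simp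
    have t2: "(2 + k * (6 * n + 6)) + 2 \<le> t2" using t 3(4,7) by linarith
    show ?case
    proof (cases "v = All_Points_Version")
      case True
      show ?thesis unfolding if_P[OF True]
      proof (rule wp_Seq, rule wp_call[OF wp_BROWS[OF b2 inp, where N = k and K = n]], goal_cases)
        case (3 s3 t3)
        then show ?case using fin[of s3 t3] True t2 unfolding rows_def by simp
      qed (use t2 in auto)
    next
      case False
      show ?thesis unfolding if_not_P[OF False]
        by (rule wp_Seq, rule wp_Skip) (use fin[of s2] t2 b2 False in \<open>auto simp: rows_def\<close>)
    qed
  qed (use t in auto)
qed

lemma off_n: "off n = n * k"
  unfolding off_def width_def by simp

lemma off_nk: "off (n + k) = 2 * (n * k)"
proof -
  have "off (n + h) = n * k + h * n" for h
    by (induction h) (simp_all add: off_n width_def)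
  from this[of k] show ?thesis by (simp add: mult.commute)
qed

lemma off_rows: "off (rows v) \<le> 2 * (n * k)" "n * k \<le> off (rows v)"
  unfolding rows_def using off_n off_nk by auto

lemma built_discs:
  assumes "built (rows v) 0 s" and "imem s ''gst'' (rows v) = off (rows v)"
  shows "discs (imem s ''gst'') (imem s ''gr'') (rows v)"
    and "discs.inst (rmem s ''cx'') (rmem s ''cy'') (imem s ''gst'') (imem s ''gr'') (rows v) s"
    and "covered (rmem s ''cx'') (rmem s ''cy'') (imem s ''gst'') (rows v) x y q
      \<longleftrightarrow> hcov v P (set xs) (vector [x, y]) (sqrt q)"
proof -
  let ?G = "rows v" and ?cx = "rmem s ''cx''" and ?cy = "rmem s ''cy''" and ?gst = "imem s ''gst''"
  have gst: "?gst h = off h" if "h \<le> ?G" for h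
    using that assms unfolding built_def by (cases "h = ?G") auto
  have cells: "filled h y s" if "h < ?G" "y < width h" for h y
    using that assms unfolding built_def by auto
  have grp: "b \<in> grp ?gst h \<longleftrightarrow> (\<exists>y < width h. b = off h + y)" if "h < ?G" for b h
    using gst[of h] gst[of "Suc h"] that
    by (auto intro!: exI[of _ "b - off h"])
  show D: "discs ?gst (imem s ''gr'') ?G"
  proof
    show "groups ?gst ?G"
      unfolding groups_def using gst width_pos P_ne by (auto simp: rows_def)
    show "imem s ''gr'' b = g" if "g < ?G" "b \<in> grp ?gst g" for g b
      using that grp[of g b] cells[of g] unfolding filled_def by (auto split: prod.splits)
  qed
  show "discs.inst ?cx ?cy ?gst (imem s ''gr'') ?G s"
    unfolding discs.inst_def[OF D] using assms unfolding built_def by simp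
  let ?d = "\<lambda>i j. dist (P ! i + vector [x, y]) (xs ! j)"
  \<comment> \<open>The distance is the root of \<open>sqd\<close>, and \<open>sqrt\<close> is
    strictly increasing on all reals, so no sign condition on \<open>q\<close> arises.\<close>
  have sq: "sqd ?cx ?cy x y (off h + y') \<le> q \<longleftrightarrow> ?d (fst (cell h y')) (snd (cell h y')) \<le> sqrt q"
    if h: "h < ?G" "y' < width h" for h y'
  proof -
    have "fst (cell h y') < n" "snd (cell h y') < k"
      using h unfolding cell_def width_def rows_def by (auto split: if_splits)
    moreover obtain i j where ij: "cell h y' = (i, j)" by fastforce
    ultimately have c: "?cx (off h + y') = xs ! j $ 1 - P ! i $ 1" "?cy (off h + y') = xs ! j $ 2 - P ! i $ 2"
      using cells[OF h] unfolding filled_def coord_array_def by auto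
    have "?d i j = sqrt ((P ! i $ 1 + x - xs ! j $ 1)\<^sup>2 + (P ! i $ 2 + y - xs ! j $ 2)\<^sup>2)"
      unfolding dist_vec_def L2_set_def by (simp add: sum_2 dist_real_def)
    also have "\<dots> = sqrt (sqd ?cx ?cy x y (off h + y'))"
      unfolding sqd_def c by (simp add: diff_diff_eq2 add.commute)
    finally show ?thesis unfolding ij by simp
  qed
  have cov: "covered ?cx ?cy ?gst ?G x y q \<longleftrightarrow>
      (\<forall>h<?G. \<exists>y'<width h. ?d (fst (cell h y')) (snd (cell h y')) \<le> sqrt q)"
  proof -
    have "(\<exists>b \<in> grp ?gst h. sqd ?cx ?cy x y b \<le> q) \<longleftrightarrow>
        (\<exists>y'<width h. ?d (fst (cell h y')) (snd (cell h y')) \<le> sqrt q)" if "h < ?G" for h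
      unfolding Bex_def grp[OF that] using sq[OF that] by blast
    then show ?thesis unfolding covered_def by (intro all_cong)
  qed
  have split: "(\<forall>h<n + k. R h) \<longleftrightarrow> (\<forall>h<n. R h) \<and> (\<forall>j<k. R (n + j))" for R
  proof (intro iffI conjI allI impI)
    fix h assume R: "(\<forall>h<n. R h) \<and> (\<forall>j<k. R (n + j))" and h: "h < n + k"
    show "R h"
    proof (cases "h < n")
      case True
      with R show ?thesis by blast
    next
      case False
      then have "h = n + (h - n)" "h - n < k" using h by auto
      with R show ?thesis by metis
    qed
  qed auto
  have rowP: "(\<exists>y'<width h. ?d (fst (cell h y')) (snd (cell h y')) \<le> sqrt q) \<longleftrightarrow> (\<exists>j<k. ?d h j \<le> sqrt q)"
    if "h < n" for h using that unfolding width_def cell_def by simp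
  have rowS: "(\<exists>y'<width (n + j). ?d (fst (cell (n + j) y')) (snd (cell (n + j) y')) \<le> sqrt q) \<longleftrightarrow> (\<exists>i<n. ?d i j \<le> sqrt q)"
    for j unfolding width_def cell_def by simp
  have ex: "(\<exists>p \<in> set L. R p) \<longleftrightarrow> (\<exists>j<length L. R (L ! j))" for L :: "point list" and R
    by (metis in_set_conv_nth)
  have "covered ?cx ?cy ?gst ?G x y q \<longleftrightarrow> (\<forall>i<n. \<exists>j<k. ?d i j \<le> sqrt q)
      \<and> (v = All_Points_Version \<longrightarrow> (\<forall>j<k. \<exists>i<n. ?d i j \<le> sqrt q))"
    unfolding cov by (cases "v = All_Points_Version") (simp_all add: rows_def split rowP rowS)
  also have "\<dots> \<longleftrightarrow> hcov v P (set xs) (vector [x, y]) (sqrt q)"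
    unfolding hcov_def Ball_set list_all_length ex by (rule refl)
  finally show "covered ?cx ?cy ?gst ?G x y q \<longleftrightarrow> hcov v P (set xs) (vector [x, y]) (sqrt q)" .
qed

end

section \<open>The two algorithms\<close>

definition DECIDE :: "matching_version \<Rightarrow> com" where
  "DECIDE v = BUILD v ;; iset ''answer'' (INat 0) ;; OUTER DBODY"

definition OPTIMIZE :: "matching_version \<Rightarrow> com" where
  "OPTIMIZE v = BUILD v ;; iset ''have'' (INat 0) ;; OUTER OBODY ;;
    (rset ''tx'' (rv ''bx'') ;; rset ''ty'' (rv ''by''))"

lemma (in discs) wp_OUTER_DBODY:
  assumes "inst s" and "rval s ''eps'' = \<epsilon>" and "0 < \<epsilon>" and "ival s ''answer'' = 0"
  shows "wp (OUTER DBODY) (\<lambda>s' _. ival s' ''answer'' = (if \<exists>x y. covered cx cy gst G x y (\<epsilon>\<^sup>2) then 1 else 0)) s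
    (2 + gst G * (6 + 4 * (140 * gst G * Suc (cl (2 * gst G)) + 5)))"
proof -
  define Inv where "Inv S s' \<longleftrightarrow> inst s' \<and> rval s' ''eps'' = \<epsilon> \<and>
    ival s' ''answer'' = (if \<exists>(a, c, r) \<in> S. feasible cx cy gst G \<epsilon> a c r then 1 else 0)" for S s'
  have mods: "''answer'' \<in> set (imods DBODY)" "set (imods DBODY) \<inter> {''a'', ''ch'', ''gst'', ''gr'', ''G'', ''M''} = {}"
    "set (rmods DBODY) \<inter> {''rc'', ''rs'', ''cx'', ''cy'', ''eps''} = {}"
    unfolding DBODY_def by simp_all
  have "wp (OUTER DBODY) (\<lambda>s' _. Inv ({..<gst G} \<times> charts) s') s
    (2 + gst G * (6 + 4 * (140 * gst G * Suc (cl (2 * gst G)) + 5)))"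
  proof (rule wp_OUTER, goal_cases)
    case (1 S s s')
    have "inst s'" by (rule inst_frame[OF _ 1(2)]) (use 1(1) in \<open>auto simp: Inv_def\<close>)
    then show ?case using 1(1) same_exceptD[OF 1(2)] unfolding Inv_def by simp
  next
    case (2 S s)
    then show ?case unfolding Inv_def by simp
  next
    case (3 S s)
    let ?a = "ival s ''a''" and ?c = "rval s ''rc''" and ?r = "rval s ''rs''"
    interpret dc: dec_chart cx cy gst gr G ?a ?c ?r \<epsilon> by unfold_locales (rule assms(3))
    have "dc.cst s" using 3(1) unfolding Inv_def dc.cst_def by simp
    then show ?case
    proof (rule wp_call[OF dc.wp_DBODY], goal_cases)
      case (2 s' t')
      have "inst s'" by (rule inst_frame[OF _ 2(2)]) (use 3(1) mods in \<open>auto simp: Inv_def\<close>)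
      moreover have "rval s' ''eps'' = \<epsilon>" using same_exceptD(2)[OF 2(2)] mods(3) 3(1) unfolding Inv_def by auto
      ultimately show ?case using 2(1) 3(1) unfolding Inv_def by auto
    qed simp
  next
    case 6
    show ?case using assms unfolding Inv_def by simp
  qed (use mods in auto)
  then show ?thesis
  proof (rule wp_conseq, goal_cases)
    case (1 s' t')
    have "(\<exists>(a, c, r) \<in> {..<gst G} \<times> charts. feasible cx cy gst G \<epsilon> a c r)
        \<longleftrightarrow> (\<exists>x y. covered cx cy gst G x y (\<epsilon>\<^sup>2))"
      unfolding decision_pivot[OF gs assms(3)] by auto
    then show ?case using 1(1) unfolding Inv_def by simp
  qed
qed

lemma (in discs) wp_OUTER_OBODY:
  assumes "inst s" and "ival s ''have'' = 0"
  shows "wp (OUTER OBODY) (\<lambda>s' _. sound s' \<and> (\<forall>x y q. covered cx cy gst G x y q \<longrightarrow> good q s')) s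
    (2 + gst G * (6 + 4 * (200 * (gst G * (3 + 2 * cl (gst G)) * Suc (cl (gst G))) + 5)))"
proof -
  define Inv where "Inv S s' \<longleftrightarrow> inst s' \<and> sound s' \<and> (\<forall>(a, c, r) \<in> S. explored a c r s')" for S s'
  have mods: "set (imods OBODY) \<inter> {''a'', ''ch'', ''gst'', ''gr'', ''G'', ''M''} = {}"
    "set (rmods OBODY) \<inter> {''rc'', ''rs'', ''cx'', ''cy''} = {}"
    unfolding OBODY_def OPHASE2_def ONEW_def by simp_all
  have "wp (OUTER OBODY) (\<lambda>s' _. Inv ({..<gst G} \<times> charts) s') s
    (2 + gst G * (6 + 4 * (200 * (gst G * (3 + 2 * cl (gst G)) * Suc (cl (gst G))) + 5)))"
  proof (rule wp_OUTER, goal_cases)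
    case (1 S s s')
    have "inst s'" by (rule inst_frame[OF _ 1(2)]) (use 1(1) in \<open>auto simp: Inv_def\<close>)
    moreover have "sound s'" "better s s'" using best_frame[OF 1(2)] 1(1) unfolding Inv_def by auto
    ultimately show ?case using 1(1) explored_better unfolding Inv_def by blast
  next
    case (2 S s)
    then show ?case unfolding Inv_def by simp
  next
    case (3 S s)
    have *: "inst s" "sound s" "\<forall>(a, c, r) \<in> S. explored a c r s" using 3(1) unfolding Inv_def by auto
    show ?case
    proof (rule wp_call[OF wp_OBODY[OF *(1) 3(3,2) *(2)]], goal_cases)
      case (2 s' t')
      have "inst s'" by (rule inst_frame[OF *(1) 2(2)]) (use mods in auto)
      then show ?case using 2(1) *(3) explored_better unfolding Inv_def by blast
    qed simp
  next
    case 6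
    show ?case using assms unfolding Inv_def sound_def by simp
  qed (use mods in auto)
  then show ?thesis
  proof (rule wp_conseq, goal_cases)
    case (1 s' t')
    then have *: "sound s'" "\<forall>(a, c, r) \<in> {..<gst G} \<times> charts. explored a c r s'" unfolding Inv_def by auto
    have "good q s'" if "covered cx cy gst G x y q" for x y q
      by (rule explored_optimal[OF _ that]) (use *(2) in blast)
    with *(1) show ?case by blast
  qed
qed

section \<open>From operation counts to the stated time bounds\<close>

lemma point_vector: "(t :: point) = vector [t $ 1, t $ 2]"
  by (simp add: vec_eq_iff forall_2)

text \<open>As \<open>N\<close> and \<open>B\<close> are at least 1, the linear and constant terms
  are absorbed into the product; four charts and \<open>M \<le> 2 * N\<close> give its main part
  \<open>8 * (N * B)\<close>.\<close>

lemma outer_time: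
  fixes N M B :: nat
  assumes "1 \<le> N" and "M \<le> 2 * N" and "1 \<le> B"
  shows "40 * N + (5 + (2 + M * (6 + 4 * (B + 5)))) \<le> 110 * N * B"
proof -
  have "M * (6 + 4 * (B + 5)) \<le> 2 * N * (6 + 4 * (B + 5))" using assms(2) by (rule mult_right_mono) simp
  also have "\<dots> = 52 * N + 8 * (N * B)" by (simp add: algebra_simps)
  finally have "40 * N + (5 + (2 + M * (6 + 4 * (B + 5)))) \<le> 92 * N + 7 + 8 * (N * B)" by simp
  moreover have "N \<le> N * B" "1 \<le> N * B" using assms by auto
  ultimately show ?thesis unfolding mult.assoc by linarith
qed

context
  fixes N :: nat and lg :: real
  assumes N: "1 \<le> N" and lg: "lg = max 1 (log 2 (real N))"
begin

text \<open>Doubling or quadrupling the argument and rounding up cost an additive constant, which is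
  absorbed because \<open>lg\<close> is at least 1.\<close>

lemma cl_le_lg: "M \<le> 2 * N \<Longrightarrow> real (cl M) \<le> 3 * lg" "M \<le> 4 * N \<Longrightarrow> real (cl M) \<le> 4 * lg"
proof -
  have l: "log 2 (2 * real N) = 1 + log 2 (real N)" "log 2 (4 * real N) = 2 + log 2 (real N)"
    using N log_pow_cancel[of 2 2] by (simp_all add: log_mult)
  show "real (cl M) \<le> 3 * lg" if "M \<le> 2 * N"
    using cl_mono[OF that] cl_le_log[of "2 * N"] N l lg by simp
  show "real (cl M) \<le> 4 * lg" if "M \<le> 4 * N"
    using cl_mono[OF that] cl_le_log[of "4 * N"] N l lg by simp
qed

text \<open>154000 is 110 * 140 * 2 * 5: the outer loops, the body, \<open>M \<le> 2 * N\<close>,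
  and \<open>5 * lg\<close> as a bound for \<open>Suc (cl (2 * M))\<close>.\<close>

lemma decide_time:
  assumes "M \<le> 2 * N" and "1 \<le> M"
  shows "real (40 * N + (5 + (2 + M * (6 + 4 * (140 * M * Suc (cl (2 * M)) + 5))))) \<le> 154000 * (real N)\<^sup>2 * lg"
proof -
  let ?B = "140 * M * Suc (cl (2 * M))"
  have "real (Suc (cl (2 * M))) \<le> 5 * lg" using cl_le_lg(2)[of "2 * M"] assms(1) lg by simp
  then have "real (140 * M) * real (Suc (cl (2 * M))) \<le> (280 * real N) * (5 * lg)"
    using assms(1) lg by (intro mult_mono) auto
  then have B: "real ?B \<le> 1400 * (real N * lg)" unfolding of_nat_mult by simp
  have B1: "1 \<le> ?B" using assms(2) by simp
  have "real (40 * N + (5 + (2 + M * (6 + 4 * (?B + 5))))) \<le> real (110 * N * ?B)"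
    by (rule of_nat_mono[OF outer_time[OF N assms(1) B1]])
  also have "\<dots> = 110 * real N * real ?B" by simp
  also have "\<dots> \<le> 110 * real N * (1400 * (real N * lg))" using B by (intro mult_left_mono) auto
  also have "\<dots> = 154000 * (real N)\<^sup>2 * lg" by (simp add: power2_eq_square)
  finally show ?thesis .
qed

text \<open>1584000 is 110 * 200 * 2 * 9 * 4, where \<open>9 * lg\<close> and \<open>4 * lg\<close>
  bound the two logarithmic factors.\<close>

lemma optimize_time:
  assumes "M \<le> 2 * N" and "1 \<le> M"
  shows "real (40 * N + (5 + (2 + M * (6 + 4 * (200 * (M * (3 + 2 * cl M) * Suc (cl M)) + 5))))) \<le> 1584000 * (real N)\<^sup>2 * lg\<^sup>2"
proof -
  let ?B = "200 * (M * (3 + 2 * cl M) * Suc (cl M))"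
  have c: "real (cl M) \<le> 3 * lg" "1 \<le> lg" using cl_le_lg(1)[OF assms(1)] lg by auto
  have "real M * real (3 + 2 * cl M) * real (Suc (cl M)) \<le> (2 * real N) * (9 * lg) * (4 * lg)"
    using assms(1) c by (intro mult_mono) auto
  also have "\<dots> = 72 * (real N * lg\<^sup>2)" by (simp add: power2_eq_square)
  finally have "real (M * (3 + 2 * cl M) * Suc (cl M)) \<le> 72 * (real N * lg\<^sup>2)" by (simp only: of_nat_mult)
  moreover have "real ?B = 200 * real (M * (3 + 2 * cl M) * Suc (cl M))" by (simp only: of_nat_mult of_nat_numeral)
  ultimately have B: "real ?B \<le> 14400 * (real N * lg\<^sup>2)" by linarith
  have "M * 1 * 1 \<le> M * (3 + 2 * cl M) * Suc (cl M)" by (intro mult_le_mono) auto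
  then have B1: "1 \<le> ?B" using assms(2) by linarith
  have "real (40 * N + (5 + (2 + M * (6 + 4 * (?B + 5))))) \<le> real (110 * N * ?B)"
    by (rule of_nat_mono[OF outer_time[OF N assms(1) B1]])
  also have "\<dots> = 110 * real N * real ?B" by simp
  also have "\<dots> \<le> 110 * real N * (14400 * (real N * lg\<^sup>2))" using B by (intro mult_left_mono) auto
  also have "\<dots> = 1584000 * (real N)\<^sup>2 * lg\<^sup>2" by (simp add: power2_eq_square)
  finally show ?thesis .
qed

end

context build begin

lemma wp_DECIDE:
  assumes "inputs s" and "rval s ''eps'' = \<epsilon>" and "0 < \<epsilon>" and "M = off (rows v)"
  shows "wp (DECIDE v) (\<lambda>s' _. ival s' ''answer'' = (if \<exists>x y. hcov v P (set xs) (vector [x, y]) \<epsilon> then 1 else 0)) s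
    (40 * (n * k) + (5 + (2 + M * (6 + 4 * (140 * M * Suc (cl (2 * M)) + 5)))))"
  unfolding DECIDE_def
proof (rule wp_Seq, rule wp_call[OF wp_BUILD[OF assms(1)]], goal_cases)
  case (2 s1 t1)
  note b = built_discs[of v s1, OF conjunct1[OF 2(1)] conjunct2[OF 2(1)]]
  interpret D: discs "rmem s1 ''cx''" "rmem s1 ''cy''" "imem s1 ''gst''" "imem s1 ''gr''" "rows v" by (rule b(1))
  have e: "rval s1 ''eps'' = \<epsilon>" using same_exceptD(2)[OF 2(2), of "''eps''"] assms(2) by simp
  have M: "imem s1 ''gst'' (rows v) = M" using 2(1) assms(4) by simp
  let ?T = "2 + M * (6 + 4 * (140 * M * Suc (cl (2 * M)) + 5))"
  have t1: "1 + ?T \<le> t1" using 2(3) by linarith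
  have I: "wp (iset ''answer'' (INat 0)) (\<lambda>s' _. ival s' ''answer'' = 0) s1 1" by (intro wp_steps; simp)
  show ?case
  proof (rule wp_Seq, rule wp_call[OF I], goal_cases)
    case (2 s2 t2)
    have "D.inst s2" by (rule D.inst_frame[OF b(2) 2(2)]) auto
    moreover have "rval s2 ''eps'' = \<epsilon>" using same_exceptD(2)[OF 2(2)] e by simp
    ultimately have "wp (OUTER DBODY) (\<lambda>s' _. ival s' ''answer'' = (if \<exists>x y. hcov v P (set xs) (vector [x, y]) \<epsilon> then 1 else 0)) s2 ?T"
      using D.wp_OUTER_DBODY[of s2 \<epsilon>] 2(1) assms(3) unfolding b(3) M by simp
    then show ?case by (rule wp_time_mono) (use 2(3) t1 in linarith)
  qed (use t1 in linarith)
qed simp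

lemma wp_OPTIMIZE:
  assumes "inputs s" and "M = off (rows v)"
  shows "wp (OPTIMIZE v) (\<lambda>s' _. is_arg_min (matching_distance v P (set xs)) (\<lambda>t. True) (translation_output s')) s
    (40 * (n * k) + (5 + (2 + M * (6 + 4 * (200 * (M * (3 + 2 * cl M) * Suc (cl M)) + 5)))))"
  unfolding OPTIMIZE_def
proof (rule wp_Seq, rule wp_call[OF wp_BUILD[OF assms(1)]], goal_cases)
  case (2 s1 t1)
  note b = built_discs[of v s1, OF conjunct1[OF 2(1)] conjunct2[OF 2(1)]]
  interpret D: discs "rmem s1 ''cx''" "rmem s1 ''cy''" "imem s1 ''gst''" "imem s1 ''gr''" "rows v" by (rule b(1))
  have M: "imem s1 ''gst'' (rows v) = M" using 2(1) assms(2) by simp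
  let ?T = "2 + M * (6 + 4 * (200 * (M * (3 + 2 * cl M) * Suc (cl M)) + 5))"
  have t1: "1 + ?T + 2 \<le> t1" using 2(3) by linarith
  have I: "wp (iset ''have'' (INat 0)) (\<lambda>s' _. ival s' ''have'' = 0) s1 1" by (intro wp_steps; simp)
  show ?case
  proof (rule wp_Seq, rule wp_call[OF I], goal_cases)
    case (2 s2 t2)
    have t2: "?T + 2 \<le> t2" using 2(3) t1 by linarith
    have "D.inst s2" by (rule D.inst_frame[OF b(2) 2(2)]) auto
    from D.wp_OUTER_OBODY[OF this 2(1)] have O: "wp (OUTER OBODY) (\<lambda>s' _. D.sound s' \<and>
        (\<forall>x y q. hcov v P (set xs) (vector [x, y]) (sqrt q) \<longrightarrow> D.good q s')) s2 ?T"
      unfolding b(3) M .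
    show ?case
    proof (rule wp_Seq, rule wp_call[OF O], goal_cases)
      case (2 s3 t3)
      let ?md = "matching_distance v P (set xs)"
      have md: "?md t \<le> r \<longleftrightarrow> hcov v P (set xs) t r" for t r
        using matching_distance_le_iff[of P "set xs"] P_ne xs_ne by simp
      \<comment> \<open>The square of the matching distance of an arbitrary \<open>t\<close> is a
        covered value, so the recorded \<open>V\<close> is at most this square; soundness of the
        record turns \<open>V\<close> back into a bound on the matching distance of the
        output.\<close>
      have best: "?md (vector [rval s3 ''bx'', rval s3 ''by'']) \<le> ?md t" for t
      proof -
        have h: "hcov v P (set xs) t (?md t)" using md by blast
        then have r: "0 \<le> ?md t" using hcov_nonneg[OF P_ne] by blast
        then have "hcov v P (set xs) (vector [t $ 1, t $ 2]) (sqrt ((?md t)\<^sup>2))"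
          using h by (simp flip: point_vector)
        then have g: "D.good ((?md t)\<^sup>2) s3" using 2(1) by blast
        then have "hcov v P (set xs) (vector [rval s3 ''bx'', rval s3 ''by'']) (sqrt (rval s3 ''V''))"
          using 2(1) unfolding D.good_def D.sound_def b(3) by simp
        then have "?md (vector [rval s3 ''bx'', rval s3 ''by'']) \<le> sqrt (rval s3 ''V'')" using md by blast
        also have "\<dots> \<le> sqrt ((?md t)\<^sup>2)" using g unfolding D.good_def by (intro real_sqrt_le_mono) simp
        finally show ?thesis using r by simp
      qed
      have "wp (rset ''tx'' (rv ''bx'') ;; rset ''ty'' (rv ''by'')) (\<lambda>s' _. translation_output s' =
          vector [rval s3 ''bx'', rval s3 ''by'']) s3 2"
        unfolding translation_output_def by (intro wp_steps; simp)
      then show ?case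
      proof (rule wp_call, goal_cases)
        case 1
        show ?case using 2(3) t2 by linarith
      next
        case (2 s4 t4)
        then show ?case using best unfolding is_arg_min_def by (auto simp: not_less)
      qed
    qed (use t2 in linarith)
  qed (use t1 in linarith)
qed simp

end

theorem mainTheorem3:
  fixes v :: matching_version
  shows
    "(\<exists>(prog :: com) (C :: real). \<forall>(P :: point list) (S :: point set) (xs :: point list) (\<epsilon> :: real).
        P \<noteq> [] \<and> S \<noteq> {} \<and> set xs = S \<and> distinct xs \<and> \<epsilon> > 0 \<longrightarrow>
        (\<exists>T s. exec prog (decision_input P xs \<epsilon>) T s \<and>
           decision_output s =
             (if \<exists>t Q. admissible v S Q \<and> discrete_frechet (translate P t) Q \<le> \<epsilon> then 1 else 0) \<and>
           real T \<le> C * real (length P)^2 * real (card S)^2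
                     * max 1 (log 2 (real (length P * card S)))))
     \<and>
     (\<exists>(prog :: com) (C :: real). \<forall>(P :: point list) (S :: point set) (xs :: point list).
        P \<noteq> [] \<and> S \<noteq> {} \<and> set xs = S \<and> distinct xs \<longrightarrow>
        (\<exists>T s. exec prog (matching_input P xs) T s \<and>
           is_arg_min (matching_distance v P S) (\<lambda>t. True) (translation_output s) \<and>
           real T \<le> C * real (length P)^2 * real (card S)^2
                     * (max 1 (log 2 (real (length P * card S))))^2))"
proof (rule conjI; rule exI, rule exI, intro allI impI, elim conjE)
  fix P :: "point list" and S :: "point set" and xs :: "point list" and \<epsilon> :: real
  assume *: "P \<noteq> []" "S \<noteq> {}" "set xs = S" "distinct xs" "\<epsilon> > 0"
  then interpret build P xs by unfold_locales auto
  define N where "N = n * k"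
  have N: "1 \<le> N" unfolding N_def using P_ne xs_ne by (simp add: Suc_le_eq)
  have M: "off (rows v) \<le> 2 * N" "1 \<le> off (rows v)" using off_rows[of v] N unfolding N_def by linarith+
  have card: "card S = k" using *(3,4) distinct_card by blast
  have in0: "inputs (decision_input P xs \<epsilon>)" "rval (decision_input P xs \<epsilon>) ''eps'' = \<epsilon>"
    unfolding inputs_def decision_input_def matching_input_def by simp_all
  have "wp (DECIDE v) (\<lambda>s' _. ival s' ''answer'' = (if \<exists>x y. hcov v P S (vector [x, y]) \<epsilon> then 1 else 0))
      (decision_input P xs \<epsilon>) (40 * N + (5 + (2 + off (rows v) * (6 + 4 * (140 * off (rows v) * Suc (cl (2 * off (rows v))) + 5)))))"
    using wp_DECIDE[OF in0 *(5) refl] unfolding *(3) N_def .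
  then obtain T s where Ts: "exec (DECIDE v) (decision_input P xs \<epsilon>) T s"
      "T \<le> 40 * N + (5 + (2 + off (rows v) * (6 + 4 * (140 * off (rows v) * Suc (cl (2 * off (rows v))) + 5))))"
      "ival s ''answer'' = (if \<exists>x y. hcov v P S (vector [x, y]) \<epsilon> then 1 else 0)"
    unfolding wp_def by blast
  have ans: "(\<exists>x y. hcov v P S (vector [x, y]) \<epsilon>) \<longleftrightarrow> (\<exists>t Q. admissible v S Q \<and> discrete_frechet (translate P t) Q \<le> \<epsilon>)"
    using hcov_iff[OF *(1), of S v] *(3) point_vector by (metis List.finite_set)
  have "real T \<le> 154000 * (real N)\<^sup>2 * max 1 (log 2 (real N))"
    by (rule order.trans[OF of_nat_mono[OF Ts(2)] decide_time[OF N refl]]) (use M in simp_all)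
  then have "real T \<le> 154000 * real n ^ 2 * real (card S) ^ 2 * max 1 (log 2 (real (n * card S)))"
    unfolding card N_def by (simp add: power_mult_distrib)
  then show "\<exists>T s. exec (DECIDE v) (decision_input P xs \<epsilon>) T s \<and>
      decision_output s = (if \<exists>t Q. admissible v S Q \<and> discrete_frechet (translate P t) Q \<le> \<epsilon> then 1 else 0) \<and>
      real T \<le> 154000 * real n ^ 2 * real (card S) ^ 2 * max 1 (log 2 (real (n * card S)))"
    using Ts(1,3) unfolding ans decision_output_def by blast
next
  fix P :: "point list" and S :: "point set" and xs :: "point list"
  assume *: "P \<noteq> []" "S \<noteq> {}" "set xs = S" "distinct xs"
  then interpret build P xs by unfold_locales auto
  define N where "N = n * k"
  have N: "1 \<le> N" unfolding N_def using P_ne xs_ne by (simp add: Suc_le_eq)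
  have M: "off (rows v) \<le> 2 * N" "1 \<le> off (rows v)" using off_rows[of v] N unfolding N_def by linarith+
  have card: "card S = k" using *(3,4) distinct_card by blast
  have in0: "inputs (matching_input P xs)" unfolding inputs_def matching_input_def by simp
  obtain T s where Ts: "exec (OPTIMIZE v) (matching_input P xs) T s"
      "T \<le> 40 * N + (5 + (2 + off (rows v) * (6 + 4 * (200 * (off (rows v) * (3 + 2 * cl (off (rows v))) * Suc (cl (off (rows v)))) + 5))))"
      "is_arg_min (matching_distance v P S) (\<lambda>t. True) (translation_output s)"
    using wp_OPTIMIZE[OF in0 refl, of v] unfolding wp_def *(3) N_def by blast
  have "real T \<le> 1584000 * (real N)\<^sup>2 * (max 1 (log 2 (real N)))\<^sup>2"
    by (rule order.trans[OF of_nat_mono[OF Ts(2)] optimize_time[OF N refl]]) (use M in simp_all)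
  then have "real T \<le> 1584000 * real n ^ 2 * real (card S) ^ 2 * (max 1 (log 2 (real (n * card S)))) ^ 2"
    unfolding card N_def by (simp add: power_mult_distrib)
  then show "\<exists>T s. exec (OPTIMIZE v) (matching_input P xs) T s \<and>
      is_arg_min (matching_distance v P S) (\<lambda>t. True) (translation_output s) \<and>
      real T \<le> 1584000 * real n ^ 2 * real (card S) ^ 2 * (max 1 (log 2 (real (n * card S)))) ^ 2"
    using Ts(1,3) by blast
qed

end
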